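(* Let $R$ be a commutative ring and $\mathcal P$ any (reduced) right symmetric operad in $R$-modules; write $\mathsf{Alg}\text{-}\mathcal P$ for the category of $\mathcal P$-algebras. Then $$\mathsf{Nil}_2(\mathsf{Alg}\text{-}\mathcal P)=\mathsf{NIL}_2(\mathsf{Alg}\text{-}\mathcal P)=\mathsf{Alg}\text{-}\mathrm{Nil}_2(\mathcal P)\quad\text{and}\quad \mathrm{nil}_2^{\mathsf{Alg}\text{-}\mathcal P}=\mathrm{NIL}_2^{\mathsf{Alg}\text{-}\mathcal P}.$$ Furthermore, the bilinear product of $\mathsf{Alg}\text{-}\mathcal P$ is given, for $\mathcal P$-algebras $A$ and $B$, by $$A\otimes B=\bigl(A/J_2(A)\otimes_RB/J_2(B)\bigr)\otimes_{\mathcal P(1)\otimes_R\mathcal P(1)}\mathcal P(2),$$ and the isomorphism $$\tilde\tau_{A,B}\colon\bigl(A/J_2(A)\otimes_RB/J_2(B)\bigr)\otimes_{\mathcal P(1)\otimes_R\mathcal P(1)}\mathcal P(2)\to\bigl(B/J_2(B)\otimes_RA/J_2(A)\bigr)\otimes_{\mathcal P(1)\otimes_R\mathcal P(1)}\mathcal P(2)$$ corresponding to the symmetry isomorphism $\tau_{A,B}\colon A\otimes B\to B\otimes A$ of the bilinear product is given by $\tilde\tau_{A,B}(a\otimes b\otimes x)=b\otimes a\otimes(t\star x)$, where $t$ is the generator of $\mathfrak S_2$.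
   Context: **Operads.** A (reduced, i.e. constant-free) right symmetric operad $\mathcal P$ in $R$-modules consists of $R$-modules $\mathcal P(n)$, $n\ge 1$, with $R$-linear left actions $\star$ of the symmetric groups $\mathfrak S_n$ on $\mathcal P(n)$, an identity $1\in\mathcal P(1)$, and $R$-linear maps $\gamma_{k_1,\dots,k_n;n}\colon \mathcal P(k_1)\otimes_R\cdots\otimes_R\mathcal P(k_n)\otimes_R\mathcal P(n)\to\mathcal P(k_1+\cdots+k_n)$ such that: (identity) $\gamma_{1,\dots,1;n}(1\otimes\cdots\otimes1\otimes\theta)=\theta=\gamma_{n;1}(\theta\otimes1)$; (associativity) composing $\theta_{i,j}$'s into the $\theta_i$'s and then the results into $\theta$ equals composing the $\theta_i$'s into $\theta$ and then all the $\theta_{i,j}$'s into the result; (equivariance 1) for $t\in\mathfrak S_n$, $\gamma_{k_1,\dots,k_n;n}(\theta_1\otimes\cdots\otimes\theta_n\otimes(t\star\theta))=t'\star\gamma_{k_{t(1)},\dots,k_{t(n)};n}(\theta_{t(1)}\otimes\cdots\otimes\theta_{t(n)}\otimes\theta)$, where $t'$ is the block permutation which rearranges a sequence consisting of consecutive blocks of sizes $k_1,\dots,k_n$ into the sequence of blocks number $t(1),\dots,t(n)$; (equivariance 2) for $s_i\in\mathfrak S_{k_i}$, $\gamma((s_1\star\theta_1)\otimes\cdots\otimes(s_n\star\theta_n)\otimes\theta)=(s_1,\dots,s_n)\star\gamma(\theta_1\otimes\cdots\otimes\theta_n\otimes\theta)$, where $(s_1,\dots,s_n)$ permutes the $i$-th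 block by $s_i$. Then $\mathcal P(1)$ is a unital $R$-algebra via $\gamma_{1;1}$, and $\mathcal P(2)$ is a left $\mathcal P(1)\otimes_R\mathcal P(1)$-module via $\gamma_{1,1;2}$ and a right $\mathcal P(1)$-module via $\gamma_{2;1}$. A $\mathcal P$-algebra is an $R$-module $A$ with $R$-linear maps $\mu_n=\mu_n^A\colon A^{\otimes n}\otimes_R\mathcal P(n)\to A$, $n\geq1$, with $\mu_1(a\otimes1)=a$, compatible with composition, i.e. $\mu_{k_1+\cdots+k_n}(a_1\otimes\cdots\otimes a_{k_1+\cdots+k_n}\otimes\gamma(\theta_1\otimes\cdots\otimes\theta_n\otimes\theta))=\mu_n(\mu_{k_1}(a_1\otimes\cdots\otimes a_{k_1}\otimes\theta_1)\otimes\cdots\otimes\mu_{k_n}(\cdots\otimes a_{k_1+\cdots+k_n}\otimes\theta_n)\otimes\theta)$, and such that $\mu_n(a_1\otimes\cdots\otimes a_n\otimes(t\star\theta))=\mu_n(a_{t(1)}\otimes\cdots\otimes a_{t(n)}\otimes\theta)$. Morphisms are $R$-linear maps commuting with all $\mu_n$. Each $\mathcal P$-algebra is a right $\mathcal P(1)$-module via $\mu_1$, and $\mathsf{Alg}\text{-}\mathcal P$ is a semi-abelian variety. A right $\mathcal P(1)$-module is viewed as a $\mathcal P$-algebra with $\mu_n=0$ for $n\ge2$. **Operadic nilpotency.** $J_n(A)=\sum_{k\ge n}\mathrm{Im}(\mu_k^A)$. A $\mathcal P$-algebra $A$ is $2$-step nilpotent if $\mu_n^A=0$ for $n>2$; these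 form the full subcategory $\mathsf{NIL}_2(\mathsf{Alg}\text{-}\mathcal P)$, with reflector $\mathrm{NIL}_2^{\mathsf{Alg}\text{-}\mathcal P}(A)=A/J_3(A)$. $\mathrm{Nil}_2(\mathcal P)$ is the operad obtained from $\mathcal P$ by truncation: it equals $\mathcal P(n)$ in arity $n\le2$ and $0$ in arity $n>2$, with compositions those of $\mathcal P$ when the target arity is $\le2$ and zero otherwise. **Categorical nilpotency and bilinear product.** In a semi-abelian category $\mathcal X$, the cosmash product $X\diamond Y$ is the kernel of the canonical morphism $X+Y\to X\times Y$, and the ternary cosmash product $X\diamond Y\diamond Z$ is the kernel of the canonical morphism $X+Y+Z\to(X+Y)\times(X+Z)\times(Y+Z)$ whose components kill $Z$, $Y$, $X$ respectively. $[X,X,X]$ is the image of $X\diamond X\diamond X\to X+X+X\to X$. $X$ is two-nilpotent if $[X,X,X]=0$; the two-nilpotent objects form the full reflective subcategory $\mathsf{Nil}_2(\mathcal X)$ with reflector $\mathrm{nil}_2^{\mathcal X}(X)=X/[X,X,X]$. The bilinear product $X\otimes Y$ is the cosmash product of $\mathrm{nil}_2(X)$ and $\mathrm{nil}_2(Y)$ computed in $\mathsf{Nil}_2(\mathcal X)$; its symmetry isomorphism $\tau_{X,Y}\colon X\otimes Y\to Y\otimes X$ is induced by the twist of coproducts and products. *)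

theory Defs
  imports "HOL-Combinatorics.Permutations" "HOL-Algebra.Module" "HOL-Algebra.AbelCoset"
begin

section \<open>Operads\<close>

text \<open>
  Positions are counted from 0, so the symmetric group on \<open>n\<close> letters is \<open>{t. t permutes {..<n}}\<close>,
  and \<open>permute_list t as\<close> is the sequence with entries number \<open>t 0, ..., t (n - 1)\<close> of \<open>as\<close>.
\<close>

definition blocks :: "nat list \<Rightarrow> nat list list" where
  "blocks ks = map (\<lambda>i. [sum_list (take i ks) ..< sum_list (take i ks) + ks ! i]) [0..<length ks]"

definition block_perm :: "nat list \<Rightarrow> (nat \<Rightarrow> nat) \<Rightarrow> nat \<Rightarrow> nat" where
  "block_perm ks t j =
     (if j < sum_list ks then concat (permute_list t (blocks ks)) ! j else j)"

definition block_sum :: "nat list \<Rightarrow> (nat \<Rightarrow> nat) list \<Rightarrow> nat \<Rightarrow> nat" where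
  "block_sum ks ss j =
     (if j < sum_list ks then concat (map2 permute_list ss (blocks ks)) ! j else j)"

text \<open>The two characteristic properties: \<open>block_perm\<close> permutes the blocks, \<open>block_sum\<close> permutes
  within the blocks; see \<open>permute_list_block_perm\<close> and \<open>permute_list_block_sum\<close>.\<close>

lemma blocks_snoc: "blocks (ks @ [k]) = blocks ks @ [[sum_list ks ..< sum_list ks + k]]"
  by (auto simp: blocks_def nth_append intro!: map_cong)

lemma concat_blocks: "concat (blocks ks) = [0..<sum_list ks]"
proof (induction ks rule: rev_induct)
  case Nil show ?case by (simp add: blocks_def)
next
  case (snoc k ks) then show ?case by (simp add: blocks_snoc upt_add_eq_append[of 0 "sum_list ks" k])
qed

lemma map_nth_blocks: "map (map ((!) (concat xss))) (blocks (map length xss)) = xss"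
proof (induction xss rule: rev_induct)
  case Nil show ?case by (simp add: blocks_def)
next
  case (snoc xs xss)
  have *: "set b \<subseteq> {..<length (concat xss)}" if "b \<in> set (blocks (map length xss))" for b
  proof -
    have "set b \<subseteq> set (concat (blocks (map length xss)))" using that by auto
    then show ?thesis unfolding concat_blocks by (auto simp: length_concat)
  qed
  have "map (map ((!) (concat xss @ xs))) (blocks (map length xss)) = xss"
    by (subst (3) snoc[symmetric]) (use * in \<open>force simp: nth_append intro!: map_cong\<close>)
  moreover have "map ((!) (concat xss @ xs)) [sum_list (map length xss)..<sum_list (map length xss) + length xs] = xs"
    by (rule nth_equalityI) (auto simp: nth_append length_concat)
  ultimately show ?case by (simp add: blocks_snoc)
qed

lemma length_blocks [simp]: "length (blocks ks) = length ks"
  by (simp add: blocks_def)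

lemma permute_list_block_perm:
  assumes "t permutes {..<length xss}"
  shows "permute_list (block_perm (map length xss) t) (concat xss) = concat (permute_list t xss)"
proof -
  let ?B = "blocks (map length xss)"
  have "mset (permute_list t ?B) = mset ?B" using assms by (intro mset_permute_list) simp
  then have len: "length (concat (permute_list t ?B)) = sum_list (map length xss)"
    by (metis concat_blocks length_upt diff_zero mset_concat mset_map sum_mset_sum_list size_mset)
  have lx: "length (concat xss) = sum_list (map length xss)" by (rule length_concat)
  have "permute_list (block_perm (map length xss) t) (concat xss)
      = map ((!) (concat xss)) (concat (permute_list t ?B))"
    using len by (intro nth_equalityI)
      (simp_all add: permute_list_def[of "block_perm _ _"] block_perm_def lx del: length_concat)
  also have "\<dots> = concat (permute_list t (map (map ((!) (concat xss))) ?B))"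
    using assms by (subst permute_list_map) (auto simp: map_concat)
  finally show ?thesis by (simp add: map_nth_blocks)
qed

lemma permute_list_block_sum:
  assumes "list_all2 (\<lambda>xs s. s permutes {..<length xs}) xss ss"
  shows "permute_list (block_sum (map length xss) ss) (concat xss) = concat (map2 permute_list ss xss)"
proof -
  let ?B = "blocks (map length xss)"
  have lens: "length ss = length xss" using assms by (auto dest: list_all2_lengthD)
  have lb: "length (?B ! i) = length (xss ! i)" if "i < length xss" for i
    using that by (simp add: blocks_def)
  have ml: "map length (map2 permute_list ss ?B) = map length xss"
    by (rule nth_equalityI) (auto simp: lens lb)
  have len: "length (concat (map2 permute_list ss ?B)) = sum_list (map length xss)"
    by (metis length_concat ml)
  have lx: "length (concat xss) = sum_list (map length xss)" by (rule length_concat)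
  have "permute_list (block_sum (map length xss) ss) (concat xss)
      = map ((!) (concat xss)) (concat (map2 permute_list ss ?B))"
    using len by (intro nth_equalityI)
      (simp_all add: permute_list_def[of "block_sum _ _"] block_sum_def lx del: length_concat)
  also have "\<dots> = concat (map (map ((!) (concat xss))) (map2 permute_list ss ?B))"
    by (simp add: map_concat)
  also have "map (map ((!) (concat xss))) (map2 permute_list ss ?B) = map2 permute_list ss xss"
  proof (rule nth_equalityI)
    fix i assume "i < length (map (map ((!) (concat xss))) (map2 permute_list ss ?B))"
    then have i: "i < length xss" by (simp add: lens)
    have p: "(ss ! i) permutes {..<length (xss ! i)}"
      using assms i by (auto simp: list_all2_conv_all_nth)
    have "map ((!) (concat xss)) (?B ! i) = xss ! i"
      using map_nth_blocks[of xss] i by (metis length_blocks length_map nth_map)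
    then show "map (map ((!) (concat xss))) (map2 permute_list ss ?B) ! i = map2 permute_list ss xss ! i"
      using i p by (simp add: lens lb flip: permute_list_map)
  qed (simp add: lens)
  finally show ?thesis .
qed

lemma block_perm_permutes:
  assumes "t permutes {..<length ks}"
  shows "block_perm ks t permutes {..<sum_list ks}"
proof -
  let ?xs = "concat (permute_list t (blocks ks))"
  have "mset (permute_list t (blocks ks)) = mset (blocks ks)" using assms by (intro mset_permute_list) simp
  then have m: "mset ?xs = mset [0..<sum_list ks]"
    by (metis concat_blocks mset_concat mset_map sum_mset_sum_list)
  have d: "distinct ?xs" using m by (metis mset_eq_imp_distinct_iff distinct_upt)
  have l: "length ?xs = sum_list ks" using m by (metis length_upt diff_zero size_mset)
  have s: "set ?xs = {..<sum_list ks}" using m by (metis atLeast_upt set_mset_mset)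
  have "bij_betw ((!) ?xs) {..<sum_list ks} {..<sum_list ks}"
    using bij_betw_nth[OF d] l s by auto
  then have "bij_betw (block_perm ks t) {..<sum_list ks} {..<sum_list ks}"
    by (rule bij_betw_cong[THEN iffD1, rotated]) (simp add: block_perm_def)
  then show ?thesis by (rule bij_imp_permutes) (simp add: block_perm_def)
qed


lemma block_sum_permutes:
  assumes "list_all2 (\<lambda>k s. s permutes {..<k}) ks ss"
  shows "block_sum ks ss permutes {..<sum_list ks}"
proof -
  let ?xss = "blocks ks"
  have ml: "map length ?xss = ks" by (rule nth_equalityI) (auto simp: blocks_def)
  have l: "length ss = length ks" using assms by (auto dest: list_all2_lengthD)
  let ?xs = "concat (map2 permute_list ss ?xss)"
  have "map mset (map2 permute_list ss ?xss) = map mset ?xss"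
    using assms l ml by (intro nth_equalityI) (auto simp: list_all2_conv_all_nth blocks_def intro!: mset_permute_list)
  then have m: "mset ?xs = mset [0..<sum_list ks]"
    by (metis concat_blocks mset_concat)
  have d: "distinct ?xs" using m by (metis mset_eq_imp_distinct_iff distinct_upt)
  have l: "length ?xs = sum_list ks" using m by (metis length_upt diff_zero size_mset)
  have s: "set ?xs = {..<sum_list ks}" using m by (metis atLeast_upt set_mset_mset)
  have "bij_betw ((!) ?xs) {..<sum_list ks} {..<sum_list ks}"
    using bij_betw_nth[OF d] l s by auto
  then have "bij_betw (block_sum ks ss) {..<sum_list ks} {..<sum_list ks}"
    by (rule bij_betw_cong[THEN iffD1, rotated]) (simp add: block_sum_def)
  then show ?thesis by (rule bij_imp_permutes) (simp add: block_sum_def)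
qed

text \<open>
  \<open>comp P [k1, ..., kn]\<close> is the composition map with values in arity \<open>k1 + ... + kn\<close>; the arities
  have to be passed since the carriers of the modules \<open>opc P n\<close> may overlap. Linear maps out of tensor
  products are given as multilinear maps. Nothing is assumed about \<open>opc P 0\<close>, and it is never used:
  operads are reduced.
\<close>

record ('r, 'p) operad =
  opc :: "nat \<Rightarrow> ('r, 'p) module"
  comp :: "nat list \<Rightarrow> 'p list \<Rightarrow> 'p \<Rightarrow> 'p"
  act :: "nat \<Rightarrow> (nat \<Rightarrow> nat) \<Rightarrow> 'p \<Rightarrow> 'p"
  unit :: 'p

definition ops_in :: "('r, 'p) operad \<Rightarrow> nat list \<Rightarrow> 'p list \<Rightarrow> bool" where
  "ops_in P ks xs \<longleftrightarrow> list_all2 (\<lambda>k x. 1 \<le> k \<and> x \<in> carrier (opc P k)) ks xs"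

locale operad = cring R for R :: "'r ring" and P :: "('r, 'p) operad" +
  assumes opc_module: "1 \<le> n \<Longrightarrow> module R (opc P n)"
    and act_closed: "\<lbrakk>1 \<le> n; t permutes {..<n}; x \<in> carrier (opc P n)\<rbrakk>
      \<Longrightarrow> act P n t x \<in> carrier (opc P n)"
    and act_add: "\<lbrakk>1 \<le> n; t permutes {..<n}; x \<in> carrier (opc P n); y \<in> carrier (opc P n)\<rbrakk>
      \<Longrightarrow> act P n t (x \<oplus>\<^bsub>opc P n\<^esub> y) = act P n t x \<oplus>\<^bsub>opc P n\<^esub> act P n t y"
    and act_smult: "\<lbrakk>1 \<le> n; t permutes {..<n}; r \<in> carrier R; x \<in> carrier (opc P n)\<rbrakk>
      \<Longrightarrow> act P n t (r \<odot>\<^bsub>opc P n\<^esub> x) = r \<odot>\<^bsub>opc P n\<^esub> act P n t x"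
    and act_id: "\<lbrakk>1 \<le> n; x \<in> carrier (opc P n)\<rbrakk> \<Longrightarrow> act P n id x = x"
    and act_comp: "\<lbrakk>1 \<le> n; s permutes {..<n}; t permutes {..<n}; x \<in> carrier (opc P n)\<rbrakk>
      \<Longrightarrow> act P n (s \<circ> t) x = act P n s (act P n t x)"
    and unit_closed: "unit P \<in> carrier (opc P 1)"
    and comp_closed: "\<lbrakk>ks \<noteq> []; ops_in P ks xs; y \<in> carrier (opc P (length ks))\<rbrakk>
      \<Longrightarrow> comp P ks xs y \<in> carrier (opc P (sum_list ks))"
    and comp_add_arg: "\<lbrakk>1 \<le> k; ops_in P js us; ops_in P ls vs;
        x \<in> carrier (opc P k); x' \<in> carrier (opc P k);
        y \<in> carrier (opc P (length (js @ k # ls)))\<rbrakk>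
      \<Longrightarrow> comp P (js @ k # ls) (us @ (x \<oplus>\<^bsub>opc P k\<^esub> x') # vs) y =
          comp P (js @ k # ls) (us @ x # vs) y \<oplus>\<^bsub>opc P (sum_list (js @ k # ls))\<^esub>
          comp P (js @ k # ls) (us @ x' # vs) y"
    and comp_smult_arg: "\<lbrakk>1 \<le> k; ops_in P js us; ops_in P ls vs;
        r \<in> carrier R; x \<in> carrier (opc P k); y \<in> carrier (opc P (length (js @ k # ls)))\<rbrakk>
      \<Longrightarrow> comp P (js @ k # ls) (us @ (r \<odot>\<^bsub>opc P k\<^esub> x) # vs) y =
          r \<odot>\<^bsub>opc P (sum_list (js @ k # ls))\<^esub> comp P (js @ k # ls) (us @ x # vs) y"
    and comp_add: "\<lbrakk>ks \<noteq> []; ops_in P ks xs; y \<in> carrier (opc P (length ks));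
        y' \<in> carrier (opc P (length ks))\<rbrakk>
      \<Longrightarrow> comp P ks xs (y \<oplus>\<^bsub>opc P (length ks)\<^esub> y') =
          comp P ks xs y \<oplus>\<^bsub>opc P (sum_list ks)\<^esub> comp P ks xs y'"
    and comp_smult: "\<lbrakk>ks \<noteq> []; ops_in P ks xs; r \<in> carrier R; y \<in> carrier (opc P (length ks))\<rbrakk>
      \<Longrightarrow> comp P ks xs (r \<odot>\<^bsub>opc P (length ks)\<^esub> y) = r \<odot>\<^bsub>opc P (sum_list ks)\<^esub> comp P ks xs y"
    and comp_unit_left: "\<lbrakk>1 \<le> n; y \<in> carrier (opc P n)\<rbrakk>
      \<Longrightarrow> comp P (replicate n 1) (replicate n (unit P)) y = y"
    and comp_unit_right: "\<lbrakk>1 \<le> n; x \<in> carrier (opc P n)\<rbrakk> \<Longrightarrow> comp P [n] [x] (unit P) = x"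
    and comp_assoc: "\<lbrakk>kss \<noteq> []; \<forall>ks \<in> set kss. ks \<noteq> []; list_all2 (ops_in P) kss xss;
        ops_in P (map length kss) ys; z \<in> carrier (opc P (length kss))\<rbrakk>
      \<Longrightarrow> comp P (map sum_list kss) (map (\<lambda>(ks, xs, y). comp P ks xs y) (zip kss (zip xss ys))) z =
          comp P (concat kss) (concat xss) (comp P (map length kss) ys z)"
    and comp_act: "\<lbrakk>ks \<noteq> []; t permutes {..<length ks}; ops_in P ks xs;
        y \<in> carrier (opc P (length ks))\<rbrakk>
      \<Longrightarrow> comp P ks xs (act P (length ks) t y) =
          act P (sum_list ks) (block_perm ks t) (comp P (permute_list t ks) (permute_list t xs) y)"
    and comp_act_args: "\<lbrakk>ks \<noteq> []; list_all2 (\<lambda>k s. s permutes {..<k}) ks ss; ops_in P ks xs;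
        y \<in> carrier (opc P (length ks))\<rbrakk>
      \<Longrightarrow> comp P ks (map (\<lambda>(k, s, x). act P k s x) (zip ks (zip ss xs))) y =
          act P (sum_list ks) (block_sum ks ss) (comp P ks xs y)"

definition trunc2 :: "('r, 'p) operad \<Rightarrow> ('r, 'p) operad" where
  "trunc2 P = P\<lparr>
     opc := \<lambda>n. if n \<le> 2 then opc P n else (opc P n)\<lparr>carrier := {\<zero>\<^bsub>opc P n\<^esub>}\<rparr>,
     comp := \<lambda>ks xs y. if sum_list ks \<le> 2 then comp P ks xs y else \<zero>\<^bsub>opc P (sum_list ks)\<^esub>\<rparr>"


context operad
begin

lemma opc_zero: "1 \<le> n \<Longrightarrow> \<zero>\<^bsub>opc P n\<^esub> \<in> carrier (opc P n)"
  using opc_module by (meson abelian_group.axioms(1) abelian_monoid.zero_closed module.axioms(2))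

lemma opc_zz: "1 \<le> n \<Longrightarrow> \<zero>\<^bsub>opc P n\<^esub> \<oplus>\<^bsub>opc P n\<^esub> \<zero>\<^bsub>opc P n\<^esub> = \<zero>\<^bsub>opc P n\<^esub>"
  using opc_module opc_zero by (meson abelian_group.axioms(1) abelian_monoid.l_zero module.axioms(2))

lemma opc_sz: "1 \<le> n \<Longrightarrow> r \<in> carrier R \<Longrightarrow> r \<odot>\<^bsub>opc P n\<^esub> \<zero>\<^bsub>opc P n\<^esub> = \<zero>\<^bsub>opc P n\<^esub>"
  using opc_module by (rule module.smult_r_null)

lemma act_zero: assumes "1 \<le> n" "t permutes {..<n}"
  shows "act P n t \<zero>\<^bsub>opc P n\<^esub> = \<zero>\<^bsub>opc P n\<^esub>"
proof -
  interpret M: module R "opc P n" using assms opc_module by simp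
  have "act P n t (\<zero>\<^bsub>R\<^esub> \<odot>\<^bsub>opc P n\<^esub> \<zero>\<^bsub>opc P n\<^esub>) = \<zero>\<^bsub>R\<^esub> \<odot>\<^bsub>opc P n\<^esub> act P n t \<zero>\<^bsub>opc P n\<^esub>"
    using assms by (intro act_smult) auto
  then show ?thesis using assms act_closed by simp
qed

lemma ops_in_bounds:
  assumes "ops_in P ks xs" shows "length ks \<le> sum_list ks" "k \<in> set ks \<Longrightarrow> 1 \<le> k"
proof -
  show g: "k \<in> set ks \<Longrightarrow> 1 \<le> k" for k
    using assms by (auto simp: ops_in_def list_all2_conv_all_nth in_set_conv_nth)
  have "(\<And>k. k \<in> set ks \<Longrightarrow> 1 \<le> k) \<Longrightarrow> length ks \<le> sum_list ks" for ks :: "nat list"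
    by (induction ks) force+
  then show "length ks \<le> sum_list ks" using g by blast
qed

lemma carrier_trunc2: "carrier (opc (trunc2 P) n) = (if n \<le> 2 then carrier (opc P n) else {\<zero>\<^bsub>opc P n\<^esub>})"
  by (simp add: trunc2_def)

lemma ctD: "1 \<le> n \<Longrightarrow> x \<in> carrier (opc (trunc2 P) n) \<Longrightarrow> x \<in> carrier (opc P n)"
  using opc_zero by (auto simp: carrier_trunc2 split: if_splits)

lemma ops_trunc2D: "ops_in (trunc2 P) ks xs \<Longrightarrow> ops_in P ks xs"
  unfolding ops_in_def by (erule list_all2_mono) (auto dest: ctD[simplified])

lemma trunc2_ops[simp]:
  "add (opc (trunc2 P) n) = add (opc P n)" "zero (opc (trunc2 P) n) = zero (opc P n)"
  "smult (opc (trunc2 P) n) = smult (opc P n)" "act (trunc2 P) = act P" "unit (trunc2 P) = unit P"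
  "comp (trunc2 P) ks xs y = (if sum_list ks \<le> 2 then comp P ks xs y else \<zero>\<^bsub>opc P (sum_list ks)\<^esub>)"
  by (simp_all add: trunc2_def)

lemma sum_ge1: "ops_in P ks xs \<Longrightarrow> ks \<noteq> [] \<Longrightarrow> 1 \<le> sum_list ks"
  using ops_in_bounds(1)[of ks xs] by (cases ks) auto

lemma ops_in_append: "ops_in P js us \<Longrightarrow> ops_in P ls vs \<Longrightarrow> 1 \<le> k \<Longrightarrow> x \<in> carrier (opc P k)
   \<Longrightarrow> ops_in P (js @ k # ls) (us @ x # vs)"
  unfolding ops_in_def by (auto intro: list_all2_appendI)

lemma operad_trunc2: "operad R (trunc2 P)"
proof (intro operad.intro operad_axioms.intro)
  fix n :: nat assume n: "1 \<le> n"
  then interpret M: module R "opc P n" by (rule opc_module)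
  show "module R (opc (trunc2 P) n)"
  proof (cases "n \<le> 2")
    case True then show ?thesis using n opc_module by (simp add: trunc2_def)
  next
    case False
    have "submodule {\<zero>\<^bsub>opc P n\<^esub>} R (opc P n)" by (rule M.submoduleI) auto
    then show ?thesis using False submodule.submodule_is_module[OF _ M.module_axioms] by (simp add: trunc2_def)
  qed
next
  fix n t x assume "1 \<le> n" "t permutes {..<n}" "x \<in> carrier (opc (trunc2 P) n)"
  then show "act (trunc2 P) n t x \<in> carrier (opc (trunc2 P) n)"
    by (auto simp: carrier_trunc2 act_closed[simplified] act_zero[simplified] split: if_splits)
next
  show "unit (trunc2 P) \<in> carrier (opc (trunc2 P) 1)" using unit_closed by (simp add: carrier_trunc2)
next
  fix ks xs y assume a: "ks \<noteq> []" "ops_in (trunc2 P) ks xs" "y \<in> carrier (opc (trunc2 P) (length ks))"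
  then show "comp (trunc2 P) ks xs y \<in> carrier (opc (trunc2 P) (sum_list ks))"
    using comp_closed[OF a(1) ops_trunc2D[OF a(2)] ctD[OF _ a(3)]] by (auto simp: carrier_trunc2 Suc_le_eq)
next
  fix kss xss ys z
  assume a: "kss \<noteq> []" "\<forall>ks\<in>set kss. ks \<noteq> []" "list_all2 (ops_in (trunc2 P)) kss xss"
    "ops_in (trunc2 P) (map length kss) ys" "z \<in> carrier (opc (trunc2 P) (length kss))"
  have k: "list_all2 (ops_in P) kss xss" using a(3) by (rule list_all2_mono) (rule ops_trunc2D)
  have y: "ops_in P (map length kss) ys" using a(4) by (rule ops_trunc2D)
  have z: "z \<in> carrier (opc P (length kss))" using a(1,5) by (intro ctD) (auto simp: Suc_le_eq)
  have s: "sum_list (concat kss) = sum_list (map sum_list kss)" by (induction kss) auto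
  have le: "\<forall>ks \<in> set kss. length ks \<le> sum_list ks"
    using k ops_in_bounds(1) by (fastforce simp: list_all2_conv_all_nth in_set_conv_nth)
  have 1: "sum_list (map length kss) \<le> sum_list (map sum_list kss)"
    using le by (intro sum_list_mono) auto
  have 2: "sum_list ks \<le> 2" if "ks \<in> set kss" "sum_list (map sum_list kss) \<le> 2" for ks
    using member_le_sum_list[of "sum_list ks" "map sum_list kss"] that by auto
  have 3: "map (\<lambda>(ks, xs, y). comp (trunc2 P) ks xs y) (zip kss (zip xss ys)) =
     map (\<lambda>(ks, xs, y). comp P ks xs y) (zip kss (zip xss ys))" if "sum_list (map sum_list kss) \<le> 2"
    using 2 that by (auto dest!: set_zip_leftD)
  show "comp (trunc2 P) (map sum_list kss) (map (\<lambda>(ks, xs, y). comp (trunc2 P) ks xs y) (zip kss (zip xss ys))) z =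
       comp (trunc2 P) (concat kss) (concat xss) (comp (trunc2 P) (map length kss) ys z)"
  proof (cases "sum_list (map sum_list kss) \<le> 2")
    case True
    show ?thesis unfolding 3[OF True] using comp_assoc[OF a(1,2) k y z] 1 s True by simp
  next
    case False then show ?thesis using s by simp
  qed
next
  fix ks t xs y assume a: "ks \<noteq> []" "t permutes {..<length ks}" "ops_in (trunc2 P) ks xs"
     "y \<in> carrier (opc (trunc2 P) (length ks))"
  have x: "ops_in P ks xs" using a(3) by (rule ops_trunc2D)
  have y: "y \<in> carrier (opc P (length ks))" using a(1,4) by (intro ctD) (auto simp: Suc_le_eq)
  have s: "sum_list (permute_list t ks) = sum_list ks"
    using mset_permute_list[OF a(2)] by (metis sum_mset_sum_list)
  show "comp (trunc2 P) ks xs (act (trunc2 P) (length ks) t y) =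
       act (trunc2 P) (sum_list ks) (block_perm ks t) (comp (trunc2 P) (permute_list t ks) (permute_list t xs) y)"
    using comp_act[OF a(1,2) x y] s act_zero[OF sum_ge1[OF x a(1)] block_perm_permutes[OF a(2)]] by simp
next
  fix ks ss xs y assume a: "ks \<noteq> []" "list_all2 (\<lambda>k s. s permutes {..<k}) ks ss" "ops_in (trunc2 P) ks xs"
     "y \<in> carrier (opc (trunc2 P) (length ks))"
  have x: "ops_in P ks xs" using a(3) by (rule ops_trunc2D)
  have y: "y \<in> carrier (opc P (length ks))" using a(1,4) by (intro ctD) (auto simp: Suc_le_eq)
  show "comp (trunc2 P) ks (map (\<lambda>(k, s, x). act (trunc2 P) k s x) (zip ks (zip ss xs))) y =
       act (trunc2 P) (sum_list ks) (block_sum ks ss) (comp (trunc2 P) ks xs y)"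
    using comp_act_args[OF a(1,2) x y] act_zero[OF sum_ge1[OF x a(1)] block_sum_permutes[OF a(2)]] by simp
next
  fix k js us ls vs x x' y
  assume a: "1 \<le> k" "ops_in (trunc2 P) js us" "ops_in (trunc2 P) ls vs" "x \<in> carrier (opc (trunc2 P) k)"
    "x' \<in> carrier (opc (trunc2 P) k)" "y \<in> carrier (opc (trunc2 P) (length (js @ k # ls)))"
  have y: "y \<in> carrier (opc P (length (js @ k # ls)))" using a(6) by (intro ctD) auto
  show "comp (trunc2 P) (js @ k # ls) (us @ (x \<oplus>\<^bsub>opc (trunc2 P) k\<^esub> x') # vs) y =
          comp (trunc2 P) (js @ k # ls) (us @ x # vs) y \<oplus>\<^bsub>opc (trunc2 P) (sum_list (js @ k # ls))\<^esub>
          comp (trunc2 P) (js @ k # ls) (us @ x' # vs) y"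
    using comp_add_arg[OF a(1) ops_trunc2D[OF a(2)] ops_trunc2D[OF a(3)] ctD[OF a(1,4)] ctD[OF a(1,5)] y]
      opc_zz[of "sum_list (js @ k # ls)"] a(1) by simp
next
  fix k js us ls vs r x y
  assume a: "1 \<le> k" "ops_in (trunc2 P) js us" "ops_in (trunc2 P) ls vs" "r \<in> carrier R" "x \<in> carrier (opc (trunc2 P) k)"
    "y \<in> carrier (opc (trunc2 P) (length (js @ k # ls)))"
  have y: "y \<in> carrier (opc P (length (js @ k # ls)))" using a(6) by (intro ctD) auto
  show "comp (trunc2 P) (js @ k # ls) (us @ (r \<odot>\<^bsub>opc (trunc2 P) k\<^esub> x) # vs) y =
          r \<odot>\<^bsub>opc (trunc2 P) (sum_list (js @ k # ls))\<^esub> comp (trunc2 P) (js @ k # ls) (us @ x # vs) y"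
    using comp_smult_arg[OF a(1) ops_trunc2D[OF a(2)] ops_trunc2D[OF a(3)] a(4) ctD[OF a(1,5)] y]
      opc_sz[of "sum_list (js @ k # ls)" r] a(1,4) by simp
next
  fix ks xs y y' assume a: "ks \<noteq> []" "ops_in (trunc2 P) ks xs" "y \<in> carrier (opc (trunc2 P) (length ks))"
    "y' \<in> carrier (opc (trunc2 P) (length ks))"
  have l: "1 \<le> length ks" using a(1) by (simp add: Suc_le_eq)
  show "comp (trunc2 P) ks xs (y \<oplus>\<^bsub>opc (trunc2 P) (length ks)\<^esub> y') =
      comp (trunc2 P) ks xs y \<oplus>\<^bsub>opc (trunc2 P) (sum_list ks)\<^esub> comp (trunc2 P) ks xs y'"
    using comp_add[OF a(1) ops_trunc2D[OF a(2)] ctD[OF l a(3)] ctD[OF l a(4)]]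
      opc_zz[OF sum_ge1[OF ops_trunc2D[OF a(2)] a(1)]] by simp
next
  fix ks xs r y assume a: "ks \<noteq> []" "ops_in (trunc2 P) ks xs" "r \<in> carrier R" "y \<in> carrier (opc (trunc2 P) (length ks))"
  have l: "1 \<le> length ks" using a(1) by (simp add: Suc_le_eq)
  show "comp (trunc2 P) ks xs (r \<odot>\<^bsub>opc (trunc2 P) (length ks)\<^esub> y) =
      r \<odot>\<^bsub>opc (trunc2 P) (sum_list ks)\<^esub> comp (trunc2 P) ks xs y"
    using comp_smult[OF a(1) ops_trunc2D[OF a(2)] a(3) ctD[OF l a(4)]]
      opc_sz[OF sum_ge1[OF ops_trunc2D[OF a(2)] a(1)] a(3)] by simp
next
  fix n y assume a: "1 \<le> n" "y \<in> carrier (opc (trunc2 P) n)"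
  have s: "sum_list (replicate n (1::nat)) = n" by (simp add: sum_list_replicate)
  show "comp (trunc2 P) (replicate n 1) (replicate n (unit (trunc2 P))) y = y"
    using comp_unit_left[OF a(1) ctD[OF a]] a s by (auto simp: carrier_trunc2)
  show "comp (trunc2 P) [n] [y] (unit (trunc2 P)) = y"
    using comp_unit_right[OF a(1) ctD[OF a]] a by (auto simp: carrier_trunc2)
qed (simp_all add: is_cring act_add[simplified] act_smult[simplified] act_id[simplified] act_comp[simplified] ctD[simplified])

end


section \<open>Algebras over an operad\<close>

text \<open>
  The arity of \<open>mu A as x\<close> is the length of \<open>as\<close>. Outside of its proper domain \<open>mu A\<close> is required to be
  \<open>undefined\<close>, so that an algebra structure is a function on that domain and nothing else.
\<close>

record ('r, 'a, 'p) palg = "('r, 'a) module" +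
  mu :: "'a list \<Rightarrow> 'p \<Rightarrow> 'a"

definition mu_dom :: "('r, 'p) operad \<Rightarrow> 'a set \<Rightarrow> 'a list \<Rightarrow> 'p \<Rightarrow> bool" where
  "mu_dom P C as x \<longleftrightarrow> as \<noteq> [] \<and> set as \<subseteq> C \<and> x \<in> carrier (opc P (length as))"

definition mk_alg ::
    "('r, 'p) operad \<Rightarrow> ('r, 'a, 'z) module_scheme \<Rightarrow> ('a list \<Rightarrow> 'p \<Rightarrow> 'a) \<Rightarrow> ('r, 'a, 'p) palg" where
  "mk_alg P M f = \<lparr>carrier = carrier M, mult = mult M, one = one M, zero = zero M, add = add M,
     smult = smult M, mu = (\<lambda>as x. if mu_dom P (carrier M) as x then f as x else undefined)\<rparr>"

locale palgebra = operad R P + module R A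
  for R :: "'r ring" and P :: "('r, 'p) operad" and A :: "('r, 'a, 'p) palg" +
  assumes mu_closed: "mu_dom P (carrier A) as x \<Longrightarrow> mu A as x \<in> carrier A"
    and mu_undefined: "\<not> mu_dom P (carrier A) as x \<Longrightarrow> mu A as x = undefined"
    and mu_add_arg: "\<lbrakk>mu_dom P (carrier A) (us @ a # vs) x; b \<in> carrier A\<rbrakk>
      \<Longrightarrow> mu A (us @ (a \<oplus>\<^bsub>A\<^esub> b) # vs) x = mu A (us @ a # vs) x \<oplus>\<^bsub>A\<^esub> mu A (us @ b # vs) x"
    and mu_smult_arg: "\<lbrakk>mu_dom P (carrier A) (us @ a # vs) x; r \<in> carrier R\<rbrakk>
      \<Longrightarrow> mu A (us @ (r \<odot>\<^bsub>A\<^esub> a) # vs) x = r \<odot>\<^bsub>A\<^esub> mu A (us @ a # vs) x"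
    and mu_add: "\<lbrakk>mu_dom P (carrier A) as x; mu_dom P (carrier A) as y\<rbrakk>
      \<Longrightarrow> mu A as (x \<oplus>\<^bsub>opc P (length as)\<^esub> y) = mu A as x \<oplus>\<^bsub>A\<^esub> mu A as y"
    and mu_smult: "\<lbrakk>mu_dom P (carrier A) as x; r \<in> carrier R\<rbrakk>
      \<Longrightarrow> mu A as (r \<odot>\<^bsub>opc P (length as)\<^esub> x) = r \<odot>\<^bsub>A\<^esub> mu A as x"
    and mu_unit: "a \<in> carrier A \<Longrightarrow> mu A [a] (unit P) = a"
    and mu_comp: "\<lbrakk>ass \<noteq> []; list_all2 (mu_dom P (carrier A)) ass xs;
        y \<in> carrier (opc P (length ass))\<rbrakk>
      \<Longrightarrow> mu A (concat ass) (comp P (map length ass) xs y) = mu A (map2 (mu A) ass xs) y"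
    and mu_act: "\<lbrakk>mu_dom P (carrier A) as x; t permutes {..<length as}\<rbrakk>
      \<Longrightarrow> mu A as (act P (length as) t x) = mu A (permute_list t as) x"

definition alg_hom ::
    "'r ring \<Rightarrow> ('r, 'p) operad \<Rightarrow> ('r, 'a, 'p) palg \<Rightarrow> ('r, 'b, 'p) palg \<Rightarrow> ('a \<Rightarrow> 'b) set" where
  "alg_hom R P A B = {f. f \<in> carrier A \<rightarrow> carrier B \<and>
     (\<forall>a \<in> carrier A. \<forall>b \<in> carrier A. f (a \<oplus>\<^bsub>A\<^esub> b) = f a \<oplus>\<^bsub>B\<^esub> f b) \<and>
     (\<forall>r \<in> carrier R. \<forall>a \<in> carrier A. f (r \<odot>\<^bsub>A\<^esub> a) = r \<odot>\<^bsub>B\<^esub> f a) \<and>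
     (\<forall>as x. mu_dom P (carrier A) as x \<longrightarrow> f (mu A as x) = mu B (map f as) x)}"

definition alg_iso ::
    "'r ring \<Rightarrow> ('r, 'p) operad \<Rightarrow> ('r, 'a, 'p) palg \<Rightarrow> ('r, 'b, 'p) palg \<Rightarrow> ('a \<Rightarrow> 'b) set" where
  "alg_iso R P A B = {f \<in> alg_hom R P A B. bij_betw f (carrier A) (carrier B)}"

text \<open>Restriction of algebras over the truncated operad along the canonical map onto \<open>trunc2 P\<close>,
  which is the identity in arities up to 2 and zero above.\<close>

definition restrict_trunc2 :: "('r, 'p) operad \<Rightarrow> ('r, 'a, 'p) palg \<Rightarrow> ('r, 'a, 'p) palg" where
  "restrict_trunc2 P A =
     mk_alg P A (\<lambda>as x. mu A as (if length as \<le> 2 then x else \<zero>\<^bsub>opc P (length as)\<^esub>))"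


section \<open>Products, subalgebras, quotients\<close>

definition prod_alg ::
    "('r, 'p) operad \<Rightarrow> ('r, 'a, 'p) palg \<Rightarrow> ('r, 'b, 'p) palg \<Rightarrow> ('r, 'a \<times> 'b, 'p) palg" where
  "prod_alg P A B = mk_alg P
     \<lparr>carrier = carrier A \<times> carrier B, mult = undefined, one = undefined,
      zero = (\<zero>\<^bsub>A\<^esub>, \<zero>\<^bsub>B\<^esub>),
      add = (\<lambda>(a, b) (a', b'). (a \<oplus>\<^bsub>A\<^esub> a', b \<oplus>\<^bsub>B\<^esub> b')),
      smult = (\<lambda>r (a, b). (r \<odot>\<^bsub>A\<^esub> a, r \<odot>\<^bsub>B\<^esub> b))\<rparr>
     (\<lambda>cs x. (mu A (map fst cs) x, mu B (map snd cs) x))"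

definition sub_alg :: "('r, 'p) operad \<Rightarrow> ('r, 'a, 'p) palg \<Rightarrow> 'a set \<Rightarrow> ('r, 'a, 'p) palg" where
  "sub_alg P A K = mk_alg P (A\<lparr>carrier := K\<rparr>) (mu A)"

definition rep :: "'a set \<Rightarrow> 'a" where
  "rep X = (SOME x. x \<in> X)"

text \<open>Quotients by a submodule \<open>I\<close>, resp. an ideal (a submodule absorbing all operations); operations are
  computed on representatives.\<close>

definition quot_mod :: "('r, 'a, 'z) module_scheme \<Rightarrow> 'a set \<Rightarrow> ('r, 'a set) module" where
  "quot_mod M I =
     \<lparr>carrier = a_rcosets\<^bsub>M\<^esub> I, mult = undefined, one = undefined, zero = I,
      add = (\<lambda>X Y. X <+>\<^bsub>M\<^esub> Y), smult = (\<lambda>r X. I +>\<^bsub>M\<^esub> (r \<odot>\<^bsub>M\<^esub> rep X))\<rparr>"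

definition quot_alg :: "('r, 'p) operad \<Rightarrow> ('r, 'a, 'p) palg \<Rightarrow> 'a set \<Rightarrow> ('r, 'a set, 'p) palg" where
  "quot_alg P A I = mk_alg P (quot_mod A I) (\<lambda>Xs x. I +>\<^bsub>A\<^esub> mu A (map rep Xs) x)"

definition quot_map :: "('r, 'b, 'p) palg \<Rightarrow> 'b set \<Rightarrow> ('a \<Rightarrow> 'b) \<Rightarrow> 'a set \<Rightarrow> 'b set" where
  "quot_map B J f X = J +>\<^bsub>B\<^esub> f (rep X)"

definition mspan :: "'r ring \<Rightarrow> ('r, 'a, 'z) module_scheme \<Rightarrow> 'a set \<Rightarrow> 'a set" where
  "mspan R M S = \<Inter>{H. submodule H R M \<and> S \<subseteq> H}"


section \<open>Coproducts of algebras\<close>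

text \<open>
  The coproduct of \<open>A\<close> and \<open>B\<close> is presented by generators and relations: formal terms in the elements
  of \<open>A\<close> and \<open>B\<close> modulo the congruence \<open>coprod_eq\<close> generated by the identities of algebras over the
  operad and by the relations which hold in \<open>A\<close> and in \<open>B\<close>.
\<close>

datatype ('g, 'r, 'p) trm =
    Gen 'g
  | Zero
  | Plus "('g, 'r, 'p) trm" "('g, 'r, 'p) trm"
  | Smul 'r "('g, 'r, 'p) trm"
  | Op "('g, 'r, 'p) trm list" 'p

fun wf_trm :: "'r ring \<Rightarrow> ('r, 'p) operad \<Rightarrow> 'g set \<Rightarrow> ('g, 'r, 'p) trm \<Rightarrow> bool" where
  "wf_trm R P G (Gen g) \<longleftrightarrow> g \<in> G"
| "wf_trm R P G Zero \<longleftrightarrow> True"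
| "wf_trm R P G (Plus t u) \<longleftrightarrow> wf_trm R P G t \<and> wf_trm R P G u"
| "wf_trm R P G (Smul r t) \<longleftrightarrow> r \<in> carrier R \<and> wf_trm R P G t"
| "wf_trm R P G (Op ts x) \<longleftrightarrow>
     ts \<noteq> [] \<and> (\<forall>t \<in> set ts. wf_trm R P G t) \<and> x \<in> carrier (opc P (length ts))"

primrec eval_trm :: "('r, 'c, 'p) palg \<Rightarrow> ('g \<Rightarrow> 'c) \<Rightarrow> ('g, 'r, 'p) trm \<Rightarrow> 'c" where
  "eval_trm C h (Gen g) = h g"
| "eval_trm C h Zero = \<zero>\<^bsub>C\<^esub>"
| "eval_trm C h (Plus t u) = eval_trm C h t \<oplus>\<^bsub>C\<^esub> eval_trm C h u"
| "eval_trm C h (Smul r t) = r \<odot>\<^bsub>C\<^esub> eval_trm C h t"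
| "eval_trm C h (Op ts x) = mu C (map (eval_trm C h) ts) x"

abbreviation wf_cop ::
    "'r ring \<Rightarrow> ('r, 'p) operad \<Rightarrow> ('r, 'a, 'p) palg \<Rightarrow> ('r, 'b, 'p) palg
     \<Rightarrow> ('a + 'b, 'r, 'p) trm \<Rightarrow> bool" where
  "wf_cop R P A B \<equiv> wf_trm R P (Inl ` carrier A \<union> Inr ` carrier B)"

inductive coprod_eq ::
    "'r ring \<Rightarrow> ('r, 'p) operad \<Rightarrow> ('r, 'a, 'p) palg \<Rightarrow> ('r, 'b, 'p) palg
     \<Rightarrow> ('a + 'b, 'r, 'p) trm \<Rightarrow> ('a + 'b, 'r, 'p) trm \<Rightarrow> bool"
  for R P A B
  where
    refl: "wf_cop R P A B t \<Longrightarrow> coprod_eq R P A B t t"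
  | sym: "coprod_eq R P A B t u \<Longrightarrow> coprod_eq R P A B u t"
  | trans: "\<lbrakk>coprod_eq R P A B t u; coprod_eq R P A B u v\<rbrakk> \<Longrightarrow> coprod_eq R P A B t v"
  | plus_cong: "\<lbrakk>coprod_eq R P A B t t'; coprod_eq R P A B u u'\<rbrakk>
      \<Longrightarrow> coprod_eq R P A B (Plus t u) (Plus t' u')"
  | smul_cong: "\<lbrakk>r \<in> carrier R; coprod_eq R P A B t t'\<rbrakk>
      \<Longrightarrow> coprod_eq R P A B (Smul r t) (Smul r t')"
  | op_cong: "\<lbrakk>wf_cop R P A B (Op (us @ t # vs) x); coprod_eq R P A B t t'\<rbrakk>
      \<Longrightarrow> coprod_eq R P A B (Op (us @ t # vs) x) (Op (us @ t' # vs) x)"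
  | plus_assoc: "\<lbrakk>wf_cop R P A B t; wf_cop R P A B u; wf_cop R P A B v\<rbrakk>
      \<Longrightarrow> coprod_eq R P A B (Plus (Plus t u) v) (Plus t (Plus u v))"
  | plus_comm: "\<lbrakk>wf_cop R P A B t; wf_cop R P A B u\<rbrakk>
      \<Longrightarrow> coprod_eq R P A B (Plus t u) (Plus u t)"
  | plus_zero: "wf_cop R P A B t \<Longrightarrow> coprod_eq R P A B (Plus Zero t) t"
  | smul_zero: "wf_cop R P A B t \<Longrightarrow> coprod_eq R P A B (Smul \<zero>\<^bsub>R\<^esub> t) Zero"
  | smul_one: "wf_cop R P A B t \<Longrightarrow> coprod_eq R P A B (Smul \<one>\<^bsub>R\<^esub> t) t"
  | smul_add: "\<lbrakk>r \<in> carrier R; s \<in> carrier R; wf_cop R P A B t\<rbrakk>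
      \<Longrightarrow> coprod_eq R P A B (Smul (r \<oplus>\<^bsub>R\<^esub> s) t) (Plus (Smul r t) (Smul s t))"
  | smul_plus: "\<lbrakk>r \<in> carrier R; wf_cop R P A B t; wf_cop R P A B u\<rbrakk>
      \<Longrightarrow> coprod_eq R P A B (Smul r (Plus t u)) (Plus (Smul r t) (Smul r u))"
  | smul_mult: "\<lbrakk>r \<in> carrier R; s \<in> carrier R; wf_cop R P A B t\<rbrakk>
      \<Longrightarrow> coprod_eq R P A B (Smul (r \<otimes>\<^bsub>R\<^esub> s) t) (Smul r (Smul s t))"
  | op_plus: "\<lbrakk>wf_cop R P A B (Op (us @ t # vs) x); wf_cop R P A B t'\<rbrakk>
      \<Longrightarrow> coprod_eq R P A B (Op (us @ Plus t t' # vs) x)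
            (Plus (Op (us @ t # vs) x) (Op (us @ t' # vs) x))"
  | op_smul: "\<lbrakk>wf_cop R P A B (Op (us @ t # vs) x); r \<in> carrier R\<rbrakk>
      \<Longrightarrow> coprod_eq R P A B (Op (us @ Smul r t # vs) x) (Smul r (Op (us @ t # vs) x))"
  | op_add: "\<lbrakk>wf_cop R P A B (Op ts x); wf_cop R P A B (Op ts y)\<rbrakk>
      \<Longrightarrow> coprod_eq R P A B (Op ts (x \<oplus>\<^bsub>opc P (length ts)\<^esub> y)) (Plus (Op ts x) (Op ts y))"
  | op_smult: "\<lbrakk>wf_cop R P A B (Op ts x); r \<in> carrier R\<rbrakk>
      \<Longrightarrow> coprod_eq R P A B (Op ts (r \<odot>\<^bsub>opc P (length ts)\<^esub> x)) (Smul r (Op ts x))"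
  | op_unit: "wf_cop R P A B t \<Longrightarrow> coprod_eq R P A B (Op [t] (unit P)) t"
  | op_comp: "\<lbrakk>tss \<noteq> []; list_all2 (\<lambda>ts x. wf_cop R P A B (Op ts x)) tss xs;
        y \<in> carrier (opc P (length tss))\<rbrakk>
      \<Longrightarrow> coprod_eq R P A B (Op (concat tss) (comp P (map length tss) xs y)) (Op (map2 Op tss xs) y)"
  | op_act: "\<lbrakk>wf_cop R P A B (Op ts x); s permutes {..<length ts}\<rbrakk>
      \<Longrightarrow> coprod_eq R P A B (Op ts (act P (length ts) s x)) (Op (permute_list s ts) x)"
  | inl_add: "\<lbrakk>a \<in> carrier A; a' \<in> carrier A\<rbrakk>
      \<Longrightarrow> coprod_eq R P A B (Gen (Inl (a \<oplus>\<^bsub>A\<^esub> a'))) (Plus (Gen (Inl a)) (Gen (Inl a')))"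
  | inl_smult: "\<lbrakk>r \<in> carrier R; a \<in> carrier A\<rbrakk>
      \<Longrightarrow> coprod_eq R P A B (Gen (Inl (r \<odot>\<^bsub>A\<^esub> a))) (Smul r (Gen (Inl a)))"
  | inl_mu: "mu_dom P (carrier A) as x
      \<Longrightarrow> coprod_eq R P A B (Gen (Inl (mu A as x))) (Op (map (\<lambda>a. Gen (Inl a)) as) x)"
  | inr_add: "\<lbrakk>b \<in> carrier B; b' \<in> carrier B\<rbrakk>
      \<Longrightarrow> coprod_eq R P A B (Gen (Inr (b \<oplus>\<^bsub>B\<^esub> b'))) (Plus (Gen (Inr b)) (Gen (Inr b')))"
  | inr_smult: "\<lbrakk>r \<in> carrier R; b \<in> carrier B\<rbrakk>
      \<Longrightarrow> coprod_eq R P A B (Gen (Inr (r \<odot>\<^bsub>B\<^esub> b))) (Smul r (Gen (Inr b)))"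
  | inr_mu: "mu_dom P (carrier B) bs x
      \<Longrightarrow> coprod_eq R P A B (Gen (Inr (mu B bs x))) (Op (map (\<lambda>b. Gen (Inr b)) bs) x)"

type_synonym ('r, 'a, 'b, 'p) cop = "('a + 'b, 'r, 'p) trm set"

definition cop_class ::
    "'r ring \<Rightarrow> ('r, 'p) operad \<Rightarrow> ('r, 'a, 'p) palg \<Rightarrow> ('r, 'b, 'p) palg
     \<Rightarrow> ('a + 'b, 'r, 'p) trm \<Rightarrow> ('r, 'a, 'b, 'p) cop" where
  "cop_class R P A B t = {u. coprod_eq R P A B t u}"

definition coprod ::
    "'r ring \<Rightarrow> ('r, 'p) operad \<Rightarrow> ('r, 'a, 'p) palg \<Rightarrow> ('r, 'b, 'p) palg
     \<Rightarrow> ('r, ('r, 'a, 'b, 'p) cop, 'p) palg" where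
  "coprod R P A B = mk_alg P
     \<lparr>carrier = cop_class R P A B ` {t. wf_cop R P A B t}, mult = undefined, one = undefined,
      zero = cop_class R P A B Zero,
      add = (\<lambda>X Y. cop_class R P A B (Plus (rep X) (rep Y))),
      smult = (\<lambda>r X. cop_class R P A B (Smul r (rep X)))\<rparr>
     (\<lambda>Xs x. cop_class R P A B (Op (map rep Xs) x))"

definition inl ::
    "'r ring \<Rightarrow> ('r, 'p) operad \<Rightarrow> ('r, 'a, 'p) palg \<Rightarrow> ('r, 'b, 'p) palg
     \<Rightarrow> 'a \<Rightarrow> ('r, 'a, 'b, 'p) cop" where
  "inl R P A B a = cop_class R P A B (Gen (Inl a))"

definition inr ::
    "'r ring \<Rightarrow> ('r, 'p) operad \<Rightarrow> ('r, 'a, 'p) palg \<Rightarrow> ('r, 'b, 'p) palg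
     \<Rightarrow> 'b \<Rightarrow> ('r, 'a, 'b, 'p) cop" where
  "inr R P A B b = cop_class R P A B (Gen (Inr b))"

definition copair ::
    "('r, 'c, 'p) palg \<Rightarrow> ('a \<Rightarrow> 'c) \<Rightarrow> ('b \<Rightarrow> 'c) \<Rightarrow> ('r, 'a, 'b, 'p) cop \<Rightarrow> 'c" where
  "copair C f g X = eval_trm C (case_sum f g) (rep X)"


subsection \<open>The universal property of the coproduct\<close>

text \<open>
  It is stated for targets \<open>D\<close> over an arbitrary carrier type: \<open>C_palgebra\<close>, \<open>inl_hom\<close>, \<open>inr_hom\<close>,
  \<open>copair_hom\<close>, \<open>copair_inl\<close>, \<open>copair_inr\<close>, \<open>copair_unique\<close>.
\<close>

lemma rep_in: "x \<in> X \<Longrightarrow> rep X \<in> X"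
  unfolding rep_def by (rule someI)

lemma (in operad) comp_dom:
  assumes "tss \<noteq> []" "list_all2 (\<lambda>ts x. ts \<noteq> [] \<and> x \<in> carrier (opc P (length ts))) tss xs"
    and "y \<in> carrier (opc P (length tss))"
  shows "comp P (map length tss) xs y \<in> carrier (opc P (length (concat tss)))"
proof -
  have "ops_in P (map length tss) xs"
    unfolding ops_in_def list_all2_map1 using assms(2)
    by (rule list_all2_mono) (auto simp: Suc_le_eq)
  from comp_closed[OF _ this] assms show ?thesis by (simp add: length_concat)
qed

locale two_palgebras = A?: palgebra R P A + B: palgebra R P B
  for R :: "'r ring" and P :: "('r, 'p) operad"
    and A :: "('r, 'a, 'p) palg" and B :: "('r, 'b, 'p) palg"
begin

abbreviation wf where "wf \<equiv> wf_cop R P A B"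
abbreviation eq (infix "\<approx>" 50) where "eq \<equiv> coprod_eq R P A B"
abbreviation cl where "cl \<equiv> cop_class R P A B"

lemma op_wfD: "1 \<le> n \<Longrightarrow> x \<in> carrier (opc P n) \<Longrightarrow> y \<in> carrier (opc P n) \<Longrightarrow>
  x \<oplus>\<^bsub>opc P n\<^esub> y \<in> carrier (opc P n)"
  using opc_module by (meson abelian_groupE(1) module.axioms(2))

lemma op_wfD2: "1 \<le> n \<Longrightarrow> r \<in> carrier R \<Longrightarrow> x \<in> carrier (opc P n) \<Longrightarrow>
  r \<odot>\<^bsub>opc P n\<^esub> x \<in> carrier (opc P n)"
  using opc_module by (rule module.smult_closed)

lemma crR: "cring R" by (rule A.operad_axioms[unfolded operad_def, THEN conjunct1])

lemma len_ge1: "ts \<noteq> [] \<Longrightarrow> 1 \<le> length ts" by (simp add: Suc_le_eq)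

lemma coprod_eq_wf: "t \<approx> u \<Longrightarrow> wf t \<and> wf u"
proof (induction rule: coprod_eq.induct)
  case (op_comp tss xs y)
  have 1: "list_all2 (\<lambda>ts x. ts \<noteq> [] \<and> x \<in> carrier (opc P (length ts))) tss xs"
    using op_comp(2) by (rule list_all2_mono) auto
  have "length xs = length tss" using 1 by (auto dest: list_all2_lengthD)
  moreover have "concat tss \<noteq> []" using op_comp(1) 1 by (cases tss) (auto simp: list_all2_Cons1)
  moreover have "\<forall>t \<in> set (map2 Op tss xs). wf t"
    using op_comp(2) by (auto simp: set_zip list_all2_conv_all_nth)
  moreover have "\<forall>ts \<in> set tss. \<forall>t \<in> set ts. wf t"
    using op_comp(2) by (fastforce simp: list_all2_conv_all_nth in_set_conv_nth)
  moreover have "map2 Op tss xs \<noteq> []" using \<open>length xs = length tss\<close> op_comp(1) by auto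
  ultimately show ?case using comp_dom[OF op_comp(1) 1 op_comp(3)] op_comp(1,3) by (auto simp del: zip_eq_Nil_iff)
next
  case (op_act ts x s)
  have "permute_list s ts \<noteq> []" using op_act by (metis length_permute_list length_0_conv wf_trm.simps(5))
  then show ?case using op_act act_closed[OF len_ge1] by (auto simp: set_permute_list)
next
  case op_unit then show ?case by (auto simp: unit_closed[simplified])
qed (auto simp: op_wfD[OF len_ge1] op_wfD2[OF len_ge1] A.mu_closed B.mu_closed mu_dom_def B.smult_closed)

lemma op_cong_list:
  assumes "list_all2 eq ts us" "ts \<noteq> []" "x \<in> carrier (opc P (length ts))"
  shows "Op ts x \<approx> Op us x"
proof -
  have "Op (ws @ ts) x \<approx> Op (ws @ us) x"
    if "list_all2 eq ts us" "ws @ ts \<noteq> []" "x \<in> carrier (opc P (length (ws @ ts)))" "\<forall>t\<in>set ws. wf t" for ws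
    using that
  proof (induction ts us arbitrary: ws rule: list_all2_induct)
    case Nil then show ?case by (auto intro: coprod_eq.refl)
  next
    case (Cons t ts u us)
    have wfs: "\<forall>t \<in> set ts. wf t"
      using Cons(2) coprod_eq_wf by (fastforce simp: list_all2_conv_all_nth in_set_conv_nth)
    have "Op (ws @ t # ts) x \<approx> Op (ws @ u # ts) x"
      using Cons wfs coprod_eq_wf by (intro coprod_eq.op_cong) auto
    moreover have "Op ((ws @ [u]) @ ts) x \<approx> Op ((ws @ [u]) @ us) x"
      using Cons coprod_eq_wf by (intro Cons.IH) auto
    ultimately show ?case by (auto intro: coprod_eq.trans)
  qed
  from this[of "[]"] assms show ?thesis by simp
qed

lemma cl_eq: "wf t \<Longrightarrow> cl t = cl u \<longleftrightarrow> t \<approx> u"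
  unfolding cop_class_def
  by (auto intro: coprod_eq.refl coprod_eq.sym coprod_eq.trans)

lemma cl_eqI: "t \<approx> u \<Longrightarrow> cl t = cl u"
  unfolding cop_class_def by (auto intro: coprod_eq.sym coprod_eq.trans)

lemma rep_cl: "wf t \<Longrightarrow> t \<approx> rep (cl t)"
  using rep_in[of t "cl t"] unfolding cop_class_def by (auto intro: coprod_eq.refl)

abbreviation C where "C \<equiv> coprod R P A B"

lemma C_carrier: "carrier C = cl ` {t. wf t}"
  by (simp add: coprod_def mk_alg_def)

lemma C_zero: "\<zero>\<^bsub>C\<^esub> = cl Zero"
  by (simp add: coprod_def mk_alg_def)

lemma C_add: "wf t \<Longrightarrow> wf u \<Longrightarrow> cl t \<oplus>\<^bsub>C\<^esub> cl u = cl (Plus t u)"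
  using coprod_eq_wf[OF rep_cl] rep_cl
  by (simp add: coprod_def mk_alg_def) (auto simp: cl_eq intro!: coprod_eq.plus_cong dest: coprod_eq.sym)

lemma C_smult: "r \<in> carrier R \<Longrightarrow> wf t \<Longrightarrow> r \<odot>\<^bsub>C\<^esub> cl t = cl (Smul r t)"
  using coprod_eq_wf[OF rep_cl] rep_cl
  by (simp add: coprod_def mk_alg_def) (auto simp: cl_eq intro!: coprod_eq.smul_cong dest: coprod_eq.sym)

lemma C_dom: "\<forall>t\<in>set ts. wf t \<Longrightarrow> mu_dom P (carrier C) (map cl ts) x \<longleftrightarrow> wf (Op ts x)"
  by (auto simp: mu_dom_def C_carrier)

lemma C_mu: assumes "wf (Op ts x)" shows "mu C (map cl ts) x = cl (Op ts x)"
proof -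
  have "list_all2 eq ts (map (rep \<circ> cl) ts)"
    using assms rep_cl by (auto simp: list_all2_conv_all_nth)
  from op_cong_list[OF this] assms have "Op ts x \<approx> Op (map (rep \<circ> cl) ts) x" by simp
  moreover have "mu_dom P (cl ` {t. wf t}) (map cl ts) x" using C_dom[of ts x] assms C_carrier by simp
  ultimately show ?thesis using cl_eqI
    by (simp add: coprod_def mk_alg_def o_def)
qed

lemma C_listE:
  assumes "set Xs \<subseteq> carrier C"
  obtains ts where "Xs = map cl ts" "\<forall>t\<in>set ts. wf t"
proof -
  from assms have "\<exists>ts. Xs = map cl ts \<and> (\<forall>t\<in>set ts. wf t)"
  proof (induction Xs)
    case (Cons X Xs)
    then obtain t ts where "X = cl t" "wf t" "Xs = map cl ts" "\<forall>t\<in>set ts. wf t" by (auto simp: C_carrier)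
    then have "X # Xs = map cl (t # ts) \<and> (\<forall>t\<in>set (t # ts). wf t)" by simp
    then show ?case by (rule exI)
  qed auto
  then show ?thesis using that by blast
qed

lemma C_module: "module R C"
proof (rule moduleI)
  show "abelian_group C"
  proof (rule abelian_groupI)
    fix x assume "x \<in> carrier C"
    then obtain t where t: "x = cl t" "wf t" by (auto simp: C_carrier)
    let ?m = "\<ominus>\<^bsub>R\<^esub> \<one>\<^bsub>R\<^esub>"
    have w: "wf (Smul ?m t)" using t by simp
    have "Plus (Smul ?m t) t \<approx> Plus (Smul ?m t) (Smul \<one>\<^bsub>R\<^esub> t)"
      using t w by (intro coprod_eq.plus_cong coprod_eq.refl coprod_eq.sym[OF coprod_eq.smul_one])
    moreover have "Plus (Smul ?m t) (Smul \<one>\<^bsub>R\<^esub> t) \<approx> Smul (?m \<oplus>\<^bsub>R\<^esub> \<one>\<^bsub>R\<^esub>) t"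
      using t by (intro coprod_eq.sym[OF coprod_eq.smul_add]) auto
    moreover have "Smul (?m \<oplus>\<^bsub>R\<^esub> \<one>\<^bsub>R\<^esub>) t \<approx> Zero"
      using t coprod_eq.smul_zero[of R P A B t] by (simp add: abelian_group.l_neg[OF ring.is_abelian_group[OF cring.axioms(1)[OF crR]]] ring.ring_simprules(6)[OF cring.axioms(1)[OF crR]])
    ultimately have "Plus (Smul ?m t) t \<approx> Zero" by (meson coprod_eq.trans)
    then have "cl (Smul ?m t) \<oplus>\<^bsub>C\<^esub> x = \<zero>\<^bsub>C\<^esub>" using t w by (simp add: C_add C_zero cl_eq)
    then show "\<exists>y\<in>carrier C. y \<oplus>\<^bsub>C\<^esub> x = \<zero>\<^bsub>C\<^esub>" using w C_carrier by (intro bexI[of _ "cl (Smul ?m t)"]) auto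
  next
    fix x y assume "x \<in> carrier C" "y \<in> carrier C"
    then show "x \<oplus>\<^bsub>C\<^esub> y = y \<oplus>\<^bsub>C\<^esub> x"
      using cl_eqI[OF coprod_eq.plus_comm] by (auto simp only: C_carrier C_add image_iff mem_Collect_eq)
  qed (auto simp: C_carrier C_zero C_add cl_eqI[OF coprod_eq.plus_assoc] cl_eqI[OF coprod_eq.plus_zero])
qed (auto simp: C_carrier C_add C_smult crR cring.cring_simprules[OF crR] cl_eqI[OF coprod_eq.smul_add] cl_eqI[OF coprod_eq.smul_plus] cl_eqI[OF coprod_eq.smul_mult] cl_eqI[OF coprod_eq.smul_one])

lemma C_palgebra: "palgebra R P C"
proof -
  interpret M: module R C by (rule C_module)
  show ?thesis
  proof
    fix Xs x assume d: "mu_dom P (carrier C) Xs x"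
    then obtain ts where ts: "Xs = map cl ts" "\<forall>t\<in>set ts. wf t" by (meson C_listE mu_dom_def)
    then have "wf (Op ts x)" using d by (simp add: C_dom)
    then show "mu C Xs x \<in> carrier C" using C_mu[of ts x] ts by (auto simp: C_carrier simp del: wf_trm.simps)
  next
    fix Xs x assume d: "\<not> mu_dom P (carrier C) Xs x"
    then show "mu C Xs x = undefined" using C_carrier by (auto simp: coprod_def mk_alg_def)
  next
    fix us a vs x b assume d: "mu_dom P (carrier C) (us @ a # vs) x" and b: "b \<in> carrier C"
    then obtain ts where ts: "us @ a # vs = map cl ts" "\<forall>t\<in>set ts. wf t" by (meson C_listE mu_dom_def)
    then obtain us' t vs' where e: "ts = us' @ t # vs'" "us = map cl us'" "a = cl t" "vs = map cl vs'"
      using ts(1)[symmetric] by (auto simp: map_eq_append_conv map_eq_Cons_conv)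
    obtain t' where t': "b = cl t'" "wf t'" using b by (auto simp: C_carrier)
    have w: "wf (Op (us' @ t # vs') x)" using d ts C_dom[of ts x] e by simp
    have "mu C (us @ (a \<oplus>\<^bsub>C\<^esub> b) # vs) x = cl (Op (us' @ Plus t t' # vs') x)"
      using w t' e C_mu[of "us' @ Plus t t' # vs'" x] by (simp add: C_add)
    also have "\<dots> = cl (Plus (Op (us' @ t # vs') x) (Op (us' @ t' # vs') x))"
      using w t' by (subst cl_eq) (auto intro!: coprod_eq.op_plus)
    also have "\<dots> = mu C (us @ a # vs) x \<oplus>\<^bsub>C\<^esub> mu C (us @ b # vs) x"
      using w t' e C_mu[of "us' @ t # vs'" x] C_mu[of "us' @ t' # vs'" x] by (simp add: C_add)
    finally show "mu C (us @ (a \<oplus>\<^bsub>C\<^esub> b) # vs) x = mu C (us @ a # vs) x \<oplus>\<^bsub>C\<^esub> mu C (us @ b # vs) x" .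
  next
    fix us a vs x r assume d: "mu_dom P (carrier C) (us @ a # vs) x" and r: "r \<in> carrier R"
    then obtain ts where ts: "us @ a # vs = map cl ts" "\<forall>t\<in>set ts. wf t" by (meson C_listE mu_dom_def)
    then obtain us' t vs' where e: "ts = us' @ t # vs'" "us = map cl us'" "a = cl t" "vs = map cl vs'"
      using ts(1)[symmetric] by (auto simp: map_eq_append_conv map_eq_Cons_conv)
    have w: "wf (Op (us' @ t # vs') x)" using d ts C_dom[of ts x] e by simp
    have "mu C (us @ (r \<odot>\<^bsub>C\<^esub> a) # vs) x = cl (Op (us' @ Smul r t # vs') x)"
      using w r e C_mu[of "us' @ Smul r t # vs'" x] by (simp add: C_smult)
    also have "\<dots> = cl (Smul r (Op (us' @ t # vs') x))"
      using w r by (subst cl_eq) (auto intro!: coprod_eq.op_smul)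
    also have "\<dots> = r \<odot>\<^bsub>C\<^esub> mu C (us @ a # vs) x"
      using w r e C_mu[of "us' @ t # vs'" x] by (simp add: C_smult)
    finally show "mu C (us @ (r \<odot>\<^bsub>C\<^esub> a) # vs) x = r \<odot>\<^bsub>C\<^esub> mu C (us @ a # vs) x" .
  next
    fix Xs x y assume d: "mu_dom P (carrier C) Xs x" "mu_dom P (carrier C) Xs y"
    then obtain ts where ts: "Xs = map cl ts" "\<forall>t\<in>set ts. wf t" by (meson C_listE mu_dom_def)
    have w: "wf (Op ts x)" "wf (Op ts y)" using d ts by (simp_all add: C_dom)
    have e: "Op ts (x \<oplus>\<^bsub>opc P (length ts)\<^esub> y) \<approx> Plus (Op ts x) (Op ts y)"
      using w by (rule coprod_eq.op_add)
    then show "mu C Xs (x \<oplus>\<^bsub>opc P (length Xs)\<^esub> y) = mu C Xs x \<oplus>\<^bsub>C\<^esub> mu C Xs y"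
      using w coprod_eq_wf[OF e] by (simp add: ts(1) C_mu C_add cl_eq del: wf_trm.simps)
  next
    fix Xs x r assume d: "mu_dom P (carrier C) Xs x" and r: "r \<in> carrier R"
    then obtain ts where ts: "Xs = map cl ts" "\<forall>t\<in>set ts. wf t" by (meson C_listE mu_dom_def)
    have w: "wf (Op ts x)" using d ts by (simp_all add: C_dom)
    have e: "Op ts (r \<odot>\<^bsub>opc P (length ts)\<^esub> x) \<approx> Smul r (Op ts x)"
      using w r by (rule coprod_eq.op_smult)
    then show "mu C Xs (r \<odot>\<^bsub>opc P (length Xs)\<^esub> x) = r \<odot>\<^bsub>C\<^esub> mu C Xs x"
      using w r coprod_eq_wf[OF e] by (simp add: ts(1) C_mu C_smult cl_eq del: wf_trm.simps)
  next
    fix X assume "X \<in> carrier C"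
    then obtain t where t: "X = cl t" "wf t" by (auto simp: C_carrier)
    have e: "Op [t] (unit P) \<approx> t" using t(2) by (rule coprod_eq.op_unit)
    show "mu C [X] (unit P) = X"
      using C_mu[of "[t]" "unit P"] coprod_eq_wf[OF e] e t by (simp add: cl_eq del: wf_trm.simps)
  next
    fix Xss xs y assume ne: "Xss \<noteq> []" and d: "list_all2 (mu_dom P (carrier C)) Xss xs"
      and y: "y \<in> carrier (opc P (length Xss))"
    have "\<exists>tss. Xss = map (map cl) tss \<and> list_all2 (\<lambda>ts x. wf (Op ts x)) tss xs"
      using d
    proof (induction rule: list_all2_induct)
      case (Cons Xs Xss x xs)
      then obtain ts tss where "Xs = map cl ts" "\<forall>t\<in>set ts. wf t"
        "Xss = map (map cl) tss" "list_all2 (\<lambda>ts x. wf (Op ts x)) tss xs"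
        by (metis C_listE mu_dom_def)
      moreover from this have "wf (Op ts x)" using Cons(1) by (simp add: C_dom)
      ultimately have "Xs # Xss = map (map cl) (ts # tss) \<and> list_all2 (\<lambda>ts x. wf (Op ts x)) (ts # tss) (x # xs)"
        by simp
      then show ?case by (rule exI)
    qed simp
    then obtain tss where tss: "Xss = map (map cl) tss" "list_all2 (\<lambda>ts x. wf (Op ts x)) tss xs" by blast
    have e: "Op (concat tss) (comp P (map length tss) xs y) \<approx> Op (map2 Op tss xs) y"
      using ne y tss by (intro coprod_eq.op_comp) auto
    have m: "map2 (mu C) Xss xs = map cl (map2 Op tss xs)"
      unfolding tss(1) using tss(2) by (induction rule: list_all2_induct) (auto simp: C_mu simp del: wf_trm.simps)
    have "mu C (concat Xss) (comp P (map length Xss) xs y) = cl (Op (concat tss) (comp P (map length tss) xs y))"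
      using C_mu[of "concat tss" "comp P (map length tss) xs y"] coprod_eq_wf[OF e]
      by (simp add: tss(1) map_concat o_def del: wf_trm.simps)
    also have "\<dots> = cl (Op (map2 Op tss xs) y)" using e coprod_eq_wf[OF e] by (simp add: cl_eq del: wf_trm.simps)
    also have "\<dots> = mu C (map2 (mu C) Xss xs) y"
      using coprod_eq_wf[OF e] by (simp only: m C_mu)
    finally show "mu C (concat Xss) (comp P (map length Xss) xs y) = mu C (map2 (mu C) Xss xs) y" .
  next
    fix Xs x s assume d: "mu_dom P (carrier C) Xs x" and s: "s permutes {..<length Xs}"
    then obtain ts where ts: "Xs = map cl ts" "\<forall>t\<in>set ts. wf t" by (meson C_listE mu_dom_def)
    have w: "wf (Op ts x)" using d ts by (simp_all add: C_dom)
    have s: "s permutes {..<length ts}" using s ts by simp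
    have e: "Op ts (act P (length ts) s x) \<approx> Op (permute_list s ts) x"
      using w s by (rule coprod_eq.op_act)
    show "mu C Xs (act P (length Xs) s x) = mu C (permute_list s Xs) x"
      using e coprod_eq_wf[OF e] s by (simp add: ts(1) permute_list_map C_mu cl_eq del: wf_trm.simps)
  qed
qed

lemma inl_hom: "inl R P A B \<in> alg_hom R P A C"
  unfolding alg_hom_def inl_def
proof (intro CollectI conjI ballI allI impI)
  fix as x assume d: "mu_dom P (carrier A) as x"
  show "cl (Gen (Inl (mu A as x))) = mu C (map (\<lambda>a. cl (Gen (Inl a))) as) x"
    using C_mu[of "map (\<lambda>a. Gen (Inl a)) as" x] coprod_eq_wf[OF coprod_eq.inl_mu[OF d]] coprod_eq.inl_mu[OF d, of R B]
    by (simp add: cl_eq o_def del: wf_trm.simps)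
qed (auto simp: C_carrier C_add C_smult cl_eq intro: coprod_eq.inl_add coprod_eq.inl_smult)

lemma inr_hom: "inr R P A B \<in> alg_hom R P B C"
  unfolding alg_hom_def inr_def
proof (intro CollectI conjI ballI allI impI)
  fix as x assume d: "mu_dom P (carrier B) as x"
  show "cl (Gen (Inr (mu B as x))) = mu C (map (\<lambda>a. cl (Gen (Inr a))) as) x"
    using C_mu[of "map (\<lambda>a. Gen (Inr a)) as" x] coprod_eq_wf[OF coprod_eq.inr_mu[OF d]] coprod_eq.inr_mu[OF d, of R A]
    by (simp add: cl_eq o_def del: wf_trm.simps)
qed (auto simp: C_carrier C_add C_smult cl_eq intro: coprod_eq.inr_add coprod_eq.inr_smult)

end

locale cop_target = two_palgebras R P A B + D: palgebra R P D
  for R :: "'r ring" and P :: "('r, 'p) operad"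
    and A :: "('r, 'a, 'p) palg" and B :: "('r, 'b, 'p) palg" and D :: "('r, 'd, 'p) palg" +
  fixes f g
  assumes f: "f \<in> alg_hom R P A D" and g: "g \<in> alg_hom R P B D"
begin

abbreviation ev where "ev \<equiv> eval_trm D (case_sum f g)"

lemma ev_closed: "wf t \<Longrightarrow> ev t \<in> carrier D"
proof (induction t)
  case (Op ts x)
  then have "mu_dom P (carrier D) (map ev ts) x" by (auto simp: mu_dom_def)
  then show ?case using D.mu_closed by simp
qed (use f g in \<open>auto simp: alg_hom_def D.smult_closed split: sum.split\<close>)

lemma ev_dom: "wf (Op ts x) \<Longrightarrow> mu_dom P (carrier D) (map ev ts) x"
  using ev_closed by (auto simp: mu_dom_def)

lemma ev_sound: "t \<approx> u \<Longrightarrow> ev t = ev u"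
proof (induction rule: coprod_eq.induct)
  case (op_comp tss xs y)
  have l: "length tss = length xs" using op_comp(2) by (rule list_all2_lengthD)
  have "list_all2 (mu_dom P (carrier D)) (map (map ev) tss) xs"
    unfolding list_all2_map1 using op_comp(2) by (rule list_all2_mono) (rule ev_dom)
  from D.mu_comp[OF _ this, of y] op_comp(1,3)
  have "mu D (concat (map (map ev) tss)) (operad.comp P (map length (map (map ev) tss)) xs y)
      = mu D (map2 (mu D) (map (map ev) tss) xs) y" by simp
  moreover have "map2 (mu D) (map (map ev) tss) xs = map ev (map2 Op tss xs)"
    using l by (induction tss xs rule: list_induct2) auto
  ultimately show ?case by (simp add: map_concat o_def)
next
  case (op_act ts x s)
  then show ?case using D.mu_act[OF ev_dom[OF op_act(1)], of s] by (simp add: permute_list_map)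
next
  case (op_plus us t vs x t')
  then show ?case using D.mu_add_arg[of "map ev us" "ev t" "map ev vs" x "ev t'"] ev_dom[OF op_plus(1)] ev_closed by simp
next
  case (op_smul us t vs x r)
  then show ?case using D.mu_smult_arg[of "map ev us" "ev t" "map ev vs" x r] ev_dom[OF op_smul(1)] by simp
next
  case (op_add ts x y)
  then show ?case using D.mu_add[OF ev_dom[OF op_add(1)] ev_dom[OF op_add(2)]] by simp
next
  case (op_smult ts x r)
  then show ?case using D.mu_smult[OF ev_dom[OF op_smult(1)]] by simp
next
  case (inl_mu as x)
  then show ?case using f by (simp add: alg_hom_def o_def)
next
  case (inr_mu as x)
  then show ?case using g by (simp add: alg_hom_def o_def)
qed (use f g ev_closed in \<open>auto simp: alg_hom_def D.mu_unit D.smult_l_distr D.smult_r_distr D.smult_assoc1 D.a_ac\<close>)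

lemma copair_cl: "wf t \<Longrightarrow> copair D f g (cl t) = ev t"
  using ev_sound[OF rep_cl] by (simp add: copair_def)

lemma copair_hom: "copair D f g \<in> alg_hom R P C D"
  unfolding alg_hom_def
proof (intro CollectI conjI ballI allI impI)
  fix Xs x assume d: "mu_dom P (carrier C) Xs x"
  then obtain ts where ts: "Xs = map cl ts" "\<forall>t\<in>set ts. wf t" by (meson C_listE mu_dom_def)
  have w: "wf (Op ts x)" using d ts by (simp add: C_dom)
  have "map (copair D f g) Xs = map ev ts" using ts by (auto simp: copair_cl)
  then show "copair D f g (mu C Xs x) = mu D (map (copair D f g) Xs) x"
    using w ts by (simp add: C_mu copair_cl o_def cong: map_cong del: wf_trm.simps)
qed (auto simp: C_carrier C_add C_smult copair_cl ev_closed)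

lemma copair_inl: "a \<in> carrier A \<Longrightarrow> copair D f g (inl R P A B a) = f a"
  by (simp add: inl_def copair_cl)

lemma copair_inr: "b \<in> carrier B \<Longrightarrow> copair D f g (inr R P A B b) = g b"
  by (simp add: inr_def copair_cl)

lemma copair_unique:
  assumes h: "h \<in> alg_hom R P C D"
    and hl: "\<And>a. a \<in> carrier A \<Longrightarrow> h (inl R P A B a) = f a"
    and hr: "\<And>b. b \<in> carrier B \<Longrightarrow> h (inr R P A B b) = g b"
    and X: "X \<in> carrier C"
  shows "h X = copair D f g X"
proof -
  have hz: "h (cl Zero) = \<zero>\<^bsub>D\<^esub>"
  proof -
    have z: "\<zero>\<^bsub>R\<^esub> \<in> carrier R" using crR by (simp add: cring.cring_simprules)
    have "cl (Smul \<zero>\<^bsub>R\<^esub> Zero) = cl Zero" by (intro cl_eqI coprod_eq.smul_zero) simp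
    then have "h (cl Zero) = h (\<zero>\<^bsub>R\<^esub> \<odot>\<^bsub>C\<^esub> cl Zero)" using z by (simp add: C_smult)
    also have "\<dots> = \<zero>\<^bsub>R\<^esub> \<odot>\<^bsub>D\<^esub> h (cl Zero)" using h z by (auto simp: alg_hom_def C_carrier)
    also have "\<dots> = \<zero>\<^bsub>D\<^esub>" using h by (intro D.smult_l_null) (auto simp: alg_hom_def C_carrier)
    finally show ?thesis .
  qed
  have "h (cl t) = ev t" if "wf t" for t
    using that
  proof (induction t)
    case (Gen z) then show ?case using hl hr by (auto simp: inl_def inr_def)
  next
    case (Plus t u)
    have "h (cl t \<oplus>\<^bsub>C\<^esub> cl u) = h (cl t) \<oplus>\<^bsub>D\<^esub> h (cl u)" using h Plus by (auto simp: alg_hom_def C_carrier)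
    then show ?case using Plus by (simp add: C_add)
  next
    case (Smul r t)
    have "h (r \<odot>\<^bsub>C\<^esub> cl t) = r \<odot>\<^bsub>D\<^esub> h (cl t)" using h Smul by (auto simp: alg_hom_def C_carrier)
    then show ?case using Smul by (simp add: C_smult)
  next
    case (Op ts x)
    have "h (mu C (map cl ts) x) = mu D (map h (map cl ts)) x"
      using h Op C_dom[of ts x] by (auto simp: alg_hom_def)
    moreover have "map h (map cl ts) = map ev ts" using Op by auto
    ultimately show ?case using Op C_mu[of ts x] by (simp del: map_map)
  qed (simp add: hz)
  then show ?thesis using X by (auto simp: C_carrier copair_cl)
qed

end


section \<open>Operadic and categorical nilpotency\<close>

definition J ::
    "'r ring \<Rightarrow> ('r, 'p) operad \<Rightarrow> nat \<Rightarrow> ('r, 'a, 'p) palg \<Rightarrow> 'a set" where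
  "J R P n A = mspan R A {mu A as x | as x. n \<le> length as \<and> mu_dom P (carrier A) as x}"

definition NIL2_obj :: "'r ring \<Rightarrow> ('r, 'p) operad \<Rightarrow> ('r, 'a, 'p) palg set" where
  "NIL2_obj R P = {A. palgebra R P A \<and>
     (\<forall>as x. 2 < length as \<and> mu_dom P (carrier A) as x \<longrightarrow> mu A as x = \<zero>\<^bsub>A\<^esub>)}"

definition NIL2 ::
    "'r ring \<Rightarrow> ('r, 'p) operad \<Rightarrow> ('r, 'a, 'p) palg \<Rightarrow> ('r, 'a set, 'p) palg" where
  "NIL2 R P A = quot_alg P A (J R P 3 A)"

definition NIL2_map ::
    "'r ring \<Rightarrow> ('r, 'p) operad \<Rightarrow> ('r, 'b, 'p) palg \<Rightarrow> ('a \<Rightarrow> 'b) \<Rightarrow> 'a set \<Rightarrow> 'b set" where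
  "NIL2_map R P B f = quot_map B (J R P 3 B) f"

abbreviation zmap :: "('r, 'b, 'p) palg \<Rightarrow> 'a \<Rightarrow> 'b" where
  "zmap B \<equiv> \<lambda>_. \<zero>\<^bsub>B\<^esub>"

text \<open>In the category of algebras, kernels and images are the set-theoretic ones.
  The ternary coproduct is \<open>(X + Y) + Z\<close>; the three components of the canonical morphism kill \<open>Z\<close>,
  \<open>Y\<close> and \<open>X\<close>, in this order.\<close>

definition cosmash3 ::
    "'r ring \<Rightarrow> ('r, 'p) operad \<Rightarrow> ('r, 'a, 'p) palg \<Rightarrow> ('r, 'b, 'p) palg \<Rightarrow> ('r, 'c, 'p) palg
     \<Rightarrow> ('r, ('r, 'a, 'b, 'p) cop, 'c, 'p) cop set" where
  "cosmash3 R P X Y Z =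
     (let XY = coprod R P X Y; XZ = coprod R P X Z; YZ = coprod R P Y Z in
      a_kernel (coprod R P XY Z) (prod_alg P XY (prod_alg P XZ YZ))
        (\<lambda>w. (copair XY id (zmap XY) w,
              copair XZ (copair XZ (inl R P X Z) (zmap XZ)) (inr R P X Z) w,
              copair YZ (copair YZ (zmap YZ) (inl R P Y Z)) (inr R P Y Z) w)))"

text \<open>The commutator \<open>[X, X, X]\<close>: the image of the ternary cosmash product under the folding map.\<close>

definition higgins3 :: "'r ring \<Rightarrow> ('r, 'p) operad \<Rightarrow> ('r, 'a, 'p) palg \<Rightarrow> 'a set" where
  "higgins3 R P X = copair X (copair X id id) id ` cosmash3 R P X X X"

definition Nil2_obj :: "'r ring \<Rightarrow> ('r, 'p) operad \<Rightarrow> ('r, 'a, 'p) palg set" where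
  "Nil2_obj R P = {A. palgebra R P A \<and> higgins3 R P A = {\<zero>\<^bsub>A\<^esub>}}"

definition nil2 ::
    "'r ring \<Rightarrow> ('r, 'p) operad \<Rightarrow> ('r, 'a, 'p) palg \<Rightarrow> ('r, 'a set, 'p) palg" where
  "nil2 R P A = quot_alg P A (higgins3 R P A)"

definition nil2_proj :: "'r ring \<Rightarrow> ('r, 'p) operad \<Rightarrow> ('r, 'a, 'p) palg \<Rightarrow> 'a \<Rightarrow> 'a set" where
  "nil2_proj R P A a = higgins3 R P A +>\<^bsub>A\<^esub> a"

definition nil2_map ::
    "'r ring \<Rightarrow> ('r, 'p) operad \<Rightarrow> ('r, 'b, 'p) palg \<Rightarrow> ('a \<Rightarrow> 'b) \<Rightarrow> 'a set \<Rightarrow> 'b set" where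
  "nil2_map R P B f = quot_map B (higgins3 R P B) f"


section \<open>The bilinear product\<close>

text \<open>In the reflective subcategory of two-nilpotent objects, products are those of the ambient category
  and coproducts are the reflections of coproducts of the ambient category.\<close>

definition coprod2 ::
    "'r ring \<Rightarrow> ('r, 'p) operad \<Rightarrow> ('r, 'a, 'p) palg \<Rightarrow> ('r, 'b, 'p) palg
     \<Rightarrow> ('r, ('r, 'a, 'b, 'p) cop set, 'p) palg" where
  "coprod2 R P X Y = nil2 R P (coprod R P X Y)"

definition inl2 ::
    "'r ring \<Rightarrow> ('r, 'p) operad \<Rightarrow> ('r, 'a, 'p) palg \<Rightarrow> ('r, 'b, 'p) palg
     \<Rightarrow> 'a \<Rightarrow> ('r, 'a, 'b, 'p) cop set" where
  "inl2 R P X Y x = nil2_proj R P (coprod R P X Y) (inl R P X Y x)"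

definition inr2 ::
    "'r ring \<Rightarrow> ('r, 'p) operad \<Rightarrow> ('r, 'a, 'p) palg \<Rightarrow> ('r, 'b, 'p) palg
     \<Rightarrow> 'b \<Rightarrow> ('r, 'a, 'b, 'p) cop set" where
  "inr2 R P X Y y = nil2_proj R P (coprod R P X Y) (inr R P X Y y)"

definition copair2 ::
    "('r, 'c, 'p) palg \<Rightarrow> ('a \<Rightarrow> 'c) \<Rightarrow> ('b \<Rightarrow> 'c) \<Rightarrow> ('r, 'a, 'b, 'p) cop set \<Rightarrow> 'c" where
  "copair2 C f g W = copair C f g (rep W)"

definition cosmash2 ::
    "'r ring \<Rightarrow> ('r, 'p) operad \<Rightarrow> ('r, 'a, 'p) palg \<Rightarrow> ('r, 'b, 'p) palg
     \<Rightarrow> ('r, ('r, 'a, 'b, 'p) cop set, 'p) palg" where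
  "cosmash2 R P X Y = sub_alg P (coprod2 R P X Y)
     (a_kernel (coprod2 R P X Y) (prod_alg P X Y)
        (\<lambda>w. (copair2 X id (zmap X) w, copair2 Y (zmap Y) id w)))"

definition bilin ::
    "'r ring \<Rightarrow> ('r, 'p) operad \<Rightarrow> ('r, 'a, 'p) palg \<Rightarrow> ('r, 'b, 'p) palg
     \<Rightarrow> ('r, ('r, 'a set, 'b set, 'p) cop set, 'p) palg" where
  "bilin R P A B = cosmash2 R P (nil2 R P A) (nil2 R P B)"

definition bilin_twist ::
    "'r ring \<Rightarrow> ('r, 'p) operad \<Rightarrow> ('r, 'a, 'p) palg \<Rightarrow> ('r, 'b, 'p) palg
     \<Rightarrow> ('r, 'a set, 'b set, 'p) cop set \<Rightarrow> ('r, 'b set, 'a set, 'p) cop set" where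
  "bilin_twist R P A B =
     copair2 (coprod2 R P (nil2 R P B) (nil2 R P A))
       (inr2 R P (nil2 R P B) (nil2 R P A)) (inl2 R P (nil2 R P B) (nil2 R P A))"

text \<open>The morphism induced by \<open>f\<close> and \<open>g\<close> from the bilinear product of their domains to that of their
  codomains \<open>A'\<close> and \<open>B'\<close>.\<close>

definition bilin_map ::
    "'r ring \<Rightarrow> ('r, 'p) operad \<Rightarrow> ('r, 'c, 'p) palg \<Rightarrow> ('r, 'd, 'p) palg \<Rightarrow> ('a \<Rightarrow> 'c) \<Rightarrow> ('b \<Rightarrow> 'd)
     \<Rightarrow> ('r, 'a set, 'b set, 'p) cop set \<Rightarrow> ('r, 'c set, 'd set, 'p) cop set" where
  "bilin_map R P A' B' f g =
     copair2 (coprod2 R P (nil2 R P A') (nil2 R P B'))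
       (inl2 R P (nil2 R P A') (nil2 R P B') \<circ> nil2_map R P A' f)
       (inr2 R P (nil2 R P A') (nil2 R P B') \<circ> nil2_map R P B' g)"


section \<open>Tensor products\<close>

definition free_mod :: "'r ring \<Rightarrow> 'g set \<Rightarrow> ('r, 'g \<Rightarrow> 'r) module" where
  "free_mod R G =
     \<lparr>carrier = {f. f \<in> UNIV \<rightarrow> carrier R \<and> finite {g. f g \<noteq> \<zero>\<^bsub>R\<^esub>} \<and> (\<forall>g. g \<notin> G \<longrightarrow> f g = \<zero>\<^bsub>R\<^esub>)},
      mult = undefined, one = undefined, zero = (\<lambda>_. \<zero>\<^bsub>R\<^esub>),
      add = (\<lambda>f h g. f g \<oplus>\<^bsub>R\<^esub> h g), smult = (\<lambda>r f g. r \<otimes>\<^bsub>R\<^esub> f g)\<rparr>"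

definition delta :: "'r ring \<Rightarrow> 'g \<Rightarrow> 'g \<Rightarrow> 'r" where
  "delta R x y = (if y = x then \<one>\<^bsub>R\<^esub> else \<zero>\<^bsub>R\<^esub>)"

text \<open>
  Tensor product of \<open>R\<close>-modules over an \<open>R\<close>-algebra with carrier \<open>S\<close> acting on \<open>M\<close> from the right by
  \<open>ra\<close> and on \<open>N\<close> from the left by \<open>la\<close>, both actions being \<open>R\<close>-bilinear.
\<close>

definition tensor_rel ::
    "'r ring \<Rightarrow> 's set \<Rightarrow> ('r, 'm, 'y) module_scheme \<Rightarrow> ('m \<Rightarrow> 's \<Rightarrow> 'm)
     \<Rightarrow> ('r, 'n, 'z) module_scheme \<Rightarrow> ('s \<Rightarrow> 'n \<Rightarrow> 'n) \<Rightarrow> ('m \<times> 'n \<Rightarrow> 'r) set" where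
  "tensor_rel R S M ra N la =
     (let F = free_mod R (carrier M \<times> carrier N); d = delta R in mspan R F
       ({d (m \<oplus>\<^bsub>M\<^esub> m', n) \<ominus>\<^bsub>F\<^esub> (d (m, n) \<oplus>\<^bsub>F\<^esub> d (m', n)) | m m' n.
           m \<in> carrier M \<and> m' \<in> carrier M \<and> n \<in> carrier N} \<union>
        {d (m, n \<oplus>\<^bsub>N\<^esub> n') \<ominus>\<^bsub>F\<^esub> (d (m, n) \<oplus>\<^bsub>F\<^esub> d (m, n')) | m n n'.
           m \<in> carrier M \<and> n \<in> carrier N \<and> n' \<in> carrier N} \<union>
        {d (r \<odot>\<^bsub>M\<^esub> m, n) \<ominus>\<^bsub>F\<^esub> r \<odot>\<^bsub>F\<^esub> d (m, n) | r m n.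
           r \<in> carrier R \<and> m \<in> carrier M \<and> n \<in> carrier N} \<union>
        {d (m, r \<odot>\<^bsub>N\<^esub> n) \<ominus>\<^bsub>F\<^esub> r \<odot>\<^bsub>F\<^esub> d (m, n) | r m n.
           r \<in> carrier R \<and> m \<in> carrier M \<and> n \<in> carrier N} \<union>
        {d (ra m s, n) \<ominus>\<^bsub>F\<^esub> d (m, la s n) | s m n.
           s \<in> S \<and> m \<in> carrier M \<and> n \<in> carrier N}))"

type_synonym ('r, 'm, 'n) tens = "('m \<times> 'n \<Rightarrow> 'r) set"

definition tensor_over ::
    "'r ring \<Rightarrow> 's set \<Rightarrow> ('r, 'm, 'y) module_scheme \<Rightarrow> ('m \<Rightarrow> 's \<Rightarrow> 'm)
     \<Rightarrow> ('r, 'n, 'z) module_scheme \<Rightarrow> ('s \<Rightarrow> 'n \<Rightarrow> 'n) \<Rightarrow> ('r, ('r, 'm, 'n) tens) module" where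
  "tensor_over R S M ra N la =
     quot_mod (free_mod R (carrier M \<times> carrier N)) (tensor_rel R S M ra N la)"

definition pure_over ::
    "'r ring \<Rightarrow> 's set \<Rightarrow> ('r, 'm, 'y) module_scheme \<Rightarrow> ('m \<Rightarrow> 's \<Rightarrow> 'm)
     \<Rightarrow> ('r, 'n, 'z) module_scheme \<Rightarrow> ('s \<Rightarrow> 'n \<Rightarrow> 'n) \<Rightarrow> 'm \<Rightarrow> 'n \<Rightarrow> ('r, 'm, 'n) tens" where
  "pure_over R S M ra N la m n =
     tensor_rel R S M ra N la +>\<^bsub>free_mod R (carrier M \<times> carrier N)\<^esub> delta R (m, n)"

text \<open>The linear map on a tensor product with values in \<open>Q\<close> which is induced by a balanced bilinear
  map \<open>h\<close>.\<close>

definition tensor_lift ::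
    "'r ring \<Rightarrow> ('r, 'q, 'z) module_scheme \<Rightarrow> ('m \<Rightarrow> 'n \<Rightarrow> 'q) \<Rightarrow> ('r, 'm, 'n) tens \<Rightarrow> 'q" where
  "tensor_lift R Q h X = finsum Q (\<lambda>(m, n). rep X (m, n) \<odot>\<^bsub>Q\<^esub> h m n) {p. rep X p \<noteq> \<zero>\<^bsub>R\<^esub>}"

definition tensor ::
    "'r ring \<Rightarrow> ('r, 'm, 'y) module_scheme \<Rightarrow> ('r, 'n, 'z) module_scheme
     \<Rightarrow> ('r, ('r, 'm, 'n) tens) module" where
  "tensor R M N = tensor_over R (carrier R) M (\<lambda>m r. r \<odot>\<^bsub>M\<^esub> m) N (\<lambda>r n. r \<odot>\<^bsub>N\<^esub> n)"

definition pure ::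
    "'r ring \<Rightarrow> ('r, 'm, 'y) module_scheme \<Rightarrow> ('r, 'n, 'z) module_scheme
     \<Rightarrow> 'm \<Rightarrow> 'n \<Rightarrow> ('r, 'm, 'n) tens" where
  "pure R M N = pure_over R (carrier R) M (\<lambda>m r. r \<odot>\<^bsub>M\<^esub> m) N (\<lambda>r n. r \<odot>\<^bsub>N\<^esub> n)"


section \<open>The tensor product describing the bilinear product\<close>

abbreviation P11 :: "'r ring \<Rightarrow> ('r, 'p) operad \<Rightarrow> ('r, ('r, 'p, 'p) tens) module" where
  "P11 R P \<equiv> tensor R (opc P 1) (opc P 1)"

text \<open>The ring structure of \<open>P11 R P\<close> enters a tensor product over it only through its actions:
  on \<open>opc P 2\<close> by composition in the operad, on a tensor product of algebras factorwise by the unary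
  operations.\<close>

definition P11_left :: "'r ring \<Rightarrow> ('r, 'p) operad \<Rightarrow> ('r, 'p, 'p) tens \<Rightarrow> 'p \<Rightarrow> 'p" where
  "P11_left R P s x = tensor_lift R (opc P 2) (\<lambda>p q. comp P [1, 1] [p, q] x) s"

definition P11_right ::
    "'r ring \<Rightarrow> ('r, 'p) operad \<Rightarrow> ('r, 'm, 'p) palg \<Rightarrow> ('r, 'n, 'p) palg
     \<Rightarrow> ('r, 'm, 'n) tens \<Rightarrow> ('r, 'p, 'p) tens \<Rightarrow> ('r, 'm, 'n) tens" where
  "P11_right R P M N z s =
     tensor_lift R (tensor R M N)
       (\<lambda>m n. tensor_lift R (tensor R M N) (\<lambda>p q. pure R M N (mu M [m] p) (mu N [n] q)) s) z"

text \<open>The quotient of \<open>A\<close> by \<open>J R P 2 A\<close>; its structure of a right \<open>opc P 1\<close>-module is given by the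
  unary operations.\<close>

definition abel :: "'r ring \<Rightarrow> ('r, 'p) operad \<Rightarrow> ('r, 'a, 'p) palg \<Rightarrow> ('r, 'a set, 'p) palg" where
  "abel R P A = quot_alg P A (J R P 2 A)"

definition abel_tensor ::
    "'r ring \<Rightarrow> ('r, 'p) operad \<Rightarrow> ('r, 'a, 'p) palg \<Rightarrow> ('r, 'b, 'p) palg
     \<Rightarrow> ('r, (('r, ('r, 'a set, 'b set) tens, 'p) tens)) module" where
  "abel_tensor R P A B =
     tensor_over R (carrier (P11 R P))
       (tensor R (abel R P A) (abel R P B)) (P11_right R P (abel R P A) (abel R P B))
       (opc P 2) (P11_left R P)"

definition abel_pure ::
    "'r ring \<Rightarrow> ('r, 'p) operad \<Rightarrow> ('r, 'a, 'p) palg \<Rightarrow> ('r, 'b, 'p) palg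
     \<Rightarrow> ('r, 'a set, 'b set) tens \<Rightarrow> 'p \<Rightarrow> ('r, ('r, 'a set, 'b set) tens, 'p) tens" where
  "abel_pure R P A B =
     pure_over R (carrier (P11 R P))
       (tensor R (abel R P A) (abel R P B)) (P11_right R P (abel R P A) (abel R P B))
       (opc P 2) (P11_left R P)"

text \<open>The right module structure over \<open>opc P 1\<close> comes from the one of \<open>opc P 2\<close>; the operations of
  arity at least 2 are zero.\<close>

definition bilin_formula ::
    "'r ring \<Rightarrow> ('r, 'p) operad \<Rightarrow> ('r, 'a, 'p) palg \<Rightarrow> ('r, 'b, 'p) palg
     \<Rightarrow> ('r, ('r, ('r, 'a set, 'b set) tens, 'p) tens, 'p) palg" where
  "bilin_formula R P A B = mk_alg P (abel_tensor R P A B)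
     (\<lambda>zs p. if length zs = 1
        then tensor_lift R (abel_tensor R P A B) (\<lambda>w x. abel_pure R P A B w (comp P [2] [x] p)) (hd zs)
        else \<zero>\<^bsub>abel_tensor R P A B\<^esub>)"

text \<open>The element written \<open>a \<otimes> b \<otimes> x\<close>, where \<open>a\<close> and \<open>b\<close> are elements of \<open>A\<close> and \<open>B\<close> standing for their
  classes.\<close>

definition gen3 ::
    "'r ring \<Rightarrow> ('r, 'p) operad \<Rightarrow> ('r, 'a, 'p) palg \<Rightarrow> ('r, 'b, 'p) palg
     \<Rightarrow> 'a \<Rightarrow> 'b \<Rightarrow> 'p \<Rightarrow> ('r, ('r, 'a set, 'b set) tens, 'p) tens" where
  "gen3 R P A B a b x =
     abel_pure R P A B
       (pure R (abel R P A) (abel R P B) (J R P 2 A +>\<^bsub>A\<^esub> a) (J R P 2 B +>\<^bsub>B\<^esub> b)) x"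

text \<open>
  An isomorphism from the tensor product to the bilinear product is canonical if it sends \<open>a \<otimes> b \<otimes> x\<close>
  to \<open>x\<close> applied to the images of \<open>a\<close> and \<open>b\<close> in the coproduct of two-nilpotent algebras. Since the
  elements \<open>a \<otimes> b \<otimes> x\<close> generate, there is at most one.
\<close>

definition canonical_isos ::
    "'r ring \<Rightarrow> ('r, 'p) operad \<Rightarrow> ('r, 'a, 'p) palg \<Rightarrow> ('r, 'b, 'p) palg
     \<Rightarrow> (('r, ('r, 'a set, 'b set) tens, 'p) tens \<Rightarrow> ('r, 'a set, 'b set, 'p) cop set) set" where
  "canonical_isos R P A B = {\<phi> \<in> alg_iso R P (bilin_formula R P A B) (bilin R P A B).
     \<forall>a \<in> carrier A. \<forall>b \<in> carrier B. \<forall>x \<in> carrier (opc P 2).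
       \<phi> (gen3 R P A B a b x) =
         mu (coprod2 R P (nil2 R P A) (nil2 R P B))
           [inl2 R P (nil2 R P A) (nil2 R P B) (nil2_proj R P A a),
            inr2 R P (nil2 R P A) (nil2 R P B) (nil2_proj R P B b)] x}"

end

theory Submission
  imports Defs
begin

text \<open>
  The heart of the matter is the equality \<open>[A, A, A] = J\<^sub>3(A)\<close>. The coproduct \<open>C = A + A + A\<close> is spanned,
  modulo \<open>J\<^sub>3(C)\<close>, by the generators and by binary operations of two generators. If \<open>e\<^sub>i\<close> denotes the
  endomorphism of \<open>C\<close> killing one of the summands, the product of the operators \<open>1 - e\<^sub>i\<close> therefore maps
  \<open>C\<close> into \<open>J\<^sub>3(C)\<close>, whereas it fixes the ternary cosmash product; folding gives one inclusion. Conversely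
  an operation of arity at least 3 on \<open>A\<close> is the image of the same operation with its arguments
  distributed over all three summands, which lies in the cosmash product.

  For the bilinear product, \<open>a \<otimes> b \<otimes> x \<mapsto> x(a, b)\<close> maps the tensor product \<open>T\<close> onto the kernel of the
  comparison from coproduct to product, since a coproduct of two-nilpotent algebras is spanned by the
  two summands and the image of \<open>T\<close>. It is injective because the coproduct maps to the algebra
  \<open>A/J\<^sub>2(A) \<times> B/J\<^sub>2(B) \<times> T\<close> with binary operations
  \<open>(m, n, z), (m', n', z') \<mapsto> (0, 0, m \<otimes> n' \<otimes> x + m' \<otimes> n \<otimes> (t \<star> x))\<close>.
\<close>


section \<open>Modules\<close>

text \<open>Inserting one operation into another adds up arities: a binary operation applied to an
  operation of arity at least 2 has arity at least 3. This is why generators and binary operations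
  on generators span modulo \<open>J R P 3\<close>, and why a and b count only modulo
  \<open>J R P 2\<close> in x(a, b). A binary operation on generators involves at most two of the
  three summands, so the \<open>e\<close> killing the remaining one fixes it and 1 - e annihilates
  it.

  The formula for the test algebra is forced: when M and N have zero binary operations, x(m + n, m'
  + n') is x(m, n') + x(n, m'), and the last term equals (t * x)(m', n) by equivariance. Its algebra
  axioms in all arities reduce to finitely many identities in arities 1 and 2.

  Elements of quotients, coproducts and tensor products are classes, and maps out of them are
  evaluated on chosen representatives. So each construction receives its universal property once;
  afterwards linear maps are only compared on generators.\<close>

definition module_hom ::
    "'r ring \<Rightarrow> ('r, 'a, 'y) module_scheme \<Rightarrow> ('r, 'b, 'z) module_scheme \<Rightarrow> ('a \<Rightarrow> 'b) set" where
  "module_hom R M N = {f. f \<in> carrier M \<rightarrow> carrier N \<and>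
     (\<forall>a \<in> carrier M. \<forall>b \<in> carrier M. f (a \<oplus>\<^bsub>M\<^esub> b) = f a \<oplus>\<^bsub>N\<^esub> f b) \<and>
     (\<forall>r \<in> carrier R. \<forall>a \<in> carrier M. f (r \<odot>\<^bsub>M\<^esub> a) = r \<odot>\<^bsub>N\<^esub> f a)}"

lemma module_homI:
  assumes "\<And>a. a \<in> carrier M \<Longrightarrow> f a \<in> carrier N"
    and "\<And>a b. a \<in> carrier M \<Longrightarrow> b \<in> carrier M \<Longrightarrow> f (a \<oplus>\<^bsub>M\<^esub> b) = f a \<oplus>\<^bsub>N\<^esub> f b"
    and "\<And>r a. r \<in> carrier R \<Longrightarrow> a \<in> carrier M \<Longrightarrow> f (r \<odot>\<^bsub>M\<^esub> a) = r \<odot>\<^bsub>N\<^esub> f a"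
  shows "f \<in> module_hom R M N"
  using assms by (auto simp: module_hom_def)

lemma module_homD:
  assumes "f \<in> module_hom R M N"
  shows "a \<in> carrier M \<Longrightarrow> f a \<in> carrier N"
    and "a \<in> carrier M \<Longrightarrow> b \<in> carrier M \<Longrightarrow> f (a \<oplus>\<^bsub>M\<^esub> b) = f a \<oplus>\<^bsub>N\<^esub> f b"
    and "r \<in> carrier R \<Longrightarrow> a \<in> carrier M \<Longrightarrow> f (r \<odot>\<^bsub>M\<^esub> a) = r \<odot>\<^bsub>N\<^esub> f a"
  using assms by (auto simp: module_hom_def)

lemma module_hom_zero:
  assumes "module R M" "module R N" "f \<in> module_hom R M N"
  shows "f \<zero>\<^bsub>M\<^esub> = \<zero>\<^bsub>N\<^esub>"
proof -
  interpret M: module R M by fact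
  interpret N: module R N by fact
  have "f (\<zero>\<^bsub>R\<^esub> \<odot>\<^bsub>M\<^esub> \<zero>\<^bsub>M\<^esub>) = \<zero>\<^bsub>R\<^esub> \<odot>\<^bsub>N\<^esub> f \<zero>\<^bsub>M\<^esub>" using assms(3) by (intro module_homD(3)) auto
  then show ?thesis using module_homD(1)[OF assms(3)] by simp
qed

lemma module_hom_a_inv:
  assumes "module R M" "module R N" "f \<in> module_hom R M N" "a \<in> carrier M"
  shows "f (\<ominus>\<^bsub>M\<^esub> a) = \<ominus>\<^bsub>N\<^esub> f a"
proof -
  interpret M: module R M by fact
  interpret N: module R N by fact
  have "f ((\<ominus>\<^bsub>R\<^esub> \<one>\<^bsub>R\<^esub>) \<odot>\<^bsub>M\<^esub> a) = (\<ominus>\<^bsub>R\<^esub> \<one>\<^bsub>R\<^esub>) \<odot>\<^bsub>N\<^esub> f a"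
    using assms(3,4) by (intro module_homD(3)) auto
  then show ?thesis using module_homD(1)[OF assms(3)] assms(4) by (simp add: M.smult_l_minus N.smult_l_minus)
qed

lemma module_hom_minus:
  assumes "module R M" "module R N" "f \<in> module_hom R M N" "a \<in> carrier M" "b \<in> carrier M"
  shows "f (a \<ominus>\<^bsub>M\<^esub> b) = f a \<ominus>\<^bsub>N\<^esub> f b"
proof -
  interpret M: module R M by fact
  show ?thesis using assms module_hom_a_inv[OF assms(1-3,5)]
    by (simp add: a_minus_def module_homD(2)[OF assms(3)])
qed

lemma module_hom_compose:
  "f \<in> module_hom R M N \<Longrightarrow> g \<in> module_hom R N Q \<Longrightarrow> (\<lambda>x. g (f x)) \<in> module_hom R M Q"
  by (auto simp: module_hom_def Pi_def)

lemma module_hom_id: "(\<lambda>x. x) \<in> module_hom R M M"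
  by (auto simp: module_hom_def)

lemma module_hom_const_zero:
  assumes "module R N" shows "(\<lambda>_. \<zero>\<^bsub>N\<^esub>) \<in> module_hom R M N"
proof -
  interpret N: module R N by fact
  show ?thesis by (auto simp: module_hom_def)
qed

text \<open>Yields the operators 1 - e on the ternary coproduct, which are linear without being
  algebra homomorphisms.\<close>

lemma module_hom_diff:
  assumes "module R M" "module R N" "f \<in> module_hom R M N" "g \<in> module_hom R M N"
  shows "(\<lambda>x. f x \<ominus>\<^bsub>N\<^esub> g x) \<in> module_hom R M N"
proof -
  interpret M: module R M by fact
  interpret N: module R N by fact
  show ?thesis
    using module_homD[OF assms(3)] module_homD[OF assms(4)]
    by (intro module_homI)
      (simp_all add: N.smult_r_distr N.smult_r_minus a_minus_def N.minus_add N.a_ac)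
qed

lemma submodule_vimage:
  assumes "module R M" "module R N" "f \<in> module_hom R M N" "submodule H R N"
  shows "submodule {x \<in> carrier M. f x \<in> H} R M"
proof -
  interpret M: module R M by fact
  interpret N: module R N by fact
  interpret H: submodule H R N by fact
  have "\<zero>\<^bsub>N\<^esub> \<in> H" using H.one_closed by simp
  then show ?thesis
    using module_homD[OF assms(3)] N.submoduleE[OF assms(4)] module_hom_a_inv[OF assms(1-3)]
      module_hom_zero[OF assms(1-3)]
    by (intro M.submoduleI) auto
qed

lemma submodule_zero: "module R M \<Longrightarrow> submodule {\<zero>\<^bsub>M\<^esub>} R M"
proof -
  assume "module R M"
  then interpret M: module R M .
  show ?thesis by (intro M.submoduleI) auto
qed

lemma zero_in_submodule: "submodule H R M \<Longrightarrow> \<zero>\<^bsub>M\<^esub> \<in> H"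
  by (auto simp: submodule_def dest: subgroup.one_closed)

lemma submodule_image:
  assumes "module R M" "module R N" "f \<in> module_hom R M N" "submodule H R M"
  shows "submodule (f ` H) R N"
proof -
  interpret M: module R M by fact
  interpret N: module R N by fact
  note HE = M.submoduleE[OF assms(4)]
  have sub: "x \<in> H \<Longrightarrow> x \<in> carrier M" for x using HE(1) by auto
  show ?thesis
  proof (rule N.submoduleI)
    show "\<zero>\<^bsub>N\<^esub> \<in> f ` H"
      using zero_in_submodule[OF assms(4)] module_hom_zero[OF assms(1-3)] by force
  next
    fix a assume "a \<in> f ` H"
    then obtain x where x: "x \<in> H" "a = f x" by auto
    then have "\<ominus>\<^bsub>N\<^esub> a = f (\<ominus>\<^bsub>M\<^esub> x)" using module_hom_a_inv[OF assms(1-3)] sub by simp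
    then show "\<ominus>\<^bsub>N\<^esub> a \<in> f ` H" using HE(3) x by blast
  next
    fix a b assume "a \<in> f ` H" "b \<in> f ` H"
    then obtain x y where x: "x \<in> H" "a = f x" "y \<in> H" "b = f y" by auto
    then have "a \<oplus>\<^bsub>N\<^esub> b = f (x \<oplus>\<^bsub>M\<^esub> y)" using module_homD(2)[OF assms(3)] sub by simp
    then show "a \<oplus>\<^bsub>N\<^esub> b \<in> f ` H" using HE(5) x by blast
  next
    fix r a assume "r \<in> carrier R" "a \<in> f ` H"
    then obtain x where x: "r \<in> carrier R" "x \<in> H" "a = f x" by auto
    then have "r \<odot>\<^bsub>N\<^esub> a = f (r \<odot>\<^bsub>M\<^esub> x)" using module_homD(3)[OF assms(3)] sub by simp
    then show "r \<odot>\<^bsub>N\<^esub> a \<in> f ` H" using HE(4) x by blast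
  qed (use module_homD(1)[OF assms(3)] sub in auto)
qed

lemma mspan_superset: "S \<subseteq> mspan R M S"
  by (auto simp: mspan_def)

lemma mspan_minimal: "submodule H R M \<Longrightarrow> S \<subseteq> H \<Longrightarrow> mspan R M S \<subseteq> H"
  by (auto simp: mspan_def)

lemma submodule_mspan:
  assumes "module R M" "S \<subseteq> carrier M"
  shows "submodule (mspan R M S) R M"
proof -
  interpret M: module R M by fact
  have c: "submodule (carrier M) R M" by (rule M.carrier_is_submodule)
  show ?thesis
  proof (rule M.submoduleI)
    show "mspan R M S \<subseteq> carrier M" using mspan_minimal[OF c assms(2)] .
  qed (auto simp: mspan_def zero_in_submodule M.submoduleE)
qed

lemma mspan_subset_carrier: "module R M \<Longrightarrow> S \<subseteq> carrier M \<Longrightarrow> mspan R M S \<subseteq> carrier M"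
  using mspan_minimal module.carrier_is_submodule by blast

text \<open>The equalizer of two linear maps is a submodule; as soon as it contains
  \<open>S\<close>, it contains the span.\<close>

lemma module_hom_eq_on_span:
  assumes "module R M" "module R N" "f \<in> module_hom R M N" "g \<in> module_hom R M N"
    and "S \<subseteq> carrier M" "\<And>x. x \<in> S \<Longrightarrow> f x = g x" "x \<in> mspan R M S"
  shows "f x = g x"
proof -
  interpret M: module R M by fact
  have "submodule {x \<in> carrier M. f x = g x} R M"
    using module_homD[OF assms(3)] module_homD[OF assms(4)] module_hom_a_inv[OF assms(1-3)]
      module_hom_a_inv[OF assms(1,2,4)] module_hom_zero[OF assms(1-3)] module_hom_zero[OF assms(1,2,4)]
    by (intro M.submoduleI) auto
  then have "mspan R M S \<subseteq> {x \<in> carrier M. f x = g x}"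
    using assms(5,6) by (intro mspan_minimal) auto
  then show ?thesis using assms(7) by auto
qed

text \<open>The preimage of \<open>H\<close> is a submodule. This replaces inductions over linear
  combinations; with the zero submodule for \<open>H\<close> it shows that a map vanishes on a
  span.\<close>

lemma module_hom_mspan:
  assumes "module R M" "module R N" "f \<in> module_hom R M N" "submodule H R N"
    and "S \<subseteq> carrier M" "\<And>x. x \<in> S \<Longrightarrow> f x \<in> H" "x \<in> mspan R M S"
  shows "f x \<in> H"
  using mspan_minimal[OF submodule_vimage[OF assms(1-4)], of S] assms(5-7) by auto

text \<open>The identities are inherited along a surjection that respects the operations, and the
  image of the negative of \<open>y\<close> is the negative of \<open>h y\<close>. Serves for
  quotients and, with the identity map, for records that agree in their module fields.\<close>

lemma module_surj_image:
  assumes "module R M" "carrier N = h ` carrier M" "\<zero>\<^bsub>N\<^esub> = h \<zero>\<^bsub>M\<^esub>"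
    and a: "\<And>a b. a \<in> carrier M \<Longrightarrow> b \<in> carrier M \<Longrightarrow> h a \<oplus>\<^bsub>N\<^esub> h b = h (a \<oplus>\<^bsub>M\<^esub> b)"
    and s: "\<And>r a. r \<in> carrier R \<Longrightarrow> a \<in> carrier M \<Longrightarrow> r \<odot>\<^bsub>N\<^esub> h a = h (r \<odot>\<^bsub>M\<^esub> a)"
  shows "module R N"
proof -
  interpret M: module R M by fact
  show ?thesis
  proof (rule moduleI)
    show "abelian_group N"
    proof (rule abelian_groupI)
      fix x assume "x \<in> carrier N"
      then obtain y where y: "y \<in> carrier M" "x = h y" by (auto simp: assms(2))
      then have "h (\<ominus>\<^bsub>M\<^esub> y) \<oplus>\<^bsub>N\<^esub> x = \<zero>\<^bsub>N\<^esub>" by (simp add: a assms(3) M.l_neg)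
      then show "\<exists>y\<in>carrier N. y \<oplus>\<^bsub>N\<^esub> x = \<zero>\<^bsub>N\<^esub>" using y by (auto simp: assms(2))
    qed (auto simp: assms(2,3) a M.a_ac)
  qed (auto simp: assms(2) a s M.smult_l_distr M.smult_r_distr M.smult_assoc1 M.R.is_cring)
qed

section \<open>Quotient modules and maps out of them\<close>

locale quotient_module = module R M + S: submodule I R M for R :: "'r ring" and M :: "('r, 'a, 'z) module_scheme" and I
begin

sublocale abelian_subgroup I M
  by (rule abelian_subgroupI3, rule additive_subgroupI) (unfold_locales)

lemma coset_eq_iff:
  assumes "a \<in> carrier M" "b \<in> carrier M"
  shows "I +>\<^bsub>M\<^esub> a = I +>\<^bsub>M\<^esub> b \<longleftrightarrow> a \<ominus>\<^bsub>M\<^esub> b \<in> I"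
proof -
  have "I +>\<^bsub>M\<^esub> a = I +>\<^bsub>M\<^esub> b \<longleftrightarrow> a \<in> I +>\<^bsub>M\<^esub> b"
    using assms a_rcos_self[of a] a_repr_independence[of a I b] S.subgroup_axioms by auto
  then show ?thesis using assms by (simp add: a_rcos_module a_minus_def)
qed

lemma carrier_quot: "carrier (quot_mod M I) = (\<lambda>a. I +>\<^bsub>M\<^esub> a) ` carrier M"
  by (auto simp: quot_mod_def A_RCOSETS_def')

lemma zero_quot: "\<zero>\<^bsub>quot_mod M I\<^esub> = I" "I +>\<^bsub>M\<^esub> \<zero>\<^bsub>M\<^esub> = I"
  by (auto simp: quot_mod_def a_subset)

lemma coset_zero_iff: "a \<in> carrier M \<Longrightarrow> I +>\<^bsub>M\<^esub> a = I \<longleftrightarrow> a \<in> I"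
  using coset_eq_iff[of a "\<zero>\<^bsub>M\<^esub>"] M.minus_equality[of "\<zero>\<^bsub>M\<^esub>" "\<zero>\<^bsub>M\<^esub>"]
  by (simp add: zero_quot(2) a_minus_def)

lemma add_quot: "a \<in> carrier M \<Longrightarrow> b \<in> carrier M \<Longrightarrow>
    (I +>\<^bsub>M\<^esub> a) \<oplus>\<^bsub>quot_mod M I\<^esub> (I +>\<^bsub>M\<^esub> b) = I +>\<^bsub>M\<^esub> (a \<oplus>\<^bsub>M\<^esub> b)"
  by (simp add: quot_mod_def a_rcos_sum)

lemma rep_coset:
  assumes "a \<in> carrier M"
  shows "rep (I +>\<^bsub>M\<^esub> a) \<in> carrier M" "I +>\<^bsub>M\<^esub> rep (I +>\<^bsub>M\<^esub> a) = I +>\<^bsub>M\<^esub> a"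
proof -
  have r: "rep (I +>\<^bsub>M\<^esub> a) \<in> I +>\<^bsub>M\<^esub> a" using a_rcos_self[OF assms] by (rule rep_in)
  then show c: "rep (I +>\<^bsub>M\<^esub> a) \<in> carrier M" using a_r_coset_subset_G[OF a_subset assms] by auto
  show "I +>\<^bsub>M\<^esub> rep (I +>\<^bsub>M\<^esub> a) = I +>\<^bsub>M\<^esub> a"
    using a_repr_independence[OF r assms S.subgroup_axioms] by simp
qed

lemma rep_quot:
  assumes "X \<in> carrier (quot_mod M I)"
  shows "rep X \<in> carrier M" "I +>\<^bsub>M\<^esub> rep X = X"
  using assms rep_coset by (auto simp: carrier_quot)

text \<open>Scalar multiplication of cosets is defined through \<open>rep\<close>, so independence
  of the representative is the point: two representatives differ by an element of \<open>I\<close>,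
  and so do their multiples by \<open>r\<close>.\<close>

lemma smult_quot:
  assumes "r \<in> carrier R" "a \<in> carrier M"
  shows "r \<odot>\<^bsub>quot_mod M I\<^esub> (I +>\<^bsub>M\<^esub> a) = I +>\<^bsub>M\<^esub> (r \<odot>\<^bsub>M\<^esub> a)"
proof -
  let ?b = "rep (I +>\<^bsub>M\<^esub> a)"
  have b: "?b \<in> carrier M" "?b \<ominus>\<^bsub>M\<^esub> a \<in> I"
    using rep_coset[OF assms(2)] coset_eq_iff assms by auto
  have "r \<odot>\<^bsub>M\<^esub> ?b \<ominus>\<^bsub>M\<^esub> r \<odot>\<^bsub>M\<^esub> a = r \<odot>\<^bsub>M\<^esub> (?b \<ominus>\<^bsub>M\<^esub> a)"
    using assms b by (simp add: a_minus_def smult_r_distr smult_r_minus)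
  then have "I +>\<^bsub>M\<^esub> (r \<odot>\<^bsub>M\<^esub> ?b) = I +>\<^bsub>M\<^esub> (r \<odot>\<^bsub>M\<^esub> a)"
    using assms b S.smult_closed by (subst coset_eq_iff) auto
  then show ?thesis by (simp add: quot_mod_def)
qed

lemma module_quot: "module R (quot_mod M I)"
  by (rule module_surj_image[OF module_axioms carrier_quot])
    (simp_all add: zero_quot add_quot smult_quot)

lemma quot_proj_hom: "(\<lambda>a. I +>\<^bsub>M\<^esub> a) \<in> module_hom R M (quot_mod M I)"
  by (rule module_homI) (auto simp: carrier_quot add_quot smult_quot)

text \<open>The representative differs from \<open>a\<close> by an element of \<open>I\<close>,
  which \<open>f\<close> kills. This is the well-definedness behind every map out of a quotient,
  since such maps are written \<open>f (rep X)\<close>.\<close>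

lemma hom_rep_coset:
  assumes "module R N" "f \<in> module_hom R M N" "\<And>x. x \<in> I \<Longrightarrow> f x = \<zero>\<^bsub>N\<^esub>" "a \<in> carrier M"
  shows "f (rep (I +>\<^bsub>M\<^esub> a)) = f a"
proof -
  interpret N: module R N by fact
  let ?b = "rep (I +>\<^bsub>M\<^esub> a)"
  have b: "?b \<in> carrier M" "?b \<ominus>\<^bsub>M\<^esub> a \<in> I"
    using rep_coset[OF assms(4)] coset_eq_iff assms(4) by auto
  then have "f ?b \<ominus>\<^bsub>N\<^esub> f a = \<zero>\<^bsub>N\<^esub>"
    using module_hom_minus[OF module_axioms assms(1,2) b(1) assms(4)] assms(3) by simp
  then show ?thesis using b assms module_homD(1)[OF assms(2)] N.minus_equality[of "f ?b" "\<ominus>\<^bsub>N\<^esub> f a"]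
    by (simp add: a_minus_def)
qed

lemma quot_lift_hom:
  assumes "module R N" "f \<in> module_hom R M N" "\<And>x. x \<in> I \<Longrightarrow> f x = \<zero>\<^bsub>N\<^esub>"
  shows "(\<lambda>X. f (rep X)) \<in> module_hom R (quot_mod M I) N"
  by (rule module_homI)
    (auto simp: carrier_quot add_quot smult_quot hom_rep_coset[OF assms] module_homD[OF assms(2)])

end

section \<open>Free modules and tensor products\<close>

lemma free_mod_sel:
  "f \<oplus>\<^bsub>free_mod R G\<^esub> h = (\<lambda>g. f g \<oplus>\<^bsub>R\<^esub> h g)" "\<zero>\<^bsub>free_mod R G\<^esub> = (\<lambda>_. \<zero>\<^bsub>R\<^esub>)"
  "r \<odot>\<^bsub>free_mod R G\<^esub> f = (\<lambda>g. r \<otimes>\<^bsub>R\<^esub> f g)"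
  by (simp_all add: free_mod_def)

lemma carrier_free_mod:
  "f \<in> carrier (free_mod R G) \<longleftrightarrow>
     (\<forall>g. f g \<in> carrier R) \<and> finite {g. f g \<noteq> \<zero>\<^bsub>R\<^esub>} \<and> (\<forall>g. g \<notin> G \<longrightarrow> f g = \<zero>\<^bsub>R\<^esub>)"
  by (auto simp: free_mod_def)

lemma module_free_mod:
  fixes R :: "'r ring"
  assumes "cring R" shows "module R (free_mod R G)"
proof -
  interpret cring R by fact
  show ?thesis
  proof (rule moduleI)
    show "abelian_group (free_mod R G)"
    proof (rule abelian_groupI)
      fix f h assume fh: "f \<in> carrier (free_mod R G)" "h \<in> carrier (free_mod R G)"
      then have "finite ({g. f g \<noteq> \<zero>\<^bsub>R\<^esub>} \<union> {g. h g \<noteq> \<zero>\<^bsub>R\<^esub>})" by (simp add: carrier_free_mod)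
      then have "finite {g. f g \<oplus>\<^bsub>R\<^esub> h g \<noteq> \<zero>\<^bsub>R\<^esub>}" by (rule rev_finite_subset) auto
      then show "f \<oplus>\<^bsub>free_mod R G\<^esub> h \<in> carrier (free_mod R G)"
        using fh by (simp add: carrier_free_mod free_mod_sel)
    next
      fix f assume f: "f \<in> carrier (free_mod R G)"
      then have "finite {g. \<ominus>\<^bsub>R\<^esub> f g \<noteq> \<zero>\<^bsub>R\<^esub>}"
        by (auto simp: carrier_free_mod elim!: rev_finite_subset)
      then have "(\<lambda>g. \<ominus>\<^bsub>R\<^esub> f g) \<in> carrier (free_mod R G)" using f by (simp add: carrier_free_mod)
      moreover have "(\<lambda>g. \<ominus>\<^bsub>R\<^esub> f g) \<oplus>\<^bsub>free_mod R G\<^esub> f = \<zero>\<^bsub>free_mod R G\<^esub>"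
        using f by (auto simp: carrier_free_mod free_mod_sel l_neg)
      ultimately show "\<exists>h\<in>carrier (free_mod R G). h \<oplus>\<^bsub>free_mod R G\<^esub> f = \<zero>\<^bsub>free_mod R G\<^esub>" by blast
    qed (auto simp: carrier_free_mod free_mod_sel a_ac)
  next
    fix r f assume rf: "r \<in> carrier R" "f \<in> carrier (free_mod R G)"
    then have "finite {g. r \<otimes>\<^bsub>R\<^esub> f g \<noteq> \<zero>\<^bsub>R\<^esub>}"
      by (auto simp: carrier_free_mod elim!: rev_finite_subset)
    then show "r \<odot>\<^bsub>free_mod R G\<^esub> f \<in> carrier (free_mod R G)"
      using rf by (simp add: carrier_free_mod free_mod_sel)
  qed (auto simp: carrier_free_mod free_mod_sel l_distr r_distr m_assoc is_cring)
qed

lemma delta_closed: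
  fixes R :: "'r ring"
  assumes "cring R" "g \<in> G" shows "delta R g \<in> carrier (free_mod R G)"
proof -
  interpret cring R by fact
  have "finite {y. delta R g y \<noteq> \<zero>\<^bsub>R\<^esub>}" by (rule finite_subset[of _ "{g}"]) (auto simp: delta_def)
  then show ?thesis using assms(2) by (auto simp: carrier_free_mod delta_def)
qed

lemma free_mod_span:
  fixes R :: "'r ring"
  assumes "cring R" "f \<in> carrier (free_mod R G)"
  shows "f \<in> mspan R (free_mod R G) (delta R ` G)"
proof -
  interpret cring R by fact
  interpret F: module R "free_mod R G" using assms(1) by (rule module_free_mod)
  let ?S = "mspan R (free_mod R G) (delta R ` G)"
  have S: "submodule ?S R (free_mod R G)"
    using delta_closed[OF assms(1)] by (intro submodule_mspan F.module_axioms) auto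
  \<comment> \<open>The induction runs over a finite set containing the support rather than over the
    support itself, so that a value may happen to be zero.\<close>
  have "f \<in> ?S" if "finite A" "A \<subseteq> G" "f \<in> carrier (free_mod R G)" "{g. f g \<noteq> \<zero>\<^bsub>R\<^esub>} \<subseteq> A" for A f
    using that
  proof (induction A arbitrary: f rule: finite_induct)
    case empty
    then have "f = \<zero>\<^bsub>free_mod R G\<^esub>" by (auto simp: free_mod_sel)
    then show ?case using zero_in_submodule[OF S] by simp
  next
    case (insert a A)
    \<comment> \<open>Erasing the value at \<open>a\<close> leaves a function supported in
      \<open>A\<close>; adding \<open>f a\<close> times the basis function at \<open>a\<close>
      restores \<open>f\<close>.\<close>
    let ?h = "f(a := \<zero>\<^bsub>R\<^esub>)"
    have "finite {g. ?h g \<noteq> \<zero>\<^bsub>R\<^esub>}"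
      using insert.prems(2) by (auto simp: carrier_free_mod elim!: rev_finite_subset)
    then have c: "?h \<in> carrier (free_mod R G)" using insert.prems(2) by (auto simp: carrier_free_mod)
    have h: "?h \<in> ?S" by (rule insert.IH[OF _ c]) (use insert.prems in auto)
    have "delta R a \<in> ?S" by (rule subsetD[OF mspan_superset]) (use insert.prems(1) in blast)
    then have "f a \<odot>\<^bsub>free_mod R G\<^esub> delta R a \<in> ?S"
      using insert.prems(2) by (intro F.submoduleE(4)[OF S]) (auto simp: carrier_free_mod)
    then have "?h \<oplus>\<^bsub>free_mod R G\<^esub> (f a \<odot>\<^bsub>free_mod R G\<^esub> delta R a) \<in> ?S"
      using h F.submoduleE(5)[OF S] by blast
    also have "?h \<oplus>\<^bsub>free_mod R G\<^esub> (f a \<odot>\<^bsub>free_mod R G\<^esub> delta R a) = f"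
      using insert.prems(2) by (auto simp: carrier_free_mod free_mod_sel delta_def fun_eq_iff)
    finally show ?case .
  qed
  then show ?thesis using assms(2) by (auto simp: carrier_free_mod)
qed

text \<open>The linear extension of \<open>h\<close> to the free module; \<open>tensor_lift\<close>
  is this map evaluated on a representative.\<close>

definition free_lift ::
    "'r ring \<Rightarrow> ('r, 'q, 'z) module_scheme \<Rightarrow> ('g \<Rightarrow> 'q) \<Rightarrow> ('g \<Rightarrow> 'r) \<Rightarrow> 'q" where
  "free_lift R Q h f = finsum Q (\<lambda>g. f g \<odot>\<^bsub>Q\<^esub> h g) {g. f g \<noteq> \<zero>\<^bsub>R\<^esub>}"

lemma tensor_lift_rep: "tensor_lift R Q h X = free_lift R Q (case_prod h) (rep X)"
  by (simp add: tensor_lift_def free_lift_def case_prod_unfold)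

context
  fixes R :: "'r ring" and Q :: "('r, 'q, 'z) module_scheme" and G :: "'g set" and h :: "'g \<Rightarrow> 'q"
  assumes Q: "module R Q" and h: "h \<in> G \<rightarrow> carrier Q"
begin

interpretation Q: module R Q by (rule Q)

text \<open>Terms outside the support are zero. The flexibility is needed to compare sums attached
  to functions with different supports.\<close>

lemma free_lift_superset:
  assumes f: "f \<in> carrier (free_mod R G)" and A: "finite A" "{g. f g \<noteq> \<zero>\<^bsub>R\<^esub>} \<subseteq> A" "A \<subseteq> G"
  shows "free_lift R Q h f = finsum Q (\<lambda>g. f g \<odot>\<^bsub>Q\<^esub> h g) A"
  unfolding free_lift_def using assms h
  by (intro Q.add.finprod_mono_neutral_cong_left) (auto simp: carrier_free_mod Pi_iff subset_eq)

lemma free_lift_hom: "free_lift R Q h \<in> module_hom R (free_mod R G) Q"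
proof (rule module_homI)
  interpret F: module R "free_mod R G" using Q.R.is_cring by (rule module_free_mod)
  have hc: "h g \<in> carrier Q" if "g \<in> G" for g using h that by auto
  have fc: "f g \<in> carrier R" if "f \<in> carrier (free_mod R G)" for f g
    using that by (simp add: carrier_free_mod)
  have supp: "finite {g. f g \<noteq> \<zero>\<^bsub>R\<^esub>}" "g \<in> {g. f g \<noteq> \<zero>\<^bsub>R\<^esub>} \<Longrightarrow> g \<in> G"
    if "f \<in> carrier (free_mod R G)" for f g
    using that by (auto simp: carrier_free_mod)
  fix f assume f: "f \<in> carrier (free_mod R G)"
  let ?A = "{g. f g \<noteq> \<zero>\<^bsub>R\<^esub>}"
  have t: "(\<lambda>g. f g \<odot>\<^bsub>Q\<^esub> h g) \<in> A \<rightarrow> carrier Q" if "A \<subseteq> G" "f \<in> carrier (free_mod R G)" for A f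
    using that fc hc by blast
  have A: "?A \<subseteq> G" using supp(2)[OF f] by blast
  show "free_lift R Q h f \<in> carrier Q"
    unfolding free_lift_def by (rule Q.finsum_closed) (rule t[OF A f])
  show "free_lift R Q h (r \<odot>\<^bsub>free_mod R G\<^esub> f) = r \<odot>\<^bsub>Q\<^esub> free_lift R Q h f"
    if r: "r \<in> carrier R" for r
  proof -
    have "free_lift R Q h (r \<odot>\<^bsub>free_mod R G\<^esub> f)
        = finsum Q (\<lambda>g. (r \<odot>\<^bsub>free_mod R G\<^esub> f) g \<odot>\<^bsub>Q\<^esub> h g) ?A"
      by (rule free_lift_superset[OF F.smult_closed[OF r f] supp(1)[OF f] _ A])
        (use r in \<open>auto simp: free_mod_sel\<close>)
    also have "\<dots> = finsum Q (\<lambda>g. r \<odot>\<^bsub>Q\<^esub> (f g \<odot>\<^bsub>Q\<^esub> h g)) ?A"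
    proof (rule Q.finsum_cong'[OF HOL.refl])
      show "(\<lambda>g. r \<odot>\<^bsub>Q\<^esub> (f g \<odot>\<^bsub>Q\<^esub> h g)) \<in> ?A \<rightarrow> carrier Q" using t[OF A f] r by blast
      fix g assume "g \<in> ?A"
      then show "(r \<odot>\<^bsub>free_mod R G\<^esub> f) g \<odot>\<^bsub>Q\<^esub> h g = r \<odot>\<^bsub>Q\<^esub> (f g \<odot>\<^bsub>Q\<^esub> h g)"
        using fc[OF f] hc A r by (simp add: free_mod_sel Q.smult_assoc1 subsetD)
    qed
    also have "\<dots> = r \<odot>\<^bsub>Q\<^esub> free_lift R Q h f"
      unfolding free_lift_def by (rule Q.finsum_smult_ldistr[OF supp(1)[OF f] r t[OF A f], symmetric])
    finally show ?thesis .
  qed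
  show "free_lift R Q h (f \<oplus>\<^bsub>free_mod R G\<^esub> k) = free_lift R Q h f \<oplus>\<^bsub>Q\<^esub> free_lift R Q h k"
    if k: "k \<in> carrier (free_mod R G)" for k
  proof -
    \<comment> \<open>The support of the sum can be smaller than this union because of cancellation,
      so all three sums are taken over the union.\<close>
    let ?B = "?A \<union> {g. k g \<noteq> \<zero>\<^bsub>R\<^esub>}"
    have B: "finite ?B" "?B \<subseteq> G" using supp[OF f] supp[OF k] by blast+
    have "free_lift R Q h (f \<oplus>\<^bsub>free_mod R G\<^esub> k)
        = finsum Q (\<lambda>g. (f \<oplus>\<^bsub>free_mod R G\<^esub> k) g \<odot>\<^bsub>Q\<^esub> h g) ?B"
      by (rule free_lift_superset[OF F.a_closed[OF f k] B(1) _ B(2)]) (auto simp: free_mod_sel)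
    also have "\<dots> = finsum Q (\<lambda>g. f g \<odot>\<^bsub>Q\<^esub> h g \<oplus>\<^bsub>Q\<^esub> k g \<odot>\<^bsub>Q\<^esub> h g) ?B"
    proof (rule Q.finsum_cong'[OF HOL.refl])
      show "(\<lambda>g. f g \<odot>\<^bsub>Q\<^esub> h g \<oplus>\<^bsub>Q\<^esub> k g \<odot>\<^bsub>Q\<^esub> h g) \<in> ?B \<rightarrow> carrier Q"
        using t[OF B(2) f] t[OF B(2) k] by blast
      fix g assume "g \<in> ?B"
      then have "g \<in> G" using B(2) by blast
      then show "(f \<oplus>\<^bsub>free_mod R G\<^esub> k) g \<odot>\<^bsub>Q\<^esub> h g = f g \<odot>\<^bsub>Q\<^esub> h g \<oplus>\<^bsub>Q\<^esub> k g \<odot>\<^bsub>Q\<^esub> h g"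
        using fc[OF f] fc[OF k] hc by (simp add: free_mod_sel Q.smult_l_distr)
    qed
    also have "\<dots> = finsum Q (\<lambda>g. f g \<odot>\<^bsub>Q\<^esub> h g) ?B \<oplus>\<^bsub>Q\<^esub> finsum Q (\<lambda>g. k g \<odot>\<^bsub>Q\<^esub> h g) ?B"
      by (rule Q.finsum_addf[OF t[OF B(2) f] t[OF B(2) k]])
    also have "finsum Q (\<lambda>g. f g \<odot>\<^bsub>Q\<^esub> h g) ?B = free_lift R Q h f"
      by (rule free_lift_superset[OF f B(1) _ B(2), symmetric]) auto
    also have "finsum Q (\<lambda>g. k g \<odot>\<^bsub>Q\<^esub> h g) ?B = free_lift R Q h k"
      by (rule free_lift_superset[OF k B(1) _ B(2), symmetric]) auto
    finally show ?thesis .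
  qed
qed

lemma free_lift_delta:
  assumes "g \<in> G" shows "free_lift R Q h (delta R g) = h g"
proof -
  have "free_lift R Q h (delta R g) = finsum Q (\<lambda>x. delta R g x \<odot>\<^bsub>Q\<^esub> h x) {g}"
    using assms delta_closed[OF Q.R.is_cring assms]
    by (intro free_lift_superset) (auto simp: delta_def)
  also have "\<dots> = h g" using assms h by (subst Q.finsum_insert) (auto simp: delta_def Pi_iff)
  finally show ?thesis .
qed

end

section \<open>Bilinear maps and the universal property of tensor products\<close>

definition bilinear ::
    "'r ring \<Rightarrow> ('r, 'm, 'y) module_scheme \<Rightarrow> ('r, 'n, 'x) module_scheme \<Rightarrow> ('r, 'q, 'z) module_scheme
     \<Rightarrow> ('m \<Rightarrow> 'n \<Rightarrow> 'q) set" where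
  "bilinear R M N Q = {h. (\<forall>n \<in> carrier N. (\<lambda>m. h m n) \<in> module_hom R M Q) \<and>
     (\<forall>m \<in> carrier M. (\<lambda>n. h m n) \<in> module_hom R N Q)}"

lemma bilinearI:
  assumes "\<And>n. n \<in> carrier N \<Longrightarrow> (\<lambda>m. h m n) \<in> module_hom R M Q"
    and "\<And>m. m \<in> carrier M \<Longrightarrow> (\<lambda>n. h m n) \<in> module_hom R N Q"
  shows "h \<in> bilinear R M N Q"
  using assms by (auto simp: bilinear_def)

lemma bilinearD:
  assumes "h \<in> bilinear R M N Q"
  shows "n \<in> carrier N \<Longrightarrow> (\<lambda>m. h m n) \<in> module_hom R M Q"
    and "m \<in> carrier M \<Longrightarrow> (\<lambda>n. h m n) \<in> module_hom R N Q"
  using assms by (auto simp: bilinear_def)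

lemma bilinear_closed:
  "h \<in> bilinear R M N Q \<Longrightarrow> m \<in> carrier M \<Longrightarrow> n \<in> carrier N \<Longrightarrow> h m n \<in> carrier Q"
  by (drule (1) bilinearD(2)) (drule (1) module_homD(1))

text \<open>\<open>S\<close> is a bare set with two actions: balancing is a relation for each single
  \<open>s\<close>, and the relations lie in the free module once the actions stay in the
  carriers.\<close>

locale tensor_factors = M: module R M + N: module R N
  for R :: "'r ring" and M :: "('r, 'm, 'y) module_scheme" and N :: "('r, 'n, 'z) module_scheme" +
  fixes S :: "'s set" and ra :: "'m \<Rightarrow> 's \<Rightarrow> 'm" and la :: "'s \<Rightarrow> 'n \<Rightarrow> 'n"
  assumes ra_closed: "s \<in> S \<Longrightarrow> m \<in> carrier M \<Longrightarrow> ra m s \<in> carrier M"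
    and la_closed: "s \<in> S \<Longrightarrow> n \<in> carrier N \<Longrightarrow> la s n \<in> carrier N"
begin

abbreviation "FF \<equiv> free_mod R (carrier M \<times> carrier N)"
abbreviation "KK \<equiv> tensor_rel R S M ra N la"
abbreviation "TT \<equiv> tensor_over R S M ra N la"
abbreviation pure_TT (infixl "\<oslash>" 70) where "m \<oslash> n \<equiv> pure_over R S M ra N la m n"

sublocale FF: module R FF by (rule module_free_mod[OF M.R.is_cring])

lemma d_closed: "m \<in> carrier M \<Longrightarrow> n \<in> carrier N \<Longrightarrow> delta R (m, n) \<in> carrier FF"
  by (rule delta_closed[OF M.R.is_cring]) simp

text \<open>The set spanned in \<open>tensor_rel\<close>, named separately so that single relations
  can be shown to lie in \<open>KK\<close> and linear maps can be shown to kill all of them.\<close>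

definition tensor_gens where
  "tensor_gens = (let d = delta R in
     ({d (m \<oplus>\<^bsub>M\<^esub> m', n) \<ominus>\<^bsub>FF\<^esub> (d (m, n) \<oplus>\<^bsub>FF\<^esub> d (m', n)) | m m' n.
           m \<in> carrier M \<and> m' \<in> carrier M \<and> n \<in> carrier N} \<union>
        {d (m, n \<oplus>\<^bsub>N\<^esub> n') \<ominus>\<^bsub>FF\<^esub> (d (m, n) \<oplus>\<^bsub>FF\<^esub> d (m, n')) | m n n'.
           m \<in> carrier M \<and> n \<in> carrier N \<and> n' \<in> carrier N} \<union>
        {d (r \<odot>\<^bsub>M\<^esub> m, n) \<ominus>\<^bsub>FF\<^esub> r \<odot>\<^bsub>FF\<^esub> d (m, n) | r m n.
           r \<in> carrier R \<and> m \<in> carrier M \<and> n \<in> carrier N} \<union>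
        {d (m, r \<odot>\<^bsub>N\<^esub> n) \<ominus>\<^bsub>FF\<^esub> r \<odot>\<^bsub>FF\<^esub> d (m, n) | r m n.
           r \<in> carrier R \<and> m \<in> carrier M \<and> n \<in> carrier N} \<union>
        {d (ra m s, n) \<ominus>\<^bsub>FF\<^esub> d (m, la s n) | s m n.
           s \<in> S \<and> m \<in> carrier M \<and> n \<in> carrier N}))"

lemma tensor_rel_gens: "KK = mspan R FF tensor_gens"
  by (simp add: tensor_rel_def tensor_gens_def Let_def)

lemma gens_closed: "tensor_gens \<subseteq> carrier FF"
  by (auto simp: tensor_gens_def Let_def d_closed ra_closed la_closed)

sublocale quotient_module R FF KK
proof -
  have "submodule KK R FF"
    unfolding tensor_rel_gens by (rule submodule_mspan[OF FF.module_axioms gens_closed])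
  then interpret K: submodule KK R FF .
  show "quotient_module R FF KK" by unfold_locales
qed

lemma gen_in: "x \<in> tensor_gens \<Longrightarrow> x \<in> KK"
  unfolding tensor_rel_gens by (rule subsetD[OF mspan_superset])

lemma module_TT: "module R TT"
  using module_quot by (simp add: tensor_over_def)

lemma pure_closed: "m \<in> carrier M \<Longrightarrow> n \<in> carrier N \<Longrightarrow> m \<oslash> n \<in> carrier TT"
  by (auto simp: tensor_over_def carrier_quot pure_over_def d_closed)

lemma pure_add_l:
  assumes "m \<in> carrier M" "m' \<in> carrier M" "n \<in> carrier N"
  shows "(m \<oplus>\<^bsub>M\<^esub> m') \<oslash> n = m \<oslash> n \<oplus>\<^bsub>TT\<^esub> m' \<oslash> n"
proof -
  have "delta R (m \<oplus>\<^bsub>M\<^esub> m', n) \<ominus>\<^bsub>FF\<^esub> (delta R (m, n) \<oplus>\<^bsub>FF\<^esub> delta R (m', n)) \<in> KK"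
    using assms by (intro gen_in) (unfold tensor_gens_def Let_def, blast)
  then show ?thesis
    using assms by (simp add: pure_over_def tensor_over_def add_quot d_closed coset_eq_iff)
qed

lemma pure_add_r:
  assumes "m \<in> carrier M" "n \<in> carrier N" "n' \<in> carrier N"
  shows "m \<oslash> (n \<oplus>\<^bsub>N\<^esub> n') = m \<oslash> n \<oplus>\<^bsub>TT\<^esub> m \<oslash> n'"
proof -
  have "delta R (m, n \<oplus>\<^bsub>N\<^esub> n') \<ominus>\<^bsub>FF\<^esub> (delta R (m, n) \<oplus>\<^bsub>FF\<^esub> delta R (m, n')) \<in> KK"
    using assms by (intro gen_in) (unfold tensor_gens_def Let_def, blast)
  then show ?thesis
    using assms by (simp add: pure_over_def tensor_over_def add_quot d_closed coset_eq_iff)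
qed

lemma pure_smult_l:
  assumes "r \<in> carrier R" "m \<in> carrier M" "n \<in> carrier N"
  shows "(r \<odot>\<^bsub>M\<^esub> m) \<oslash> n = r \<odot>\<^bsub>TT\<^esub> (m \<oslash> n)"
proof -
  have "delta R (r \<odot>\<^bsub>M\<^esub> m, n) \<ominus>\<^bsub>FF\<^esub> r \<odot>\<^bsub>FF\<^esub> delta R (m, n) \<in> KK"
    using assms by (intro gen_in) (unfold tensor_gens_def Let_def, blast)
  then show ?thesis
    using assms by (simp add: pure_over_def tensor_over_def smult_quot d_closed coset_eq_iff)
qed

lemma pure_smult_r:
  assumes "r \<in> carrier R" "m \<in> carrier M" "n \<in> carrier N"
  shows "m \<oslash> (r \<odot>\<^bsub>N\<^esub> n) = r \<odot>\<^bsub>TT\<^esub> (m \<oslash> n)"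
proof -
  have "delta R (m, r \<odot>\<^bsub>N\<^esub> n) \<ominus>\<^bsub>FF\<^esub> r \<odot>\<^bsub>FF\<^esub> delta R (m, n) \<in> KK"
    using assms by (intro gen_in) (unfold tensor_gens_def Let_def, blast)
  then show ?thesis
    using assms by (simp add: pure_over_def tensor_over_def smult_quot d_closed coset_eq_iff)
qed

lemma pure_balanced:
  assumes "s \<in> S" "m \<in> carrier M" "n \<in> carrier N"
  shows "ra m s \<oslash> n = m \<oslash> la s n"
proof -
  have "delta R (ra m s, n) \<ominus>\<^bsub>FF\<^esub> delta R (m, la s n) \<in> KK"
    using assms by (intro gen_in) (unfold tensor_gens_def Let_def, blast)
  then show ?thesis
    using assms by (simp add: pure_over_def tensor_over_def d_closed coset_eq_iff ra_closed la_closed)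
qed

lemma pure_bilinear: "(\<lambda>m n. m \<oslash> n) \<in> bilinear R M N TT"
  by (intro bilinearI module_homI)
    (auto simp: pure_closed pure_add_l pure_add_r pure_smult_l pure_smult_r)

text \<open>Pure tensors are the images of the basis functions, which span the free module.\<close>

lemma TT_span:
  assumes "z \<in> carrier TT"
  shows "z \<in> mspan R TT {m \<oslash> n | m n. m \<in> carrier M \<and> n \<in> carrier N}"
proof -
  let ?P = "{m \<oslash> n | m n. m \<in> carrier M \<and> n \<in> carrier N}"
  obtain f where f: "f \<in> carrier FF" "z = KK +>\<^bsub>FF\<^esub> f"
    using assms by (auto simp: tensor_over_def carrier_quot)
  have s: "submodule (mspan R TT ?P) R TT"
    by (rule submodule_mspan[OF module_TT]) (auto simp: pure_closed)
  have "KK +>\<^bsub>FF\<^esub> f \<in> mspan R TT ?P"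
  proof (rule module_hom_mspan[OF FF.module_axioms module_TT _ s])
    show "(\<lambda>f. KK +>\<^bsub>FF\<^esub> f) \<in> module_hom R FF TT"
      using quot_proj_hom by (simp add: tensor_over_def)
    show "f \<in> mspan R FF (delta R ` (carrier M \<times> carrier N))"
      using M.R.is_cring f(1) by (rule free_mod_span)
  next
    fix x assume "x \<in> delta R ` (carrier M \<times> carrier N)"
    then have "KK +>\<^bsub>FF\<^esub> x \<in> ?P" by (auto simp: pure_over_def)
    then show "KK +>\<^bsub>FF\<^esub> x \<in> mspan R TT ?P" by (rule subsetD[OF mspan_superset])
  qed (auto simp: d_closed)
  then show ?thesis using f(2) by simp
qed

lemma TT_hom_eqI:
  assumes "module R Q" "f \<in> module_hom R TT Q" "g \<in> module_hom R TT Q"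
    and "\<And>m n. m \<in> carrier M \<Longrightarrow> n \<in> carrier N \<Longrightarrow> f (m \<oslash> n) = g (m \<oslash> n)"
    and "z \<in> carrier TT"
  shows "f z = g z"
  by (rule module_hom_eq_on_span[OF module_TT assms(1-3) _ _ TT_span[OF assms(5)]])
    (auto simp: pure_closed assms(4))

context
  fixes Q :: "('r, 'q, 'x) module_scheme" and h
  assumes Q: "module R Q" and h: "h \<in> bilinear R M N Q"
    and bal: "\<And>s m n. s \<in> S \<Longrightarrow> m \<in> carrier M \<Longrightarrow> n \<in> carrier N \<Longrightarrow> h (ra m s) n = h m (la s n)"
begin

interpretation Q: module R Q by (rule Q)

lemma uncurry_closed: "case_prod h \<in> carrier M \<times> carrier N \<rightarrow> carrier Q"
  using bilinear_closed[OF h] by auto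

text \<open>Additivity and homogeneity in each argument and balancing say exactly that the linear
  extension of \<open>h\<close> kills the five families of relations; it then kills their
  span.\<close>

lemma free_lift_rel:
  assumes "x \<in> KK" shows "free_lift R Q (case_prod h) x = \<zero>\<^bsub>Q\<^esub>"
proof -
  let ?L = "free_lift R Q (case_prod h)"
  have L: "?L \<in> module_hom R FF Q" by (rule free_lift_hom[OF Q uncurry_closed])
  have Ld: "?L (delta R (m, n)) = h m n" if "m \<in> carrier M" "n \<in> carrier N" for m n
    using free_lift_delta[OF Q uncurry_closed, of "(m, n)"] that by simp
  note cl = d_closed ra_closed la_closed bilinear_closed[OF h]
  note Lm = module_hom_minus[OF FF.module_axioms Q L] module_homD(2,3)[OF L]
  have hm: "h (m \<oplus>\<^bsub>M\<^esub> m') n = h m n \<oplus>\<^bsub>Q\<^esub> h m' n" "h (r \<odot>\<^bsub>M\<^esub> m) n = r \<odot>\<^bsub>Q\<^esub> h m n"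
    if "m \<in> carrier M" "m' \<in> carrier M" "n \<in> carrier N" "r \<in> carrier R" for m m' n r
    using module_homD(2,3)[OF bilinearD(1)[OF h that(3)]] that by auto
  have hn: "h m (n \<oplus>\<^bsub>N\<^esub> n') = h m n \<oplus>\<^bsub>Q\<^esub> h m n'" "h m (r \<odot>\<^bsub>N\<^esub> n) = r \<odot>\<^bsub>Q\<^esub> h m n"
    if "m \<in> carrier M" "n \<in> carrier N" "n' \<in> carrier N" "r \<in> carrier R" for m n n' r
    using module_homD(2,3)[OF bilinearD(2)[OF h that(1)]] that by auto
  have "?L y = \<zero>\<^bsub>Q\<^esub>" if "y \<in> tensor_gens" for y
  proof -
    have z: "q \<ominus>\<^bsub>Q\<^esub> q = \<zero>\<^bsub>Q\<^esub>" if "q \<in> carrier Q" for q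
      using that by (simp add: a_minus_def Q.r_neg)
    \<comment> \<open>One fact for each family of relations, in the order of
      \<open>tensor_gens\<close>.\<close>
    have 1: "?L (delta R (m \<oplus>\<^bsub>M\<^esub> m', n) \<ominus>\<^bsub>FF\<^esub> (delta R (m, n) \<oplus>\<^bsub>FF\<^esub> delta R (m', n))) = \<zero>\<^bsub>Q\<^esub>"
      if "m \<in> carrier M" "m' \<in> carrier M" "n \<in> carrier N" for m m' n
      using that hm(1)[of m m' n \<open>\<zero>\<^bsub>R\<^esub>\<close>] by (simp add: Lm Ld cl z)
    have 2: "?L (delta R (m, n \<oplus>\<^bsub>N\<^esub> n') \<ominus>\<^bsub>FF\<^esub> (delta R (m, n) \<oplus>\<^bsub>FF\<^esub> delta R (m, n'))) = \<zero>\<^bsub>Q\<^esub>"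
      if "m \<in> carrier M" "n \<in> carrier N" "n' \<in> carrier N" for m n n'
      using that hn(1)[of m n n' \<open>\<zero>\<^bsub>R\<^esub>\<close>] by (simp add: Lm Ld cl z)
    have 3: "?L (delta R (r \<odot>\<^bsub>M\<^esub> m, n) \<ominus>\<^bsub>FF\<^esub> r \<odot>\<^bsub>FF\<^esub> delta R (m, n)) = \<zero>\<^bsub>Q\<^esub>"
      if "r \<in> carrier R" "m \<in> carrier M" "n \<in> carrier N" for r m n
      using that hm(2)[of m m n r] by (simp add: Lm Ld cl z)
    have 4: "?L (delta R (m, r \<odot>\<^bsub>N\<^esub> n) \<ominus>\<^bsub>FF\<^esub> r \<odot>\<^bsub>FF\<^esub> delta R (m, n)) = \<zero>\<^bsub>Q\<^esub>"
      if "r \<in> carrier R" "m \<in> carrier M" "n \<in> carrier N" for r m n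
      using that hn(2)[of m n n r] by (simp add: Lm Ld cl z)
    have 5: "?L (delta R (ra m s, n) \<ominus>\<^bsub>FF\<^esub> delta R (m, la s n)) = \<zero>\<^bsub>Q\<^esub>"
      if "s \<in> S" "m \<in> carrier M" "n \<in> carrier N" for s m n
      using that bal[of s m n] by (simp add: Lm Ld cl z)
    show ?thesis
      using that unfolding tensor_gens_def Let_def by (elim UnE CollectE exE conjE) (simp_all only: 1 2 3 4 5)
  qed
  then have z: "?L y \<in> {\<zero>\<^bsub>Q\<^esub>}" if "y \<in> tensor_gens" for y using that by simp
  have "?L x \<in> {\<zero>\<^bsub>Q\<^esub>}"
    by (rule module_hom_mspan[OF FF.module_axioms Q L submodule_zero[OF Q] gens_closed z assms[unfolded tensor_rel_gens]])
  then show ?thesis by simp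
qed

lemma tensor_lift_hom: "tensor_lift R Q h \<in> module_hom R TT Q"
  using quot_lift_hom[OF Q free_lift_hom[OF Q uncurry_closed] free_lift_rel]
  by (simp add: tensor_lift_rep[abs_def] tensor_over_def)

lemma tensor_lift_pure:
  assumes "m \<in> carrier M" "n \<in> carrier N" shows "tensor_lift R Q h (m \<oslash> n) = h m n"
  using hom_rep_coset[OF Q free_lift_hom[OF Q uncurry_closed] free_lift_rel d_closed[OF assms]]
    free_lift_delta[OF Q uncurry_closed, of "(m, n)"] assms
  by (simp add: tensor_lift_rep pure_over_def)

end

end

text \<open>The tensor product over \<open>R\<close> itself is the instance in which both actions
  are scalar multiplication.\<close>

lemma tensor_factors_scalars:
  "module R M \<Longrightarrow> module R N \<Longrightarrow>
   tensor_factors R M N (carrier R) (\<lambda>m r. r \<odot>\<^bsub>M\<^esub> m) (\<lambda>r n. r \<odot>\<^bsub>N\<^esub> n)"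
  by (intro tensor_factors.intro tensor_factors_axioms.intro) (auto simp: module.smult_closed)

lemma
  fixes R :: "'r ring"
  assumes M: "module R M" and N: "module R N"
  shows module_tensor: "module R (tensor R M N)"
    and pure_bilinear: "pure R M N \<in> bilinear R M N (tensor R M N)"
    and tensor_hom_eqI: "\<lbrakk>module R Q; f \<in> module_hom R (tensor R M N) Q; g \<in> module_hom R (tensor R M N) Q;
      \<And>m n. m \<in> carrier M \<Longrightarrow> n \<in> carrier N \<Longrightarrow> f (pure R M N m n) = g (pure R M N m n);
      z \<in> carrier (tensor R M N)\<rbrakk> \<Longrightarrow> f z = g z"
    and bilinear_tensor_lift: "\<lbrakk>module R Q; h \<in> bilinear R M N Q\<rbrakk>
      \<Longrightarrow> tensor_lift R Q h \<in> module_hom R (tensor R M N) Q"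
    and bilinear_tensor_lift_pure: "\<lbrakk>module R Q; h \<in> bilinear R M N Q; m \<in> carrier M; n \<in> carrier N\<rbrakk>
      \<Longrightarrow> tensor_lift R Q h (pure R M N m n) = h m n"
proof -
  interpret tensor_factors R M N "carrier R" "\<lambda>m r. r \<odot>\<^bsub>M\<^esub> m" "\<lambda>r n. r \<odot>\<^bsub>N\<^esub> n"
    using M N by (rule tensor_factors_scalars)
  show "module R (tensor R M N)" using module_TT by (simp add: tensor_def)
  show "pure R M N \<in> bilinear R M N (tensor R M N)"
    using pure_bilinear by (simp add: tensor_def pure_def)
  show "f z = g z" if "module R Q" "f \<in> module_hom R (tensor R M N) Q" "g \<in> module_hom R (tensor R M N) Q"
      "\<And>m n. m \<in> carrier M \<Longrightarrow> n \<in> carrier N \<Longrightarrow> f (pure R M N m n) = g (pure R M N m n)"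
      "z \<in> carrier (tensor R M N)"
    using that TT_hom_eqI[of Q f g z] unfolding tensor_def pure_def by blast
  \<comment> \<open>Over \<open>R\<close> a bilinear map is automatically balanced: the scalar can
    be pulled out of either argument.\<close>
  have b: "h (r \<odot>\<^bsub>M\<^esub> m) n = h m (r \<odot>\<^bsub>N\<^esub> n)"
    if "h \<in> bilinear R M N Q" "r \<in> carrier R" "m \<in> carrier M" "n \<in> carrier N"
    for h and Q :: "('r, 'q, 'x) module_scheme" and r m n
    using that module_homD(3)[OF bilinearD(1)[OF that(1)]] module_homD(3)[OF bilinearD(2)[OF that(1)]] by simp
  show "tensor_lift R Q h \<in> module_hom R (tensor R M N) Q"
    if "module R Q" "h \<in> bilinear R M N Q"
    using tensor_lift_hom[OF that b[OF that(2)]] unfolding tensor_def by blast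
  show "tensor_lift R Q h (pure R M N m n) = h m n"
    if "module R Q" "h \<in> bilinear R M N Q" "m \<in> carrier M" "n \<in> carrier N"
    using tensor_lift_pure[OF that(1,2) b[OF that(2)] that(3,4)] unfolding pure_def by blast
qed

section \<open>Algebras and their quotients\<close>

lemma mu_dom_simps:
  "mu_dom P C [a] p \<longleftrightarrow> a \<in> C \<and> p \<in> carrier (opc P 1)"
  "mu_dom P C [a, b] x \<longleftrightarrow> a \<in> C \<and> b \<in> C \<and> x \<in> carrier (opc P 2)"
  by (auto simp: mu_dom_def numeral_2_eq_2)

lemma alg_homD:
  assumes "f \<in> alg_hom R P A B"
  shows "a \<in> carrier A \<Longrightarrow> f a \<in> carrier B"
    and "a \<in> carrier A \<Longrightarrow> b \<in> carrier A \<Longrightarrow> f (a \<oplus>\<^bsub>A\<^esub> b) = f a \<oplus>\<^bsub>B\<^esub> f b"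
    and "r \<in> carrier R \<Longrightarrow> a \<in> carrier A \<Longrightarrow> f (r \<odot>\<^bsub>A\<^esub> a) = r \<odot>\<^bsub>B\<^esub> f a"
    and "mu_dom P (carrier A) as x \<Longrightarrow> f (mu A as x) = mu B (map f as) x"
  using assms by (auto simp: alg_hom_def)

lemma alg_homI:
  assumes "f \<in> module_hom R A B"
    and "\<And>as x. mu_dom P (carrier A) as x \<Longrightarrow> f (mu A as x) = mu B (map f as) x"
  shows "f \<in> alg_hom R P A B"
  using assms by (auto simp: alg_hom_def module_hom_def)

lemma alg_hom_module_hom: "f \<in> alg_hom R P A B \<Longrightarrow> f \<in> module_hom R A B"
  by (auto simp: alg_hom_def module_hom_def)

lemma alg_hom_compose:
  assumes f: "f \<in> alg_hom R P A B" and g: "g \<in> alg_hom R P B C"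
  shows "(\<lambda>x. g (f x)) \<in> alg_hom R P A C"
proof (rule alg_homI)
  show "(\<lambda>x. g (f x)) \<in> module_hom R A C"
    using f g by (intro module_hom_compose[of f R A B g C] alg_hom_module_hom)
  fix as x assume d: "mu_dom P (carrier A) as x"
  then have "mu_dom P (carrier B) (map f as) x" using alg_homD(1)[OF f] by (auto simp: mu_dom_def)
  then show "g (f (mu A as x)) = mu C (map (\<lambda>x. g (f x)) as) x"
    using d alg_homD(4)[OF f] alg_homD(4)[OF g] by (simp add: o_def)
qed

lemma alg_hom_id: "(\<lambda>x. x) \<in> alg_hom R P A A" "id \<in> alg_hom R P A A"
  by (auto simp: alg_hom_def)

lemma mu_dom_map:
  "f \<in> carrier A \<rightarrow> carrier B \<Longrightarrow> mu_dom P (carrier A) as x \<Longrightarrow> mu_dom P (carrier B) (map f as) x"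
  by (auto simp: mu_dom_def)

lemma mk_alg_sel [simp]:
  "carrier (mk_alg P M f) = carrier M" "zero (mk_alg P M f) = zero M" "add (mk_alg P M f) = add M"
  "smult (mk_alg P M f) = smult M"
  by (simp_all add: mk_alg_def)

lemma mu_mk_alg:
  "mu (mk_alg P M f) as x = (if mu_dom P (carrier M) as x then f as x else undefined)"
  by (simp add: mk_alg_def)

lemma module_cong:
  assumes "module R M" "carrier N = carrier M" "zero N = zero M" "add N = add M" "smult N = smult M"
  shows "module R N"
  by (rule module_surj_image[of R M N "\<lambda>x. x"]) (use assms in auto)

context operad
begin

lemma swap_permutes: "Transposition.transpose 0 1 permutes {..<2::nat}"
  by (rule permutes_swap_id) auto

lemma comp1_closed: "p \<in> carrier (opc P 1) \<Longrightarrow> q \<in> carrier (opc P 1) \<Longrightarrow> comp P [1] [p] q \<in> carrier (opc P 1)"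
  using comp_closed[of "[1]" "[p]" q] by (simp add: ops_in_def)

lemma comp2_closed: "x \<in> carrier (opc P 2) \<Longrightarrow> q \<in> carrier (opc P 1) \<Longrightarrow> comp P [2] [x] q \<in> carrier (opc P 2)"
  using comp_closed[of "[2]" "[x]" q] by (simp add: ops_in_def)

lemma comp11_closed:
  "p \<in> carrier (opc P 1) \<Longrightarrow> q \<in> carrier (opc P 1) \<Longrightarrow> x \<in> carrier (opc P 2)
   \<Longrightarrow> comp P [1, 1] [p, q] x \<in> carrier (opc P 2)"
  using comp_closed[of "[1, 1]" "[p, q]" x] by (simp add: ops_in_def numeral_2_eq_2)

end

context palgebra
begin

text \<open>Multilinearity packaged as linear maps in a single argument, the form in which spans and
  uniqueness statements use it.\<close>

lemma mu_arg_hom: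
  assumes "set us \<subseteq> carrier A" "set vs \<subseteq> carrier A" "x \<in> carrier (opc P (Suc (length us + length vs)))"
  shows "(\<lambda>a. mu A (us @ a # vs) x) \<in> module_hom R A A"
proof (rule module_homI)
  have d: "mu_dom P (carrier A) (us @ a # vs) x" if "a \<in> carrier A" for a
    using assms that by (simp add: mu_dom_def)
  show "mu A (us @ a # vs) x \<in> carrier A" if "a \<in> carrier A" for a
    using d[OF that] by (rule mu_closed)
qed (use assms in \<open>auto intro!: mu_add_arg mu_smult_arg simp: mu_dom_def\<close>)

lemma mu_op_hom:
  assumes "as \<noteq> []" "set as \<subseteq> carrier A"
  shows "mu A as \<in> module_hom R (opc P (length as)) A"
  using assms by (intro module_homI mu_closed mu_add mu_smult) (auto simp: mu_dom_def)

lemma mu_zero_arg: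
  assumes "set us \<subseteq> carrier A" "set vs \<subseteq> carrier A" "x \<in> carrier (opc P (Suc (length us + length vs)))"
  shows "mu A (us @ \<zero>\<^bsub>A\<^esub> # vs) x = \<zero>\<^bsub>A\<^esub>"
  using module_hom_zero[OF module_axioms module_axioms mu_arg_hom[OF assms]] .

lemma mu_zero_in:
  assumes "mu_dom P (carrier A) as x" "\<zero>\<^bsub>A\<^esub> \<in> set as" shows "mu A as x = \<zero>\<^bsub>A\<^esub>"
proof -
  obtain us vs where "as = us @ \<zero>\<^bsub>A\<^esub> # vs" using assms(2) by (meson split_list)
  then show ?thesis using mu_zero_arg[of us vs x] assms(1) by (simp add: mu_dom_def)
qed

lemma mu_zero_op:
  assumes "as \<noteq> []" "set as \<subseteq> carrier A" shows "mu A as \<zero>\<^bsub>opc P (length as)\<^esub> = \<zero>\<^bsub>A\<^esub>"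
  using module_hom_zero[OF opc_module module_axioms mu_op_hom[OF assms]] assms by (simp add: Suc_le_eq)

lemma mu1_closed: "a \<in> carrier A \<Longrightarrow> p \<in> carrier (opc P 1) \<Longrightarrow> mu A [a] p \<in> carrier A"
  by (rule mu_closed) (simp only: mu_dom_simps)

lemma mu2_closed:
  "a \<in> carrier A \<Longrightarrow> b \<in> carrier A \<Longrightarrow> x \<in> carrier (opc P 2) \<Longrightarrow> mu A [a, b] x \<in> carrier A"
  by (rule mu_closed) (simp only: mu_dom_simps)

lemma mu2_hom_l:
  "b \<in> carrier A \<Longrightarrow> x \<in> carrier (opc P 2) \<Longrightarrow> (\<lambda>a. mu A [a, b] x) \<in> module_hom R A A"
  using mu_arg_hom[of "[]" "[b]" x] by (simp add: numeral_2_eq_2)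

lemma mu2_hom_r:
  "a \<in> carrier A \<Longrightarrow> x \<in> carrier (opc P 2) \<Longrightarrow> (\<lambda>b. mu A [a, b] x) \<in> module_hom R A A"
  using mu_arg_hom[of "[a]" "[]" x] by (simp add: numeral_2_eq_2)

lemma mu2_hom_op:
  "a \<in> carrier A \<Longrightarrow> b \<in> carrier A \<Longrightarrow> (\<lambda>x. mu A [a, b] x) \<in> module_hom R (opc P 2) A"
  using mu_op_hom[of "[a, b]"] by (simp add: numeral_2_eq_2)

lemma mu1_hom: "p \<in> carrier (opc P 1) \<Longrightarrow> (\<lambda>a. mu A [a] p) \<in> module_hom R A A"
  using mu_arg_hom[of "[]" "[]" p] by simp

lemma mu1_hom_op: "a \<in> carrier A \<Longrightarrow> (\<lambda>p. mu A [a] p) \<in> module_hom R (opc P 1) A"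
  using mu_op_hom[of "[a]"] by simp

lemma mu1_mu1:
  assumes "a \<in> carrier A" "p \<in> carrier (opc P 1)" "q \<in> carrier (opc P 1)"
  shows "mu A [mu A [a] p] q = mu A [a] (comp P [1] [p] q)"
  using mu_comp[of "[[a]]" "[p]" q] assms by (simp add: mu_dom_def)

lemma mu1_mu2:
  assumes "a \<in> carrier A" "b \<in> carrier A" "x \<in> carrier (opc P 2)" "q \<in> carrier (opc P 1)"
  shows "mu A [mu A [a, b] x] q = mu A [a, b] (comp P [2] [x] q)"
  using mu_comp[of "[[a, b]]" "[x]" q] assms by (simp add: mu_dom_def numeral_2_eq_2)

text \<open>Unary operations on both arguments are absorbed by the left action of
  \<open>P11 R P\<close> on binary operations; this is the source of the balancing relation in the
  tensor product formula.\<close>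

lemma mu2_mu1:
  assumes "a \<in> carrier A" "b \<in> carrier A" "p \<in> carrier (opc P 1)" "q \<in> carrier (opc P 1)" "x \<in> carrier (opc P 2)"
  shows "mu A [mu A [a] p, mu A [b] q] x = mu A [a, b] (comp P [1, 1] [p, q] x)"
  using mu_comp[of "[[a], [b]]" "[p, q]" x] assms by (simp add: mu_dom_def numeral_2_eq_2)

lemma mu2_swap:
  assumes "a \<in> carrier A" "b \<in> carrier A" "x \<in> carrier (opc P 2)"
  shows "mu A [a, b] (act P 2 (Transposition.transpose 0 1) x) = mu A [b, a] x"
proof -
  have "mu A [a, b] (act P (length [a, b]) (Transposition.transpose 0 1) x)
      = mu A (permute_list (Transposition.transpose 0 1) [a, b]) x"
    using assms swap_permutes by (intro mu_act) (auto simp: mu_dom_simps numeral_2_eq_2)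
  then show ?thesis by (simp add: permute_list_def numeral_2_eq_2)
qed

lemma mu_unit_map: "set us \<subseteq> carrier A \<Longrightarrow> map2 (mu A) (map (\<lambda>u. [u]) us) (replicate (length us) (unit P)) = us"
  by (induction us) (auto simp: mu_unit)

text \<open>Filling the remaining slots with the identity operation turns the nested expression into
  one full composition, hence into a single operation on the flattened argument list.\<close>

lemma mu_nest:
  assumes as: "mu_dom P (carrier A) as x" and d: "mu_dom P (carrier A) (us @ mu A as x # vs) y"
  obtains z where "mu_dom P (carrier A) (us @ as @ vs) z"
    "mu A (us @ mu A as x # vs) y = mu A (us @ as @ vs) z"
proof -
  let ?ass = "map (\<lambda>u. [u]) us @ as # map (\<lambda>u. [u]) vs"
  \<comment> \<open>Each argument in \<open>us\<close> and \<open>vs\<close> becomes a one-element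
    list acted on by the identity of the operad, which leaves it unchanged.\<close>
  let ?xs = "replicate (length us) (unit P) @ x # replicate (length vs) (unit P)"
  have s: "set us \<subseteq> carrier A" "set vs \<subseteq> carrier A" using d by (auto simp: mu_dom_def)
  have u: "list_all2 (mu_dom P (carrier A)) (map (\<lambda>u. [u]) us) (replicate (length us) (unit P))"
    if "set us \<subseteq> carrier A" for us
    using that unit_closed by (induction us) (auto simp: mu_dom_simps)
  have l: "list_all2 (mu_dom P (carrier A)) ?ass ?xs"
    using as u s by (auto intro!: list_all2_appendI)
  have y: "y \<in> carrier (opc P (length ?ass))" using d by (simp add: mu_dom_def)
  have c: "concat ?ass = us @ as @ vs" by simp
  have m: "map2 (mu A) ?ass ?xs = us @ mu A as x # vs"
    using mu_unit_map s by simp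
  have o: "ops_in P (map length ?ass) ?xs"
    unfolding ops_in_def list_all2_map1 using l
    by (rule list_all2_mono) (auto simp: mu_dom_def Suc_le_eq)
  have "comp P (map length ?ass) ?xs y \<in> carrier (opc P (sum_list (map length ?ass)))"
    using o y by (intro comp_closed) auto
  also have "sum_list (map length ?ass) = length (us @ as @ vs)"
    using length_concat[of ?ass] c by simp
  finally have "mu_dom P (carrier A) (us @ as @ vs) (comp P (map length ?ass) ?xs y)"
    using as s by (auto simp: mu_dom_def)
  moreover have "mu A (us @ mu A as x # vs) y = mu A (us @ as @ vs) (comp P (map length ?ass) ?xs y)"
    using mu_comp[OF _ l y] unfolding c m by simp
  ultimately show ?thesis by (rule that)
qed

abbreviation "ops_ge n \<equiv> {mu A as x | as x. n \<le> length as \<and> mu_dom P (carrier A) as x}"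

lemma ops_ge_closed: "ops_ge n \<subseteq> carrier A"
  using mu_closed by auto

text \<open>The inner operation occupies one slot of the outer one, so its arity and the number of
  the other arguments add up.\<close>

lemma ops_ge_absorb:
  assumes "g \<in> ops_ge n" "mu_dom P (carrier A) (us @ g # vs) y"
  shows "mu A (us @ g # vs) y \<in> ops_ge (n + length us + length vs)"
proof -
  obtain as x where g: "g = mu A as x" "n \<le> length as" "mu_dom P (carrier A) as x" using assms(1) by auto
  obtain z where "mu_dom P (carrier A) (us @ as @ vs) z" "mu A (us @ g # vs) y = mu A (us @ as @ vs) z"
    using mu_nest[OF g(3)] assms(2) g(1) by metis
  then show ?thesis using g(2) by force
qed

lemma submodule_J: "submodule (J R P n A) R A"
  unfolding J_def by (rule submodule_mspan[OF module_axioms ops_ge_closed])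

lemma J_gen: "n \<le> length as \<Longrightarrow> mu_dom P (carrier A) as x \<Longrightarrow> mu A as x \<in> J R P n A"
  unfolding J_def by (rule subsetD[OF mspan_superset]) auto

text \<open>The operation is linear in the distinguished argument, so it suffices to insert
  generators of \<open>J R P n A\<close>, where arities add up.\<close>

lemma J_absorb_sum:
  assumes "mu_dom P (carrier A) (us @ a # vs) y" "a \<in> J R P n A"
  shows "mu A (us @ a # vs) y \<in> J R P (n + length us + length vs) A"
proof (rule module_hom_mspan[OF module_axioms module_axioms _ submodule_J ops_ge_closed _ assms(2)[unfolded J_def]])
  show "(\<lambda>a. mu A (us @ a # vs) y) \<in> module_hom R A A"
    using assms(1) by (intro mu_arg_hom) (auto simp: mu_dom_def)
  fix g assume g: "g \<in> ops_ge n"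
  then have "mu_dom P (carrier A) (us @ g # vs) y"
    using assms(1) ops_ge_closed[of n] by (auto simp: mu_dom_def)
  from ops_ge_absorb[OF g this] show "mu A (us @ g # vs) y \<in> J R P (n + length us + length vs) A"
    by (auto intro: J_gen)
qed

lemma J_antimono: "m \<le> n \<Longrightarrow> J R P n A \<subseteq> J R P m A"
  unfolding J_def by (rule mspan_minimal[OF submodule_J[unfolded J_def]]) (use J_gen[unfolded J_def] in auto)

text \<open>Makes \<open>J R P n A\<close> an ideal, so that the quotient by it is again an
  algebra.\<close>

lemma J_absorb:
  assumes "mu_dom P (carrier A) (us @ a # vs) y" "a \<in> J R P n A"
  shows "mu A (us @ a # vs) y \<in> J R P n A"
  using J_absorb_sum[OF assms] J_antimono[of n "n + length us + length vs"] by auto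

end

text \<open>A homomorphism sends a value of an operation to a value of the same operation, so
  generators go to generators.\<close>

lemma alg_hom_J:
  assumes "palgebra R P A" "palgebra R P B" "f \<in> alg_hom R P A B" "a \<in> J R P n A"
  shows "f a \<in> J R P n B"
proof -
  interpret A: palgebra R P A by fact
  interpret B: palgebra R P B by fact
  have f: "f \<in> carrier A \<rightarrow> carrier B" using alg_homD(1)[OF assms(3)] by auto
  show ?thesis
  proof (rule module_hom_mspan[OF A.module_axioms B.module_axioms alg_hom_module_hom[OF assms(3)]
        B.submodule_J A.ops_ge_closed _ assms(4)[unfolded J_def]])
    fix x assume "x \<in> A.ops_ge n"
    then show "f x \<in> J R P n B"
      using alg_homD(4)[OF assms(3)] by (auto intro!: B.J_gen mu_dom_map[OF f])
  qed
qed

lemma set_map2_subset: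
  assumes "list_all2 D as bs" "\<And>a b. D a b \<Longrightarrow> f a b \<in> S"
  shows "set (map2 f as bs) \<subseteq> S"
  using assms(1) by (induction rule: list_all2_induct) (auto intro: assms(2))

lemma mu_dom_map2:
  assumes l: "list_all2 D ass xs" and "\<And>as x. D as x \<Longrightarrow> f as x \<in> C"
    and "ass \<noteq> []" "y \<in> carrier (opc P (length ass))"
  shows "mu_dom P C (map2 f ass xs) y"
proof -
  have "length (map2 f ass xs) = length ass" using list_all2_lengthD[OF l] by simp
  moreover from this have "map2 f ass xs \<noteq> []" using assms(3) by (metis length_0_conv)
  ultimately show ?thesis
    using assms(4) set_map2_subset[OF assms(1,2)] by (simp only: mu_dom_def simp_thms)
qed

lemma (in operad) mu_dom_concat:
  assumes ne: "ass \<noteq> []" and l: "list_all2 (mu_dom P C) ass xs" and y: "y \<in> carrier (opc P (length ass))"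
  shows "mu_dom P C (concat ass) (comp P (map length ass) xs y)"
proof -
  have "\<exists>x. mu_dom P C as x" if "as \<in> set ass" for as
    using l that by (metis list_all2_conv_all_nth in_set_conv_nth)
  then have "concat ass \<noteq> []" "set (concat ass) \<subseteq> C"
    using ne by (auto simp: mu_dom_def subset_eq)
  moreover have "comp P (map length ass) xs y \<in> carrier (opc P (length (concat ass)))"
    by (rule comp_dom[OF ne list_all2_mono[OF l] y]) (auto simp: mu_dom_def)
  ultimately show ?thesis by (simp only: mu_dom_def simp_thms)
qed

lemma (in operad) mu_dom_act:
  assumes "mu_dom P C as x" "t permutes {..<length as}"
  shows "mu_dom P C as (act P (length as) t x)" "mu_dom P C (permute_list t as) x"
proof -
  have n: "1 \<le> length as" using assms(1) by (simp add: mu_dom_def Suc_le_eq)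
  show "mu_dom P C as (act P (length as) t x)"
    using assms(1) act_closed[OF n assms(2)] by (simp add: mu_dom_def)
  have "permute_list t as \<noteq> []" using n by (metis length_permute_list list.size(3) not_one_le_zero)
  then show "mu_dom P C (permute_list t as) x" using assms by (simp add: mu_dom_def)
qed

text \<open>The algebra axioms with the linearity conditions bundled into linear maps, so that they
  can be supplied by composing linear maps.\<close>

lemma palgebraI:
  assumes P: "operad R P" and A: "module R A"
    and u: "\<And>as x. \<not> mu_dom P (carrier A) as x \<Longrightarrow> mu A as x = undefined"
    and arg: "\<And>us vs x. \<lbrakk>set us \<subseteq> carrier A; set vs \<subseteq> carrier A; x \<in> carrier (opc P (Suc (length us + length vs)))\<rbrakk>
      \<Longrightarrow> (\<lambda>a. mu A (us @ a # vs) x) \<in> module_hom R A A"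
    and op: "\<And>as. \<lbrakk>as \<noteq> []; set as \<subseteq> carrier A\<rbrakk> \<Longrightarrow> mu A as \<in> module_hom R (opc P (length as)) A"
    and unit: "\<And>a. a \<in> carrier A \<Longrightarrow> mu A [a] (unit P) = a"
    and comp: "\<And>ass xs y. \<lbrakk>ass \<noteq> []; list_all2 (mu_dom P (carrier A)) ass xs; y \<in> carrier (opc P (length ass))\<rbrakk>
      \<Longrightarrow> mu A (concat ass) (comp P (map length ass) xs y) = mu A (map2 (mu A) ass xs) y"
    and act: "\<And>as x t. \<lbrakk>mu_dom P (carrier A) as x; t permutes {..<length as}\<rbrakk>
      \<Longrightarrow> mu A as (act P (length as) t x) = mu A (permute_list t as) x"
  shows "palgebra R P A"
proof -
  interpret operad R P by fact
  interpret module R A by fact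
  have o: "as \<noteq> []" "set as \<subseteq> carrier A" "x \<in> carrier (opc P (length as))" if "mu_dom P (carrier A) as x" for as x
    using that by (auto simp: mu_dom_def)
  have a: "set us \<subseteq> carrier A" "set vs \<subseteq> carrier A" "x \<in> carrier (opc P (Suc (length us + length vs)))" "a \<in> carrier A"
    if "mu_dom P (carrier A) (us @ a # vs) x" for us a vs x
    using that by (auto simp: mu_dom_def)
  show ?thesis
  proof
    fix as x y r assume d: "mu_dom P (carrier A) as x"
    note h = module_homD[OF op[OF o(1,2)[OF d]]]
    show "mu A as x \<in> carrier A" by (rule h(1)[OF o(3)[OF d]])
    show "mu A as (x \<oplus>\<^bsub>opc P (length as)\<^esub> y) = mu A as x \<oplus>\<^bsub>A\<^esub> mu A as y" if "mu_dom P (carrier A) as y"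
      by (rule h(2)[OF o(3)[OF d] o(3)[OF that]])
    show "mu A as (r \<odot>\<^bsub>opc P (length as)\<^esub> x) = r \<odot>\<^bsub>A\<^esub> mu A as x" if "r \<in> carrier R"
      by (rule h(3)[OF that o(3)[OF d]])
  next
    fix us a vs x b r assume d: "mu_dom P (carrier A) (us @ a # vs) x"
    note h = module_homD[OF arg[OF a(1-3)[OF d]]]
    show "mu A (us @ (a \<oplus>\<^bsub>A\<^esub> b) # vs) x = mu A (us @ a # vs) x \<oplus>\<^bsub>A\<^esub> mu A (us @ b # vs) x" if "b \<in> carrier A"
      by (rule h(2)[OF a(4)[OF d] that])
    show "mu A (us @ (r \<odot>\<^bsub>A\<^esub> a) # vs) x = r \<odot>\<^bsub>A\<^esub> mu A (us @ a # vs) x" if "r \<in> carrier R"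
      by (rule h(3)[OF that a(4)[OF d]])
  qed (rule u unit comp act; assumption)+
qed

lemma module_hom_cong:
  assumes "module R M" "f \<in> module_hom R M N" "\<And>x. x \<in> carrier M \<Longrightarrow> g x = f x"
  shows "g \<in> module_hom R M N"
proof -
  interpret module R M by fact
  show ?thesis using assms(3) module_homD[OF assms(2)] by (intro module_homI) simp_all
qed

text \<open>Every element of \<open>N\<close> is of the form \<open>h a\<close>, where
  \<open>g\<close> is known to agree with the linear map \<open>f\<close>; linearity of
  \<open>g\<close> can therefore be tested on \<open>M\<close>.\<close>

lemma module_hom_of_surj:
  assumes "module R M" "module R N" and h: "h \<in> module_hom R M N" "carrier N = h ` carrier M"
    and f: "f \<in> module_hom R M Q" and g: "\<And>a. a \<in> carrier M \<Longrightarrow> g (h a) = f a"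
  shows "g \<in> module_hom R N Q"
proof -
  interpret M: module R M by fact
  have c: "\<exists>a \<in> carrier M. X = h a" if "X \<in> carrier N" for X using that unfolding h(2) by blast
  show ?thesis
  proof (rule module_homI)
    fix X assume "X \<in> carrier N"
    then obtain a where a: "a \<in> carrier M" "X = h a" using c by blast
    show "g X \<in> carrier Q" unfolding a(2) g[OF a(1)] by (rule module_homD(1)[OF f a(1)])
    show "g (X \<oplus>\<^bsub>N\<^esub> Y) = g X \<oplus>\<^bsub>Q\<^esub> g Y" if "Y \<in> carrier N" for Y
    proof -
      obtain b where b: "b \<in> carrier M" "Y = h b" using c \<open>Y \<in> carrier N\<close> by blast
      show ?thesis
        unfolding a(2) b(2) module_homD(2)[OF h(1) a(1) b(1), symmetric] g[OF a(1)] g[OF b(1)] g[OF M.a_closed[OF a(1) b(1)]]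
        by (rule module_homD(2)[OF f a(1) b(1)])
    qed
    show "g (r \<odot>\<^bsub>N\<^esub> X) = r \<odot>\<^bsub>Q\<^esub> g X" if r: "r \<in> carrier R" for r
      unfolding a(2) module_homD(3)[OF h(1) r a(1), symmetric] g[OF a(1)] g[OF M.smult_closed[OF r a(1)]]
      by (rule module_homD(3)[OF f r a(1)])
  qed
qed

text \<open>The maps \<open>q n\<close> have to respect compositions only up to operations acting by zero: this covers
  quotients as well as both directions between \<open>P\<close> and its truncation.\<close>

lemma palgebra_transport:
  assumes A: "palgebra R P A" and P': "operad R P'" and Q: "module R Q"
    and h: "h \<in> module_hom R A Q" and surj: "carrier Q = h ` carrier A"
    and q: "\<And>n. 1 \<le> n \<Longrightarrow> q n \<in> module_hom R (opc P' n) (opc P n)" and q1: "q 1 (unit P') = unit P"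
    and qact: "\<And>n t x. \<lbrakk>1 \<le> n; t permutes {..<n}; x \<in> carrier (opc P' n)\<rbrakk> \<Longrightarrow> q n (act P' n t x) = act P n t (q n x)"
    and qcomp: "\<And>ass xs y. \<lbrakk>ass \<noteq> []; list_all2 (mu_dom P' (carrier A)) ass xs; y \<in> carrier (opc P' (length ass))\<rbrakk>
      \<Longrightarrow> mu A (concat ass) (q (length (concat ass)) (comp P' (map length ass) xs y)) =
          mu A (concat ass) (comp P (map length ass) (map2 (\<lambda>as. q (length as)) ass xs) (q (length ass) y))"
    and m: "\<And>as x. mu_dom P' (carrier A) as x \<Longrightarrow> mu Q (map h as) x = h (mu A as (q (length as) x))"
    and u: "\<And>as x. \<not> mu_dom P' (carrier Q) as x \<Longrightarrow> mu Q as x = undefined"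
  shows "palgebra R P' Q"
proof -
  interpret A: palgebra R P A by fact
  interpret P': operad R P' by fact
  have qd: "mu_dom P (carrier A) as (q (length as) x)" if "mu_dom P' (carrier A) as x" for as x
    using that module_homD(1)[OF q] by (auto simp: mu_dom_def Suc_le_eq)
  \<comment> \<open>Arguments in \<open>Q\<close> are replaced by chosen preimages, so that
    hypothesis \<open>m\<close> computes every operation of \<open>Q\<close> inside
    \<open>A\<close>.\<close>
  have lift: "\<exists>as. Xs = map h as \<and> set as \<subseteq> carrier A" if "set Xs \<subseteq> carrier Q" for Xs
    using that f_inv_into_f[of _ h "carrier A"] inv_into_into[of _ h "carrier A"] unfolding surj
    by (intro exI[of _ "map (inv_into (carrier A) h) Xs"]) (auto simp: map_idI subset_eq)
  have liftd: "\<exists>as. Xs = map h as \<and> mu_dom P' (carrier A) as x" if "mu_dom P' (carrier Q) Xs x" for Xs x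
  proof -
    obtain as where "Xs = map h as" "set as \<subseteq> carrier A" using lift[of Xs] \<open>mu_dom P' (carrier Q) Xs x\<close> by (auto simp: mu_dom_def)
    then show ?thesis using that by (auto simp: mu_dom_def)
  qed
  show ?thesis
  proof (rule palgebraI[OF P' Q u])
    fix us vs x
    assume uv: "set us \<subseteq> carrier Q" "set vs \<subseteq> carrier Q" and x: "x \<in> carrier (opc P' (Suc (length us + length vs)))"
    obtain bs cs where b: "us = map h bs" "set bs \<subseteq> carrier A" "vs = map h cs" "set cs \<subseteq> carrier A"
      using lift uv by metis
    let ?n = "Suc (length us + length vs)"
    have f: "(\<lambda>a. h (mu A (bs @ a # cs) (q ?n x))) \<in> module_hom R A Q"
      using b x module_homD(1)[OF q[of ?n]] by (intro module_hom_compose[OF A.mu_arg_hom h]) auto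
    have e: "mu Q (us @ h a # vs) x = h (mu A (bs @ a # cs) (q ?n x))" if "a \<in> carrier A" for a
      using m[of "bs @ a # cs" x] b x that by (simp add: mu_dom_def)
    show "(\<lambda>X. mu Q (us @ X # vs) x) \<in> module_hom R Q Q"
      by (rule module_hom_of_surj[OF A.module_axioms Q h surj f e])
  next
    fix Xs assume X: "Xs \<noteq> []" "set Xs \<subseteq> carrier Q"
    obtain as where as: "Xs = map h as" "set as \<subseteq> carrier A" using lift[OF X(2)] by blast
    then have n: "as \<noteq> []" "1 \<le> length as" using X(1) by (auto simp: Suc_le_eq)
    have f: "(\<lambda>x. h (mu A as (q (length as) x))) \<in> module_hom R (opc P' (length as)) Q"
      by (rule module_hom_compose[OF module_hom_compose[OF q[OF n(2)] A.mu_op_hom[OF n(1) as(2)]] h])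
    have e: "mu Q Xs x = h (mu A as (q (length as) x))" if "x \<in> carrier (opc P' (length as))" for x
      using m[of as x] as n(1) that by (simp add: mu_dom_def)
    have "length Xs = length as" using as(1) by simp
    then show "mu Q Xs \<in> module_hom R (opc P' (length Xs)) Q"
      using module_hom_cong[OF P'.opc_module[OF n(2)] f e] by simp
  next
    fix X assume "X \<in> carrier Q"
    then obtain b where "b \<in> carrier A" "X = h b" unfolding surj by blast
    then show "mu Q [X] (unit P') = X"
      using m[of "[b]" "unit P'"] A.mu_unit P'.unit_closed q1 by (simp add: mu_dom_simps)
  next
    fix Xss xs y assume ne: "Xss \<noteq> []" and d: "list_all2 (mu_dom P' (carrier Q)) Xss xs"
      and y: "y \<in> carrier (opc P' (length Xss))"
    have "\<exists>ass. Xss = map (map h) ass \<and> list_all2 (mu_dom P' (carrier A)) ass xs"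
      using d
    proof (induction rule: list_all2_induct)
      case (Cons Xs Xss x xs)
      then obtain ass as where "Xss = map (map h) ass" "list_all2 (mu_dom P' (carrier A)) ass xs"
        "Xs = map h as" "mu_dom P' (carrier A) as x" using liftd by blast
      then show ?case by (intro exI[of _ "as # ass"]) auto
    qed simp
    then obtain ass where ass: "Xss = map (map h) ass" and l: "list_all2 (mu_dom P' (carrier A)) ass xs" by blast
    let ?xs = "map2 (\<lambda>as. q (length as)) ass xs"
    have ane: "ass \<noteq> []" and y': "y \<in> carrier (opc P' (length ass))" using ne y ass by simp_all
    have yq: "q (length ass) y \<in> carrier (opc P (length ass))"
      using module_homD(1)[OF q y'] ane by (simp add: Suc_le_eq)
    have lq: "list_all2 (mu_dom P (carrier A)) ass ?xs"
      using l qd by (auto simp: list_all2_conv_all_nth)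
    have d3: "mu_dom P' (carrier A) (map2 (mu A) ass ?xs) y"
      by (rule mu_dom_map2[OF lq A.mu_closed ane y'])
    have m2: "map2 (mu Q) Xss xs = map h (map2 (mu A) ass ?xs)"
      unfolding ass using l by (induction rule: list_all2_induct) (auto simp: m)
    have len: "length (map2 (mu A) ass ?xs) = length ass" using list_all2_lengthD[OF l] by simp
    have "mu Q (concat Xss) (comp P' (map length Xss) xs y)
        = h (mu A (concat ass) (q (length (concat ass)) (comp P' (map length ass) xs y)))"
      using m[OF P'.mu_dom_concat[OF ane l y']] unfolding ass
      by (simp only: map_concat length_map list.map_comp o_def)
    \<comment> \<open>Inside \<open>mu A\<close>, hypothesis \<open>qcomp\<close> trades the image
      of the composition for the composition of the images; then compatibility with composition in
      \<open>A\<close> applies.\<close>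
    also have "\<dots> = h (mu A (map2 (mu A) ass ?xs) (q (length ass) y))"
      by (simp only: qcomp[OF ane l y'] A.mu_comp[OF ane lq yq])
    also have "\<dots> = mu Q (map2 (mu Q) Xss xs) y" unfolding m2 m[OF d3] len ..
    finally show "mu Q (concat Xss) (comp P' (map length Xss) xs y) = mu Q (map2 (mu Q) Xss xs) y" .
  next
    fix Xs x t assume d: "mu_dom P' (carrier Q) Xs x" and t: "t permutes {..<length Xs}"
    obtain as where as: "Xs = map h as" "mu_dom P' (carrier A) as x" using liftd[OF d] by blast
    have t: "t permutes {..<length as}" using t as by simp
    have n: "1 \<le> length as" "x \<in> carrier (opc P' (length as))" using as(2) by (auto simp: mu_dom_def Suc_le_eq)
    show "mu Q Xs (act P' (length Xs) t x) = mu Q (permute_list t Xs) x"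
      using m[OF P'.mu_dom_act(1)[OF as(2) t]] m[OF P'.mu_dom_act(2)[OF as(2) t]]
        A.mu_act[OF qd[OF as(2)] t] qact[OF n(1) t n(2)] t as(1) by (simp add: permute_list_map)
  qed
qed

lemma map2_snd: "length as = length bs \<Longrightarrow> map2 (\<lambda>a b. b) as bs = bs"
  by (induction as bs rule: list_induct2) auto

section \<open>Quotients of algebras by ideals\<close>

locale quotient_palgebra = palgebra R P A + quotient_module R A I
  for R :: "'r ring" and P :: "('r, 'p) operad" and A :: "('r, 'a, 'p) palg" and I +
  assumes absorb: "mu_dom P (carrier A) (us @ a # vs) x \<Longrightarrow> a \<in> I \<Longrightarrow> mu A (us @ a # vs) x \<in> I"
begin

abbreviation "QA \<equiv> quot_alg P A I"
abbreviation "pr a \<equiv> I +>\<^bsub>A\<^esub> a"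

lemma quot_alg_sel:
  "carrier QA = pr ` carrier A" "\<zero>\<^bsub>QA\<^esub> = pr \<zero>\<^bsub>A\<^esub>" "\<zero>\<^bsub>QA\<^esub> = I"
  "\<lbrakk>a \<in> carrier A; b \<in> carrier A\<rbrakk> \<Longrightarrow> pr a \<oplus>\<^bsub>QA\<^esub> pr b = pr (a \<oplus>\<^bsub>A\<^esub> b)"
  "\<lbrakk>r \<in> carrier R; a \<in> carrier A\<rbrakk> \<Longrightarrow> r \<odot>\<^bsub>QA\<^esub> pr a = pr (r \<odot>\<^bsub>A\<^esub> a)"
  by (simp_all add: quot_alg_def carrier_quot zero_quot add_quot smult_quot)

text \<open>The arguments are replaced one at a time. Each replacement changes the value by the same
  operation with the difference of the two arguments inserted, which lies in \<open>I\<close> by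
  absorption.\<close>

lemma mu_cong_mod:
  assumes "list_all2 (\<lambda>a b. pr a = pr b) as bs" "mu_dom P (carrier A) as x" "set bs \<subseteq> carrier A"
  shows "pr (mu A as x) = pr (mu A bs x)"
proof -
  \<comment> \<open>The prefix \<open>us\<close> collects the arguments already replaced.\<close>
  have "pr (mu A (us @ as) x) = pr (mu A (us @ bs) x)"
    if "list_all2 (\<lambda>a b. pr a = pr b) as bs" "mu_dom P (carrier A) (us @ as) x" "set bs \<subseteq> carrier A" for us
    using that
  proof (induction as bs arbitrary: us rule: list_all2_induct)
    case (Cons a as b bs)
    have ab: "a \<in> carrier A" "b \<in> carrier A" using Cons.prems by (auto simp: mu_dom_def)
    then have i: "a \<ominus>\<^bsub>A\<^esub> b \<in> I" using Cons.hyps coset_eq_iff by simp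
    have d: "mu_dom P (carrier A) (us @ b # as) x" "mu_dom P (carrier A) (us @ (a \<ominus>\<^bsub>A\<^esub> b) # as) x"
      using Cons.prems ab by (auto simp: mu_dom_def)
    have "mu A (us @ (a \<ominus>\<^bsub>A\<^esub> b) # as) x = mu A (us @ a # as) x \<ominus>\<^bsub>A\<^esub> mu A (us @ b # as) x"
      using Cons.prems ab
      by (intro module_hom_minus[OF module_axioms module_axioms mu_arg_hom]) (auto simp: mu_dom_def)
    then have "pr (mu A (us @ a # as) x) = pr (mu A (us @ b # as) x)"
      using absorb[OF d(2) i] mu_closed[OF Cons.prems(1)] mu_closed[OF d(1)] by (simp add: coset_eq_iff)
    also have "\<dots> = pr (mu A ((us @ [b]) @ bs) x)"
      using Cons.IH[of "us @ [b]"] d Cons.prems by simp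
    finally show ?case by simp
  qed simp
  from this[of "[]"] assms show ?thesis by simp
qed

lemma mu_quot:
  assumes "mu_dom P (carrier A) as x" shows "mu QA (map pr as) x = pr (mu A as x)"
proof -
  have s: "set as \<subseteq> carrier A" using assms by (simp add: mu_dom_def)
  have d: "mu_dom P (carrier (quot_mod A I)) (map pr as) x"
    using assms by (auto simp: mu_dom_def carrier_quot)
  have "pr (mu A as x) = pr (mu A (map rep (map pr as)) x)"
    using s rep_coset by (intro mu_cong_mod[OF _ assms]) (auto simp: list_all2_conv_all_nth subset_eq)
  then show ?thesis using d by (simp add: quot_alg_def mu_mk_alg)
qed

lemma pr_module_hom: "pr \<in> module_hom R A QA"
  by (rule module_homI) (auto simp: quot_alg_sel(1,4,5))

text \<open>Transport along the projection with the operad unchanged, so that the condition on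
  compositions is an identity.\<close>

lemma quot_palgebra: "palgebra R P QA"
proof (rule palgebra_transport[OF palgebra_axioms operad_axioms _ pr_module_hom quot_alg_sel(1), where q = "\<lambda>_ x. x"])
  show "module R QA" by (rule module_cong[OF module_quot]) (simp_all add: quot_alg_def)
  fix ass xs y assume "list_all2 (mu_dom P (carrier A)) ass xs"
  then have "map2 (\<lambda>as x. x) ass xs = xs" by (intro map2_snd list_all2_lengthD)
  then show "mu A (concat ass) (comp P (map length ass) xs y) =
      mu A (concat ass) (comp P (map length ass) (map2 (\<lambda>as x. x) ass xs) y)" by simp
qed (simp_all add: mu_quot module_hom_id, simp add: quot_alg_def mu_mk_alg)

lemma pr_hom: "pr \<in> alg_hom R P A QA"
  unfolding alg_hom_def by (auto simp: quot_alg_sel(1,4,5) mu_quot)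

lemma hom_rep_pr:
  assumes "palgebra R P B" "f \<in> alg_hom R P A B" "\<And>x. x \<in> I \<Longrightarrow> f x = \<zero>\<^bsub>B\<^esub>" "a \<in> carrier A"
  shows "f (rep (pr a)) = f a"
proof -
  interpret B: palgebra R P B by fact
  show ?thesis using hom_rep_coset[OF B.module_axioms alg_hom_module_hom[OF assms(2)] assms(3,4)] .
qed

lemma quot_alg_lift:
  assumes "palgebra R P B" "f \<in> alg_hom R P A B" "\<And>x. x \<in> I \<Longrightarrow> f x = \<zero>\<^bsub>B\<^esub>"
  shows "(\<lambda>X. f (rep X)) \<in> alg_hom R P QA B"
  unfolding alg_hom_def
proof (intro CollectI conjI ballI allI impI)
  fix Xs x assume "mu_dom P (carrier QA) Xs x"
  then have d: "mu_dom P (carrier A) (map rep Xs) x" and s: "set Xs \<subseteq> carrier (quot_mod A I)"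
    using rep_quot by (auto simp: mu_dom_def quot_alg_def)
  have X: "Xs = map pr (map rep Xs)" using s rep_quot by (auto simp: map_idI subset_eq)
  have "mu QA Xs x = pr (mu A (map rep Xs) x)" using mu_quot[OF d] X by simp
  then have "f (rep (mu QA Xs x)) = f (mu A (map rep Xs) x)"
    using hom_rep_pr[OF assms mu_closed[OF d]] by simp
  then show "f (rep (mu QA Xs x)) = mu B (map (\<lambda>X. f (rep X)) Xs) x"
    using alg_homD(4)[OF assms(2) d] by (simp add: o_def)
qed (auto simp: quot_alg_sel(1,4,5) hom_rep_pr[OF assms] alg_homD(1-3)[OF assms(2)])

end

lemma (in palgebra) quotient_by_J: "quotient_palgebra R P A (J R P n A)"
proof -
  interpret I: submodule "J R P n A" R A by (rule submodule_J)
  show ?thesis by unfold_locales (rule J_absorb)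
qed

section \<open>Algebras over the truncated operad\<close>

lemma restrict_trunc2_sel [simp]:
  "carrier (restrict_trunc2 P A) = carrier A" "zero (restrict_trunc2 P A) = zero A"
  "add (restrict_trunc2 P A) = add A" "smult (restrict_trunc2 P A) = smult A"
  by (simp_all add: restrict_trunc2_def)

context operad
begin

text \<open>The canonical morphism from \<open>P\<close> to \<open>trunc2 P\<close>. The arity is an
  argument because an element does not determine the arity it is regarded in.\<close>

definition trunc2_op :: "nat \<Rightarrow> 'p \<Rightarrow> 'p" where
  "trunc2_op n x = (if n \<le> 2 then x else \<zero>\<^bsub>opc P n\<^esub>)"

lemma mu_restrict_trunc2:
  "mu (restrict_trunc2 P A) as x =
     (if mu_dom P (carrier A) as x then mu A as (trunc2_op (length as) x) else undefined)"
  by (simp add: restrict_trunc2_def mu_mk_alg trunc2_op_def)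

lemma mu_dom_trunc2_op: "mu_dom P C as x \<Longrightarrow> mu_dom (trunc2 P) C as (trunc2_op (length as) x)"
  by (auto simp: mu_dom_def carrier_trunc2 trunc2_op_def)

lemma mu_dom_trunc2D:
  assumes "mu_dom (trunc2 P) C as x"
  shows "mu_dom P C as x" "trunc2_op (length as) x = x"
proof -
  have "1 \<le> length as" using assms by (simp add: mu_dom_def Suc_le_eq)
  then show "mu_dom P C as x" using assms ctD by (auto simp: mu_dom_def)
  show "trunc2_op (length as) x = x"
    using assms by (auto simp: mu_dom_def carrier_trunc2 trunc2_op_def split: if_splits)
qed

text \<open>If the total arity is at most 2, then so are the outer and all inner arities, and
  nothing is truncated; otherwise both sides are zero.\<close>

lemma trunc2_op_comp:
  assumes ne: "ass \<noteq> []" and d: "list_all2 (mu_dom P C) ass xs"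
  shows "comp (trunc2 P) (map length ass) (map2 (\<lambda>as x. trunc2_op (length as) x) ass xs) (trunc2_op (length ass) y)
    = trunc2_op (length (concat ass)) (comp P (map length ass) xs y)"
proof (cases "sum_list (map length ass) \<le> 2")
  case True
  have len: "length ass = length xs" using d by (rule list_all2_lengthD)
  have ne: "as \<noteq> []" if "as \<in> set ass" for as
    using d that by (metis list_all2_conv_all_nth in_set_conv_nth mu_dom_def)
  have l2: "length as \<le> 2" if "as \<in> set ass" for as
    using member_le_sum_list[of "length as" "map length ass"] that True by auto
  \<comment> \<open>Inner argument lists are nonempty, so the outer arity is bounded by the total
    arity.\<close>
  have "sum_list (map (\<lambda>_. 1) ass) \<le> sum_list (map length ass)"
    using ne by (intro sum_list_mono) (simp add: Suc_le_eq)
  then have "length ass \<le> sum_list (map length ass)" by (simp add: sum_list_triv)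
  then have y: "trunc2_op (length ass) y = y" using True by (simp add: trunc2_op_def)
  have "map2 (\<lambda>as x. trunc2_op (length as) x) ass xs = map2 (\<lambda>as x. x) ass xs"
    using l2 by (intro map_cong) (auto simp: trunc2_op_def dest: set_zip_leftD)
  also have "\<dots> = xs" using len by (induction ass xs rule: list_induct2) auto
  finally show ?thesis using True y by (simp add: length_concat trunc2_op_def[of "sum_list (map length ass)"])
qed (simp add: length_concat trunc2_op_def[of "sum_list (map length ass)"])

lemma palgebra_restrict_trunc2:
  assumes "palgebra R (trunc2 P) A"
  shows "palgebra R P (restrict_trunc2 P A)"
proof -
  interpret T: palgebra R "trunc2 P" A by fact
  have m: "module R (restrict_trunc2 P A)" by (rule module_cong[OF T.module_axioms]) simp_all
  have s: "carrier (restrict_trunc2 P A) = (\<lambda>x. x) ` carrier A" by simp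
  show ?thesis
  proof (rule palgebra_transport[OF assms operad_axioms m _ s, where q = trunc2_op])
    show "(\<lambda>x. x) \<in> module_hom R A (restrict_trunc2 P A)" by (simp add: module_hom_def)
    fix n :: nat assume n: "1 \<le> n"
    interpret O: module R "opc P n" by (rule opc_module[OF n])
    show "trunc2_op n \<in> module_hom R (opc P n) (opc (trunc2 P) n)"
      by (rule module_homI) (auto simp: trunc2_op_def carrier_trunc2)
    show "trunc2_op n (act P n t x) = act (trunc2 P) n t (trunc2_op n x)" if "t permutes {..<n}" for t x
      using act_zero[OF n that] by (simp add: trunc2_op_def)
  next
    fix ass xs y assume "ass \<noteq> []" "list_all2 (mu_dom P (carrier A)) ass xs"
    from trunc2_op_comp[OF this]
    show "mu A (concat ass) (trunc2_op (length (concat ass)) (comp P (map length ass) xs y)) = mu A (concat ass)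
        (comp (trunc2 P) (map length ass) (map2 (\<lambda>as. trunc2_op (length as)) ass xs) (trunc2_op (length ass) y))"
      by simp
  qed (simp_all add: mu_restrict_trunc2, simp add: trunc2_op_def)
qed

lemma restrict_trunc2_NIL2:
  assumes "palgebra R (trunc2 P) A" shows "restrict_trunc2 P A \<in> NIL2_obj R P"
proof -
  interpret T: palgebra R "trunc2 P" A by fact
  have "mu (restrict_trunc2 P A) as x = \<zero>\<^bsub>A\<^esub>" if "2 < length as" "mu_dom P (carrier A) as x" for as x
    using that T.mu_zero_op[of as] by (auto simp: mu_restrict_trunc2 trunc2_op_def mu_dom_def)
  then show ?thesis using palgebra_restrict_trunc2[OF assms] by (simp add: NIL2_obj_def)
qed

text \<open>\<open>trunc2_op\<close> fixes the truncated operations, so all operations of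
  \<open>A\<close> can be read off from the restriction. Off their domain the structure maps are
  \<open>undefined\<close> on both sides, which gives equality of the records and not just an
  isomorphism.\<close>

lemma restrict_trunc2_inj:
  assumes "palgebra R (trunc2 P) A" "palgebra R (trunc2 P) B" "restrict_trunc2 P A = restrict_trunc2 P B"
  shows "A = B"
proof -
  interpret A: palgebra R "trunc2 P" A by fact
  interpret B: palgebra R "trunc2 P" B by fact
  have c: "carrier A = carrier B" using arg_cong[OF assms(3), of carrier] by simp
  have "mult A = mult B" "one A = one B"
    using arg_cong[OF assms(3), of mult] arg_cong[OF assms(3), of one]
    by (simp_all add: restrict_trunc2_def mk_alg_def)
  moreover have "mu A as x = mu B as x" for as x
  proof (cases "mu_dom (trunc2 P) (carrier A) as x")
    case True
    note d = mu_dom_trunc2D[OF True]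
    have "mu A as x = mu (restrict_trunc2 P A) as x" using d by (simp add: mu_restrict_trunc2)
    also have "\<dots> = mu B as x" using d c by (simp add: assms(3) mu_restrict_trunc2)
    finally show ?thesis .
  next
    case False then show ?thesis using A.mu_undefined B.mu_undefined c by simp
  qed
  ultimately show ?thesis
    using c arg_cong[OF assms(3), of zero] arg_cong[OF assms(3), of add] arg_cong[OF assms(3), of smult]
    by (intro palg.equality) auto
qed

text \<open>The operations of \<open>N\<close> are kept on the smaller domain. The inclusion of
  \<open>trunc2 P\<close> into \<open>P\<close> does not respect compositions of total arity above
  2, but there both results act by zero on \<open>N\<close>.\<close>

lemma restrict_trunc2_surj:
  assumes "N \<in> NIL2_obj R P"
  shows "\<exists>A. palgebra R (trunc2 P) A \<and> restrict_trunc2 P A = N"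
proof -
  interpret N: palgebra R P N using assms by (simp add: NIL2_obj_def)
  have nil: "mu N as x = \<zero>\<^bsub>N\<^esub>" if "2 < length as" "mu_dom P (carrier N) as x" for as x
    using assms that by (simp add: NIL2_obj_def)
  define A where "A = mk_alg (trunc2 P) N (mu N)"
  have sel: "carrier A = carrier N" "zero A = zero N" "add A = add N" "smult A = smult N"
    by (simp_all add: A_def)
  have m: "module R A" by (rule module_cong[OF N.module_axioms]) (simp_all add: sel)
  have mA: "mu A as x = mu N as x" if "mu_dom (trunc2 P) (carrier N) as x" for as x
    using that by (simp add: A_def mu_mk_alg)
  note dD = mu_dom_trunc2D(1)
  have s: "carrier A = (\<lambda>x. x) ` carrier N" by (simp add: sel)
  interpret O: operad R "trunc2 P" by (rule operad_trunc2)
  have "palgebra R (trunc2 P) A"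
  proof (rule palgebra_transport[OF N.palgebra_axioms O.operad_axioms m _ s, where q = "\<lambda>_ x. x"])
    show "(\<lambda>x. x) \<in> module_hom R N A" by (simp add: module_hom_def sel)
    show "(\<lambda>x. x) \<in> module_hom R (opc (trunc2 P) n) (opc P n)" if "1 \<le> n" for n
      by (rule module_homI) (use ctD[OF that] in simp_all)
  next
    fix ass xs y assume ne: "ass \<noteq> []" and l: "list_all2 (mu_dom (trunc2 P) (carrier N)) ass xs"
      and y: "y \<in> carrier (opc (trunc2 P) (length ass))"
    have e: "map2 (\<lambda>as x. x) ass xs = xs" by (rule map2_snd[OF list_all2_lengthD[OF l]])
    have y': "y \<in> carrier (opc P (length ass))" using ne y by (intro ctD) (auto simp: Suc_le_eq)
    have l': "list_all2 (mu_dom P (carrier N)) ass xs" using l by (rule list_all2_mono) (rule dD)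
    show "mu N (concat ass) (comp (trunc2 P) (map length ass) xs y)
        = mu N (concat ass) (comp P (map length ass) (map2 (\<lambda>as x. x) ass xs) y)"
    \<comment> \<open>Up to total arity 2 the two compositions coincide; above, two-nilpotency of
      \<open>N\<close> makes both sides zero although the operations may differ.\<close>
    proof (cases "length (concat ass) \<le> 2")
      case True then show ?thesis by (simp add: e length_concat)
    next
      case False
      then show ?thesis
        using nil[OF _ mu_dom_concat[OF ne l' y']] nil[OF _ dD[OF O.mu_dom_concat[OF ne l y]]] unfolding e
        by (simp only: not_le)
    qed
  qed (simp_all add: mA, simp add: A_def mu_mk_alg)
  moreover have "restrict_trunc2 P A = N"
  proof (rule palg.equality)
    show "mu (restrict_trunc2 P A) = mu N"
    proof (intro ext)
      fix as x
      show "mu (restrict_trunc2 P A) as x = mu N as x"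
      proof (cases "mu_dom P (carrier N) as x")
        case True
        note q = mu_dom_trunc2_op[OF True]
        have "mu (restrict_trunc2 P A) as x = mu N as (trunc2_op (length as) x)"
          using True mA[OF q] by (simp add: mu_restrict_trunc2 sel)
        also have "\<dots> = mu N as x"
          using nil[OF _ True] nil[OF _ dD[OF q]] by (cases "length as \<le> 2") (auto simp: trunc2_op_def)
        finally show ?thesis .
      next
        case False then show ?thesis using N.mu_undefined by (simp add: mu_restrict_trunc2 sel)
      qed
    qed
  qed (simp_all add: sel, simp_all add: A_def restrict_trunc2_def mk_alg_def)
  ultimately show ?thesis by blast
qed

lemma bij_restrict_trunc2:
  "bij_betw (restrict_trunc2 P) {A. palgebra R (trunc2 P) A} (NIL2_obj R P)"
  unfolding bij_betw_def inj_on_def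
  using restrict_trunc2_inj restrict_trunc2_NIL2 restrict_trunc2_surj by blast

text \<open>The two conditions on \<open>f\<close> concern the same operations:
  \<open>trunc2_op\<close> maps operations of \<open>P\<close> to truncated ones and fixes
  those.\<close>

lemma alg_hom_restrict_trunc2:
  assumes "palgebra R (trunc2 P) A" "palgebra R (trunc2 P) B"
  shows "alg_hom R (trunc2 P) A B = alg_hom R P (restrict_trunc2 P A) (restrict_trunc2 P B)"
proof -
  have "(\<forall>as x. mu_dom (trunc2 P) (carrier A) as x \<longrightarrow> f (mu A as x) = mu B (map f as) x) \<longleftrightarrow>
    (\<forall>as x. mu_dom P (carrier A) as x \<longrightarrow>
       f (mu (restrict_trunc2 P A) as x) = mu (restrict_trunc2 P B) (map f as) x)" (is "?L \<longleftrightarrow> ?R")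
    if f: "f \<in> carrier A \<rightarrow> carrier B" for f
  proof (intro iffI allI impI)
    fix as x assume ?L "mu_dom P (carrier A) as x"
    then show "f (mu (restrict_trunc2 P A) as x) = mu (restrict_trunc2 P B) (map f as) x"
      using mu_dom_trunc2_op[of "carrier A" as x] mu_dom_map[OF f, of P as x] by (simp add: mu_restrict_trunc2)
  next
    fix as x assume R: ?R and d: "mu_dom (trunc2 P) (carrier A) as x"
    note d' = mu_dom_trunc2D[OF d]
    have "f (mu (restrict_trunc2 P A) as x) = mu (restrict_trunc2 P B) (map f as) x" using R d'(1) by blast
    then show "f (mu A as x) = mu B (map f as) x"
      using d' mu_dom_map[OF f d'(1)] by (simp add: mu_restrict_trunc2)
  qed
  then show ?thesis by (auto simp: alg_hom_def)
qed

end

section \<open>The ternary commutator\<close>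

lemma (in palgebra) ops_ge_antimono: "m \<le> n \<Longrightarrow> ops_ge n \<subseteq> ops_ge m"
  by (rule subsetI) (elim CollectE exE conjE, intro CollectI exI conjI, assumption, rule order_trans, assumption+)

text \<open>The span is closed under all operations, so it exhausts an algebra generated by
  \<open>G\<close>: as arities add up, a binary operation can only leave the first two kinds of
  elements by reaching arity 3. Used for the ternary coproduct and for coproducts of two-nilpotent
  algebras.\<close>

lemma (in palgebra) span_of_generators:
  assumes G: "G \<subseteq> carrier A" "\<And>g p. g \<in> G \<Longrightarrow> p \<in> carrier (opc P 1) \<Longrightarrow> mu A [g] p \<in> G"
    and gen: "\<And>S. submodule S R A \<Longrightarrow> G \<subseteq> S \<Longrightarrow> (\<And>as x. mu_dom P S as x \<Longrightarrow> mu A as x \<in> S) \<Longrightarrow> carrier A \<subseteq> S"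
  shows "carrier A \<subseteq> mspan R A (G \<union> {mu A [g, g'] x | g g' x. g \<in> G \<and> g' \<in> G \<and> x \<in> carrier (opc P 2)} \<union> ops_ge 3)"
proof -
  let ?G2 = "{mu A [g, g'] x | g g' x. g \<in> G \<and> g' \<in> G \<and> x \<in> carrier (opc P 2)}"
  let ?U = "G \<union> ?G2 \<union> ops_ge 3"
  let ?S = "mspan R A ?U"
  have G2: "?G2 \<subseteq> ops_ge 2"
  proof
    fix u assume "u \<in> ?G2"
    then obtain g g' x where u: "u = mu A [g, g'] x" "g \<in> G" "g' \<in> G" "x \<in> carrier (opc P 2)" by blast
    then have "mu_dom P (carrier A) [g, g'] x" unfolding mu_dom_simps using G(1) by blast
    then show "u \<in> ops_ge 2" using u(1) by force
  qed
  have ops32: "ops_ge 3 \<subseteq> ops_ge 2" by (rule ops_ge_antimono) simp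
  have U: "?U \<subseteq> carrier A" using G(1) G2 ops_ge_closed by blast
  have S: "submodule ?S R A" by (rule submodule_mspan[OF module_axioms U])
  have Sc: "?S \<subseteq> carrier A" by (rule mspan_subset_carrier[OF module_axioms U])
  have US: "u \<in> ?U \<Longrightarrow> u \<in> ?S" for u by (rule subsetD[OF mspan_superset])
  have ge3: "u \<in> ?S" if "u \<in> ops_ge 3" for u using that by (intro US) blast
  \<comment> \<open>Unary operations preserve each of the three kinds of spanning elements:
    \<open>G\<close> by hypothesis, binary operations by composition in the operad, and operations
    of higher arity by absorption.\<close>
  have one: "mu A [s] p \<in> ?S" if "s \<in> ?S" and p: "p \<in> carrier (opc P 1)" for s p
  proof (rule module_hom_mspan[OF module_axioms module_axioms mu1_hom[OF p] S U _ \<open>s \<in> ?S\<close>])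
    fix u assume "u \<in> ?U"
    then consider "u \<in> G" | "u \<in> ?G2" | "u \<in> ops_ge 3" by blast
    then show "mu A [u] p \<in> ?S"
    proof cases
      case 1 then show ?thesis using G(2) p by (intro US) blast
    next
      case 2
      then obtain g g' x where u: "u = mu A [g, g'] x" "g \<in> G" "g' \<in> G" "x \<in> carrier (opc P 2)" by blast
      then have "mu A [u] p = mu A [g, g'] (comp P [2] [x] p)" using mu1_mu2 p G(1) by blast
      then show ?thesis using u comp2_closed[OF u(4) p] by (intro US) blast
    next
      case 3
      then have "mu_dom P (carrier A) ([] @ u # []) p"
        unfolding append_Nil mu_dom_simps using p ops_ge_closed[of 3] by blast
      from ops_ge_absorb[OF \<open>u \<in> ops_ge 3\<close> this] show ?thesis
        by (intro ge3) simp
    qed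
  qed
  \<comment> \<open>Binary operations are treated one argument at a time, here with a generator on
    the left. An operation of arity at least 2 on the right brings the arity to at least 3.\<close>
  have right: "mu A [g, s] x \<in> ?S" if g: "g \<in> G" and "s \<in> ?S" and x: "x \<in> carrier (opc P 2)" for g s x
  proof -
    have gc: "g \<in> carrier A" using g G(1) by blast
    have absorb: "mu A [g, u] x \<in> ?S" if "u \<in> ops_ge 2" for u
    proof -
      have "mu_dom P (carrier A) ([g] @ u # []) x"
        unfolding append.simps mu_dom_simps using x gc that ops_ge_closed[of 2] by blast
      from ops_ge_absorb[OF that this] show ?thesis by (intro ge3) simp
    qed
    show ?thesis
    proof (rule module_hom_mspan[OF module_axioms module_axioms mu2_hom_r[OF gc x] S U _ \<open>s \<in> ?S\<close>])
      fix u assume "u \<in> ?U"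
      then consider "u \<in> G" | "u \<in> ops_ge 2" using G2 ops32 by blast
      then show "mu A [g, u] x \<in> ?S"
      proof cases
        case 1 then show ?thesis using g x by (intro US) blast
      qed (rule absorb)
    qed
  qed
  \<comment> \<open>Now the left argument runs through the span as well: a generator there is the
    previous case, and anything else brings the arity to at least 3.\<close>
  have two: "mu A [s, s'] x \<in> ?S" if "s \<in> ?S" and s': "s' \<in> ?S" and x: "x \<in> carrier (opc P 2)" for s s' x
  proof -
    have c: "s' \<in> carrier A" using s' Sc by blast
    have absorb: "mu A [u, s'] x \<in> ?S" if "u \<in> ops_ge 2" for u
    proof -
      have "mu_dom P (carrier A) ([] @ u # [s']) x"
        unfolding append.simps mu_dom_simps using x c that ops_ge_closed[of 2] by blast
      from ops_ge_absorb[OF that this] show ?thesis by (intro ge3) simp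
    qed
    show ?thesis
    proof (rule module_hom_mspan[OF module_axioms module_axioms mu2_hom_l[OF c x] S U _ \<open>s \<in> ?S\<close>])
      fix u assume "u \<in> ?U"
      then consider "u \<in> G" | "u \<in> ops_ge 2" using G2 ops32 by blast
      then show "mu A [u, s'] x \<in> ?S"
      proof cases
        case 1 then show ?thesis using s' x by (rule right)
      qed (rule absorb)
    qed
  qed
  have "mu A as x \<in> ?S" if d: "mu_dom P ?S as x" for as x
  proof -
    have dA: "mu_dom P (carrier A) as x" using d Sc unfolding mu_dom_def by blast
    consider a where "as = [a]" | a b where "as = [a, b]" | "3 \<le> length as"
    proof (cases as)
      case Nil then show ?thesis using d by (simp add: mu_dom_def)
    next
      case (Cons a bs)
      show ?thesis
      proof (cases bs)
        case Nil then show ?thesis using Cons that(1) by blast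
      next
        case (Cons b cs)
        show ?thesis
          using \<open>as = a # bs\<close> Cons that(2)[of a b] that(3) by (cases cs) auto
      qed
    qed
    then show ?thesis
    proof cases
      case 1 then show ?thesis using d by (auto simp only: mu_dom_simps intro: one)
    next
      case 2 then show ?thesis using d by (auto simp only: mu_dom_simps intro: two)
    next
      case 3 then show ?thesis using dA by (intro US) blast
    qed
  qed
  then show ?thesis by (intro gen[OF S]) (rule subsetI, rule US, blast)
qed

text \<open>Restated outside of the locale, since coproducts are iterated below and used with
  several pairs of summands at once.\<close>

lemma
  assumes "palgebra R P A" "palgebra R P B"
  shows palgebra_coprod: "palgebra R P (coprod R P A B)"
    and inl_alg_hom: "inl R P A B \<in> alg_hom R P A (coprod R P A B)"
    and inr_alg_hom: "inr R P A B \<in> alg_hom R P B (coprod R P A B)"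
proof -
  interpret two_palgebras R P A B by (intro two_palgebras.intro assms)
  show "palgebra R P (coprod R P A B)" by (rule C_palgebra)
  show "inl R P A B \<in> alg_hom R P A (coprod R P A B)" by (rule inl_hom)
  show "inr R P A B \<in> alg_hom R P B (coprod R P A B)" by (rule inr_hom)
qed

lemma
  assumes "palgebra R P A" "palgebra R P B" "palgebra R P D" "f \<in> alg_hom R P A D" "g \<in> alg_hom R P B D"
  shows copair_alg_hom: "copair D f g \<in> alg_hom R P (coprod R P A B) D"
    and copair_of_inl: "a \<in> carrier A \<Longrightarrow> copair D f g (inl R P A B a) = f a"
    and copair_of_inr: "b \<in> carrier B \<Longrightarrow> copair D f g (inr R P A B b) = g b"
proof -
  interpret cop_target R P A B D f g
    by (intro cop_target.intro two_palgebras.intro cop_target_axioms.intro assms)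
  show "copair D f g \<in> alg_hom R P (coprod R P A B) D" by (rule copair_hom)
  show "a \<in> carrier A \<Longrightarrow> copair D f g (inl R P A B a) = f a" by (rule copair_inl)
  show "b \<in> carrier B \<Longrightarrow> copair D f g (inr R P A B b) = g b" by (rule copair_inr)
qed

text \<open>By induction on terms: every class is obtained from the two inclusions by module
  operations and operations of the operad.\<close>

lemma coprod_generated:
  assumes "palgebra R P A" "palgebra R P B" and S: "submodule S R (coprod R P A B)"
    and l: "\<And>a. a \<in> carrier A \<Longrightarrow> inl R P A B a \<in> S" and r: "\<And>b. b \<in> carrier B \<Longrightarrow> inr R P A B b \<in> S"
    and m: "\<And>ws x. mu_dom P S ws x \<Longrightarrow> mu (coprod R P A B) ws x \<in> S"
  shows "carrier (coprod R P A B) \<subseteq> S"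
proof -
  interpret two_palgebras R P A B by (intro two_palgebras.intro assms)
  interpret M: module R C by (rule C_module)
  note SE = M.submoduleE[OF S]
  have "cl t \<in> S" if "wf t" for t
    using that
  proof (induction t)
    case (Gen z) then show ?case using l r by (auto simp: inl_def inr_def)
  next
    case Zero show ?case using zero_in_submodule[OF S] by (simp add: C_zero)
  next
    case (Plus t u)
    then have "cl t \<oplus>\<^bsub>C\<^esub> cl u \<in> S" using SE(5) by simp
    then show ?case using Plus.prems by (simp add: C_add)
  next
    case (Smul r t)
    then have "r \<odot>\<^bsub>C\<^esub> cl t \<in> S" using SE(4) by simp
    then show ?case using Smul.prems by (simp add: C_smult)
  next
    case (Op ts x)
    have "mu_dom P S (map cl ts) x" using Op by (auto simp: mu_dom_def)
    then show ?case using m C_mu[OF Op.prems] by metis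
  qed
  then show ?thesis by (auto simp: C_carrier)
qed

text \<open>Operads are constant-free, so every operation has an argument; at zero arguments it
  vanishes by multilinearity.\<close>

lemma zmap_alg_hom:
  assumes "palgebra R P A" "palgebra R P B"
  shows "zmap B \<in> alg_hom R P A B"
proof -
  interpret A: palgebra R P A by fact
  interpret B: palgebra R P B by fact
  show ?thesis
  proof (rule alg_homI[OF module_hom_const_zero[OF B.module_axioms]])
    fix as x assume d: "mu_dom P (carrier A) as x"
    then have "mu_dom P (carrier B) (map (zmap B) as) x" by (auto simp: mu_dom_def)
    moreover have "\<zero>\<^bsub>B\<^esub> \<in> set (map (zmap B) as)" using d by (cases as) (auto simp: mu_dom_def)
    ultimately show "\<zero>\<^bsub>B\<^esub> = mu B (map (zmap B) as) x" using B.mu_zero_in by simp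
  qed
qed

lemma alg_hom_zero:
  assumes "palgebra R P A" "palgebra R P B" "f \<in> alg_hom R P A B"
  shows "f \<zero>\<^bsub>A\<^esub> = \<zero>\<^bsub>B\<^esub>"
  using assms by (intro module_hom_zero[of R A B f] alg_hom_module_hom) (auto simp: palgebra_def)

section \<open>The ternary coproduct and its projections onto pairs of summands\<close>

locale triple_coprod = palgebra R P A for R :: "'r ring" and P :: "('r, 'p) operad" and A :: "('r, 'a, 'p) palg"
begin

abbreviation "XX \<equiv> coprod R P A A"
abbreviation "CC \<equiv> coprod R P XX A"

definition "i1 a = inl R P XX A (inl R P A A a)"
definition "i2 a = inl R P XX A (inr R P A A a)"
definition "i3 a = inr R P XX A a"
definition "c1 = copair XX id (zmap XX)"
definition "c2 = copair XX (copair XX (inl R P A A) (zmap XX)) (inr R P A A)"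
definition "c3 = copair XX (copair XX (zmap XX) (inl R P A A)) (inr R P A A)"
text \<open>\<open>e1\<close>, \<open>e2\<close>, \<open>e3\<close> are the components
  \<open>c1\<close>, \<open>c2\<close>, \<open>c3\<close> of the comparison map, each followed by
  the inclusion of the two surviving summands; they kill summand 3, 2 and 1 respectively. An element
  killed by every \<open>c\<close> is killed by every \<open>e\<close>.\<close>

definition "e1 w = inl R P XX A (c1 w)"
definition "e2 w = copair CC i1 i3 (c2 w)"
definition "e3 w = copair CC i2 i3 (c3 w)"
definition "fold3 = copair A (copair A id id) id"

lemmas pA = palgebra_axioms
lemma pXX: "palgebra R P XX" by (rule palgebra_coprod[OF pA pA])
lemma pCC: "palgebra R P CC" by (rule palgebra_coprod[OF pXX pA])

sublocale XX: palgebra R P XX by (rule pXX)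
sublocale CC: palgebra R P CC by (rule pCC)

lemmas lA = inl_alg_hom[OF pA pA] and rA = inr_alg_hom[OF pA pA]
  and lXX = inl_alg_hom[OF pXX pA] and rXX = inr_alg_hom[OF pXX pA]
  and zA = zmap_alg_hom[OF pA pXX]

lemma i_hom: "i1 \<in> alg_hom R P A CC" "i2 \<in> alg_hom R P A CC" "i3 \<in> alg_hom R P A CC"
  using alg_hom_compose[OF lA lXX] alg_hom_compose[OF rA lXX] rXX
  by (simp_all add: i1_def[abs_def] i2_def[abs_def] i3_def[abs_def])

lemmas c2' = pA pA pXX lA zA and c3' = pA pA pXX zA lA

lemma c_hom: "c1 \<in> alg_hom R P CC XX" "c2 \<in> alg_hom R P CC XX" "c3 \<in> alg_hom R P CC XX"
  unfolding c1_def c2_def c3_def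
  by (rule copair_alg_hom[OF pXX pA pXX alg_hom_id(2) zA])
    (rule copair_alg_hom[OF pXX pA pXX copair_alg_hom[OF c2'] rA]
      copair_alg_hom[OF pXX pA pXX copair_alg_hom[OF c3'] rA])+

lemma c_i:
  assumes a: "a \<in> carrier A"
  shows "c1 (i1 a) = inl R P A A a" "c1 (i2 a) = inr R P A A a" "c1 (i3 a) = \<zero>\<^bsub>XX\<^esub>"
    "c2 (i1 a) = inl R P A A a" "c2 (i2 a) = \<zero>\<^bsub>XX\<^esub>" "c2 (i3 a) = inr R P A A a"
    "c3 (i1 a) = \<zero>\<^bsub>XX\<^esub>" "c3 (i2 a) = inl R P A A a" "c3 (i3 a) = inr R P A A a"
  unfolding c1_def c2_def c3_def i1_def i2_def i3_def
  using alg_homD(1)[OF lA a] alg_homD(1)[OF rA a] a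
  by (simp_all add: copair_of_inl[OF pXX pA pXX alg_hom_id(2) zA] copair_of_inr[OF pXX pA pXX alg_hom_id(2) zA]
      copair_of_inl[OF pXX pA pXX copair_alg_hom[OF c2'] rA] copair_of_inr[OF pXX pA pXX copair_alg_hom[OF c2'] rA]
      copair_of_inl[OF pXX pA pXX copair_alg_hom[OF c3'] rA] copair_of_inr[OF pXX pA pXX copair_alg_hom[OF c3'] rA]
      copair_of_inl[OF c2'] copair_of_inr[OF c2'] copair_of_inl[OF c3'] copair_of_inr[OF c3'])

lemma e_hom: "e1 \<in> alg_hom R P CC CC" "e2 \<in> alg_hom R P CC CC" "e3 \<in> alg_hom R P CC CC"
  using alg_hom_compose[OF c_hom(1) lXX] alg_hom_compose[OF c_hom(2) copair_alg_hom[OF pA pA pCC i_hom(1,3)]]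
    alg_hom_compose[OF c_hom(3) copair_alg_hom[OF pA pA pCC i_hom(2,3)]]
  by (simp_all add: e1_def[abs_def] e2_def[abs_def] e3_def[abs_def])

lemma e_i:
  assumes a: "a \<in> carrier A"
  shows "e1 (i1 a) = i1 a" "e1 (i2 a) = i2 a" "e1 (i3 a) = \<zero>\<^bsub>CC\<^esub>"
    "e2 (i1 a) = i1 a" "e2 (i2 a) = \<zero>\<^bsub>CC\<^esub>" "e2 (i3 a) = i3 a"
    "e3 (i1 a) = \<zero>\<^bsub>CC\<^esub>" "e3 (i2 a) = i2 a" "e3 (i3 a) = i3 a"
  using a c_i[OF a] alg_hom_zero[OF pXX pCC lXX]
    alg_hom_zero[OF pXX pCC copair_alg_hom[OF pA pA pCC i_hom(1,3)]]
    alg_hom_zero[OF pXX pCC copair_alg_hom[OF pA pA pCC i_hom(2,3)]]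
  by (simp_all add: e1_def e2_def e3_def copair_of_inl[OF pA pA pCC i_hom(1,3)] copair_of_inr[OF pA pA pCC i_hom(1,3)]
      copair_of_inl[OF pA pA pCC i_hom(2,3)] copair_of_inr[OF pA pA pCC i_hom(2,3)])
   (simp_all add: i1_def i2_def)

lemma fold3_hom: "fold3 \<in> alg_hom R P CC A"
  unfolding fold3_def
  by (rule copair_alg_hom[OF pXX pA pA copair_alg_hom[OF pA pA pA alg_hom_id(2) alg_hom_id(2)] alg_hom_id(2)])

lemma fold3_i:
  assumes a: "a \<in> carrier A" shows "fold3 (i1 a) = a" "fold3 (i2 a) = a" "fold3 (i3 a) = a"
proof -
  note k = alg_hom_id(2)[of R P A]
  note f = copair_alg_hom[OF pA pA pA k k]
  show "fold3 (i1 a) = a" "fold3 (i2 a) = a" "fold3 (i3 a) = a"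
    unfolding fold3_def i1_def i2_def i3_def
    using alg_homD(1)[OF lA a] alg_homD(1)[OF rA a] a
    by (simp_all add: copair_of_inl[OF pXX pA pA f k] copair_of_inr[OF pXX pA pA f k]
      copair_of_inl[OF pA pA pA k k] copair_of_inr[OF pA pA pA k k])
qed

lemma cosmash3_eq:
  "cosmash3 R P A A A = {w \<in> carrier CC. c1 w = \<zero>\<^bsub>XX\<^esub> \<and> c2 w = \<zero>\<^bsub>XX\<^esub> \<and> c3 w = \<zero>\<^bsub>XX\<^esub>}"
  by (auto simp: cosmash3_def Let_def a_kernel_def' prod_alg_def c1_def c2_def c3_def)

lemma higgins3_eq: "higgins3 R P A = fold3 ` cosmash3 R P A A A"
  by (simp add: higgins3_def fold3_def)

text \<open>The union of the three summands and not its span: on each single element of it an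
  \<open>e\<close> is either the identity or zero.\<close>

definition "II = i1 ` carrier A \<union> i2 ` carrier A \<union> i3 ` carrier A"

lemma II_closed: "g \<in> II \<Longrightarrow> g \<in> carrier CC"
  using alg_homD(1)[OF i_hom(1)] alg_homD(1)[OF i_hom(2)] alg_homD(1)[OF i_hom(3)] by (auto simp: II_def)

lemma II_mu1:
  assumes "g \<in> II" and p: "p \<in> carrier (opc P 1)"
  shows "mu CC [g] p \<in> II"
proof -
  have "mu CC [i a] p \<in> i ` carrier A" if "i \<in> alg_hom R P A CC" "a \<in> carrier A" for i a
  proof -
    have "i (mu A [a] p) = mu CC (map i [a]) p"
      using that p by (intro alg_homD(4)) (simp_all only: mu_dom_simps simp_thms)
    then show ?thesis using mu1_closed[OF that(2) p] by (metis image_eqI list.simps(8,9))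
  qed
  then show ?thesis using assms(1) i_hom unfolding II_def by blast
qed

lemma II_e:
  assumes "g \<in> II"
  shows "e1 g \<in> {g, \<zero>\<^bsub>CC\<^esub>}" "e2 g \<in> {g, \<zero>\<^bsub>CC\<^esub>}" "e3 g \<in> {g, \<zero>\<^bsub>CC\<^esub>}"
  using assms e_i unfolding II_def by (elim UnE imageE; simp)+

text \<open>Two generators lie in at most two summands, and the \<open>e\<close> that kills a
  remaining summand fixes both.\<close>

lemma II_e2:
  assumes "g \<in> II" "g' \<in> II"
  shows "e1 g = g \<and> e1 g' = g' \<or> e2 g = g \<and> e2 g' = g' \<or> e3 g = g \<and> e3 g' = g'"
  using assms e_i unfolding II_def by (elim UnE imageE; simp)

lemma CC_span:
  "carrier CC \<subseteq> mspan R CC (II \<union> {mu CC [g, g'] x | g g' x. g \<in> II \<and> g' \<in> II \<and> x \<in> carrier (opc P 2)} \<union> CC.ops_ge 3)"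
proof (rule CC.span_of_generators[OF _ II_mu1])
  show "II \<subseteq> carrier CC" using II_closed by blast
next
  fix S assume S: "submodule S R CC" "II \<subseteq> S" and m: "\<And>as x. mu_dom P S as x \<Longrightarrow> mu CC as x \<in> S"
  \<comment> \<open>The left summand of \<open>CC\<close> is itself a coproduct: its elements that
    land in \<open>S\<close> form a subalgebra containing both copies of \<open>A\<close>, hence are
    all of it.\<close>
  let ?T = "{w \<in> carrier XX. inl R P XX A w \<in> S}"
  have T: "submodule ?T R XX"
    by (rule submodule_vimage[OF XX.module_axioms CC.module_axioms alg_hom_module_hom[OF lXX] S(1)])
  have "carrier XX \<subseteq> ?T"
  proof (rule coprod_generated[OF pA pA T])
    fix a assume a: "a \<in> carrier A"
    show "inl R P A A a \<in> ?T" using S(2) a alg_homD(1)[OF lA a] by (auto simp: II_def i1_def)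
    show "inr R P A A a \<in> ?T" using S(2) a alg_homD(1)[OF rA a] by (auto simp: II_def i2_def)
  next
    fix ws x assume d: "mu_dom P ?T ws x"
    then have d1: "mu_dom P (carrier XX) ws x" by (auto simp: mu_dom_def)
    have "mu_dom P S (map (inl R P XX A) ws) x" using d by (auto simp: mu_dom_def)
    then have "inl R P XX A (mu XX ws x) \<in> S" using m alg_homD(4)[OF lXX d1] by simp
    then show "mu XX ws x \<in> ?T" using XX.mu_closed[OF d1] by simp
  qed
  then show "carrier CC \<subseteq> S"
    using S(2) by (intro coprod_generated[OF pXX pA S(1) _ _ m]) (auto simp: II_def i3_def)
qed

definition "dd e w = w \<ominus>\<^bsub>CC\<^esub> e w"

lemma dd_hom: "e \<in> alg_hom R P CC CC \<Longrightarrow> dd e \<in> module_hom R CC CC"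
  unfolding dd_def[abs_def]
  by (rule module_hom_diff[OF CC.module_axioms CC.module_axioms module_hom_id alg_hom_module_hom])

lemma dd_vals:
  assumes "w \<in> carrier CC"
  shows "e w = w \<Longrightarrow> dd e w = \<zero>\<^bsub>CC\<^esub>" "e w = \<zero>\<^bsub>CC\<^esub> \<Longrightarrow> dd e w = w"
proof -
  have "\<ominus>\<^bsub>CC\<^esub> \<zero>\<^bsub>CC\<^esub> = \<zero>\<^bsub>CC\<^esub>" using CC.minus_equality[of "\<zero>\<^bsub>CC\<^esub>" "\<zero>\<^bsub>CC\<^esub>"] by simp
  then show "e w = w \<Longrightarrow> dd e w = \<zero>\<^bsub>CC\<^esub>" "e w = \<zero>\<^bsub>CC\<^esub> \<Longrightarrow> dd e w = w"
    using assms by (simp_all add: dd_def a_minus_def CC.r_neg)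
qed

definition "DD w = dd e1 (dd e2 (dd e3 w))"

lemma DD_hom: "DD \<in> module_hom R CC CC"
  unfolding DD_def[abs_def]
  by (rule module_hom_compose[OF module_hom_compose[OF dd_hom[OF e_hom(3)] dd_hom[OF e_hom(2)]] dd_hom[OF e_hom(1)]])

text \<open>Each \<open>e\<close> fixes or kills \<open>w\<close>, so each factor 1 - e kills or
  fixes it; the factors that fix \<open>w\<close> pass it on until one of them kills it.\<close>

lemma DD_zero:
  assumes w: "w \<in> carrier CC" and e: "e1 w \<in> {w, \<zero>\<^bsub>CC\<^esub>}" "e2 w \<in> {w, \<zero>\<^bsub>CC\<^esub>}" "e3 w \<in> {w, \<zero>\<^bsub>CC\<^esub>}"
    and f: "e1 w = w \<or> e2 w = w \<or> e3 w = w"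
  shows "DD w = \<zero>\<^bsub>CC\<^esub>"
proof -
  have z: "dd e1 \<zero>\<^bsub>CC\<^esub> = \<zero>\<^bsub>CC\<^esub>" "dd e2 \<zero>\<^bsub>CC\<^esub> = \<zero>\<^bsub>CC\<^esub>"
    by (rule module_hom_zero[OF CC.module_axioms CC.module_axioms dd_hom], rule e_hom)+
  consider "e3 w = w" | "e3 w = \<zero>\<^bsub>CC\<^esub>" "e2 w = w" | "e3 w = \<zero>\<^bsub>CC\<^esub>" "e2 w = \<zero>\<^bsub>CC\<^esub>" "e1 w = w"
    using e f by blast
  then show ?thesis
    unfolding DD_def by cases (simp_all only: dd_vals[OF w] z)
qed

text \<open>Endomorphisms preserve \<open>J R P 3 CC\<close>, and since this is a submodule, so does
  every 1 - e.\<close>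

lemma DD_J:
  assumes w: "w \<in> J R P 3 CC" shows "DD w \<in> J R P 3 CC"
proof -
  have d: "dd e w \<in> J R P 3 CC" if "e \<in> alg_hom R P CC CC" "w \<in> J R P 3 CC" for e w
    unfolding dd_def a_minus_def
    by (intro CC.submoduleE(3,5)[OF CC.submodule_J] that alg_hom_J[OF pCC pCC that])
  show ?thesis unfolding DD_def by (intro d e_hom w)
qed

lemma DD_in_J:
  assumes "w \<in> carrier CC" shows "DD w \<in> J R P 3 CC"
proof (rule module_hom_mspan[OF CC.module_axioms CC.module_axioms DD_hom CC.submodule_J _ _ subsetD[OF CC_span assms]])
  let ?G2 = "{mu CC [g, g'] x | g g' x. g \<in> II \<and> g' \<in> II \<and> x \<in> carrier (opc P 2)}"
  have G2: "mu CC [g, g'] x \<in> carrier CC" if "g \<in> II" "g' \<in> II" "x \<in> carrier (opc P 2)" for g g' x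
    using that II_closed by (intro CC.mu2_closed)
  then show "II \<union> ?G2 \<union> CC.ops_ge 3 \<subseteq> carrier CC" using II_closed CC.ops_ge_closed by blast
  have z: "\<zero>\<^bsub>CC\<^esub> \<in> J R P 3 CC" by (rule zero_in_submodule[OF CC.submodule_J])
  fix u assume "u \<in> II \<union> ?G2 \<union> CC.ops_ge 3"
  then consider "u \<in> II" | "u \<in> ?G2" | "u \<in> CC.ops_ge 3" by blast
  then show "DD u \<in> J R P 3 CC"
  proof cases
    case 1
    then have "DD u = \<zero>\<^bsub>CC\<^esub>" using II_closed II_e[OF 1] II_e2[OF 1 1] by (intro DD_zero) blast+
    then show ?thesis using z by simp
  next
    case 2
    then obtain g g' x where u: "u = mu CC [g, g'] x" and g: "g \<in> II" "g' \<in> II" and x: "x \<in> carrier (opc P 2)" by blast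
    have zz: "mu CC [a, b] x = \<zero>\<^bsub>CC\<^esub>" if "a \<in> carrier CC" "b \<in> carrier CC" "a = \<zero>\<^bsub>CC\<^esub> \<or> b = \<zero>\<^bsub>CC\<^esub>" for a b
      using that x by (intro CC.mu_zero_in) (auto simp: mu_dom_simps)
    have e: "e u = mu CC [e g, e g'] x" if "e \<in> alg_hom R P CC CC" for e
      using alg_homD(4)[OF that, of "[g, g']" x] II_closed g x by (simp add: u mu_dom_simps)
    \<comment> \<open>If \<open>e\<close> kills one of the two arguments, it kills the binary
      operation by multilinearity; otherwise it fixes both arguments and hence
      \<open>u\<close>.\<close>
    have ed: "e u \<in> {u, \<zero>\<^bsub>CC\<^esub>}" if "e \<in> alg_hom R P CC CC" "e g \<in> {g, \<zero>\<^bsub>CC\<^esub>}" "e g' \<in> {g', \<zero>\<^bsub>CC\<^esub>}" for e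
      using that e[OF that(1)] zz[of "e g" "e g'"] II_closed g CC.zero_closed unfolding u by auto
    have "e1 u = u \<or> e2 u = u \<or> e3 u = u"
      using II_e2[OF g] e[OF e_hom(1)] e[OF e_hom(2)] e[OF e_hom(3)] unfolding u by auto
    then have "DD u = \<zero>\<^bsub>CC\<^esub>"
      using G2[OF g x] unfolding u[symmetric]
      by (intro DD_zero ed e_hom II_e g)
    then show ?thesis using z by simp
  next
    case 3
    then have "u \<in> J R P 3 CC" by (auto intro: CC.J_gen)
    then show ?thesis by (rule DD_J)
  qed
qed

lemma higgins3_subset_J: "higgins3 R P A \<subseteq> J R P 3 A"
proof
  fix a assume "a \<in> higgins3 R P A"
  then obtain w where w: "a = fold3 w" "w \<in> carrier CC" and c: "c1 w = \<zero>\<^bsub>XX\<^esub>" "c2 w = \<zero>\<^bsub>XX\<^esub>" "c3 w = \<zero>\<^bsub>XX\<^esub>"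
    by (auto simp: higgins3_eq cosmash3_eq)
  have "e1 w = \<zero>\<^bsub>CC\<^esub>" "e2 w = \<zero>\<^bsub>CC\<^esub>" "e3 w = \<zero>\<^bsub>CC\<^esub>"
    using c alg_hom_zero[OF pXX pCC lXX]
      alg_hom_zero[OF pXX pCC copair_alg_hom[OF pA pA pCC i_hom(1,3)]]
      alg_hom_zero[OF pXX pCC copair_alg_hom[OF pA pA pCC i_hom(2,3)]]
    by (simp_all add: e1_def e2_def e3_def)
  then have "DD w = w" using dd_vals(2)[OF w(2)] by (simp add: DD_def)
  then have "w \<in> J R P 3 CC" using DD_in_J[OF w(2)] by simp
  then show "a \<in> J R P 3 A" unfolding w(1) by (rule alg_hom_J[OF pCC pA fold3_hom])
qed

text \<open>A linear image of a kernel. Needed because \<open>J R P 3 A\<close> is a span, while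
  single operations only show that its generators lie in the commutator.\<close>

lemma submodule_higgins3: "submodule (higgins3 R P A) R A"
proof -
  have "submodule (cosmash3 R P A A A) R CC"
  proof (rule CC.submoduleI)
    fix w assume "w \<in> cosmash3 R P A A A"
    then show "\<ominus>\<^bsub>CC\<^esub> w \<in> cosmash3 R P A A A"
      using c_hom[THEN alg_hom_module_hom, THEN module_hom_a_inv[OF CC.module_axioms XX.module_axioms], of w]
        XX.minus_equality[of "\<zero>\<^bsub>XX\<^esub>" "\<zero>\<^bsub>XX\<^esub>"]
      by (auto simp: cosmash3_eq)
  qed (auto simp: cosmash3_eq alg_hom_zero[OF pCC pXX] c_hom alg_homD(2)[OF c_hom(1)] alg_homD(2)[OF c_hom(2)]
      alg_homD(2)[OF c_hom(3)] alg_homD(3)[OF c_hom(1)] alg_homD(3)[OF c_hom(2)] alg_homD(3)[OF c_hom(3)])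
  then show ?thesis
    unfolding higgins3_eq
    by (rule submodule_image[OF CC.module_axioms module_axioms alg_hom_module_hom[OF fold3_hom]])
qed

lemma J_subset_higgins3: "J R P 3 A \<subseteq> higgins3 R P A"
  unfolding J_def
proof (rule mspan_minimal[OF submodule_higgins3], rule subsetI)
  fix u assume "u \<in> ops_ge 3"
  then obtain as x where u: "u = mu A as x" "3 \<le> length as" and d: "mu_dom P (carrier A) as x" by auto
  then obtain a b c cs where as: "as = a # b # c # cs"
    by (metis Suc_le_length_iff numeral_3_eq_3)
  \<comment> \<open>What counts is that all three summands occur: every \<open>c\<close> then kills
    one argument. The remaining arguments are put into the third summand, and folding restores the
    original list.\<close>
  let ?ws = "i1 a # i2 b # i3 c # map i3 cs"
  have ac: "a \<in> carrier A" "b \<in> carrier A" "c \<in> carrier A" "set cs \<subseteq> carrier A"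
    using d by (auto simp: as mu_dom_def)
  have i: "i1 y \<in> carrier CC" "i2 y \<in> carrier CC" "i3 y \<in> carrier CC" if "y \<in> carrier A" for y
    using that alg_homD(1)[OF i_hom(1)] alg_homD(1)[OF i_hom(2)] alg_homD(1)[OF i_hom(3)] by auto
  have dw: "mu_dom P (carrier CC) ?ws x" using d ac i by (auto simp: as mu_dom_def)
  have z: "f (mu CC ?ws x) = \<zero>\<^bsub>XX\<^esub>"
    if "f \<in> alg_hom R P CC XX" "\<zero>\<^bsub>XX\<^esub> \<in> set (map f ?ws)" for f
  proof -
    have "f (mu CC ?ws x) = mu XX (map f ?ws) x" by (rule alg_homD(4)[OF that(1) dw])
    also have "\<dots> = \<zero>\<^bsub>XX\<^esub>"
      using alg_homD(1)[OF that(1)] by (intro XX.mu_zero_in[OF mu_dom_map[OF _ dw] that(2)]) auto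
    finally show ?thesis .
  qed
  have "c1 (mu CC ?ws x) = \<zero>\<^bsub>XX\<^esub>" by (rule z[OF c_hom(1)]) (use c_i(3)[OF ac(3)] in simp)
  moreover have "c2 (mu CC ?ws x) = \<zero>\<^bsub>XX\<^esub>" by (rule z[OF c_hom(2)]) (use c_i(5)[OF ac(2)] in simp)
  moreover have "c3 (mu CC ?ws x) = \<zero>\<^bsub>XX\<^esub>" by (rule z[OF c_hom(3)]) (use c_i(7)[OF ac(1)] in simp)
  ultimately have "mu CC ?ws x \<in> cosmash3 R P A A A" using CC.mu_closed[OF dw] by (simp add: cosmash3_eq)
  moreover have "map fold3 ?ws = as" using ac fold3_i by (auto simp: as subset_eq map_idI)
  then have "fold3 (mu CC ?ws x) = u" using alg_homD(4)[OF fold3_hom dw] u(1) by simp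
  ultimately show "u \<in> higgins3 R P A" unfolding higgins3_eq by blast
qed

end

theorem higgins3_eq_J:
  assumes "palgebra R P A" shows "higgins3 R P A = J R P 3 A"
proof -
  interpret triple_coprod R P A using assms by (rule triple_coprod.intro)
  show ?thesis using higgins3_subset_J J_subset_higgins3 by blast
qed

lemma J3_zero_iff:
  assumes "palgebra R P A"
  shows "J R P 3 A = {\<zero>\<^bsub>A\<^esub>} \<longleftrightarrow> A \<in> NIL2_obj R P"
proof -
  interpret palgebra R P A by fact
  show ?thesis
  proof
    assume J: "J R P 3 A = {\<zero>\<^bsub>A\<^esub>}"
    have "mu A as x = \<zero>\<^bsub>A\<^esub>" if "2 < length as" "mu_dom P (carrier A) as x" for as x
      using J_gen[of 3 as x] that J by auto
    then show "A \<in> NIL2_obj R P" using assms by (simp add: NIL2_obj_def)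
  next
    assume "A \<in> NIL2_obj R P"
    then have "ops_ge 3 \<subseteq> {\<zero>\<^bsub>A\<^esub>}" by (auto simp: NIL2_obj_def)
    then have "J R P 3 A \<subseteq> {\<zero>\<^bsub>A\<^esub>}"
      unfolding J_def by (rule mspan_minimal[OF submodule_zero[OF module_axioms]])
    then show "J R P 3 A = {\<zero>\<^bsub>A\<^esub>}" using zero_in_submodule[OF submodule_J[of 3]] by blast
  qed
qed

lemma Nil2_obj_eq:
  fixes R :: "'r ring" and P :: "('r, 'p) operad"
  shows "(Nil2_obj R P :: ('r, 'a, 'p) palg set) = NIL2_obj R P"
proof -
  have "A \<in> Nil2_obj R P \<longleftrightarrow> A \<in> NIL2_obj R P" if "palgebra R P A" for A :: "('r, 'a, 'p) palg"
    using that by (simp add: Nil2_obj_def higgins3_eq_J J3_zero_iff)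
  then show ?thesis by (auto simp: Nil2_obj_def NIL2_obj_def)
qed

lemma nil2_eq: "palgebra R P A \<Longrightarrow> nil2 R P A = NIL2 R P A"
  by (simp add: nil2_def NIL2_def higgins3_eq_J)

section \<open>The tensor product formula\<close>

lemma module_hom_add:
  assumes "module R M" "module R N" "f \<in> module_hom R M N" "g \<in> module_hom R M N"
  shows "(\<lambda>x. f x \<oplus>\<^bsub>N\<^esub> g x) \<in> module_hom R M N"
proof -
  interpret M: module R M by fact
  interpret N: module R N by fact
  show ?thesis
    using module_homD[OF assms(3)] module_homD[OF assms(4)]
    by (intro module_homI) (simp_all add: N.smult_r_distr N.a_ac)
qed

text \<open>Commutativity of \<open>R\<close> is what makes multiplication by a scalar
  linear.\<close>

lemma module_hom_smult:
  assumes "module R M" "module R N" "f \<in> module_hom R M N" "r \<in> carrier R"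
  shows "(\<lambda>x. r \<odot>\<^bsub>N\<^esub> f x) \<in> module_hom R M N"
proof -
  interpret M: module R M by fact
  interpret N: module R N by fact
  have "r \<odot>\<^bsub>N\<^esub> (s \<odot>\<^bsub>N\<^esub> y) = s \<odot>\<^bsub>N\<^esub> (r \<odot>\<^bsub>N\<^esub> y)" if "s \<in> carrier R" "y \<in> carrier N" for s y
    using assms(4) that by (simp add: M.R.m_comm flip: N.smult_assoc1)
  then show ?thesis
    using module_homD[OF assms(3)] assms(4)
    by (intro module_homI) (simp_all add: N.smult_r_distr)
qed

text \<open>The lifts of a family of bilinear maps depend linearly on the parameter, since this can
  be checked on pure tensors. Both actions of \<open>P11 R P\<close> and the iterated lift out of
  the final tensor product are of this kind.\<close>

lemma tensor_lift_bilinear: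
  fixes R :: "'r ring"
  assumes M: "module R M" and N: "module R N" and Q: "module R Q"
    and h: "\<And>s. s \<in> carrier S \<Longrightarrow> h s \<in> bilinear R M N Q"
    and hs: "\<And>m n. m \<in> carrier M \<Longrightarrow> n \<in> carrier N \<Longrightarrow> (\<lambda>s. h s m n) \<in> module_hom R S Q"
    and S: "module R S"
  shows "(\<lambda>z s. tensor_lift R Q (h s) z) \<in> bilinear R (tensor R M N) S Q"
proof -
  interpret S: module R S by fact
  interpret Q: module R Q by fact
  note l = bilinear_tensor_lift[OF M N Q h]
  note lp = bilinear_tensor_lift_pure[OF M N Q h]
  note T = module_tensor[OF M N]
  show ?thesis
  proof (rule bilinearI[OF l])
    fix z assume z: "z \<in> carrier (tensor R M N)"
    show "(\<lambda>s. tensor_lift R Q (h s) z) \<in> module_hom R S Q"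
    proof (rule module_homI)
      fix s assume s: "s \<in> carrier S"
      then show "tensor_lift R Q (h s) z \<in> carrier Q" using module_homD(1)[OF l z] by blast
    next
      fix s t assume st: "s \<in> carrier S" "t \<in> carrier S"
      show "tensor_lift R Q (h (s \<oplus>\<^bsub>S\<^esub> t)) z = tensor_lift R Q (h s) z \<oplus>\<^bsub>Q\<^esub> tensor_lift R Q (h t) z"
        by (rule tensor_hom_eqI[OF M N Q l module_hom_add[OF T Q l l] _ z])
          (use st in \<open>simp_all add: lp module_homD(2)[OF hs]\<close>)
    next
      fix r s assume rs: "r \<in> carrier R" "s \<in> carrier S"
      show "tensor_lift R Q (h (r \<odot>\<^bsub>S\<^esub> s)) z = r \<odot>\<^bsub>Q\<^esub> tensor_lift R Q (h s) z"
        by (rule tensor_hom_eqI[OF M N Q l module_hom_smult[OF T Q l] _ z])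
          (use rs in \<open>simp_all add: lp module_homD(3)[OF hs]\<close>)
    qed
  qed
qed

context operad
begin

lemma opc1: "module R (opc P 1)" by (rule opc_module) simp
lemma opc2: "module R (opc P 2)" by (rule opc_module) simp

lemma comp2_hom_l: "p \<in> carrier (opc P 1) \<Longrightarrow> (\<lambda>x. comp P [2] [x] p) \<in> module_hom R (opc P 2) (opc P 2)"
  using comp_add_arg[of 2 "[]" "[]" "[]" "[]"] comp_smult_arg[of 2 "[]" "[]" "[]" "[]"]
  by (intro module_homI comp2_closed) (simp_all add: ops_in_def)

lemma comp2_hom_r: "x \<in> carrier (opc P 2) \<Longrightarrow> (\<lambda>p. comp P [2] [x] p) \<in> module_hom R (opc P 1) (opc P 2)"
  using comp_add[of "[2]" "[x]"] comp_smult[of "[2]" "[x]"]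
  by (intro module_homI comp2_closed) (simp_all add: ops_in_def)

lemma comp11_bilinear:
  assumes x: "x \<in> carrier (opc P 2)"
  shows "(\<lambda>p q. comp P [1, 1] [p, q] x) \<in> bilinear R (opc P 1) (opc P 1) (opc P 2)"
proof (intro bilinearI module_homI comp11_closed x)
  note x = x[unfolded numeral_2_eq_2]
  fix p q r p'
  assume p: "p \<in> carrier (opc P 1)" and q: "q \<in> carrier (opc P 1)"
  show "comp P [1, 1] [r \<odot>\<^bsub>opc P 1\<^esub> p, q] x = r \<odot>\<^bsub>opc P 2\<^esub> comp P [1, 1] [p, q] x" if "r \<in> carrier R"
    using comp_smult_arg[of 1 "[]" "[]" "[1]" "[q]" r p x] p q that x by (simp add: ops_in_def numeral_2_eq_2)
  show "comp P [1, 1] [p, r \<odot>\<^bsub>opc P 1\<^esub> q] x = r \<odot>\<^bsub>opc P 2\<^esub> comp P [1, 1] [p, q] x" if "r \<in> carrier R"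
    using comp_smult_arg[of 1 "[1]" "[p]" "[]" "[]" r q x] p q that x by (simp add: ops_in_def numeral_2_eq_2)
  assume p': "p' \<in> carrier (opc P 1)"
  show "comp P [1, 1] [p \<oplus>\<^bsub>opc P 1\<^esub> p', q] x = comp P [1, 1] [p, q] x \<oplus>\<^bsub>opc P 2\<^esub> comp P [1, 1] [p', q] x"
    using comp_add_arg[of 1 "[]" "[]" "[1]" "[q]" p p' x] p q p' x by (simp add: ops_in_def numeral_2_eq_2)
  show "comp P [1, 1] [q, p \<oplus>\<^bsub>opc P 1\<^esub> p'] x = comp P [1, 1] [q, p] x \<oplus>\<^bsub>opc P 2\<^esub> comp P [1, 1] [q, p'] x"
    using comp_add_arg[of 1 "[1]" "[q]" "[]" "[]" p p' x] p q p' x by (simp add: ops_in_def numeral_2_eq_2)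
qed

lemma comp11_hom_op:
  "p \<in> carrier (opc P 1) \<Longrightarrow> q \<in> carrier (opc P 1)
   \<Longrightarrow> (\<lambda>x. comp P [1, 1] [p, q] x) \<in> module_hom R (opc P 2) (opc P 2)"
  using comp_add[of "[1, 1]" "[p, q]"] comp_smult[of "[1, 1]" "[p, q]"]
  by (intro module_homI comp11_closed) (simp_all add: ops_in_def numeral_2_eq_2)

text \<open>The left action on binary operations commutes with the right action of unary ones; this
  lets the right action pass to the tensor product.\<close>

lemma comp11_comp2:
  assumes "p \<in> carrier (opc P 1)" "q \<in> carrier (opc P 1)" "x \<in> carrier (opc P 2)" "u \<in> carrier (opc P 1)"
  shows "comp P [1, 1] [p, q] (comp P [2] [x] u) = comp P [2] [comp P [1, 1] [p, q] x] u"
  using comp_assoc[of "[[1, 1]]" "[[p, q]]" "[x]" u] assms by (simp add: ops_in_def numeral_2_eq_2)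

lemma comp2_comp1:
  assumes "x \<in> carrier (opc P 2)" "p \<in> carrier (opc P 1)" "q \<in> carrier (opc P 1)"
  shows "comp P [2] [comp P [2] [x] p] q = comp P [2] [x] (comp P [1] [p] q)"
  using comp_assoc[of "[[2]]" "[[x]]" "[p]" q] assms by (simp add: ops_in_def)

lemma comp2_unit: "x \<in> carrier (opc P 2) \<Longrightarrow> comp P [2] [x] (unit P) = x"
  using comp_unit_right[of 2 x] by simp

abbreviation swap :: "nat \<Rightarrow> nat" where "swap \<equiv> Transposition.transpose 0 1"

lemma act_hom: "(\<lambda>x. act P 2 swap x) \<in> module_hom R (opc P 2) (opc P 2)"
  using swap_permutes by (intro module_homI act_closed act_add act_smult) auto

lemma act_act: "x \<in> carrier (opc P 2) \<Longrightarrow> act P 2 swap (act P 2 swap x) = x"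
  using act_comp[of 2 swap swap x] act_id[of 2 x] swap_permutes by simp

text \<open>The first equivariance axiom: with two blocks of size 1 the block permutation is the
  swap itself, and the two unary operations change places.\<close>

lemma comp11_act:
  assumes "p \<in> carrier (opc P 1)" "q \<in> carrier (opc P 1)" "x \<in> carrier (opc P 2)"
  shows "comp P [1, 1] [p, q] (act P 2 swap x) = act P 2 swap (comp P [1, 1] [q, p] x)"
proof -
  have b: "block_perm [1, 1] swap = swap"
  proof
    fix j :: nat
    consider "j = 0" | "j = 1" | "2 \<le> j" by linarith
    then show "block_perm [1, 1] swap j = swap j"
    proof cases
      case 3 then show ?thesis by (simp add: block_perm_def transpose_def)
    qed (simp_all add: block_perm_def blocks_def permute_list_def)
  qed
  show ?thesis
    using comp_act[of "[1, 1]" swap "[p, q]" x] assms swap_permutes b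
    by (simp add: ops_in_def numeral_2_eq_2 permute_list_def)
qed

text \<open>The second equivariance axiom with a single block, on which \<open>block_sum\<close> is
  the given permutation.\<close>

lemma comp2_act:
  assumes "x \<in> carrier (opc P 2)" "u \<in> carrier (opc P 1)"
  shows "comp P [2] [act P 2 swap x] u = act P 2 swap (comp P [2] [x] u)"
proof -
  have b: "block_sum [2] [swap] = swap"
  proof
    fix j :: nat
    consider "j = 0" | "j = 1" | "2 \<le> j" by linarith
    then show "block_sum [2] [swap] j = swap j"
    proof cases
      case 3 then show ?thesis by (simp add: block_sum_def transpose_def)
    qed (simp_all add: block_sum_def blocks_def permute_list_def upt_rec)
  qed
  show ?thesis
    using comp_act_args[of "[2]" "[swap]" "[x]" u] assms swap_permutes b by (simp add: ops_in_def)
qed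

lemma P11_left_bilinear: "P11_left R P \<in> bilinear R (P11 R P) (opc P 2) (opc P 2)"
  unfolding P11_left_def[abs_def]
  by (rule tensor_lift_bilinear[OF opc1 opc1 opc2 comp11_bilinear comp11_hom_op opc2])

lemma P11_left_pure:
  assumes "p \<in> carrier (opc P 1)" "q \<in> carrier (opc P 1)" "x \<in> carrier (opc P 2)"
  shows "P11_left R P (pure R (opc P 1) (opc P 1) p q) x = comp P [1, 1] [p, q] x"
  unfolding P11_left_def by (rule bilinear_tensor_lift_pure[OF opc1 opc1 opc2 comp11_bilinear[OF assms(3)] assms(1,2)])

lemma P11_left_comp2:
  assumes s: "s \<in> carrier (P11 R P)" and x: "x \<in> carrier (opc P 2)" and u: "u \<in> carrier (opc P 1)"
  shows "P11_left R P s (comp P [2] [x] u) = comp P [2] [P11_left R P s x] u"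
proof (rule tensor_hom_eqI[OF opc1 opc1 opc2 _ _ _ s])
  show "(\<lambda>s. P11_left R P s (comp P [2] [x] u)) \<in> module_hom R (P11 R P) (opc P 2)"
    by (rule bilinearD(1)[OF P11_left_bilinear comp2_closed[OF x u]])
  show "(\<lambda>s. comp P [2] [P11_left R P s x] u) \<in> module_hom R (P11 R P) (opc P 2)"
    by (rule module_hom_compose[OF bilinearD(1)[OF P11_left_bilinear x] comp2_hom_l[OF u]])
qed (use x u in \<open>simp add: P11_left_pure comp2_closed comp11_comp2 del: One_nat_def\<close>)

lemma module_P11: "module R (P11 R P)" by (rule module_tensor[OF opc1 opc1])

end

text \<open>\<open>P11_right\<close> is a lift of a lift. The outer lift makes sense once the inner
  one is known to be bilinear in \<open>m\<close> and \<open>n\<close>, and linearity in the acting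
  element is then a second application of the same principle.\<close>

lemma
  assumes "palgebra R P M" "palgebra R P N"
  shows P11_right_bilinear: "P11_right R P M N \<in> bilinear R (tensor R M N) (P11 R P) (tensor R M N)"
    and P11_right_pure: "\<lbrakk>m \<in> carrier M; n \<in> carrier N; p \<in> carrier (opc P 1); q \<in> carrier (opc P 1)\<rbrakk> \<Longrightarrow>
      P11_right R P M N (pure R M N m n) (pure R (opc P 1) (opc P 1) p q) = pure R M N (mu M [m] p) (mu N [n] q)"
proof -
  interpret M: palgebra R P M by fact
  interpret N: palgebra R P N by fact
  let ?T = "tensor R M N"
  note MM = M.module_axioms note NM = N.module_axioms
  note o1 = M.opc1 note T = module_tensor[OF MM NM] note pb = pure_bilinear[OF MM NM]
  have b: "(\<lambda>p q. pure R M N (mu M [m] p) (mu N [n] q)) \<in> bilinear R (opc P 1) (opc P 1) ?T"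
    if "m \<in> carrier M" "n \<in> carrier N" for m n
    using that
    by (intro bilinearI module_hom_compose[OF M.mu1_hom_op bilinearD(1)[OF pb]]
        module_hom_compose[OF N.mu1_hom_op bilinearD(2)[OF pb]] M.mu1_closed N.mu1_closed)
  \<comment> \<open>The action of \<open>s\<close> on the pure tensor of \<open>m\<close> and
    \<open>n\<close>. Its linearity in \<open>m\<close> and in \<open>n\<close> comes from
    \<open>tensor_lift_bilinear\<close> with \<open>m\<close> or \<open>n\<close> as the parameter
    and \<open>s\<close> in the role of the tensor.\<close>
  let ?K = "\<lambda>m n s. tensor_lift R ?T (\<lambda>p q. pure R M N (mu M [m] p) (mu N [n] q)) s"
  have h1: "(\<lambda>m. pure R M N (mu M [m] p) (mu N [n] q)) \<in> module_hom R M ?T"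
    if "n \<in> carrier N" "p \<in> carrier (opc P 1)" "q \<in> carrier (opc P 1)" for n p q
    by (rule module_hom_compose[OF M.mu1_hom bilinearD(1)[OF pb N.mu1_closed]]) (rule that)+
  have h2: "(\<lambda>n. pure R M N (mu M [m] p) (mu N [n] q)) \<in> module_hom R N ?T"
    if "m \<in> carrier M" "p \<in> carrier (opc P 1)" "q \<in> carrier (opc P 1)" for m p q
    by (rule module_hom_compose[OF N.mu1_hom bilinearD(2)[OF pb M.mu1_closed]]) (rule that)+
  have K1: "(\<lambda>s m. ?K m n s) \<in> bilinear R (P11 R P) M ?T" if n: "n \<in> carrier N" for n
    by (rule tensor_lift_bilinear[OF o1 o1 T _ _ MM], erule b[OF _ n], erule (1) h1[OF n])
  have K2: "(\<lambda>s n. ?K m n s) \<in> bilinear R (P11 R P) N ?T" if m: "m \<in> carrier M" for m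
    by (rule tensor_lift_bilinear[OF o1 o1 T _ _ NM], erule b[OF m], erule (1) h2[OF m])
  have K: "(\<lambda>m n. ?K m n s) \<in> bilinear R M N ?T" if s: "s \<in> carrier (P11 R P)" for s
    using bilinearD(2)[OF K1 s] bilinearD(2)[OF K2 s] by (rule bilinearI)
  have Ks: "(\<lambda>s. ?K m n s) \<in> module_hom R (P11 R P) ?T" if "m \<in> carrier M" "n \<in> carrier N" for m n
    using bilinearD(1)[OF K1[OF that(2)] that(1)] .
  show "P11_right R P M N \<in> bilinear R ?T (P11 R P) ?T"
    unfolding P11_right_def[abs_def]
    by (rule tensor_lift_bilinear[OF MM NM T K Ks M.module_P11])
  show "P11_right R P M N (pure R M N m n) (pure R (opc P 1) (opc P 1) p q) = pure R M N (mu M [m] p) (mu N [n] q)"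
    if "m \<in> carrier M" "n \<in> carrier N" "p \<in> carrier (opc P 1)" "q \<in> carrier (opc P 1)"
  proof -
    have "pure R (opc P 1) (opc P 1) p q \<in> carrier (P11 R P)"
      using bilinear_closed[OF pure_bilinear[OF o1 o1] that(3,4)] .
    then show ?thesis
      unfolding P11_right_def
      using bilinear_tensor_lift_pure[OF MM NM T K that(1,2)]
        bilinear_tensor_lift_pure[OF o1 o1 T b[OF that(1,2)] that(3,4)] by simp
  qed
qed

section \<open>The tensor product attached to a pair of algebras\<close>

locale palgebra_pair = A: palgebra R P A + B: palgebra R P B
  for R :: "'r ring" and P :: "('r, 'p) operad"
    and A :: "('r, 'a, 'p) palg" and B :: "('r, 'b, 'p) palg"
begin

abbreviation "M \<equiv> abel R P A"
abbreviation "N \<equiv> abel R P B"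
abbreviation "T \<equiv> abel_tensor R P A B"
abbreviation "TA \<equiv> bilin_formula R P A B"
abbreviation "g3 \<equiv> gen3 R P A B"
abbreviation "ca a \<equiv> J R P 2 A +>\<^bsub>A\<^esub> a"
abbreviation "cb b \<equiv> J R P 2 B +>\<^bsub>B\<^esub> b"

sublocale qa: quotient_palgebra R P A "J R P 2 A" by (rule A.quotient_by_J)
sublocale qb: quotient_palgebra R P B "J R P 2 B" by (rule B.quotient_by_J)

lemma pM: "palgebra R P M" unfolding abel_def by (rule qa.quot_palgebra)
lemma pN: "palgebra R P N" unfolding abel_def by (rule qb.quot_palgebra)

sublocale M: palgebra R P M by (rule pM)
sublocale N: palgebra R P N by (rule pN)

lemma ca_hom: "(\<lambda>a. ca a) \<in> alg_hom R P A M" unfolding abel_def by (rule qa.pr_hom)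
lemma cb_hom: "(\<lambda>b. cb b) \<in> alg_hom R P B N" unfolding abel_def by (rule qb.pr_hom)

lemma ca_onto: "m \<in> carrier M \<Longrightarrow> \<exists>a \<in> carrier A. m = ca a"
  by (auto simp: abel_def qa.quot_alg_sel)
lemma cb_onto: "n \<in> carrier N \<Longrightarrow> \<exists>b \<in> carrier B. n = cb b"
  by (auto simp: abel_def qb.quot_alg_sel)

lemma ca_zero: "a \<in> J R P 2 A \<Longrightarrow> ca a = \<zero>\<^bsub>M\<^esub>"
  using qa.coset_zero_iff[of a] A.submoduleE(1)[OF A.submodule_J]
  by (auto simp: abel_def qa.quot_alg_sel(3))
lemma cb_zero: "b \<in> J R P 2 B \<Longrightarrow> cb b = \<zero>\<^bsub>N\<^esub>"
  using qb.coset_zero_iff[of b] B.submoduleE(1)[OF B.submodule_J]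
  by (auto simp: abel_def qb.quot_alg_sel(3))

lemma ca_mu1: "a \<in> carrier A \<Longrightarrow> p \<in> carrier (opc P 1) \<Longrightarrow> mu M [ca a] p = ca (mu A [a] p)"
  using alg_homD(4)[OF ca_hom, of "[a]" p] by (simp add: mu_dom_simps)
lemma cb_mu1: "b \<in> carrier B \<Longrightarrow> p \<in> carrier (opc P 1) \<Longrightarrow> mu N [cb b] p = cb (mu B [b] p)"
  using alg_homD(4)[OF cb_hom, of "[b]" p] by (simp add: mu_dom_simps)

abbreviation "TMN \<equiv> tensor R M N"

lemmas mM = M.module_axioms and mN = N.module_axioms
lemma mTMN: "module R TMN" by (rule module_tensor[OF mM mN])

sublocale tf: tensor_factors R TMN "opc P 2" "carrier (P11 R P)" "P11_right R P M N" "P11_left R P"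
proof -
  interpret X: module R TMN by (rule mTMN)
  interpret Y: module R "opc P 2" by (rule A.opc2)
  show "tensor_factors R TMN (opc P 2) (carrier (P11 R P)) (P11_right R P M N) (P11_left R P)"
    by unfold_locales
      (use bilinear_closed[OF P11_right_bilinear[OF pM pN]] bilinear_closed[OF A.P11_left_bilinear] in auto)
qed

lemma T_TT: "T = tf.TT" by (simp add: abel_tensor_def)
lemma abel_pure_eq: "abel_pure R P A B = pure_over R (carrier (P11 R P)) TMN (P11_right R P M N) (opc P 2) (P11_left R P)"
  by (simp add: abel_pure_def[abs_def])

lemma mT: "module R T" unfolding T_TT by (rule tf.module_TT)
sublocale T: module R T by (rule mT)

abbreviation "H \<equiv> abel_pure R P A B"

lemma H_bilinear: "H \<in> bilinear R TMN (opc P 2) T"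
  unfolding abel_pure_eq T_TT by (rule tf.pure_bilinear)

lemma H_balanced:
  "s \<in> carrier (P11 R P) \<Longrightarrow> w \<in> carrier TMN \<Longrightarrow> x \<in> carrier (opc P 2) \<Longrightarrow>
   H (P11_right R P M N w s) x = H w (P11_left R P s x)"
  unfolding abel_pure_eq by (rule tf.pure_balanced)

lemma g3_eq: "g3 a b x = H (pure R M N (ca a) (cb b)) x"
  by (simp add: gen3_def)

lemma pc: "a \<in> carrier A \<Longrightarrow> b \<in> carrier B \<Longrightarrow> pure R M N (ca a) (cb b) \<in> carrier TMN"
  using bilinear_closed[OF pure_bilinear[OF mM mN]] alg_homD(1)[OF ca_hom] alg_homD(1)[OF cb_hom] by blast

lemma g3_hom_l:
  assumes "b \<in> carrier B" "x \<in> carrier (opc P 2)" shows "(\<lambda>a. g3 a b x) \<in> module_hom R A T"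
  unfolding g3_eq
  by (rule module_hom_compose[OF alg_hom_module_hom[OF ca_hom] module_hom_compose[OF
        bilinearD(1)[OF pure_bilinear[OF mM mN] alg_homD(1)[OF cb_hom assms(1)]] bilinearD(1)[OF H_bilinear assms(2)]]])

lemma g3_hom_r:
  assumes "a \<in> carrier A" "x \<in> carrier (opc P 2)" shows "(\<lambda>b. g3 a b x) \<in> module_hom R B T"
  unfolding g3_eq
  by (rule module_hom_compose[OF alg_hom_module_hom[OF cb_hom] module_hom_compose[OF
        bilinearD(2)[OF pure_bilinear[OF mM mN] alg_homD(1)[OF ca_hom assms(1)]] bilinearD(1)[OF H_bilinear assms(2)]]])

lemma g3_hom_op:
  assumes "a \<in> carrier A" "b \<in> carrier B" shows "(\<lambda>x. g3 a b x) \<in> module_hom R (opc P 2) T"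
  unfolding g3_eq by (rule bilinearD(2)[OF H_bilinear pc[OF assms]])

lemma g3_closed: "a \<in> carrier A \<Longrightarrow> b \<in> carrier B \<Longrightarrow> x \<in> carrier (opc P 2) \<Longrightarrow> g3 a b x \<in> carrier T"
  using module_homD(1)[OF g3_hom_op] by blast

lemma pure_opc: "p \<in> carrier (opc P 1) \<Longrightarrow> q \<in> carrier (opc P 1)
  \<Longrightarrow> pure R (opc P 1) (opc P 1) p q \<in> carrier (P11 R P)"
  using bilinear_closed[OF pure_bilinear[OF A.opc1 A.opc1]] by blast

lemma P11_right_coset:
  assumes "a \<in> carrier A" "b \<in> carrier B" "p \<in> carrier (opc P 1)" "q \<in> carrier (opc P 1)"
  shows "P11_right R P M N (pure R M N (ca a) (cb b)) (pure R (opc P 1) (opc P 1) p q)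
    = pure R M N (ca (mu A [a] p)) (cb (mu B [b] q))"
  using assms alg_homD(1)[OF ca_hom] alg_homD(1)[OF cb_hom]
  by (simp add: P11_right_pure[OF pM pN] ca_mu1 cb_mu1 del: One_nat_def)

lemma g3_balanced:
  assumes "a \<in> carrier A" "b \<in> carrier B" "p \<in> carrier (opc P 1)" "q \<in> carrier (opc P 1)" "x \<in> carrier (opc P 2)"
  shows "g3 (mu A [a] p) (mu B [b] q) x = g3 a b (comp P [1, 1] [p, q] x)"
  using H_balanced[OF pure_opc[OF assms(3,4)] pc[OF assms(1,2)] assms(5)] assms
  by (simp add: g3_eq P11_right_coset A.P11_left_pure del: One_nat_def)

lemma g3_J:
  assumes "a \<in> carrier A" "b \<in> carrier B" "x \<in> carrier (opc P 2)"
  shows "a \<in> J R P 2 A \<Longrightarrow> g3 a b x = \<zero>\<^bsub>T\<^esub>" "b \<in> J R P 2 B \<Longrightarrow> g3 a b x = \<zero>\<^bsub>T\<^esub>"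
proof -
  have z: "\<zero>\<^bsub>A\<^esub> \<in> J R P 2 A" "\<zero>\<^bsub>B\<^esub> \<in> J R P 2 B"
    by (rule zero_in_submodule[OF A.submodule_J], rule zero_in_submodule[OF B.submodule_J])
  show "g3 a b x = \<zero>\<^bsub>T\<^esub>" if "a \<in> J R P 2 A"
    using module_hom_zero[OF A.module_axioms mT g3_hom_l[OF assms(2,3)]] ca_zero[OF that] ca_zero[OF z(1)]
    by (simp add: g3_eq)
  show "g3 a b x = \<zero>\<^bsub>T\<^esub>" if "b \<in> J R P 2 B"
    using module_hom_zero[OF B.module_axioms mT g3_hom_r[OF assms(1,3)]] cb_zero[OF that] cb_zero[OF z(2)]
    by (simp add: g3_eq)
qed

text \<open>Uniqueness for the two nested tensor products, together with surjectivity of the class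
  maps. Identities between linear maps on \<open>T\<close> are from here on checked on the elements
  \<open>g3 a b x\<close>.\<close>

lemma T_hom_eqI:
  assumes Q: "module R Q" and f: "f \<in> module_hom R T Q" and g: "g \<in> module_hom R T Q"
    and e: "\<And>a b x. a \<in> carrier A \<Longrightarrow> b \<in> carrier B \<Longrightarrow> x \<in> carrier (opc P 2) \<Longrightarrow> f (g3 a b x) = g (g3 a b x)"
    and z: "z \<in> carrier T"
  shows "f z = g z"
proof (rule tf.TT_hom_eqI[OF Q f[unfolded T_TT] g[unfolded T_TT] _ z[unfolded T_TT]], fold abel_pure_eq)
  fix w x assume w: "w \<in> carrier TMN" and x: "x \<in> carrier (opc P 2)"
  note Hx = bilinearD(1)[OF H_bilinear x]
  show "f (H w x) = g (H w x)"
  proof (rule tensor_hom_eqI[OF mM mN Q module_hom_compose[OF Hx f] module_hom_compose[OF Hx g] _ w])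
    fix m n assume "m \<in> carrier M" "n \<in> carrier N"
    then obtain a b where ab: "a \<in> carrier A" "m = ca a" "b \<in> carrier B" "n = cb b"
      using ca_onto cb_onto by blast
    show "f (H (pure R M N m n) x) = g (H (pure R M N m n) x)"
      using e[OF ab(1,3) x] by (simp add: g3_eq ab(2,4))
  qed
qed

text \<open>The universal property of \<open>T\<close> in terms of elements of \<open>A\<close>,
  \<open>B\<close> and P(2) alone. Vanishing on operations of arity at least 2 lets \<open>g\<close>
  descend to the quotients, and balancing for single \<open>p\<close>, \<open>q\<close> extends to
  \<open>P11 R P\<close> by linearity.\<close>

lemma T_lift:
  fixes Q :: "('r, 'q, 'z) module_scheme"
  assumes Q: "module R Q"
    and gl: "\<And>b x. b \<in> carrier B \<Longrightarrow> x \<in> carrier (opc P 2) \<Longrightarrow> (\<lambda>a. g a b x) \<in> module_hom R A Q"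
    and gr: "\<And>a x. a \<in> carrier A \<Longrightarrow> x \<in> carrier (opc P 2) \<Longrightarrow> (\<lambda>b. g a b x) \<in> module_hom R B Q"
    and gop: "\<And>a b. a \<in> carrier A \<Longrightarrow> b \<in> carrier B \<Longrightarrow> (\<lambda>x. g a b x) \<in> module_hom R (opc P 2) Q"
    and bal: "\<And>a b p q x. a \<in> carrier A \<Longrightarrow> b \<in> carrier B \<Longrightarrow> p \<in> carrier (opc P 1) \<Longrightarrow> q \<in> carrier (opc P 1)
      \<Longrightarrow> x \<in> carrier (opc P 2) \<Longrightarrow> g (mu A [a] p) (mu B [b] q) x = g a b (comp P [1, 1] [p, q] x)"
    and gA: "\<And>a b x. a \<in> A.ops_ge 2 \<Longrightarrow> b \<in> carrier B \<Longrightarrow> x \<in> carrier (opc P 2) \<Longrightarrow> g a b x = \<zero>\<^bsub>Q\<^esub>"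
    and gB: "\<And>a b x. a \<in> carrier A \<Longrightarrow> b \<in> B.ops_ge 2 \<Longrightarrow> x \<in> carrier (opc P 2) \<Longrightarrow> g a b x = \<zero>\<^bsub>Q\<^esub>"
  obtains f where "f \<in> module_hom R T Q"
    "\<And>a b x. a \<in> carrier A \<Longrightarrow> b \<in> carrier B \<Longrightarrow> x \<in> carrier (opc P 2) \<Longrightarrow> f (g3 a b x) = g a b x"
proof -
  have gAJ: "g a b x = \<zero>\<^bsub>Q\<^esub>" if "a \<in> J R P 2 A" "b \<in> carrier B" "x \<in> carrier (opc P 2)" for a b x
    using module_hom_mspan[OF A.module_axioms Q gl[OF that(2,3)] submodule_zero[OF Q] A.ops_ge_closed[of 2] _
        that(1)[unfolded J_def]] gA that by blast
  have gBJ: "g a b x = \<zero>\<^bsub>Q\<^esub>" if "b \<in> J R P 2 B" "a \<in> carrier A" "x \<in> carrier (opc P 2)" for a b x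
    using module_hom_mspan[OF B.module_axioms Q gr[OF that(2,3)] submodule_zero[OF Q] B.ops_ge_closed[of 2] _
        that(1)[unfolded J_def]] gB that by blast
  have repA: "rep m \<in> carrier A" if "m \<in> carrier M" for m
    using that qa.rep_quot(1)[of m] by (simp add: abel_def quot_alg_def)
  have repB: "rep n \<in> carrier B" if "n \<in> carrier N" for n
    using that qb.rep_quot(1)[of n] by (simp add: abel_def quot_alg_def)
  \<comment> \<open>On classes \<open>g\<close> is evaluated at representatives; \<open>gAJ\<close>
    and \<open>gBJ\<close> make the value independent of their choice.\<close>
  let ?g = "\<lambda>x m n. g (rep m) (rep n) x"
  have homM: "f \<in> module_hom R (quot_mod A (J R P 2 A)) Q \<longleftrightarrow> f \<in> module_hom R M Q" for f
    by (simp add: module_hom_def abel_def quot_alg_def)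
  have homN: "f \<in> module_hom R (quot_mod B (J R P 2 B)) Q \<longleftrightarrow> f \<in> module_hom R N Q" for f
    by (simp add: module_hom_def abel_def quot_alg_def)
  have gbil: "?g x \<in> bilinear R M N Q" if x: "x \<in> carrier (opc P 2)" for x
  proof (rule bilinearI)
    fix n assume "n \<in> carrier N"
    then show "(\<lambda>m. ?g x m n) \<in> module_hom R M Q"
      using qa.quot_lift_hom[OF Q gl[OF repB x] gAJ[OF _ repB x]] unfolding homM by blast
  next
    fix m assume "m \<in> carrier M"
    then show "(\<lambda>n. ?g x m n) \<in> module_hom R N Q"
      using qb.quot_lift_hom[OF Q gr[OF repA x] gBJ[OF _ repA x]] unfolding homN by blast
  qed
  have gx: "(\<lambda>x. ?g x m n) \<in> module_hom R (opc P 2) Q" if "m \<in> carrier M" "n \<in> carrier N" for m n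
    using gop[OF repA repB] that by blast
  have gval: "?g x (ca a) (cb b) = g a b x" if "a \<in> carrier A" "b \<in> carrier B" "x \<in> carrier (opc P 2)" for a b x
  proof -
    have "cb b \<in> carrier N" using alg_homD(1)[OF cb_hom that(2)] .
    then have "?g x (ca a) (cb b) = g a (rep (cb b)) x"
      using qa.hom_rep_coset[OF Q gl[OF repB that(3)] gAJ[OF _ repB that(3)] that(1)] by blast
    also have "\<dots> = g a b x"
      using qb.hom_rep_coset[OF Q gr[OF that(1,3)] gBJ[OF _ that(1,3)] that(2)] by blast
    finally show ?thesis .
  qed
  \<comment> \<open>The inner lift, over \<open>R\<close>, with \<open>x\<close> as a linear
    parameter. The outer lift, over \<open>P11 R P\<close>, is then applied to
    \<open>?k\<close>.\<close>
  let ?k = "\<lambda>w x. tensor_lift R Q (?g x) w"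
  have k: "?k \<in> bilinear R TMN (opc P 2) Q"
    by (rule tensor_lift_bilinear[OF mM mN Q gbil gx A.opc2])
  have kpure: "?k (pure R M N (ca a) (cb b)) x = g a b x"
    if "a \<in> carrier A" "b \<in> carrier B" "x \<in> carrier (opc P 2)" for a b x
    using bilinear_tensor_lift_pure[OF mM mN Q gbil[OF that(3)] alg_homD(1)[OF ca_hom that(1)] alg_homD(1)[OF cb_hom that(2)]]
      gval[OF that] by simp
  \<comment> \<open>Both sides are linear in \<open>w\<close> and in \<open>s\<close>, so pure
    tensors suffice; there it is hypothesis \<open>bal\<close>.\<close>
  have kbal: "?k (P11_right R P M N w s) x = ?k w (P11_left R P s x)"
    if s: "s \<in> carrier (P11 R P)" and w: "w \<in> carrier TMN" and x: "x \<in> carrier (opc P 2)" for s w x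
  proof (rule tensor_hom_eqI[OF mM mN Q _ _ _ w])
    show "(\<lambda>w. ?k (P11_right R P M N w s) x) \<in> module_hom R TMN Q"
      by (rule module_hom_compose[OF bilinearD(1)[OF P11_right_bilinear[OF pM pN] s] bilinearD(1)[OF k x]])
    show "(\<lambda>w. ?k w (P11_left R P s x)) \<in> module_hom R TMN Q"
      by (rule bilinearD(1)[OF k bilinear_closed[OF A.P11_left_bilinear s x]])
    fix m n assume "m \<in> carrier M" "n \<in> carrier N"
    then obtain a b where ab: "a \<in> carrier A" "m = ca a" "b \<in> carrier B" "n = cb b"
      using ca_onto cb_onto by blast
    have w: "pure R M N m n \<in> carrier TMN" using pc ab by simp
    show "?k (P11_right R P M N (pure R M N m n) s) x = ?k (pure R M N m n) (P11_left R P s x)"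
    proof (rule tensor_hom_eqI[OF A.opc1 A.opc1 Q _ _ _ s])
      show "(\<lambda>s. ?k (P11_right R P M N (pure R M N m n) s) x) \<in> module_hom R (P11 R P) Q"
        by (rule module_hom_compose[OF bilinearD(2)[OF P11_right_bilinear[OF pM pN] w] bilinearD(1)[OF k x]])
      show "(\<lambda>s. ?k (pure R M N m n) (P11_left R P s x)) \<in> module_hom R (P11 R P) Q"
        by (rule module_hom_compose[OF bilinearD(1)[OF A.P11_left_bilinear x] bilinearD(2)[OF k w]])
      fix p q assume pq: "p \<in> carrier (opc P 1)" "q \<in> carrier (opc P 1)"
      have "?k (P11_right R P M N (pure R M N m n) (pure R (opc P 1) (opc P 1) p q)) x
          = g (mu A [a] p) (mu B [b] q) x"
        unfolding ab(2,4) P11_right_coset[OF ab(1,3) pq]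
        by (rule kpure[OF A.mu1_closed[OF ab(1) pq(1)] B.mu1_closed[OF ab(3) pq(2)] x])
      also have "\<dots> = g a b (comp P [1, 1] [p, q] x)" by (rule bal[OF ab(1,3) pq x])
      also have "\<dots> = ?k (pure R M N m n) (P11_left R P (pure R (opc P 1) (opc P 1) p q) x)"
        unfolding ab(2,4) A.P11_left_pure[OF pq x] by (rule kpure[OF ab(1,3) A.comp11_closed[OF pq x], symmetric])
      finally show "?k (P11_right R P M N (pure R M N m n) (pure R (opc P 1) (opc P 1) p q)) x
          = ?k (pure R M N m n) (P11_left R P (pure R (opc P 1) (opc P 1) p q) x)" .
    qed
  qed
  show ?thesis
  proof (rule that)
    show "tensor_lift R Q ?k \<in> module_hom R T Q"
      unfolding T_TT by (rule tf.tensor_lift_hom[OF Q k kbal])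
    fix a b x assume abx: "a \<in> carrier A" "b \<in> carrier B" "x \<in> carrier (opc P 2)"
    have "tensor_lift R Q ?k (g3 a b x) = ?k (pure R M N (ca a) (cb b)) x"
      unfolding g3_eq abel_pure_eq by (rule tf.tensor_lift_pure[OF Q k kbal pc[OF abx(1,2)] abx(3)])
    then show "tensor_lift R Q ?k (g3 a b x) = g a b x" using kpure[OF abx] by simp
  qed
qed

lemma TA_sel [simp]:
  "carrier TA = carrier T" "zero TA = zero T" "add TA = add T" "smult TA = smult T"
  by (simp_all add: bilin_formula_def)

lemma TA_module_hom [simp]:
  "module_hom R TA Q = module_hom R T Q" "module_hom R Q' TA = module_hom R Q' T"
  by (simp_all add: module_hom_def)

lemma mTA: "module R TA" by (rule module_cong[OF mT]) simp_all

definition "tmul p z = tensor_lift R T (\<lambda>w x. H w (comp P [2] [x] p)) z"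

lemma mu_TA1: "z \<in> carrier T \<Longrightarrow> p \<in> carrier (opc P 1) \<Longrightarrow> mu TA [z] p = tmul p z"
  by (simp add: bilin_formula_def mu_mk_alg mu_dom_simps tmul_def)

lemma mu_TA2: "mu_dom P (carrier T) zs p \<Longrightarrow> 2 \<le> length zs \<Longrightarrow> mu TA zs p = \<zero>\<^bsub>T\<^esub>"
  by (auto simp add: bilin_formula_def mu_mk_alg)

text \<open>\<open>?h\<close> is balanced because the right action of \<open>p\<close> on P(2)
  commutes with the left action of \<open>P11 R P\<close>.\<close>

lemma tmul_hom_gen:
  assumes p: "p \<in> carrier (opc P 1)"
  shows "tmul p \<in> module_hom R T T"
    and "\<lbrakk>a \<in> carrier A; b \<in> carrier B; x \<in> carrier (opc P 2)\<rbrakk> \<Longrightarrow> tmul p (g3 a b x) = g3 a b (comp P [2] [x] p)"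
proof -
  let ?h = "\<lambda>w x. H w (comp P [2] [x] p)"
  have h: "?h \<in> bilinear R TMN (opc P 2) T"
    by (rule bilinearI, rule bilinearD(1)[OF H_bilinear A.comp2_closed[OF _ p]], assumption,
        rule module_hom_compose[OF A.comp2_hom_l[OF p] bilinearD(2)[OF H_bilinear]])
  have bal: "?h (P11_right R P M N w s) x = ?h w (P11_left R P s x)"
    if "s \<in> carrier (P11 R P)" "w \<in> carrier TMN" "x \<in> carrier (opc P 2)" for s w x
    using H_balanced[OF that(1,2) A.comp2_closed[OF that(3) p]] A.P11_left_comp2[OF that(1,3) p] by simp
  show "tmul p \<in> module_hom R T T"
    unfolding T_TT tmul_def[abs_def] unfolding T_TT[symmetric]
    by (rule tf.tensor_lift_hom[OF mT h bal, folded T_TT])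
  show "tmul p (g3 a b x) = g3 a b (comp P [2] [x] p)"
    if "a \<in> carrier A" "b \<in> carrier B" "x \<in> carrier (opc P 2)"
    using tf.tensor_lift_pure[OF mT h bal pc[OF that(1,2)] that(3)]
    unfolding tmul_def g3_eq abel_pure_eq .
qed

lemma tmul_closed: "z \<in> carrier T \<Longrightarrow> p \<in> carrier (opc P 1) \<Longrightarrow> tmul p z \<in> carrier T"
  using module_homD(1)[OF tmul_hom_gen(1)] by blast

lemma tmul_hom_op:
  assumes z: "z \<in> carrier T" shows "(\<lambda>p. tmul p z) \<in> module_hom R (opc P 1) T"
proof (rule module_homI)
  interpret O: module R "opc P 1" by (rule A.opc1)
  fix p assume p: "p \<in> carrier (opc P 1)"
  show "tmul p z \<in> carrier T" by (rule tmul_closed[OF z p])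
  {
    fix q assume q: "q \<in> carrier (opc P 1)"
    have pq: "p \<oplus>\<^bsub>opc P 1\<^esub> q \<in> carrier (opc P 1)" using p q by (rule O.a_closed)
    show "tmul (p \<oplus>\<^bsub>opc P 1\<^esub> q) z = tmul p z \<oplus>\<^bsub>T\<^esub> tmul q z"
    proof (rule T_hom_eqI[OF mT tmul_hom_gen(1)[OF pq]
          module_hom_add[OF mT mT tmul_hom_gen(1)[OF p] tmul_hom_gen(1)[OF q]] _ z])
      fix a b x assume abx: "a \<in> carrier A" "b \<in> carrier B" "x \<in> carrier (opc P 2)"
      show "tmul (p \<oplus>\<^bsub>opc P 1\<^esub> q) (g3 a b x) = tmul p (g3 a b x) \<oplus>\<^bsub>T\<^esub> tmul q (g3 a b x)"
        unfolding tmul_hom_gen(2)[OF pq abx] tmul_hom_gen(2)[OF p abx] tmul_hom_gen(2)[OF q abx]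
          module_homD(2)[OF A.comp2_hom_r[OF abx(3)] p q]
        by (rule module_homD(2)[OF g3_hom_op[OF abx(1,2)] A.comp2_closed[OF abx(3) p] A.comp2_closed[OF abx(3) q]])
    qed
  next
    fix r assume r: "r \<in> carrier R"
    have rp: "r \<odot>\<^bsub>opc P 1\<^esub> p \<in> carrier (opc P 1)" using r p by (rule O.smult_closed)
    show "tmul (r \<odot>\<^bsub>opc P 1\<^esub> p) z = r \<odot>\<^bsub>T\<^esub> tmul p z"
    proof (rule T_hom_eqI[OF mT tmul_hom_gen(1)[OF rp] module_hom_smult[OF mT mT tmul_hom_gen(1)[OF p] r] _ z])
      fix a b x assume abx: "a \<in> carrier A" "b \<in> carrier B" "x \<in> carrier (opc P 2)"
      show "tmul (r \<odot>\<^bsub>opc P 1\<^esub> p) (g3 a b x) = r \<odot>\<^bsub>T\<^esub> tmul p (g3 a b x)"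
        unfolding tmul_hom_gen(2)[OF rp abx] tmul_hom_gen(2)[OF p abx]
          module_homD(3)[OF A.comp2_hom_r[OF abx(3)] r p]
        by (rule module_homD(3)[OF g3_hom_op[OF abx(1,2)] r A.comp2_closed[OF abx(3) p]])
    qed
  }
qed

lemma tmul_unit:
  assumes z: "z \<in> carrier T" shows "tmul (unit P) z = z"
  by (rule T_hom_eqI[OF mT tmul_hom_gen(1)[OF A.unit_closed] module_hom_id _ z])
    (simp add: tmul_hom_gen(2)[OF A.unit_closed] A.comp2_unit)

lemma tmul_tmul:
  assumes z: "z \<in> carrier T" and p: "p \<in> carrier (opc P 1)" and q: "q \<in> carrier (opc P 1)"
  shows "tmul q (tmul p z) = tmul (comp P [1] [p] q) z"
proof (rule T_hom_eqI[OF mT module_hom_compose[OF tmul_hom_gen(1)[OF p] tmul_hom_gen(1)[OF q]]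
      tmul_hom_gen(1)[OF A.comp1_closed[OF p q]] _ z])
  fix a b x assume abx: "a \<in> carrier A" "b \<in> carrier B" "x \<in> carrier (opc P 2)"
  show "tmul q (tmul p (g3 a b x)) = tmul (comp P [1] [p] q) (g3 a b x)"
    unfolding tmul_hom_gen(2)[OF p abx] tmul_hom_gen(2)[OF A.comp1_closed[OF p q] abx]
      tmul_hom_gen(2)[OF q abx(1,2) A.comp2_closed[OF abx(3) p]] A.comp2_comp1[OF abx(3) p q] ..
qed

end

section \<open>Two-nilpotent algebras\<close>

lemma permutes_lessThan_1: "t permutes {..<1::nat} \<Longrightarrow> t = id"
  by (simp add: lessThan_Suc)

lemma permutes_lessThan_2:
  assumes t: "t permutes {..<2::nat}" shows "t = id \<or> t = Transposition.transpose 0 1"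
proof -
  have out: "t j = j" if "2 \<le> j" for j using t that by (simp add: permutes_def)
  have "t 0 < 2" "t 1 < 2" using permutes_in_image[OF t, of 0] permutes_in_image[OF t, of 1] by auto
  moreover have "t 0 \<noteq> t 1" using permutes_inj[OF t] by (metis injD zero_neq_one)
  ultimately consider "t 0 = 0" "t 1 = 1" | "t 0 = 1" "t 1 = 0" by linarith
  then show ?thesis
  proof cases
    case 1
    have "t j = j" for j using out[of j] 1 by (cases "j = 0"; cases "j = 1") auto
    then show ?thesis by auto
  next
    case 2
    have "t j = Transposition.transpose 0 1 j" for j
      using out[of j] 2 by (cases "j = 0"; cases "j = 1") (auto simp: transpose_def)
    then show ?thesis by blast
  qed
qed

lemma list_length_cases:
  obtains "as = []" | a where "as = [a]" | a b where "as = [a, b]" | "3 \<le> length as"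
proof (cases as)
  case Nil then show ?thesis using that(1) by blast
next
  case (Cons a bs)
  show ?thesis
  proof (cases bs)
    case Nil then show ?thesis using Cons that(2) by blast
  next
    case (Cons b cs)
    then show ?thesis using \<open>as = a # bs\<close> that(3)[of a b] that(4) by (cases cs) auto
  qed
qed

text \<open>A two-nilpotent algebra presented by its unary and binary operations. The assumptions
  are the algebra axioms of total arity at most 2 and the vanishing of a binary operation nested in
  the left argument; nesting in the right argument is then covered by
  \<open>op2_swap\<close>.\<close>

locale nil2_structure = operad R P + module R E
  for R :: "'r ring" and P :: "('r, 'p) operad" and E :: "('r, 'e, 'p) palg" +
  fixes op1 :: "'e \<Rightarrow> 'p \<Rightarrow> 'e" and op2 :: "'e \<Rightarrow> 'e \<Rightarrow> 'p \<Rightarrow> 'e"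
  assumes op1: "op1 \<in> bilinear R E (opc P 1) E"
    and op2l: "\<And>w x. w \<in> carrier E \<Longrightarrow> x \<in> carrier (opc P 2) \<Longrightarrow> (\<lambda>z. op2 z w x) \<in> module_hom R E E"
    and op2r: "\<And>z x. z \<in> carrier E \<Longrightarrow> x \<in> carrier (opc P 2) \<Longrightarrow> (\<lambda>w. op2 z w x) \<in> module_hom R E E"
    and op2op: "\<And>z w. z \<in> carrier E \<Longrightarrow> w \<in> carrier E \<Longrightarrow> (\<lambda>x. op2 z w x) \<in> module_hom R (opc P 2) E"
    and op1_unit: "\<And>z. z \<in> carrier E \<Longrightarrow> op1 z (unit P) = z"
    and op1_op1: "\<And>z p q. \<lbrakk>z \<in> carrier E; p \<in> carrier (opc P 1); q \<in> carrier (opc P 1)\<rbrakk>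
      \<Longrightarrow> op1 (op1 z p) q = op1 z (comp P [1] [p] q)"
    and op1_op2: "\<And>z w x q. \<lbrakk>z \<in> carrier E; w \<in> carrier E; x \<in> carrier (opc P 2); q \<in> carrier (opc P 1)\<rbrakk>
      \<Longrightarrow> op1 (op2 z w x) q = op2 z w (comp P [2] [x] q)"
    and op2_op1: "\<And>z w x p q. \<lbrakk>z \<in> carrier E; w \<in> carrier E; p \<in> carrier (opc P 1); q \<in> carrier (opc P 1);
      x \<in> carrier (opc P 2)\<rbrakk> \<Longrightarrow> op2 (op1 z p) (op1 w q) x = op2 z w (comp P [1, 1] [p, q] x)"
    and op2_op2: "\<And>u v w x y. \<lbrakk>u \<in> carrier E; v \<in> carrier E; w \<in> carrier E; x \<in> carrier (opc P 2); y \<in> carrier (opc P 2)\<rbrakk>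
      \<Longrightarrow> op2 (op2 u v x) w y = \<zero>\<^bsub>E\<^esub>"
    and op2_swap: "\<And>z w x. \<lbrakk>z \<in> carrier E; w \<in> carrier E; x \<in> carrier (opc P 2)\<rbrakk>
      \<Longrightarrow> op2 z w (act P 2 (Transposition.transpose 0 1) x) = op2 w z x"
begin

definition ops :: "'e list \<Rightarrow> 'p \<Rightarrow> 'e" where
  "ops zs x = (if length zs = 1 then op1 (zs ! 0) x else if length zs = 2 then op2 (zs ! 0) (zs ! 1) x else \<zero>\<^bsub>E\<^esub>)"

abbreviation "EA \<equiv> mk_alg P E ops"

lemma ops_simps: "ops [z] x = op1 z x" "ops [z, w] x = op2 z w x" "3 \<le> length zs \<Longrightarrow> ops zs x = \<zero>\<^bsub>E\<^esub>"
  by (auto simp: ops_def)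

lemma op1_closed: "z \<in> carrier E \<Longrightarrow> p \<in> carrier (opc P 1) \<Longrightarrow> op1 z p \<in> carrier E"
  by (rule bilinear_closed[OF op1])

lemma op2_closed: "z \<in> carrier E \<Longrightarrow> w \<in> carrier E \<Longrightarrow> x \<in> carrier (opc P 2) \<Longrightarrow> op2 z w x \<in> carrier E"
  using module_homD(1)[OF op2op] by blast

lemma op1_zero: "p \<in> carrier (opc P 1) \<Longrightarrow> op1 \<zero>\<^bsub>E\<^esub> p = \<zero>\<^bsub>E\<^esub>"
  using module_hom_zero[OF module_axioms module_axioms bilinearD(1)[OF op1]] by blast

lemma op2_zero: "w \<in> carrier E \<Longrightarrow> x \<in> carrier (opc P 2) \<Longrightarrow> op2 \<zero>\<^bsub>E\<^esub> w x = \<zero>\<^bsub>E\<^esub>"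
  "w \<in> carrier E \<Longrightarrow> x \<in> carrier (opc P 2) \<Longrightarrow> op2 w \<zero>\<^bsub>E\<^esub> x = \<zero>\<^bsub>E\<^esub>"
  using module_hom_zero[OF module_axioms module_axioms op2l] module_hom_zero[OF module_axioms module_axioms op2r]
  by blast+

text \<open>Equivariance moves the nested operation to the left argument, the swap being an
  involution.\<close>

lemma op2_op2_r:
  assumes "u \<in> carrier E" "v \<in> carrier E" "w \<in> carrier E" "x \<in> carrier (opc P 2)" "y \<in> carrier (opc P 2)"
  shows "op2 w (op2 u v x) y = \<zero>\<^bsub>E\<^esub>"
proof -
  have a: "act P 2 swap y \<in> carrier (opc P 2)" by (rule module_homD(1)[OF act_hom assms(5)])
  show ?thesis
    using op2_swap[OF assms(3) op2_closed[OF assms(1,2,4)] a] op2_op2[OF assms(1-4) a]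
      op2_swap[OF op2_closed[OF assms(1,2,4)] assms(3) a] act_act[OF assms(5)]
      op2_op2[OF assms(1-5)] op2_swap[OF op2_closed[OF assms(1,2,4)] assms(3,5)] by simp
qed

lemma ops_closed: "mu_dom P (carrier E) zs x \<Longrightarrow> ops zs x \<in> carrier E"
  by (rule list_length_cases[of zs])
    (simp_all add: ops_simps mu_dom_simps op1_closed op2_closed del: One_nat_def, simp add: mu_dom_def)

lemma op2_ops:
  assumes zs: "mu_dom P (carrier E) zs x" "2 \<le> length zs" and w: "w \<in> carrier E" and y: "y \<in> carrier (opc P 2)"
  shows "op2 (ops zs x) w y = \<zero>\<^bsub>E\<^esub>" "op2 w (ops zs x) y = \<zero>\<^bsub>E\<^esub>"
proof -
  consider u v where "zs = [u, v]" | "3 \<le> length zs"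
    by (rule list_length_cases[of zs]) (use zs(2) in auto)
  then have "op2 (ops zs x) w y = \<zero>\<^bsub>E\<^esub> \<and> op2 w (ops zs x) y = \<zero>\<^bsub>E\<^esub>"
    by cases (use zs w y in \<open>simp_all add: ops_simps op2_zero op2_op2 op2_op2_r mu_dom_simps\<close>)
  then show "op2 (ops zs x) w y = \<zero>\<^bsub>E\<^esub>" "op2 w (ops zs x) y = \<zero>\<^bsub>E\<^esub>" by auto
qed

text \<open>The total arity of a composition is at most 2 only for inner arities 1, or 2, or 1 and
  1; these are the assumptions \<open>op1_op1\<close>, \<open>op1_op2\<close> and
  \<open>op2_op1\<close>. In all other cases both sides are zero.\<close>

lemma palgebra_EA: "palgebra R P EA"
proof -
  have mEA: "module R EA" by (rule module_cong[OF module_axioms]) simp_all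
  have mE: "mu EA zs x = ops zs x" if "mu_dom P (carrier E) zs x" for zs x
    using that by (simp add: mu_mk_alg)
  have cE: "f \<in> module_hom R N EA" if "f \<in> module_hom R N E" for f and N :: "('r, 's, 'z) module_scheme"
    using that by (simp add: module_hom_def)
  have z: "(\<lambda>_. \<zero>\<^bsub>E\<^esub>) \<in> module_hom R N E" for N :: "('r, 's, 'z) module_scheme"
    by (rule module_hom_const_zero[OF module_axioms])
  show ?thesis
  proof (rule palgebraI[OF operad_axioms mEA])
    fix zs x assume "\<not> mu_dom P (carrier EA) zs x"
    then show "mu EA zs x = undefined" by (simp add: mu_mk_alg)
  next
    fix us vs x assume "set us \<subseteq> carrier EA" "set vs \<subseteq> carrier EA" and x: "x \<in> carrier (opc P (Suc (length us + length vs)))"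
    then have uv: "set us \<subseteq> carrier E" "set vs \<subseteq> carrier E" by simp_all
    consider "us = []" "vs = []" | u where "us = [u]" "vs = []" | v where "us = []" "vs = [v]"
      | "3 \<le> Suc (length us + length vs)"
      by (rule list_length_cases[of us]; rule list_length_cases[of vs]) auto
    then have "(\<lambda>a. ops (us @ a # vs) x) \<in> module_hom R E E"
    proof cases
      case 1 then show ?thesis using bilinearD(1)[OF op1] x by (simp add: ops_simps)
    next
      case 2 then show ?thesis using op2r[of u x] x uv by (simp add: ops_simps numeral_2_eq_2)
    next
      case 3 then show ?thesis using op2l[of v x] x uv by (simp add: ops_simps numeral_2_eq_2)
    next
      case 4 then show ?thesis using z by (simp add: ops_simps(3))
    qed
    then have "(\<lambda>a. mu EA (us @ a # vs) x) \<in> module_hom R E E"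
      by (rule module_hom_cong[OF module_axioms]) (rule mE, use uv x in \<open>simp add: mu_dom_def\<close>)
    then show "(\<lambda>a. mu EA (us @ a # vs) x) \<in> module_hom R EA EA" by (simp add: module_hom_def)
  next
    fix zs assume n: "zs \<noteq> []" and "set zs \<subseteq> carrier EA"
    then have zs: "set zs \<subseteq> carrier E" by simp
    have "ops zs \<in> module_hom R (opc P (length zs)) E"
    proof (rule list_length_cases[of zs])
      fix a assume "zs = [a]"
      then show ?thesis using bilinearD(2)[OF op1, of a] zs by (simp add: ops_simps(1)[abs_def])
    next
      fix a b assume "zs = [a, b]"
      then show ?thesis using op2op[of a b] zs by (simp add: ops_simps(2)[abs_def] numeral_2_eq_2)
    next
      assume "3 \<le> length zs"
      then have "ops zs = (\<lambda>_. \<zero>\<^bsub>E\<^esub>)" by (simp add: ops_simps(3) fun_eq_iff)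
      then show ?thesis using z by simp
    qed (use n in simp)
    then show "mu EA zs \<in> module_hom R (opc P (length zs)) EA"
      by (intro cE, rule module_hom_cong[rotated]) (use n zs in \<open>auto intro!: opc_module mE simp: mu_dom_def Suc_le_eq\<close>)
  next
    fix zs x t assume "mu_dom P (carrier EA) zs x" and t: "t permutes {..<length zs}"
    then have d: "mu_dom P (carrier E) zs x" by simp
    have "ops zs (act P (length zs) t x) = ops (permute_list t zs) x"
    proof (rule list_length_cases[of zs])
      assume "zs = []" then show ?thesis using d by (simp add: mu_dom_def)
    next
      fix a assume a: "zs = [a]"
      then have "t = id" using t permutes_lessThan_1 by simp
      then show ?thesis using act_id[of 1 x] d a by (simp add: mu_dom_simps)
    next
      fix a b assume a: "zs = [a, b]"
      have x: "x \<in> carrier (opc P 2)" "a \<in> carrier E" "b \<in> carrier E" using d a by (simp_all add: mu_dom_simps)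
      have "t permutes {..<2}" using t a by (simp add: numeral_2_eq_2)
      then consider "t = id" | "t = swap" using permutes_lessThan_2 by blast
      then show ?thesis
      proof cases
        case 1 then show ?thesis using act_id[of 2 x] x a by (simp add: numeral_2_eq_2)
      next
        case 2
        have "permute_list swap [a, b] = [b, a]" by (simp add: permute_list_def)
        then show ?thesis using op2_swap[OF x(2,3,1)] a 2 by (simp add: ops_simps numeral_2_eq_2)
      qed
    qed (simp add: ops_simps)
    then show "mu EA zs (act P (length zs) t x) = mu EA (permute_list t zs) x"
      using mE[OF mu_dom_act(1)[OF d t]] mE[OF mu_dom_act(2)[OF d t]] by simp
  next
    fix a assume "a \<in> carrier EA"
    then show "mu EA [a] (unit P) = a"
      using mE[of "[a]" "unit P"] op1_unit unit_closed by (simp add: mu_dom_simps ops_simps)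
  next
    fix ass xs y assume ne: "ass \<noteq> []" and "list_all2 (mu_dom P (carrier EA)) ass xs"
      and y: "y \<in> carrier (opc P (length ass))"
    then have l: "list_all2 (mu_dom P (carrier E)) ass xs" by simp
    have len: "length ass = length xs" using l by (rule list_all2_lengthD)
    have l2: "length (map2 ops ass xs) = length ass" using len by simp
    have d2: "mu_dom P (carrier E) (map2 ops ass xs) y" by (rule mu_dom_map2[OF l ops_closed ne y])
    have m: "map2 (mu EA) ass xs = map2 ops ass xs"
      using l by (induction rule: list_all2_induct) (simp_all add: mE)
    have n1: "1 \<le> length zs" if "mu_dom P (carrier E) zs x" for zs x
      using that by (simp add: mu_dom_def Suc_le_eq)
    have dx: "\<exists>x. mu_dom P (carrier E) as x" if "as \<in> set ass" for as
      using l that by (metis list_all2_conv_all_nth in_set_conv_nth)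
    have "ops (concat ass) (comp P (map length ass) xs y) = ops (map2 ops ass xs) y"
    proof (rule list_length_cases[of ass])
      fix as assume a: "ass = [as]"
      then obtain x where x: "xs = [x]" using len by (cases xs) auto
      have d: "mu_dom P (carrier E) as x" using l a x by simp
      have y1: "y \<in> carrier (opc P 1)" using y a by simp
      show ?thesis
      proof (rule list_length_cases[of as])
        assume "as = []" then show ?thesis using d by (simp add: mu_dom_def)
      next
        fix u assume u: "as = [u]"
        then show ?thesis using a x d y1 op1_op1[of u x y] by (simp add: ops_simps mu_dom_simps)
      next
        fix u v assume u: "as = [u, v]"
        then show ?thesis using a x d y1 op1_op2[of u v x y] by (simp add: ops_simps mu_dom_simps numeral_2_eq_2)
      next
        assume "3 \<le> length as"
        then show ?thesis using a x op1_zero[OF y1] by (simp add: ops_simps)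
      qed
    next
      fix as bs assume a: "ass = [as, bs]"
      then obtain x z where x: "xs = [x, z]" using len by (cases xs; cases "tl xs") auto
      have d: "mu_dom P (carrier E) as x" "mu_dom P (carrier E) bs z" using l a x by simp_all
      have y2: "y \<in> carrier (opc P 2)" using y a by (simp add: numeral_2_eq_2)
      have ln: "1 \<le> length as" "1 \<le> length bs" using n1 d by blast+
      show ?thesis
      proof (cases "length as = 1 \<and> length bs = 1")
        case True
        then obtain u v where "as = [u]" "bs = [v]" by (auto simp: length_Suc_conv)
        then show ?thesis using a x d y2 op2_op1[of u v x z y] by (simp add: ops_simps mu_dom_simps)
      next
        \<comment> \<open>An inner operation of arity at least 2 makes the right side a nested
          binary operation, which is zero, and the total arity on the left at least 3.\<close>
        case False
        then have "2 \<le> length as \<or> 2 \<le> length bs" using ln by linarith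
        then have "op2 (ops as x) (ops bs z) y = \<zero>\<^bsub>E\<^esub>"
          using op2_ops(1)[OF d(1) _ ops_closed[OF d(2)] y2] op2_ops(2)[OF d(2) _ ops_closed[OF d(1)] y2] by blast
        moreover have "3 \<le> length (as @ bs)" using False ln by simp linarith
        ultimately show ?thesis using a x by (simp add: ops_simps)
      qed
    next
      \<comment> \<open>The inner lists are nonempty, so the total arity is at least 3 as well and
        both sides are zero.\<close>
      assume a: "3 \<le> length ass"
      have "sum_list (map (\<lambda>_. 1) ass) \<le> sum_list (map length ass)"
        using dx by (intro sum_list_mono) (force simp: mu_dom_def Suc_le_eq)
      then have "3 \<le> length (concat ass)" using a by (simp add: sum_list_triv length_concat)
      then show ?thesis using a l2 ops_simps(3)[of "map2 ops ass xs" y] by (simp add: ops_simps(3))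
    qed (use ne in simp)
    then show "mu EA (concat ass) (comp P (map length ass) xs y) = mu EA (map2 (mu EA) ass xs) y"
      unfolding m mE[OF mu_dom_concat[OF ne l y]] mE[OF d2] .
  qed
qed

lemma EA_NIL2: "EA \<in> NIL2_obj R P"
  using palgebra_EA ops_simps(3) by (simp add: NIL2_obj_def mu_mk_alg)

lemma mu_EA:
  "z \<in> carrier E \<Longrightarrow> p \<in> carrier (opc P 1) \<Longrightarrow> mu EA [z] p = op1 z p"
  "z \<in> carrier E \<Longrightarrow> w \<in> carrier E \<Longrightarrow> x \<in> carrier (opc P 2) \<Longrightarrow> mu EA [z, w] x = op2 z w x"
  "mu_dom P (carrier E) zs x \<Longrightarrow> 3 \<le> length zs \<Longrightarrow> mu EA zs x = \<zero>\<^bsub>E\<^esub>"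
  by (simp_all add: mu_mk_alg mu_dom_simps ops_simps)

text \<open>Made for the inclusion of one summand: operations of arity at least 2 die on both sides,
  so that only the unary ones have to be compared.\<close>

lemma alg_hom_EA:
  fixes A :: "('r, 'a, 'p) palg"
  assumes j: "j \<in> module_hom R A E"
    and j1: "\<And>a p. \<lbrakk>a \<in> carrier A; p \<in> carrier (opc P 1)\<rbrakk> \<Longrightarrow> j (mu A [a] p) = op1 (j a) p"
    and j2: "\<And>a b x. \<lbrakk>a \<in> carrier A; b \<in> carrier A; x \<in> carrier (opc P 2)\<rbrakk> \<Longrightarrow> op2 (j a) (j b) x = \<zero>\<^bsub>E\<^esub>"
    and z: "\<And>as x. \<lbrakk>mu_dom P (carrier A) as x; 2 \<le> length as\<rbrakk> \<Longrightarrow> j (mu A as x) = \<zero>\<^bsub>E\<^esub>"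
  shows "j \<in> alg_hom R P A EA"
proof (rule alg_homI)
  note jc = module_homD(1)[OF j]
  show "j \<in> module_hom R A EA" using j by (simp add: module_hom_def)
  fix as x assume d: "mu_dom P (carrier A) as x"
  have dm: "mu_dom P (carrier E) (map j as) x" using d jc by (auto simp: mu_dom_def)
  show "j (mu A as x) = mu EA (map j as) x"
  proof (rule list_length_cases[of as])
    assume "as = []" then show ?thesis using d by (simp add: mu_dom_def)
  next
    fix a assume "as = [a]"
    then show ?thesis using d j1 mu_EA(1) jc by (simp add: mu_dom_simps)
  next
    fix a b assume "as = [a, b]"
    then show ?thesis using d j2 z[OF d] mu_EA(2) jc by (simp add: mu_dom_simps)
  qed (use z[OF d] mu_EA(3)[OF dm] in simp)
qed

end

section \<open>The two-nilpotent reflection and coproducts of two-nilpotent algebras\<close>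

context palgebra
begin

lemma nil2_quot: "nil2 R P A = quot_alg P A (J R P 3 A)" "nil2_proj R P A a = J R P 3 A +>\<^bsub>A\<^esub> a"
  by (simp_all add: nil2_def nil2_proj_def higgins3_eq_J[OF palgebra_axioms])

lemma nil2_palgebra: "palgebra R P (nil2 R P A)"
  unfolding nil2_quot by (rule quotient_palgebra.quot_palgebra[OF quotient_by_J])

lemma nil2_proj_hom: "nil2_proj R P A \<in> alg_hom R P A (nil2 R P A)"
  unfolding nil2_quot nil2_quot(2)[abs_def] by (rule quotient_palgebra.pr_hom[OF quotient_by_J])

lemma carrier_nil2: "carrier (nil2 R P A) = nil2_proj R P A ` carrier A"
  unfolding nil2_quot by (rule quotient_palgebra.quot_alg_sel(1)[OF quotient_by_J])

lemma nil2_NIL2: "nil2 R P A \<in> NIL2_obj R P"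
proof -
  interpret q: quotient_palgebra R P A "J R P 3 A" by (rule quotient_by_J)
  have "mu (nil2 R P A) Xs x = \<zero>\<^bsub>nil2 R P A\<^esub>" if "2 < length Xs" "mu_dom P (carrier (nil2 R P A)) Xs x" for Xs x
  proof -
    have "set Xs \<subseteq> carrier (quot_mod A (J R P 3 A))"
      using that(2) by (simp add: mu_dom_def nil2_quot(1) quot_alg_def)
    then have "Xs = map q.pr (map rep Xs)" "set (map rep Xs) \<subseteq> carrier A"
      using q.rep_quot by (auto simp: map_idI subset_eq)
    then obtain as where as: "Xs = map q.pr as" "set as \<subseteq> carrier A" by blast
    have d: "mu_dom P (carrier A) as x" using that(2) as by (simp add: mu_dom_def)
    have "mu A as x \<in> J R P 3 A" using that(1) as d by (intro J_gen) auto
    then have "q.pr (mu A as x) = J R P 3 A" using q.coset_zero_iff mu_closed[OF d] by simp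
    then show ?thesis using q.mu_quot[OF d] as(1) by (simp add: nil2_quot(1) q.quot_alg_sel(3))
  qed
  then show ?thesis using nil2_palgebra by (simp add: NIL2_obj_def)
qed

text \<open>A homomorphism maps \<open>J R P 3 A\<close> into \<open>J R P 3 D\<close>, which is
  zero; so it factors through the quotient. This is the universal property of the
  reflection.\<close>

lemma nil2_lift:
  assumes "D \<in> NIL2_obj R P" "f \<in> alg_hom R P A D"
  shows "(\<lambda>X. f (rep X)) \<in> alg_hom R P (nil2 R P A) D"
    and "a \<in> carrier A \<Longrightarrow> f (rep (nil2_proj R P A a)) = f a"
proof -
  have D: "palgebra R P D" using assms(1) by (simp add: NIL2_obj_def)
  have z: "f x = \<zero>\<^bsub>D\<^esub>" if "x \<in> J R P 3 A" for x
    using alg_hom_J[OF palgebra_axioms D assms(2) that] J3_zero_iff[OF D] assms(1) by simp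
  show "(\<lambda>X. f (rep X)) \<in> alg_hom R P (nil2 R P A) D"
    unfolding nil2_quot by (rule quotient_palgebra.quot_alg_lift[OF quotient_by_J D assms(2) z])
  show "a \<in> carrier A \<Longrightarrow> f (rep (nil2_proj R P A a)) = f a"
    unfolding nil2_quot by (rule quotient_palgebra.hom_rep_pr[OF quotient_by_J D assms(2) z])
qed

end

lemma NIL2_objD:
  assumes "D \<in> NIL2_obj R P"
  shows "palgebra R P D" "mu_dom P (carrier D) as x \<Longrightarrow> 3 \<le> length as \<Longrightarrow> mu D as x = \<zero>\<^bsub>D\<^esub>"
  using assms by (auto simp: NIL2_obj_def)

lemma nil2_map_hom:
  assumes A: "palgebra R P A" and A': "palgebra R P A'" and f: "f \<in> alg_hom R P A A'"
  shows "nil2_map R P A' f \<in> alg_hom R P (nil2 R P A) (nil2 R P A')"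
    and "a \<in> carrier A \<Longrightarrow> nil2_map R P A' f (nil2_proj R P A a) = nil2_proj R P A' (f a)"
proof -
  interpret A: palgebra R P A by fact
  interpret A': palgebra R P A' by fact
  have e: "nil2_map R P A' f = (\<lambda>X. nil2_proj R P A' (f (rep X)))"
    by (simp add: nil2_map_def quot_map_def nil2_proj_def fun_eq_iff)
  note h = alg_hom_compose[OF f A'.nil2_proj_hom]
  show "nil2_map R P A' f \<in> alg_hom R P (nil2 R P A) (nil2 R P A')"
    unfolding e by (rule A.nil2_lift(1)[OF A'.nil2_NIL2 h])
  show "a \<in> carrier A \<Longrightarrow> nil2_map R P A' f (nil2_proj R P A a) = nil2_proj R P A' (f a)"
    unfolding e by (rule A.nil2_lift(2)[OF A'.nil2_NIL2 h])
qed

locale nil_coproduct = X: palgebra R P X + Y: palgebra R P Y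
  for R :: "'r ring" and P :: "('r, 'p) operad"
    and X :: "('r, 'a, 'p) palg" and Y :: "('r, 'b, 'p) palg"
begin

abbreviation "C2 \<equiv> coprod2 R P X Y"
abbreviation "l2 \<equiv> inl2 R P X Y"
abbreviation "r2 \<equiv> inr2 R P X Y"

lemmas pX = X.palgebra_axioms and pY = Y.palgebra_axioms
lemmas pC = palgebra_coprod[OF pX pY]

sublocale C: palgebra R P "coprod R P X Y" by (rule pC)

lemma C2_NIL2: "C2 \<in> NIL2_obj R P" unfolding coprod2_def by (rule C.nil2_NIL2)
lemma pC2: "palgebra R P C2" unfolding coprod2_def by (rule C.nil2_palgebra)
sublocale C2: palgebra R P C2 by (rule pC2)

lemma l2_hom: "l2 \<in> alg_hom R P X C2"
  unfolding coprod2_def inl2_def[abs_def] by (rule alg_hom_compose[OF inl_alg_hom[OF pX pY] C.nil2_proj_hom])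
lemma r2_hom: "r2 \<in> alg_hom R P Y C2"
  unfolding coprod2_def inr2_def[abs_def] by (rule alg_hom_compose[OF inr_alg_hom[OF pX pY] C.nil2_proj_hom])

text \<open>The universal property of the coproduct among two-nilpotent algebras: the copairing
  factors through the reflection because \<open>D\<close> is two-nilpotent.\<close>

lemma copair2_props:
  assumes D: "D \<in> NIL2_obj R P" and f: "f \<in> alg_hom R P X D" and g: "g \<in> alg_hom R P Y D"
  shows "copair2 D f g \<in> alg_hom R P C2 D"
    and "x \<in> carrier X \<Longrightarrow> copair2 D f g (l2 x) = f x"
    and "y \<in> carrier Y \<Longrightarrow> copair2 D f g (r2 y) = g y"
proof -
  note pD = NIL2_objD(1)[OF D]
  note h = copair_alg_hom[OF pX pY pD f g]
  show "copair2 D f g \<in> alg_hom R P C2 D"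
    unfolding coprod2_def copair2_def[abs_def] by (rule C.nil2_lift(1)[OF D h])
  show "copair2 D f g (l2 x) = f x" if "x \<in> carrier X"
    unfolding copair2_def inl2_def C.nil2_lift(2)[OF D h alg_homD(1)[OF inl_alg_hom[OF pX pY] that]]
    by (rule copair_of_inl[OF pX pY pD f g that])
  show "copair2 D f g (r2 y) = g y" if "y \<in> carrier Y"
    unfolding copair2_def inr2_def C.nil2_lift(2)[OF D h alg_homD(1)[OF inr_alg_hom[OF pX pY] that]]
    by (rule copair_of_inr[OF pX pY pD f g that])
qed

lemma C2_generated:
  assumes S: "submodule S R C2" and l: "\<And>x. x \<in> carrier X \<Longrightarrow> l2 x \<in> S" and r: "\<And>y. y \<in> carrier Y \<Longrightarrow> r2 y \<in> S"
    and m: "\<And>ws x. mu_dom P S ws x \<Longrightarrow> mu C2 ws x \<in> S"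
  shows "carrier C2 \<subseteq> S"
proof -
  let ?C = "coprod R P X Y" let ?q = "nil2_proj R P ?C"
  have q: "?q \<in> alg_hom R P ?C C2" unfolding coprod2_def by (rule C.nil2_proj_hom)
  let ?S = "{w \<in> carrier ?C. ?q w \<in> S}"
  have "carrier ?C \<subseteq> ?S"
  proof (rule coprod_generated[OF pX pY])
    show "submodule ?S R ?C"
      by (rule submodule_vimage[OF C.module_axioms C2.module_axioms alg_hom_module_hom[OF q] S])
    fix x assume "x \<in> carrier X"
    then show "inl R P X Y x \<in> ?S" using l alg_homD(1)[OF inl_alg_hom[OF pX pY]] by (simp add: inl2_def)
  next
    fix y assume "y \<in> carrier Y"
    then show "inr R P X Y y \<in> ?S" using r alg_homD(1)[OF inr_alg_hom[OF pX pY]] by (simp add: inr2_def)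
  next
    fix ws x assume d: "mu_dom P ?S ws x"
    then have d1: "mu_dom P (carrier ?C) ws x" by (auto simp: mu_dom_def)
    have "mu_dom P S (map ?q ws) x" using d by (auto simp: mu_dom_def)
    then have "?q (mu ?C ws x) \<in> S" using m alg_homD(4)[OF q d1] by simp
    then show "mu ?C ws x \<in> ?S" using C.mu_closed[OF d1] by simp
  qed
  then show ?thesis unfolding coprod2_def C.carrier_nil2 by blast
qed

lemma C2_nil3: "u \<in> C2.ops_ge 3 \<Longrightarrow> u = \<zero>\<^bsub>C2\<^esub>"
  using NIL2_objD(2)[OF C2_NIL2] by blast

text \<open>The images of the two summands are closed under unary operations, so
  \<open>span_of_generators\<close> applies. The operations of arity at least 3 in the span are zero
  by \<open>C2_nil3\<close>.\<close>

lemma C2_span: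
  "carrier C2 \<subseteq> mspan R C2 (l2 ` carrier X \<union> r2 ` carrier Y \<union>
     {mu C2 [g, g'] x | g g' x. g \<in> l2 ` carrier X \<union> r2 ` carrier Y \<and>
        g' \<in> l2 ` carrier X \<union> r2 ` carrier Y \<and> x \<in> carrier (opc P 2)} \<union> C2.ops_ge 3)"
proof (rule C2.span_of_generators)
  show "l2 ` carrier X \<union> r2 ` carrier Y \<subseteq> carrier C2"
    using alg_homD(1)[OF l2_hom] alg_homD(1)[OF r2_hom] by blast
  fix g p assume g: "g \<in> l2 ` carrier X \<union> r2 ` carrier Y" and p: "p \<in> carrier (opc P 1)"
  have l: "mu C2 [l2 x] p = l2 (mu X [x] p)" if "x \<in> carrier X" for x
    using alg_homD(4)[OF l2_hom, of "[x]" p] that p by (simp add: mu_dom_simps)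
  have r: "mu C2 [r2 y] p = r2 (mu Y [y] p)" if "y \<in> carrier Y" for y
    using alg_homD(4)[OF r2_hom, of "[y]" p] that p by (simp add: mu_dom_simps)
  show "mu C2 [g] p \<in> l2 ` carrier X \<union> r2 ` carrier Y"
    using g l r X.mu1_closed[OF _ p] Y.mu1_closed[OF _ p] by auto
next
  fix S assume "submodule S R C2" "l2 ` carrier X \<union> r2 ` carrier Y \<subseteq> S" "\<And>as x. mu_dom P S as x \<Longrightarrow> mu C2 as x \<in> S"
  then show "carrier C2 \<subseteq> S" by (intro C2_generated) blast+
qed

text \<open>The nested operation has total arity at least 3, hence is zero in
  \<open>C2\<close>.\<close>

lemma mu2_mu2_zero:
  assumes "u \<in> C2.ops_ge 2" "w \<in> carrier C2" "x \<in> carrier (opc P 2)"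
  shows "mu C2 [u, w] x = \<zero>\<^bsub>C2\<^esub>" "mu C2 [w, u] x = \<zero>\<^bsub>C2\<^esub>"
proof -
  have uc: "u \<in> carrier C2" using assms(1) C2.ops_ge_closed by blast
  have "mu_dom P (carrier C2) ([] @ u # [w]) x" "mu_dom P (carrier C2) ([w] @ u # []) x"
    unfolding append.simps mu_dom_simps using uc assms(2,3) by blast+
  from this[THEN C2.ops_ge_absorb[OF assms(1)]]
  show "mu C2 [u, w] x = \<zero>\<^bsub>C2\<^esub>" "mu C2 [w, u] x = \<zero>\<^bsub>C2\<^esub>" by (intro C2_nil3; simp)+
qed

definition "K2 = {w \<in> carrier C2. copair2 X id (zmap X) w = \<zero>\<^bsub>X\<^esub> \<and> copair2 Y (zmap Y) id w = \<zero>\<^bsub>Y\<^esub>}"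

lemma cosmash2_eq: "cosmash2 R P X Y = sub_alg P C2 K2"
  by (simp add: cosmash2_def a_kernel_def' prod_alg_def K2_def)

end

lemma sub_alg_sel [simp]:
  "carrier (sub_alg P A K) = K" "zero (sub_alg P A K) = zero A" "add (sub_alg P A K) = add A"
  "smult (sub_alg P A K) = smult A"
  by (simp_all add: sub_alg_def)

lemma mu_sub_alg: "mu_dom P K as x \<Longrightarrow> mu (sub_alg P A K) as x = mu A as x"
  by (simp add: sub_alg_def mu_mk_alg)

text \<open>\<open>prod_alg\<close> serves below as a direct sum of modules, for the test algebra
  and for the decomposition of the coproduct.\<close>

lemma module_prod_alg:
  assumes "module R A" "module R B" shows "module R (prod_alg P A B)"
proof -
  interpret A: module R A by fact
  interpret B: module R B by fact
  show ?thesis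
  proof (rule moduleI)
    show "abelian_group (prod_alg P A B)"
    proof (rule abelian_groupI)
      fix x assume "x \<in> carrier (prod_alg P A B)"
      then obtain a b where x: "x = (a, b)" "a \<in> carrier A" "b \<in> carrier B" by (auto simp: prod_alg_def)
      then have "(\<ominus>\<^bsub>A\<^esub> a, \<ominus>\<^bsub>B\<^esub> b) \<oplus>\<^bsub>prod_alg P A B\<^esub> x = \<zero>\<^bsub>prod_alg P A B\<^esub>"
        by (simp add: prod_alg_def A.l_neg B.l_neg)
      moreover have "(\<ominus>\<^bsub>A\<^esub> a, \<ominus>\<^bsub>B\<^esub> b) \<in> carrier (prod_alg P A B)" using x by (simp add: prod_alg_def)
      ultimately show "\<exists>y\<in>carrier (prod_alg P A B). y \<oplus>\<^bsub>prod_alg P A B\<^esub> x = \<zero>\<^bsub>prod_alg P A B\<^esub>" by blast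
    qed (auto simp: prod_alg_def A.a_ac B.a_ac)
  qed (auto simp: prod_alg_def A.smult_l_distr A.smult_r_distr A.smult_assoc1
      B.smult_l_distr B.smult_r_distr B.smult_assoc1 A.R.is_cring)
qed

lemma prod_alg_sel:
  "carrier (prod_alg P A B) = carrier A \<times> carrier B" "\<zero>\<^bsub>prod_alg P A B\<^esub> = (\<zero>\<^bsub>A\<^esub>, \<zero>\<^bsub>B\<^esub>)"
  "(a, b) \<oplus>\<^bsub>prod_alg P A B\<^esub> (a', b') = (a \<oplus>\<^bsub>A\<^esub> a', b \<oplus>\<^bsub>B\<^esub> b')"
  "r \<odot>\<^bsub>prod_alg P A B\<^esub> (a, b) = (r \<odot>\<^bsub>A\<^esub> a, r \<odot>\<^bsub>B\<^esub> b)"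
  by (simp_all add: prod_alg_def)

section \<open>The test algebra and the canonical map\<close>

context palgebra_pair
begin

text \<open>\<open>g3\<close> as a function of classes, since the components of elements of
  \<open>EE\<close> are classes without chosen representatives.\<close>

definition hh where "hh m n x = H (pure R M N m n) x"

lemma hh_closed: "m \<in> carrier M \<Longrightarrow> n \<in> carrier N \<Longrightarrow> x \<in> carrier (opc P 2) \<Longrightarrow> hh m n x \<in> carrier T"
  unfolding hh_def by (rule bilinear_closed[OF H_bilinear bilinear_closed[OF pure_bilinear[OF mM mN]]])

lemma hh_hom:
  shows "n \<in> carrier N \<Longrightarrow> x \<in> carrier (opc P 2) \<Longrightarrow> (\<lambda>m. hh m n x) \<in> module_hom R M T"
    and "m \<in> carrier M \<Longrightarrow> x \<in> carrier (opc P 2) \<Longrightarrow> (\<lambda>n. hh m n x) \<in> module_hom R N T"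
    and "m \<in> carrier M \<Longrightarrow> n \<in> carrier N \<Longrightarrow> (\<lambda>x. hh m n x) \<in> module_hom R (opc P 2) T"
  unfolding hh_def
  by (rule module_hom_compose[OF bilinearD(1)[OF pure_bilinear[OF mM mN]] bilinearD(1)[OF H_bilinear]], assumption+)
    (rule module_hom_compose[OF bilinearD(2)[OF pure_bilinear[OF mM mN]] bilinearD(1)[OF H_bilinear]], assumption+,
     rule bilinearD(2)[OF H_bilinear bilinear_closed[OF pure_bilinear[OF mM mN]]], assumption+)

lemma hh_zero:
  "n \<in> carrier N \<Longrightarrow> x \<in> carrier (opc P 2) \<Longrightarrow> hh \<zero>\<^bsub>M\<^esub> n x = \<zero>\<^bsub>T\<^esub>"
  "m \<in> carrier M \<Longrightarrow> x \<in> carrier (opc P 2) \<Longrightarrow> hh m \<zero>\<^bsub>N\<^esub> x = \<zero>\<^bsub>T\<^esub>"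
  using module_hom_zero[OF mM mT hh_hom(1)] module_hom_zero[OF mN mT hh_hom(2)] by blast+

lemma hh_tmul:
  assumes "m \<in> carrier M" "n \<in> carrier N" "x \<in> carrier (opc P 2)" "p \<in> carrier (opc P 1)"
  shows "tmul p (hh m n x) = hh m n (comp P [2] [x] p)"
proof -
  obtain a b where "a \<in> carrier A" "m = ca a" "b \<in> carrier B" "n = cb b" using assms ca_onto cb_onto by blast
  then show ?thesis using tmul_hom_gen(2)[OF assms(4) _ _ assms(3)] by (simp add: hh_def g3_eq)
qed

lemma hh_balanced:
  assumes "m \<in> carrier M" "n \<in> carrier N" "p \<in> carrier (opc P 1)" "q \<in> carrier (opc P 1)" "x \<in> carrier (opc P 2)"
  shows "hh (mu M [m] p) (mu N [n] q) x = hh m n (comp P [1, 1] [p, q] x)"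
proof -
  obtain a b where ab: "a \<in> carrier A" "m = ca a" "b \<in> carrier B" "n = cb b" using assms ca_onto cb_onto by blast
  then show ?thesis using g3_balanced[OF ab(1,3) assms(3-5)] assms(3,4) by (simp add: hh_def g3_eq ca_mu1 cb_mu1 del: One_nat_def)
qed

abbreviation "sw \<equiv> act P 2 A.swap"

lemma sw_closed: "x \<in> carrier (opc P 2) \<Longrightarrow> sw x \<in> carrier (opc P 2)"
  by (rule module_homD(1)[OF A.act_hom])

definition "EE = prod_alg P M (prod_alg P N TA)"

lemma mEE: "module R EE" unfolding EE_def by (intro module_prod_alg mM mN mTA)

lemma EE_sel:
  "carrier EE = carrier M \<times> carrier N \<times> carrier T" "\<zero>\<^bsub>EE\<^esub> = (\<zero>\<^bsub>M\<^esub>, \<zero>\<^bsub>N\<^esub>, \<zero>\<^bsub>T\<^esub>)"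
  "(m, n, t) \<oplus>\<^bsub>EE\<^esub> (m', n', t') = (m \<oplus>\<^bsub>M\<^esub> m', n \<oplus>\<^bsub>N\<^esub> n', t \<oplus>\<^bsub>T\<^esub> t')"
  "r \<odot>\<^bsub>EE\<^esub> (m, n, t) = (r \<odot>\<^bsub>M\<^esub> m, r \<odot>\<^bsub>N\<^esub> n, r \<odot>\<^bsub>T\<^esub> t)"
  by (simp_all add: EE_def prod_alg_sel)

definition "eop1 z p = (case z of (m, n, t) \<Rightarrow> (mu M [m] p, mu N [n] p, tmul p t))"
text \<open>Only mixed terms survive: operations inside one summand vanish modulo
  \<open>J R P 2\<close>, and those involving \<open>t\<close> or \<open>t'\<close> are nested. The
  swap in the second term is due to the class from \<open>A\<close> being the second argument
  there.\<close>

definition "eop2 z w x = (case z of (m, n, t) \<Rightarrow> case w of (m', n', t') \<Rightarrow>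
  (\<zero>\<^bsub>M\<^esub>, \<zero>\<^bsub>N\<^esub>, hh m n' x \<oplus>\<^bsub>T\<^esub> hh m' n (sw x)))"

lemma nil2_structure_EE: "nil2_structure R P EE eop1 eop2"
proof (intro nil2_structure.intro nil2_structure_axioms.intro A.operad_axioms mEE)
  show "eop1 \<in> bilinear R EE (opc P 1) EE"
  proof (rule bilinearI)
    fix p assume p: "p \<in> carrier (opc P 1)"
    show "(\<lambda>z. eop1 z p) \<in> module_hom R EE EE"
      using module_homD[OF M.mu1_hom[OF p]] module_homD[OF N.mu1_hom[OF p]] module_homD[OF tmul_hom_gen(1)[OF p]]
      by (intro module_homI) (auto simp: EE_sel eop1_def)
  next
    fix z assume "z \<in> carrier EE"
    then obtain m n t where z: "z = (m, n, t)" "m \<in> carrier M" "n \<in> carrier N" "t \<in> carrier T" by (auto simp: EE_sel)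
    then show "(\<lambda>p. eop1 z p) \<in> module_hom R (opc P 1) EE"
      using module_homD[OF M.mu1_hom_op[OF z(2)]] module_homD[OF N.mu1_hom_op[OF z(3)]]
        module_homD[OF tmul_hom_op[OF z(4)]]
      by (intro module_homI) (auto simp: EE_sel eop1_def)
  qed
next
  fix w x assume "w \<in> carrier EE" and x: "x \<in> carrier (opc P 2)"
  then obtain m n t where w: "w = (m, n, t)" "m \<in> carrier M" "n \<in> carrier N" "t \<in> carrier T" by (auto simp: EE_sel)
  note s = sw_closed[OF x]
  note h1 = module_homD[OF hh_hom(1)[OF w(3) x]] module_homD[OF hh_hom(2)[OF w(2) s]]
  note h2 = module_homD[OF hh_hom(2)[OF w(2) x]] module_homD[OF hh_hom(1)[OF w(3) s]]
  show "(\<lambda>z. eop2 z w x) \<in> module_hom R EE EE"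
    using h1 by (intro module_homI) (auto simp: EE_sel eop2_def w(1) T.a_ac T.smult_r_distr)
  show "(\<lambda>z. eop2 w z x) \<in> module_hom R EE EE"
    using h2 by (intro module_homI) (auto simp: EE_sel eop2_def w(1) T.a_ac T.smult_r_distr)
next
  fix z w assume "z \<in> carrier EE" "w \<in> carrier EE"
  then obtain m n t m' n' t' where zw: "z = (m, n, t)" "m \<in> carrier M" "n \<in> carrier N" "t \<in> carrier T"
    "w = (m', n', t')" "m' \<in> carrier M" "n' \<in> carrier N" "t' \<in> carrier T" by (auto simp: EE_sel)
  note h = module_homD[OF hh_hom(3)[OF zw(2,7)]]
    module_homD[OF module_hom_compose[OF A.act_hom hh_hom(3)[OF zw(6,3)]]]
  show "(\<lambda>x. eop2 z w x) \<in> module_hom R (opc P 2) EE"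
    using h by (intro module_homI) (auto simp: EE_sel eop2_def zw(1,5) T.a_ac T.smult_r_distr)
  fix x assume x: "x \<in> carrier (opc P 2)"
  note s = sw_closed[OF x]
  \<comment> \<open>The two terms of \<open>eop2\<close> change places, since the swap is an
    involution.\<close>
  show "eop2 z w (sw x) = eop2 w z x"
    using T.a_comm[OF hh_closed[OF zw(2,7) s] hh_closed[OF zw(6,3) x]]
    by (simp add: eop2_def zw(1,5) A.act_act[OF x] del: One_nat_def)
  {
    fix q assume q: "q \<in> carrier (opc P 1)"
    have "tmul q (hh m n' x \<oplus>\<^bsub>T\<^esub> hh m' n (sw x)) = hh m n' (comp P [2] [x] q) \<oplus>\<^bsub>T\<^esub> hh m' n (sw (comp P [2] [x] q))"
      unfolding module_homD(2)[OF tmul_hom_gen(1)[OF q] hh_closed[OF zw(2,7) x] hh_closed[OF zw(6,3) s]]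
        hh_tmul[OF zw(2,7) x q] hh_tmul[OF zw(6,3) s q] A.comp2_act[OF x q] ..
    then show "eop1 (eop2 z w x) q = eop2 z w (comp P [2] [x] q)"
      using module_hom_zero[OF mM mM M.mu1_hom[OF q]] module_hom_zero[OF mN mN N.mu1_hom[OF q]]
      by (simp add: eop1_def eop2_def zw(1,5))
  next
    fix v y assume "v \<in> carrier EE" and y: "y \<in> carrier (opc P 2)"
    then obtain m2 n2 t2 where v: "v = (m2, n2, t2)" "m2 \<in> carrier M" "n2 \<in> carrier N" by (auto simp: EE_sel)
    \<comment> \<open>A value of \<open>eop2\<close> has zero components in \<open>M\<close> and
      \<open>N\<close>, and these are the only components on which \<open>eop2\<close>
      depends.\<close>
    then show "eop2 (eop2 z w x) v y = \<zero>\<^bsub>EE\<^esub>"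
      using hh_zero y sw_closed[OF y] by (simp add: eop2_def zw(1,5) EE_sel)
  next
    fix p q assume p: "p \<in> carrier (opc P 1)" and q: "q \<in> carrier (opc P 1)"
    \<comment> \<open>In the second term the arguments are exchanged, so balancing produces
      \<open>q\<close> before \<open>p\<close>; \<open>comp11_act\<close> moves them past the swap
      and restores the order.\<close>
    show "eop2 (eop1 z p) (eop1 w q) x = eop2 z w (comp P [1, 1] [p, q] x)"
      using hh_balanced[OF zw(2,7) p q x] hh_balanced[OF zw(6,3) q p s] A.comp11_act[OF q p x]
      by (simp add: eop1_def eop2_def zw(1,5))
  }
next
  fix z assume "z \<in> carrier EE"
  then show "eop1 z (unit P) = z"
    by (auto simp: EE_sel eop1_def M.mu_unit N.mu_unit tmul_unit)
  fix p q assume "p \<in> carrier (opc P 1)" "q \<in> carrier (opc P 1)"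
  then show "eop1 (eop1 z p) q = eop1 z (comp P [1] [p] q)"
    using \<open>z \<in> carrier EE\<close> by (auto simp: EE_sel eop1_def M.mu1_mu1 N.mu1_mu1 tmul_tmul simp del: One_nat_def)
qed

sublocale E: nil2_structure R P EE eop1 eop2 by (rule nil2_structure_EE)

lemma tmul_zero: "p \<in> carrier (opc P 1) \<Longrightarrow> tmul p \<zero>\<^bsub>T\<^esub> = \<zero>\<^bsub>T\<^esub>"
  by (rule module_hom_zero[OF mT mT tmul_hom_gen(1)])

lemma mu_zero1: "p \<in> carrier (opc P 1) \<Longrightarrow> mu M [\<zero>\<^bsub>M\<^esub>] p = \<zero>\<^bsub>M\<^esub>" "p \<in> carrier (opc P 1) \<Longrightarrow> mu N [\<zero>\<^bsub>N\<^esub>] p = \<zero>\<^bsub>N\<^esub>"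
  by (rule module_hom_zero[OF mM mM M.mu1_hom], assumption) (rule module_hom_zero[OF mN mN N.mu1_hom])

definition "jA a = (ca a, \<zero>\<^bsub>N\<^esub>, \<zero>\<^bsub>T\<^esub>)"
definition "jB b = (\<zero>\<^bsub>M\<^esub>, cb b, \<zero>\<^bsub>T\<^esub>)"

text \<open>Operations of arity at least 2 lie in \<open>J R P 2 A\<close> and have class zero,
  while \<open>eop2\<close> only pairs components from different summands.\<close>

lemma jA_hom: "jA \<in> alg_hom R P A E.EA"
proof (rule E.alg_hom_EA)
  show "jA \<in> module_hom R A EE"
    using alg_homD(1-3)[OF ca_hom] by (intro module_homI) (simp_all add: EE_sel jA_def)
  show "jA (mu A [a] p) = eop1 (jA a) p" if "a \<in> carrier A" "p \<in> carrier (opc P 1)" for a p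
    using ca_mu1[OF that] tmul_zero[OF that(2)] mu_zero1(2)[OF that(2)] by (simp add: jA_def eop1_def)
  show "eop2 (jA a) (jA b) x = \<zero>\<^bsub>EE\<^esub>" if "a \<in> carrier A" "b \<in> carrier A" "x \<in> carrier (opc P 2)" for a b x
    using hh_zero(2)[OF alg_homD(1)[OF ca_hom that(1)] that(3)]
      hh_zero(2)[OF alg_homD(1)[OF ca_hom that(2)] sw_closed[OF that(3)]]
    by (simp add: jA_def eop2_def EE_sel)
  show "jA (mu A as x) = \<zero>\<^bsub>EE\<^esub>" if "mu_dom P (carrier A) as x" "2 \<le> length as" for as x
    using ca_zero[OF A.J_gen[OF that(2,1)]] by (simp add: jA_def EE_sel)
qed

lemma jB_hom: "jB \<in> alg_hom R P B E.EA"
proof (rule E.alg_hom_EA)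
  show "jB \<in> module_hom R B EE"
    using alg_homD(1-3)[OF cb_hom] by (intro module_homI) (simp_all add: EE_sel jB_def)
  show "jB (mu B [b] p) = eop1 (jB b) p" if "b \<in> carrier B" "p \<in> carrier (opc P 1)" for b p
    using cb_mu1[OF that] tmul_zero[OF that(2)] mu_zero1(1)[OF that(2)] by (simp add: jB_def eop1_def)
  show "eop2 (jB a) (jB b) x = \<zero>\<^bsub>EE\<^esub>" if "a \<in> carrier B" "b \<in> carrier B" "x \<in> carrier (opc P 2)" for a b x
    using hh_zero(1)[OF alg_homD(1)[OF cb_hom that(2)] that(3)]
      hh_zero(1)[OF alg_homD(1)[OF cb_hom that(1)] sw_closed[OF that(3)]]
    by (simp add: jB_def eop2_def EE_sel)
  show "jB (mu B as x) = \<zero>\<^bsub>EE\<^esub>" if "mu_dom P (carrier B) as x" "2 \<le> length as" for as x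
    using cb_zero[OF B.J_gen[OF that(2,1)]] by (simp add: jB_def EE_sel)
qed

abbreviation "XA \<equiv> nil2 R P A"
abbreviation "YB \<equiv> nil2 R P B"
abbreviation "prA \<equiv> nil2_proj R P A"
abbreviation "prB \<equiv> nil2_proj R P B"

sublocale nc: nil_coproduct R P XA YB
  by (intro nil_coproduct.intro A.nil2_palgebra B.nil2_palgebra)

abbreviation "CB \<equiv> coprod2 R P XA YB"

definition "u a = nc.l2 (prA a)"
definition "v b = nc.r2 (prB b)"

lemma u_hom: "u \<in> alg_hom R P A CB"
  unfolding u_def[abs_def] by (rule alg_hom_compose[OF A.nil2_proj_hom nc.l2_hom])
lemma v_hom: "v \<in> alg_hom R P B CB"
  unfolding v_def[abs_def] by (rule alg_hom_compose[OF B.nil2_proj_hom nc.r2_hom])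

lemma u_closed: "a \<in> carrier A \<Longrightarrow> u a \<in> carrier CB" by (rule alg_homD(1)[OF u_hom])
lemma v_closed: "b \<in> carrier B \<Longrightarrow> v b \<in> carrier CB" by (rule alg_homD(1)[OF v_hom])

lemma hom_ops_ge:
  assumes "palgebra R P D" "palgebra R P D'" "f \<in> alg_hom R P D D'" "g \<in> palgebra.ops_ge P D n"
  shows "f g \<in> palgebra.ops_ge P D' n"
proof -
  obtain as x where g: "g = mu D as x" "n \<le> length as" "mu_dom P (carrier D) as x" using assms(4) by blast
  have "mu_dom P (carrier D') (map f as) x" using alg_homD(1)[OF assms(3)] by (intro mu_dom_map[OF _ g(3)]) auto
  moreover have "f g = mu D' (map f as) x" using alg_homD(4)[OF assms(3) g(3)] g(1) by simp
  ultimately show ?thesis using g(2) by force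
qed

text \<open>The formula x(a, b) respects the relations of \<open>T\<close>: balancing is
  compatibility with composition, and an argument that is itself an operation of arity at least 2
  makes the total arity at least 3, which gives zero in \<open>CB\<close>.\<close>

lemma canonical_map:
  obtains \<phi> where "\<phi> \<in> module_hom R T CB"
    "\<And>a b x. a \<in> carrier A \<Longrightarrow> b \<in> carrier B \<Longrightarrow> x \<in> carrier (opc P 2) \<Longrightarrow> \<phi> (g3 a b x) = mu CB [u a, v b] x"
proof (rule T_lift[OF nc.C2.module_axioms])
  fix b x assume "b \<in> carrier B" "x \<in> carrier (opc P 2)"
  then show "(\<lambda>a. mu CB [u a, v b] x) \<in> module_hom R A CB"
    by (intro module_hom_compose[OF alg_hom_module_hom[OF u_hom] nc.C2.mu2_hom_l] v_closed)
next
  fix a x assume "a \<in> carrier A" "x \<in> carrier (opc P 2)"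
  then show "(\<lambda>b. mu CB [u a, v b] x) \<in> module_hom R B CB"
    by (intro module_hom_compose[OF alg_hom_module_hom[OF v_hom] nc.C2.mu2_hom_r] u_closed)
next
  fix a b assume ab: "a \<in> carrier A" "b \<in> carrier B"
  then show "(\<lambda>x. mu CB [u a, v b] x) \<in> module_hom R (opc P 2) CB"
    by (intro nc.C2.mu2_hom_op u_closed v_closed)
  fix p q x assume pqx: "p \<in> carrier (opc P 1)" "q \<in> carrier (opc P 1)" "x \<in> carrier (opc P 2)"
  have "u (mu A [a] p) = mu CB [u a] p" "v (mu B [b] q) = mu CB [v b] q"
    using alg_homD(4)[OF u_hom, of "[a]" p] alg_homD(4)[OF v_hom, of "[b]" q] ab pqx by (simp_all add: mu_dom_simps)
  then show "mu CB [u (mu A [a] p), v (mu B [b] q)] x = mu CB [u a, v b] (comp P [1, 1] [p, q] x)"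
    using nc.C2.mu2_mu1[OF u_closed[OF ab(1)] v_closed[OF ab(2)] pqx] by simp
next
  fix a b x assume a: "a \<in> A.ops_ge 2" and b: "b \<in> carrier B" and x: "x \<in> carrier (opc P 2)"
  show "mu CB [u a, v b] x = \<zero>\<^bsub>CB\<^esub>"
    by (rule nc.mu2_mu2_zero(1)[OF hom_ops_ge[OF A.palgebra_axioms nc.pC2 u_hom a] v_closed[OF b] x])
next
  fix a b x assume a: "a \<in> carrier A" and b: "b \<in> B.ops_ge 2" and x: "x \<in> carrier (opc P 2)"
  show "mu CB [u a, v b] x = \<zero>\<^bsub>CB\<^esub>"
    by (rule nc.mu2_mu2_zero(2)[OF hom_ops_ge[OF B.palgebra_axioms nc.pC2 v_hom b] u_closed[OF a] x])
qed (rule that)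

end

section \<open>The canonical isomorphism, its symmetry and naturality\<close>

context palgebra_pair
begin

definition "PHI = copair2 E.EA (\<lambda>X. jA (rep X)) (\<lambda>Y. jB (rep Y))"

lemma PHI:
  shows PHI_hom: "PHI \<in> alg_hom R P CB E.EA"
    and PHI_u: "a \<in> carrier A \<Longrightarrow> PHI (u a) = jA a"
    and PHI_v: "b \<in> carrier B \<Longrightarrow> PHI (v b) = jB b"
proof -
  note fA = A.nil2_lift[OF E.EA_NIL2 jA_hom] and fB = B.nil2_lift[OF E.EA_NIL2 jB_hom]
  note k = nc.copair2_props[OF E.EA_NIL2 fA(1) fB(1)]
  show "PHI \<in> alg_hom R P CB E.EA" unfolding PHI_def by (rule k(1))
  show "PHI (u a) = jA a" if "a \<in> carrier A"
    unfolding PHI_def u_def k(2)[OF alg_homD(1)[OF A.nil2_proj_hom that]] by (rule fA(2)[OF that])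
  show "PHI (v b) = jB b" if "b \<in> carrier B"
    unfolding PHI_def v_def k(3)[OF alg_homD(1)[OF B.nil2_proj_hom that]] by (rule fB(2)[OF that])
qed

lemma hom_mu2:
  assumes "f \<in> alg_hom R P D D'" "z \<in> carrier D" "w \<in> carrier D" "x \<in> carrier (opc P 2)"
  shows "f (mu D [z, w] x) = mu D' [f z, f w] x"
  using alg_homD(4)[OF assms(1), of "[z, w]" x] assms(2-4) by (simp add: mu_dom_simps)

lemma bilin_eq: "bilin R P A B = sub_alg P CB nc.K2"
  by (simp add: bilin_def nc.cosmash2_eq)

context
  fixes \<phi>
  assumes phi: "\<phi> \<in> module_hom R T CB"
    and phi_g3: "\<And>a b x. a \<in> carrier A \<Longrightarrow> b \<in> carrier B \<Longrightarrow> x \<in> carrier (opc P 2) \<Longrightarrow> \<phi> (g3 a b x) = mu CB [u a, v b] x"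
begin

text \<open>The test algebra recovers the tensor from its image in the coproduct, which makes
  \<open>\<phi>\<close> injective. Both sides are linear in z, so it is enough to evaluate on
  \<open>g3 a b x\<close>.\<close>

lemma PHI_phi: assumes z: "z \<in> carrier T" shows "PHI (\<phi> z) = (\<zero>\<^bsub>M\<^esub>, \<zero>\<^bsub>N\<^esub>, z)"
proof (rule T_hom_eqI[OF palgebra.axioms(2)[OF E.palgebra_EA] module_hom_compose[OF phi alg_hom_module_hom[OF PHI_hom]] _ _ z])
  show "(\<lambda>z. (\<zero>\<^bsub>M\<^esub>, \<zero>\<^bsub>N\<^esub>, z)) \<in> module_hom R T E.EA"
    by (intro module_homI) (simp_all add: EE_sel)
  fix a b x assume ab: "a \<in> carrier A" "b \<in> carrier B" and x: "x \<in> carrier (opc P 2)"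
  have c: "jA a \<in> carrier EE" "jB b \<in> carrier EE"
    using alg_homD(1)[OF jA_hom ab(1)] alg_homD(1)[OF jB_hom ab(2)] by simp_all
  have "PHI (\<phi> (g3 a b x)) = mu E.EA [jA a, jB b] x"
    unfolding phi_g3[OF ab x] hom_mu2[OF PHI_hom u_closed[OF ab(1)] v_closed[OF ab(2)] x] PHI_u[OF ab(1)] PHI_v[OF ab(2)] ..
  also have "\<dots> = eop2 (jA a) (jB b) x" by (rule E.mu_EA(2)[OF c x])
  \<comment> \<open>The element coming from \<open>A\<close> has no component in \<open>N\<close>
    and the one from \<open>B\<close> none in \<open>M\<close>, so the second term of
    \<open>eop2\<close> vanishes.\<close>
  also have "\<dots> = (\<zero>\<^bsub>M\<^esub>, \<zero>\<^bsub>N\<^esub>, g3 a b x)"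
    using hh_zero(1)[OF N.zero_closed sw_closed[OF x]] g3_closed[OF ab x]
    by (simp add: eop2_def jA_def jB_def g3_eq hh_def)
  finally show "PHI (\<phi> (g3 a b x)) = (\<zero>\<^bsub>M\<^esub>, \<zero>\<^bsub>N\<^esub>, g3 a b x)" .
qed

lemma phi_inj: "inj_on \<phi> (carrier T)"
  by (rule inj_onI) (metis PHI_phi prod.inject)

lemma proj_props:
  shows "copair2 XA id (zmap XA) \<in> alg_hom R P CB XA"
    and "\<alpha> \<in> carrier XA \<Longrightarrow> copair2 XA id (zmap XA) (nc.l2 \<alpha>) = \<alpha>"
    and "\<beta> \<in> carrier YB \<Longrightarrow> copair2 XA id (zmap XA) (nc.r2 \<beta>) = \<zero>\<^bsub>XA\<^esub>"
    and "copair2 YB (zmap YB) id \<in> alg_hom R P CB YB"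
    and "\<alpha> \<in> carrier XA \<Longrightarrow> copair2 YB (zmap YB) id (nc.l2 \<alpha>) = \<zero>\<^bsub>YB\<^esub>"
    and "\<beta> \<in> carrier YB \<Longrightarrow> copair2 YB (zmap YB) id (nc.r2 \<beta>) = \<beta>"
  using nc.copair2_props[OF A.nil2_NIL2 alg_hom_id(2) zmap_alg_hom[OF nc.pY nc.pX]]
    nc.copair2_props[OF B.nil2_NIL2 zmap_alg_hom[OF nc.pX nc.pY] alg_hom_id(2)]
  by simp_all

text \<open>Projecting to one summand kills one of the two arguments of each generator x(a,
  b).\<close>

lemma phi_proj:
  assumes z: "z \<in> carrier T"
  shows "copair2 XA id (zmap XA) (\<phi> z) = \<zero>\<^bsub>XA\<^esub>" "copair2 YB (zmap YB) id (\<phi> z) = \<zero>\<^bsub>YB\<^esub>"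
proof -
  note pr = proj_props
  have prc: "prA a \<in> carrier XA" if "a \<in> carrier A" for a by (rule alg_homD(1)[OF A.nil2_proj_hom that])
  have prc': "prB b \<in> carrier YB" if "b \<in> carrier B" for b by (rule alg_homD(1)[OF B.nil2_proj_hom that])
  show "copair2 XA id (zmap XA) (\<phi> z) = \<zero>\<^bsub>XA\<^esub>"
  proof (rule T_hom_eqI[OF nc.X.module_axioms module_hom_compose[OF phi alg_hom_module_hom[OF pr(1)]]
        module_hom_const_zero[OF nc.X.module_axioms] _ z])
    fix a b x assume ab: "a \<in> carrier A" "b \<in> carrier B" and x: "x \<in> carrier (opc P 2)"
    have "mu XA [prA a, \<zero>\<^bsub>XA\<^esub>] x = \<zero>\<^bsub>XA\<^esub>"
      by (rule nc.X.mu_zero_in) (use prc[OF ab(1)] x in \<open>simp_all add: mu_dom_simps\<close>)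
    then show "copair2 XA id (zmap XA) (\<phi> (g3 a b x)) = \<zero>\<^bsub>XA\<^esub>"
      unfolding phi_g3[OF ab x] hom_mu2[OF pr(1) u_closed[OF ab(1)] v_closed[OF ab(2)] x]
      unfolding u_def v_def pr(2)[OF prc[OF ab(1)]] pr(3)[OF prc'[OF ab(2)]] .
  qed
  show "copair2 YB (zmap YB) id (\<phi> z) = \<zero>\<^bsub>YB\<^esub>"
  proof (rule T_hom_eqI[OF nc.Y.module_axioms module_hom_compose[OF phi alg_hom_module_hom[OF pr(4)]]
        module_hom_const_zero[OF nc.Y.module_axioms] _ z])
    fix a b x assume ab: "a \<in> carrier A" "b \<in> carrier B" and x: "x \<in> carrier (opc P 2)"
    have "mu YB [\<zero>\<^bsub>YB\<^esub>, prB b] x = \<zero>\<^bsub>YB\<^esub>"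
      by (rule nc.Y.mu_zero_in) (use prc'[OF ab(2)] x in \<open>simp_all add: mu_dom_simps\<close>)
    then show "copair2 YB (zmap YB) id (\<phi> (g3 a b x)) = \<zero>\<^bsub>YB\<^esub>"
      unfolding phi_g3[OF ab x] hom_mu2[OF pr(4) u_closed[OF ab(1)] v_closed[OF ab(2)] x]
      unfolding u_def v_def pr(5)[OF prc[OF ab(1)]] pr(6)[OF prc'[OF ab(2)]] .
  qed
qed

lemma phi_K2: "z \<in> carrier T \<Longrightarrow> \<phi> z \<in> nc.K2"
  using phi_proj module_homD(1)[OF phi] by (simp add: nc.K2_def)

text \<open>The image of the linear map \<open>?psi\<close> is a submodule, so by
  \<open>C2_span\<close> it only has to contain the two summands and the binary operations on pairs
  of their elements.\<close>

lemma CB_decomp: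
  assumes w: "w \<in> carrier CB"
  obtains \<alpha> \<beta> t where "\<alpha> \<in> carrier XA" "\<beta> \<in> carrier YB" "t \<in> carrier T"
    "w = nc.l2 \<alpha> \<oplus>\<^bsub>CB\<^esub> (nc.r2 \<beta> \<oplus>\<^bsub>CB\<^esub> \<phi> t)"
proof -
  let ?D = "prod_alg P XA (prod_alg P YB TA)"
  let ?psi = "\<lambda>p. nc.l2 (fst p) \<oplus>\<^bsub>CB\<^esub> (nc.r2 (fst (snd p)) \<oplus>\<^bsub>CB\<^esub> \<phi> (snd (snd p)))"
  note mCB = nc.C2.module_axioms
  have mD: "module R ?D" by (intro module_prod_alg nc.X.module_axioms nc.Y.module_axioms mTA)
  have h1: "(\<lambda>p. nc.l2 (fst p)) \<in> module_hom R ?D CB"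
    using alg_homD(1-3)[OF nc.l2_hom] by (intro module_homI) (auto simp: prod_alg_sel)
  have h2: "(\<lambda>p. nc.r2 (fst (snd p))) \<in> module_hom R ?D CB"
    using alg_homD(1-3)[OF nc.r2_hom] by (intro module_homI) (auto simp: prod_alg_sel)
  have h3: "(\<lambda>p. \<phi> (snd (snd p))) \<in> module_hom R ?D CB"
    using module_homD[OF phi] by (intro module_homI) (auto simp: prod_alg_sel)
  have psi: "?psi \<in> module_hom R ?D CB"
    by (rule module_hom_add[OF mD mCB h1 module_hom_add[OF mD mCB h2 h3]])
  let ?S = "?psi ` carrier ?D"
  have S: "submodule ?S R CB"
    by (rule submodule_image[OF mD mCB psi module.carrier_is_submodule[OF mD]])
  have z: "nc.l2 \<zero>\<^bsub>XA\<^esub> = \<zero>\<^bsub>CB\<^esub>" "nc.r2 \<zero>\<^bsub>YB\<^esub> = \<zero>\<^bsub>CB\<^esub>" "\<phi> \<zero>\<^bsub>T\<^esub> = \<zero>\<^bsub>CB\<^esub>"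
    by (rule alg_hom_zero[OF nc.pX nc.pC2 nc.l2_hom], rule alg_hom_zero[OF nc.pY nc.pC2 nc.r2_hom],
        rule module_hom_zero[OF mT mCB phi])
  have Sl: "nc.l2 \<alpha> \<in> ?S" if "\<alpha> \<in> carrier XA" for \<alpha>
    by (rule image_eqI[of _ _ "(\<alpha>, \<zero>\<^bsub>YB\<^esub>, \<zero>\<^bsub>T\<^esub>)"])
      (use that alg_homD(1)[OF nc.l2_hom that] in \<open>simp_all add: prod_alg_sel z\<close>)
  have Sr: "nc.r2 \<beta> \<in> ?S" if "\<beta> \<in> carrier YB" for \<beta>
    by (rule image_eqI[of _ _ "(\<zero>\<^bsub>XA\<^esub>, \<beta>, \<zero>\<^bsub>T\<^esub>)"])
      (use that alg_homD(1)[OF nc.r2_hom that] in \<open>simp_all add: prod_alg_sel z\<close>)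
  have St: "\<phi> t \<in> ?S" if "t \<in> carrier T" for t
    by (rule image_eqI[of _ _ "(\<zero>\<^bsub>XA\<^esub>, \<zero>\<^bsub>YB\<^esub>, t)"])
      (use that module_homD(1)[OF phi that] in \<open>simp_all add: prod_alg_sel z\<close>)
  \<comment> \<open>The elements of the reflections are classes of elements of \<open>A\<close> and
    \<open>B\<close>, so this is a value of \<open>\<phi>\<close> on a generator.\<close>
  have mix: "mu CB [nc.l2 \<alpha>, nc.r2 \<beta>] x \<in> ?S" if c: "\<alpha> \<in> carrier XA" "\<beta> \<in> carrier YB" and x: "x \<in> carrier (opc P 2)" for \<alpha> \<beta> x
  proof -
    obtain a b where ab: "a \<in> carrier A" "\<alpha> = prA a" "b \<in> carrier B" "\<beta> = prB b"
      using c unfolding A.carrier_nil2 B.carrier_nil2 by (elim imageE)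
    have "mu CB [nc.l2 \<alpha>, nc.r2 \<beta>] x = \<phi> (g3 a b x)"
      unfolding phi_g3[OF ab(1,3) x] u_def v_def ab(2,4) ..
    then show ?thesis using St[OF g3_closed[OF ab(1,3) x]] by simp
  qed
  have lc: "nc.l2 \<alpha> \<in> carrier CB" if "\<alpha> \<in> carrier XA" for \<alpha> by (rule alg_homD(1)[OF nc.l2_hom that])
  have rc: "nc.r2 \<beta> \<in> carrier CB" if "\<beta> \<in> carrier YB" for \<beta> by (rule alg_homD(1)[OF nc.r2_hom that])
  have ll: "mu CB [nc.l2 \<alpha>, nc.l2 \<alpha>'] x \<in> ?S"
    if "\<alpha> \<in> carrier XA" "\<alpha>' \<in> carrier XA" "x \<in> carrier (opc P 2)" for \<alpha> \<alpha>' x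
    unfolding hom_mu2[OF nc.l2_hom that, symmetric] by (rule Sl[OF nc.X.mu2_closed[OF that]])
  have rr: "mu CB [nc.r2 \<beta>, nc.r2 \<beta>'] x \<in> ?S"
    if "\<beta> \<in> carrier YB" "\<beta>' \<in> carrier YB" "x \<in> carrier (opc P 2)" for \<beta> \<beta>' x
    unfolding hom_mu2[OF nc.r2_hom that, symmetric] by (rule Sr[OF nc.Y.mu2_closed[OF that]])
  \<comment> \<open>The reversed order is reduced to \<open>mix\<close> by equivariance, with
    \<open>sw x\<close> in place of \<open>x\<close>.\<close>
  have rl: "mu CB [nc.r2 \<beta>, nc.l2 \<alpha>] x \<in> ?S"
    if "\<beta> \<in> carrier YB" "\<alpha> \<in> carrier XA" "x \<in> carrier (opc P 2)" for \<alpha> \<beta> x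
    unfolding nc.C2.mu2_swap[OF lc[OF that(2)] rc[OF that(1)] that(3), symmetric]
    by (rule mix[OF that(2,1) sw_closed[OF that(3)]])
  let ?G = "nc.l2 ` carrier XA \<union> nc.r2 ` carrier YB"
  have "carrier CB \<subseteq> ?S"
  proof (rule order_trans[OF nc.C2_span mspan_minimal[OF S]], intro Un_least subsetI)
    show "g \<in> ?S" if "g \<in> nc.l2 ` carrier XA" for g using that by (rule imageE) (simp only: Sl)
    show "g \<in> ?S" if "g \<in> nc.r2 ` carrier YB" for g using that by (rule imageE) (simp only: Sr)
    show "g \<in> ?S" if "g \<in> nc.C2.ops_ge 3" for g
      using nc.C2_nil3[OF that] zero_in_submodule[OF S] by simp
    fix g assume "g \<in> {mu CB [g, g'] x | g g' x. g \<in> ?G \<and> g' \<in> ?G \<and> x \<in> carrier (opc P 2)}"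
    then obtain h h' x where g: "g = mu CB [h, h'] x" and h: "h \<in> ?G" "h' \<in> ?G" and x: "x \<in> carrier (opc P 2)"
      by blast
    show "g \<in> ?S" unfolding g
      by (rule UnE[OF h(1)]; rule UnE[OF h(2)]; elim imageE) (simp_all only: ll rr rl mix x)
  qed
  then have "w \<in> ?S" using w by blast
  then obtain p where "p \<in> carrier ?D" "w = ?psi p" by blast
  then show ?thesis using that[of "fst p" "fst (snd p)" "snd (snd p)"] by (auto simp: prod_alg_sel)
qed

text \<open>The two projections kill the tensor part of a decomposition and return its components in
  the summands; on the kernel these are zero and only the tensor part is left.\<close>

lemma phi_onto:
  assumes "w \<in> nc.K2" shows "w \<in> \<phi> ` carrier T"
proof -
  have w: "w \<in> carrier CB" "copair2 XA id (zmap XA) w = \<zero>\<^bsub>XA\<^esub>" "copair2 YB (zmap YB) id w = \<zero>\<^bsub>YB\<^esub>"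
    using assms by (auto simp: nc.K2_def)
  obtain \<alpha> \<beta> t where d: "\<alpha> \<in> carrier XA" "\<beta> \<in> carrier YB" "t \<in> carrier T"
    "w = nc.l2 \<alpha> \<oplus>\<^bsub>CB\<^esub> (nc.r2 \<beta> \<oplus>\<^bsub>CB\<^esub> \<phi> t)" by (rule CB_decomp[OF w(1)])
  have c: "nc.l2 \<alpha> \<in> carrier CB" "nc.r2 \<beta> \<in> carrier CB" "\<phi> t \<in> carrier CB"
    using alg_homD(1)[OF nc.l2_hom d(1)] alg_homD(1)[OF nc.r2_hom d(2)] module_homD(1)[OF phi d(3)] by auto
  have "copair2 XA id (zmap XA) w = \<alpha>"
    unfolding d(4) alg_homD(2)[OF proj_props(1) c(1) nc.C2.a_closed[OF c(2,3)]] alg_homD(2)[OF proj_props(1) c(2,3)]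
      proj_props(2)[OF d(1)] proj_props(3)[OF d(2)] phi_proj(1)[OF d(3)]
    using d(1) by simp
  then have a: "\<alpha> = \<zero>\<^bsub>XA\<^esub>" using w(2) by simp
  have "copair2 YB (zmap YB) id w = \<beta>"
    unfolding d(4) alg_homD(2)[OF proj_props(4) c(1) nc.C2.a_closed[OF c(2,3)]] alg_homD(2)[OF proj_props(4) c(2,3)]
      proj_props(5)[OF d(1)] proj_props(6)[OF d(2)] phi_proj(2)[OF d(3)]
    using d(2) by simp
  then have b: "\<beta> = \<zero>\<^bsub>YB\<^esub>" using w(3) by simp
  have "nc.l2 \<alpha> = \<zero>\<^bsub>CB\<^esub>" unfolding a by (rule alg_hom_zero[OF nc.pX nc.pC2 nc.l2_hom])
  moreover have "nc.r2 \<beta> = \<zero>\<^bsub>CB\<^esub>" unfolding b by (rule alg_hom_zero[OF nc.pY nc.pC2 nc.r2_hom])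
  ultimately have "w = \<phi> t" using d(4) c(3) by simp
  then show ?thesis using d(3) by blast
qed

lemma phi_tmul:
  assumes z: "z \<in> carrier T" and p: "p \<in> carrier (opc P 1)"
  shows "\<phi> (tmul p z) = mu CB [\<phi> z] p"
proof (rule T_hom_eqI[OF nc.C2.module_axioms module_hom_compose[OF tmul_hom_gen(1)[OF p] phi]
      module_hom_compose[OF phi nc.C2.mu1_hom[OF p]] _ z])
  fix a b x assume ab: "a \<in> carrier A" "b \<in> carrier B" and x: "x \<in> carrier (opc P 2)"
  show "\<phi> (tmul p (g3 a b x)) = mu CB [\<phi> (g3 a b x)] p"
    unfolding tmul_hom_gen(2)[OF p ab x] phi_g3[OF ab x] phi_g3[OF ab A.comp2_closed[OF x p]]
    by (rule nc.C2.mu1_mu2[OF u_closed[OF ab(1)] v_closed[OF ab(2)] x p, symmetric])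
qed

text \<open>Values of \<open>\<phi>\<close> are combinations of binary operations, and nesting these
  gives zero. This matches the zero operations of arity at least 2 in
  \<open>bilin_formula\<close>.\<close>

lemma phi_mu2:
  assumes z: "z \<in> carrier T" and w: "w \<in> carrier CB" and y: "y \<in> carrier (opc P 2)"
  shows "mu CB [\<phi> z, w] y = \<zero>\<^bsub>CB\<^esub>"
proof (rule T_hom_eqI[OF nc.C2.module_axioms module_hom_compose[OF phi nc.C2.mu2_hom_l[OF w y]]
      module_hom_const_zero[OF nc.C2.module_axioms] _ z])
  fix a b x assume ab: "a \<in> carrier A" "b \<in> carrier B" and x: "x \<in> carrier (opc P 2)"
  have "mu_dom P (carrier CB) [u a, v b] x" using u_closed[OF ab(1)] v_closed[OF ab(2)] x by (simp add: mu_dom_simps)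
  then have "\<phi> (g3 a b x) \<in> nc.C2.ops_ge 2" unfolding phi_g3[OF ab x] by force
  then show "mu CB [\<phi> (g3 a b x), w] y = \<zero>\<^bsub>CB\<^esub>" by (rule nc.mu2_mu2_zero(1)[OF _ w y])
qed

lemma phi_canonical: "\<phi> \<in> canonical_isos R P A B"
proof -
  have K: "nc.K2 \<subseteq> carrier CB" by (auto simp: nc.K2_def)
  have "\<phi> \<in> alg_hom R P TA (bilin R P A B)"
  proof (rule alg_homI)
    show "\<phi> \<in> module_hom R TA (bilin R P A B)"
      using module_homD(2,3)[OF phi] phi_K2 by (intro module_homI) (simp_all add: bilin_eq)
    fix zs x assume "mu_dom P (carrier TA) zs x"
    then have d: "mu_dom P (carrier T) zs x" by simp
    have dK: "mu_dom P nc.K2 (map \<phi> zs) x" using d phi_K2 by (auto simp: mu_dom_def)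
    then have dC: "mu_dom P (carrier CB) (map \<phi> zs) x" using K by (auto simp: mu_dom_def)
    have z: "\<phi> (mu TA zs x) = \<zero>\<^bsub>CB\<^esub>" if "2 \<le> length zs"
      unfolding mu_TA2[OF d that] by (rule module_hom_zero[OF mT nc.C2.module_axioms phi])
    have "\<phi> (mu TA zs x) = mu CB (map \<phi> zs) x"
    proof (rule list_length_cases[of zs])
      assume "zs = []" then show ?thesis using d by (simp add: mu_dom_def)
    next
      fix t assume t: "zs = [t]"
      then have t1: "t \<in> carrier T" "x \<in> carrier (opc P 1)" using d by (simp_all only: mu_dom_simps)
      show ?thesis using phi_tmul[OF t1] mu_TA1[OF t1] t by simp
    next
      fix s t assume t: "zs = [s, t]"
      then have t1: "s \<in> carrier T" "t \<in> carrier T" "x \<in> carrier (opc P 2)" using d by (simp_all only: mu_dom_simps)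
      show ?thesis using phi_mu2[OF t1(1) module_homD(1)[OF phi t1(2)] t1(3)] z t by simp
    next
      assume "3 \<le> length zs"
      then show ?thesis using z NIL2_objD(2)[OF nc.C2_NIL2 dC] by simp
    qed
    then show "\<phi> (mu TA zs x) = mu (bilin R P A B) (map \<phi> zs) x"
      unfolding bilin_eq mu_sub_alg[OF dK] .
  qed
  moreover have "bij_betw \<phi> (carrier TA) (carrier (bilin R P A B))"
    unfolding bij_betw_def using phi_inj phi_K2 phi_onto by (auto simp: bilin_eq)
  ultimately show ?thesis
    using phi_g3 by (simp add: canonical_isos_def alg_iso_def u_def v_def)
qed

end

text \<open>The two properties by which a canonical isomorphism is compared on generators; symmetry
  and naturality thus hold for every canonical isomorphism and not just for the one
  constructed.\<close>

lemma canonical_isosD: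
  assumes "\<phi> \<in> canonical_isos R P A B"
  shows "\<phi> \<in> module_hom R T CB"
    and "\<lbrakk>a \<in> carrier A; b \<in> carrier B; x \<in> carrier (opc P 2)\<rbrakk> \<Longrightarrow> \<phi> (g3 a b x) = mu CB [u a, v b] x"
proof -
  have h: "\<phi> \<in> alg_hom R P TA (bilin R P A B)" using assms by (simp add: canonical_isos_def alg_iso_def)
  have "nc.K2 \<subseteq> carrier CB" by (auto simp: nc.K2_def)
  then show "\<phi> \<in> module_hom R T CB"
    using alg_homD(1-3)[OF h] by (intro module_homI) (auto simp: bilin_eq)
  show "\<phi> (g3 a b x) = mu CB [u a, v b] x"
    if "a \<in> carrier A" "b \<in> carrier B" "x \<in> carrier (opc P 2)"
    using assms that by (simp add: canonical_isos_def u_def v_def)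
qed

lemma canonical_exists: "\<exists>\<phi>. \<phi> \<in> canonical_isos R P A B"
  by (rule canonical_map) (blast intro: phi_canonical)

text \<open>The relations of \<open>T\<close> are carried to those of the tensor product with
  factors exchanged; balancing survives because the swap exchanges \<open>p\<close> and
  \<open>q\<close>.\<close>

lemma symmetry_map:
  obtains \<sigma> where "\<sigma> \<in> module_hom R T (abel_tensor R P B A)"
    "\<And>a b x. a \<in> carrier A \<Longrightarrow> b \<in> carrier B \<Longrightarrow> x \<in> carrier (opc P 2) \<Longrightarrow> \<sigma> (g3 a b x) = gen3 R P B A b a (sw x)"
proof -
  interpret BA: palgebra_pair R P B A by unfold_locales
  show ?thesis
  proof (rule T_lift[OF BA.mT])
    fix b x assume "b \<in> carrier B" "x \<in> carrier (opc P 2)"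
    then show "(\<lambda>a. gen3 R P B A b a (sw x)) \<in> module_hom R A (abel_tensor R P B A)"
      by (intro BA.g3_hom_r sw_closed)
  next
    fix a x assume "a \<in> carrier A" "x \<in> carrier (opc P 2)"
    then show "(\<lambda>b. gen3 R P B A b a (sw x)) \<in> module_hom R B (abel_tensor R P B A)"
      by (intro BA.g3_hom_l sw_closed)
  next
    fix a b assume ab: "a \<in> carrier A" "b \<in> carrier B"
    show "(\<lambda>x. gen3 R P B A b a (sw x)) \<in> module_hom R (opc P 2) (abel_tensor R P B A)"
      by (rule module_hom_compose[OF A.act_hom BA.g3_hom_op[OF ab(2,1)]])
    fix p q x assume pqx: "p \<in> carrier (opc P 1)" "q \<in> carrier (opc P 1)" "x \<in> carrier (opc P 2)"
    show "gen3 R P B A (mu B [b] q) (mu A [a] p) (sw x) = gen3 R P B A b a (sw (comp P [1, 1] [p, q] x))"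
      unfolding BA.g3_balanced[OF ab(2,1) pqx(2,1) sw_closed[OF pqx(3)]] A.comp11_act[OF pqx(2,1,3)] ..
  next
    fix a b x assume a: "a \<in> A.ops_ge 2" and b: "b \<in> carrier B" and x: "x \<in> carrier (opc P 2)"
    have "a \<in> J R P 2 A" using a by (auto intro: A.J_gen)
    then show "gen3 R P B A b a (sw x) = \<zero>\<^bsub>abel_tensor R P B A\<^esub>"
      using a A.ops_ge_closed by (intro BA.g3_J(2)[OF b _ sw_closed[OF x]]) blast+
  next
    fix a b x assume a: "a \<in> carrier A" and b: "b \<in> B.ops_ge 2" and x: "x \<in> carrier (opc P 2)"
    have "b \<in> J R P 2 B" using b by (auto intro: B.J_gen)
    then show "gen3 R P B A b a (sw x) = \<zero>\<^bsub>abel_tensor R P B A\<^esub>"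
      using b B.ops_ge_closed by (intro BA.g3_J(1)[OF _ a sw_closed[OF x]]) blast+
  qed (rule that)
qed

text \<open>The inverse is the same map for the pair \<open>B\<close>, \<open>A\<close>, as the swap
  is an involution. Unary operations are respected since the right action on P(2) commutes with the
  swap, and higher ones are zero on both sides.\<close>

lemma symmetry_iso:
  obtains \<sigma> where "\<sigma> \<in> alg_iso R P TA (bilin_formula R P B A)"
    "\<And>a b x. a \<in> carrier A \<Longrightarrow> b \<in> carrier B \<Longrightarrow> x \<in> carrier (opc P 2) \<Longrightarrow> \<sigma> (g3 a b x) = gen3 R P B A b a (sw x)"
proof -
  interpret BA: palgebra_pair R P B A by unfold_locales
  obtain \<sigma> where s: "\<sigma> \<in> module_hom R T BA.T"
    and sg: "\<And>a b x. a \<in> carrier A \<Longrightarrow> b \<in> carrier B \<Longrightarrow> x \<in> carrier (opc P 2) \<Longrightarrow> \<sigma> (g3 a b x) = BA.g3 b a (sw x)"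
    by (rule symmetry_map) (rule that)
  obtain \<sigma>' where s': "\<sigma>' \<in> module_hom R BA.T T"
    and sg': "\<And>b a x. b \<in> carrier B \<Longrightarrow> a \<in> carrier A \<Longrightarrow> x \<in> carrier (opc P 2) \<Longrightarrow> \<sigma>' (BA.g3 b a x) = g3 a b (sw x)"
    by (rule BA.symmetry_map) (rule that)
  have 1: "\<sigma>' (\<sigma> z) = z" if z: "z \<in> carrier T" for z
    by (rule T_hom_eqI[OF mT module_hom_compose[OF s s'] module_hom_id _ z])
      (simp add: sg sg' sw_closed A.act_act del: One_nat_def)
  have 2: "\<sigma> (\<sigma>' z) = z" if z: "z \<in> carrier BA.T" for z
    by (rule BA.T_hom_eqI[OF BA.mT module_hom_compose[OF s' s] module_hom_id _ z])
      (simp add: sg sg' sw_closed A.act_act del: One_nat_def)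
  have t: "\<sigma> (tmul p z) = BA.tmul p (\<sigma> z)" if p: "p \<in> carrier (opc P 1)" and z: "z \<in> carrier T" for p z
  proof (rule T_hom_eqI[OF BA.mT module_hom_compose[OF tmul_hom_gen(1)[OF p] s]
        module_hom_compose[OF s BA.tmul_hom_gen(1)[OF p]] _ z])
    fix a b x assume ab: "a \<in> carrier A" "b \<in> carrier B" and x: "x \<in> carrier (opc P 2)"
    show "\<sigma> (tmul p (g3 a b x)) = BA.tmul p (\<sigma> (g3 a b x))"
      unfolding tmul_hom_gen(2)[OF p ab x] sg[OF ab x] sg[OF ab A.comp2_closed[OF x p]]
        BA.tmul_hom_gen(2)[OF p ab(2,1) sw_closed[OF x]] A.comp2_act[OF x p] ..
  qed
  have "\<sigma> \<in> alg_hom R P TA BA.TA"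
  proof (rule alg_homI)
    show "\<sigma> \<in> module_hom R TA BA.TA" using s by simp
    fix zs x assume "mu_dom P (carrier TA) zs x"
    then have d: "mu_dom P (carrier T) zs x" by simp
    then have d': "mu_dom P (carrier BA.T) (map \<sigma> zs) x" using module_homD(1)[OF s] by (auto simp: mu_dom_def)
    consider z where "zs = [z]" | "2 \<le> length zs"
      by (rule list_length_cases[of zs]) (use d in \<open>auto simp: mu_dom_def\<close>)
    then show "\<sigma> (mu TA zs x) = mu BA.TA (map \<sigma> zs) x"
    proof cases
      case 1
      then have z: "z \<in> carrier T" "x \<in> carrier (opc P 1)" using d by (simp_all only: mu_dom_simps)
      show ?thesis
        using mu_TA1[OF z] BA.mu_TA1[OF module_homD(1)[OF s z(1)] z(2)] t[OF z(2,1)] 1 by simp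
    next
      case 2
      then show ?thesis using mu_TA2[OF d] BA.mu_TA2[OF d'] module_hom_zero[OF mT BA.mT s] by simp
    qed
  qed
  moreover have "bij_betw \<sigma> (carrier TA) (carrier BA.TA)"
    by (rule bij_betw_byWitness[of _ \<sigma>']) (use 1 2 module_homD(1)[OF s] module_homD(1)[OF s'] in auto)
  ultimately have "\<sigma> \<in> alg_iso R P TA BA.TA" by (simp add: alg_iso_def)
  then show ?thesis using sg by (rule that)
qed

text \<open>The twist exchanges the two inclusions, so it sends x(a, b) to the operation x with the
  image of a, now in the right summand, as first argument; by equivariance this is the swapped
  operation on (b, a).\<close>

lemma canonical_symmetry:
  assumes phi: "\<phi> \<in> canonical_isos R P A B" and psi: "\<psi> \<in> canonical_isos R P B A"
    and s: "\<sigma> \<in> alg_iso R P TA (bilin_formula R P B A)"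
    and sg: "\<And>a b x. a \<in> carrier A \<Longrightarrow> b \<in> carrier B \<Longrightarrow> x \<in> carrier (opc P 2) \<Longrightarrow> \<sigma> (g3 a b x) = gen3 R P B A b a (sw x)"
    and z: "z \<in> carrier T"
  shows "\<psi> (\<sigma> z) = bilin_twist R P A B (\<phi> z)"
proof -
  interpret BA: palgebra_pair R P B A by unfold_locales
  note phi' = canonical_isosD[OF phi] and psi' = BA.canonical_isosD[OF psi]
  have s': "\<sigma> \<in> module_hom R T BA.T"
    using s alg_hom_module_hom[of \<sigma> R P TA BA.TA] by (simp add: alg_iso_def)
  note tw = nc.copair2_props[OF BA.nc.C2_NIL2 BA.nc.r2_hom BA.nc.l2_hom, folded bilin_twist_def]
  show ?thesis
  proof (rule T_hom_eqI[OF BA.nc.C2.module_axioms module_hom_compose[OF s' psi'(1)]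
        module_hom_compose[OF phi'(1) alg_hom_module_hom[OF tw(1)]] _ z])
    fix a b x assume ab: "a \<in> carrier A" "b \<in> carrier B" and x: "x \<in> carrier (opc P 2)"
    have "bilin_twist R P A B (u a) = BA.v a" "bilin_twist R P A B (v b) = BA.u b"
      unfolding u_def v_def BA.u_def BA.v_def
      by (rule tw(2)[OF alg_homD(1)[OF A.nil2_proj_hom ab(1)]], rule tw(3)[OF alg_homD(1)[OF B.nil2_proj_hom ab(2)]])
    then show "\<psi> (\<sigma> (g3 a b x)) = bilin_twist R P A B (\<phi> (g3 a b x))"
      unfolding sg[OF ab x] psi'(2)[OF ab(2,1) sw_closed[OF x]] phi'(2)[OF ab x]
        hom_mu2[OF tw(1) u_closed[OF ab(1)] v_closed[OF ab(2)] x]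
      using BA.nc.C2.mu2_swap[OF BA.u_closed[OF ab(2)] BA.v_closed[OF ab(1)] x] by simp
  qed
qed

end

text \<open>\<open>bilin_map\<close> is a homomorphism on the whole coproduct and sends the images
  of \<open>a\<close> and \<open>b\<close> to those of \<open>f a\<close> and \<open>g b\<close>; it
  therefore carries x(a, b) to x(f a, g b).\<close>

lemma canonical_natural:
  assumes A: "palgebra R P A" and B: "palgebra R P B" and A': "palgebra R P A'" and B': "palgebra R P B'"
    and f: "f \<in> alg_hom R P A A'" and g: "g \<in> alg_hom R P B B'"
    and phi: "\<phi> \<in> canonical_isos R P A B" and phi': "\<phi>' \<in> canonical_isos R P A' B'"
    and a: "a \<in> carrier A" and b: "b \<in> carrier B" and x: "x \<in> carrier (opc P 2)"
  shows "bilin_map R P A' B' f g (\<phi> (gen3 R P A B a b x)) = \<phi>' (gen3 R P A' B' (f a) (g b) x)"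
proof -
  interpret AB: palgebra_pair R P A B by (intro palgebra_pair.intro A B)
  interpret AB': palgebra_pair R P A' B' by (intro palgebra_pair.intro A' B')
  note h1 = alg_hom_compose[OF nil2_map_hom(1)[OF A A' f] AB'.nc.l2_hom]
  note h2 = alg_hom_compose[OF nil2_map_hom(1)[OF B B' g] AB'.nc.r2_hom]
  note k = AB.nc.copair2_props[OF AB'.nc.C2_NIL2 h1 h2]
  have bm: "bilin_map R P A' B' f g = copair2 (coprod2 R P (nil2 R P A') (nil2 R P B'))
      (\<lambda>X. inl2 R P (nil2 R P A') (nil2 R P B') (nil2_map R P A' f X))
      (\<lambda>X. inr2 R P (nil2 R P A') (nil2 R P B') (nil2_map R P B' g X))"
    by (simp add: bilin_map_def o_def)
  have "bilin_map R P A' B' f g (AB.u a) = AB'.u (f a)" "bilin_map R P A' B' f g (AB.v b) = AB'.v (g b)"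
    unfolding bm AB.u_def AB.v_def AB'.u_def AB'.v_def
      k(2)[OF alg_homD(1)[OF AB.A.nil2_proj_hom a]] k(3)[OF alg_homD(1)[OF AB.B.nil2_proj_hom b]]
      nil2_map_hom(2)[OF A A' f a] nil2_map_hom(2)[OF B B' g b] by (rule HOL.refl)+
  moreover have "bilin_map R P A' B' f g (mu AB.CB [AB.u a, AB.v b] x)
      = mu AB'.CB [bilin_map R P A' B' f g (AB.u a), bilin_map R P A' B' f g (AB.v b)] x"
    unfolding bm by (rule AB.hom_mu2[OF k(1) AB.u_closed[OF a] AB.v_closed[OF b] x])
  ultimately show ?thesis
    unfolding AB.canonical_isosD(2)[OF phi a b x]
      AB'.canonical_isosD(2)[OF phi' alg_homD(1)[OF f a] alg_homD(1)[OF g b] x] by simp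
qed

lemma canonical_iso_and_symmetry:
  assumes "palgebra R P A" "palgebra R P B"
  shows "\<exists>\<phi> \<in> canonical_isos R P A B. \<exists>\<psi> \<in> canonical_isos R P B A.
         \<exists>\<sigma> \<in> alg_iso R P (bilin_formula R P A B) (bilin_formula R P B A).
           (\<forall>z \<in> carrier (bilin_formula R P A B). \<psi> (\<sigma> z) = bilin_twist R P A B (\<phi> z)) \<and>
           (\<forall>a \<in> carrier A. \<forall>b \<in> carrier B. \<forall>x \<in> carrier (opc P 2).
              \<sigma> (gen3 R P A B a b x) = gen3 R P B A b a (act P 2 (Transposition.transpose 0 1) x))"
proof -
  interpret AB: palgebra_pair R P A B by (intro palgebra_pair.intro assms)
  interpret BA: palgebra_pair R P B A by (intro palgebra_pair.intro assms)
  obtain \<phi> \<psi> where phi: "\<phi> \<in> canonical_isos R P A B" and psi: "\<psi> \<in> canonical_isos R P B A"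
    using AB.canonical_exists BA.canonical_exists by blast
  obtain \<sigma> where s: "\<sigma> \<in> alg_iso R P (bilin_formula R P A B) (bilin_formula R P B A)"
    and sg: "\<And>a b x. a \<in> carrier A \<Longrightarrow> b \<in> carrier B \<Longrightarrow> x \<in> carrier (opc P 2) \<Longrightarrow>
      \<sigma> (gen3 R P A B a b x) = gen3 R P B A b a (act P 2 (Transposition.transpose 0 1) x)"
    by (rule AB.symmetry_iso) (rule that)
  have "\<psi> (\<sigma> z) = bilin_twist R P A B (\<phi> z)" if "z \<in> carrier (bilin_formula R P A B)" for z
    by (rule AB.canonical_symmetry[OF phi psi s sg that[unfolded AB.TA_sel]])
  then show ?thesis
    by (intro bexI[OF _ phi] bexI[OF _ psi] bexI[OF _ s] conjI ballI sg)
qed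

lemma nil2_map_eq:
  assumes "palgebra R P B" shows "nil2_map R P B f X = NIL2_map R P B f X"
  using assms by (simp add: nil2_map_def NIL2_map_def higgins3_eq_J)

text \<open>Restriction along the truncation is bijective on objects and leaves the hom sets
  unchanged as sets of functions. It is thus an isomorphism of categories, which is how the
  identification with algebras over the truncated operad is rendered.\<close>

theorem corollary6p13:
  fixes R :: "'r ring" and P :: "('r, 'p) operad"
  assumes "cring R" and "operad R P"
  shows
    "(Nil2_obj R P :: ('r, 'a, 'p) palg set) = NIL2_obj R P \<and>
     bij_betw (restrict_trunc2 P)
       {A :: ('r, 'a, 'p) palg. palgebra R (trunc2 P) A} (NIL2_obj R P) \<and>
     (\<forall>(A :: ('r, 'a, 'p) palg) (B :: ('r, 'b, 'p) palg).
        palgebra R (trunc2 P) A \<and> palgebra R (trunc2 P) B \<longrightarrow>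
        alg_hom R (trunc2 P) A B = alg_hom R P (restrict_trunc2 P A) (restrict_trunc2 P B)) \<and>
     (\<forall>A :: ('r, 'a, 'p) palg. palgebra R P A \<longrightarrow> nil2 R P A = NIL2 R P A) \<and>
     (\<forall>(A :: ('r, 'a, 'p) palg) (B :: ('r, 'b, 'p) palg). \<forall>f X.
        palgebra R P A \<and> palgebra R P B \<and> f \<in> alg_hom R P A B \<and> X \<in> carrier (nil2 R P A) \<longrightarrow>
        nil2_map R P B f X = NIL2_map R P B f X) \<and>
     (\<forall>(A :: ('r, 'a, 'p) palg) (B :: ('r, 'b, 'p) palg).
        palgebra R P A \<and> palgebra R P B \<longrightarrow>
        (\<exists>\<phi> \<in> canonical_isos R P A B. \<exists>\<psi> \<in> canonical_isos R P B A.
         \<exists>\<sigma> \<in> alg_iso R P (bilin_formula R P A B) (bilin_formula R P B A).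
           (\<forall>z \<in> carrier (bilin_formula R P A B). \<psi> (\<sigma> z) = bilin_twist R P A B (\<phi> z)) \<and>
           (\<forall>a \<in> carrier A. \<forall>b \<in> carrier B. \<forall>x \<in> carrier (opc P 2).
              \<sigma> (gen3 R P A B a b x) =
              gen3 R P B A b a (act P 2 (Transposition.transpose 0 1) x)))) \<and>
     (\<forall>(A :: ('r, 'a, 'p) palg) (B :: ('r, 'b, 'p) palg)
        (A' :: ('r, 'c, 'p) palg) (B' :: ('r, 'd, 'p) palg). \<forall>f g \<phi> \<phi>'.
        palgebra R P A \<and> palgebra R P B \<and> palgebra R P A' \<and> palgebra R P B' \<and>
        f \<in> alg_hom R P A A' \<and> g \<in> alg_hom R P B B' \<and>
        \<phi> \<in> canonical_isos R P A B \<and> \<phi>' \<in> canonical_isos R P A' B' \<longrightarrow>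
        (\<forall>a \<in> carrier A. \<forall>b \<in> carrier B. \<forall>x \<in> carrier (opc P 2).
           bilin_map R P A' B' f g (\<phi> (gen3 R P A B a b x)) = \<phi>' (gen3 R P A' B' (f a) (g b) x)))"
proof -
  interpret operad R P by fact
  show ?thesis
    by (intro conjI allI impI ballI Nil2_obj_eq bij_restrict_trunc2; (elim conjE)?;
        rule alg_hom_restrict_trunc2 nil2_eq nil2_map_eq canonical_iso_and_symmetry canonical_natural; assumption)
qed

end
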